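(* Let $T>0$. Let $u_0,v_0\in C_d^0(\overline\Omega)^+\cap W_0^{1,p(x)}(\Omega)$ and assume that either $u_0^q,v_0^q\in\overline{\mathcal D(\mathcal R)}^{L^2(\Omega)}$ or $p_-\ge2$. Let $h,g\in L^\infty(Q_T)$ and $h_0\in L^\infty(\Omega)$ be such that $0<h_0\le h\le g$, and assume $u_0\le v_0$. Let $u$ be a weak solution, with source $k=h$ and initial datum $w_0=u_0$, and $v$ a weak solution, with source $k=g$ and initial datum $w_0=v_0$, of $$\begin{cases}w^{q-1}\partial_t(w^q)-\Delta_{p(x)}w=k(t,x)w^{q-1}+f(x,w)&\text{in }Q_T,\\ w>0&\text{in }Q_T,\\ w=0&\text{on }\Gamma,\\ w(0,\cdot)=w_0&\text{in }\Omega.\end{cases}$$ Then $u\le v$.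
   Context: $\Omega\subset\mathbb{R}^N$ is a bounded open interval if $N=1$, and for $N\ge2$ a bounded domain whose boundary is a compact manifold of class $C^{1,\gamma}$ for some $\gamma\in(0,1)$ and satisfies the interior sphere condition at every boundary point. The exponent $p\in C^1(\overline\Omega)$ satisfies $1<p_-:=\min_{\overline\Omega}p\le p(x)\le p_+:=\max_{\overline\Omega}p<\infty$, and $q\in(1,p_-)$. $\mathbb{R}^+=[0,\infty)$, $Q_T=(0,T)\times\Omega$, $\Gamma=(0,T)\times\partial\Omega$. $L^{p(x)}(\Omega)$ is the space of measurable $u$ with $\int_\Omega|u|^{p(x)}dx<\infty$; $W^{1,p(x)}(\Omega)=\{u\in L^{p(x)}(\Omega):|\nabla u|\in L^{p(x)}(\Omega)\}$; $W_0^{1,p(x)}(\Omega)=W_0^{1,1}(\Omega)\cap W^{1,p(x)}(\Omega)$. $\Delta_{p(x)}v=\operatorname{div}(|\nabla v|^{p(x)-2}\nabla v)$. $C_d^0(\overline\Omega)^+$ is the set of continuous functions $v$ on $\overline\Omega$ vanishing on $\partial\Omega$ for which there are $c_1,c_2>0$ with $c_1\le v(x)/\operatorname{dist}(x,\partial\Omega)\le c_2$ in $\Omega$. Assumptions on $f$: ($f_1$) $f:\Omega\times\mathbb{R}^+\to\mathbb{R}^+$ with $f(x,0)=0$ for all $x\in\Omega$ and $f\not\equiv0$; ($f_2$) $\lim_{s\to0^+}\frac{f(x,s)}{s^{2q-1}}=+\infty$ uniformly in $x$; ($f_3$) for any $x\in\Omega$, $s\mapsto\frac{f(x,s)}{s^{q-1}}$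 is nonincreasing in $\mathbb{R}^+\setminus\{0\}$. The operator $\mathcal R$ is $\mathcal Rv=\frac{-\Delta_{p(x)}(v^{1/q})}{v^{(q-1)/q}}-\frac{f(x,v^{1/q})}{v^{(q-1)/q}}$ with domain $\mathcal D(\mathcal R)=\{v:\Omega\to(0,\infty):\ v^{1/q}\in W_0^{1,p(x)}(\Omega),\ v\in L^2(\Omega),\ \mathcal Rv\in L^2(\Omega)\}$. Weak solution (with source $k$ and initial datum $w_0$): a positive function $w\in L^\infty(0,T;W_0^{1,p(x)}(\Omega))\cap L^\infty(Q_T)\cap C(0,T;L^r(\Omega))$ for any $r\ge1$ (with $w(0,\cdot)=w_0$) such that $\partial_t(w^q)\in L^2(Q_T)$ and for any $\phi\in C_0^\infty(Q_T)$ $$\int_0^T\!\!\int_\Omega\partial_t(w^q)w^{q-1}\phi\,dxdt+\int_0^T\!\!\int_\Omega|\nabla w|^{p(x)-2}\nabla w\cdot\nabla\phi\,dxdt=\int_0^T\!\!\int_\Omega k\,w^{q-1}\phi\,dxdt+\int_0^T\!\!\int_\Omega f(x,w)\phi\,dxdt.$$ *)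

theory Defs
  imports "HOL-Analysis.Analysis"
begin

text \<open>
  A subset of the ambient Euclidean space is an embedded hypersurface of class
  \<open>C\<^sup>1\<close> with Hoelder exponent \<open>\<gamma>\<close> if it is locally the zero set of a function with nowhere
  vanishing, \<open>\<gamma>\<close>-Hoelder continuous gradient.
\<close>

definition C1_holder_hypersurface :: "real \<Rightarrow> 'a::euclidean_space set \<Rightarrow> bool" where
  "C1_holder_hypersurface \<gamma> M \<longleftrightarrow>
     (\<forall>x0\<in>M. \<exists>U \<psi> D C. open U \<and> x0 \<in> U \<and>
        (\<forall>x\<in>U. (\<psi> has_derivative (\<lambda>y. D x \<bullet> y)) (at x)) \<and>
        (\<forall>x\<in>U. D x \<noteq> 0) \<and>
        (\<forall>x\<in>U. \<forall>y\<in>U. norm (D x - D y) \<le> C * dist x y powr \<gamma>) \<and>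
        M \<inter> U = {x \<in> U. \<psi> x = (0::real)})"

definition interior_sphere_condition :: "'a::euclidean_space set \<Rightarrow> bool" where
  "interior_sphere_condition \<Omega> \<longleftrightarrow>
     (\<forall>x\<in>frontier \<Omega>. \<exists>y r. r > 0 \<and> ball y r \<subseteq> \<Omega> \<and> x \<in> sphere y r)"

definition admissible_domain :: "'a::euclidean_space set \<Rightarrow> bool" where
  "admissible_domain \<Omega> \<longleftrightarrow>
     (if DIM('a) = 1 then \<Omega> \<noteq> {} \<and> (\<exists>a b. \<Omega> = box a b)
      else \<Omega> \<noteq> {} \<and> open \<Omega> \<and> connected \<Omega> \<and> bounded \<Omega> \<and>
           compact (frontier \<Omega>) \<and>
           (\<exists>\<gamma>\<in>{0<..<1}. C1_holder_hypersurface \<gamma> (frontier \<Omega>)) \<and>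
           interior_sphere_condition \<Omega>)"

definition C1_closure :: "'a::euclidean_space set \<Rightarrow> ('a \<Rightarrow> real) \<Rightarrow> bool" where
  "C1_closure \<Omega> p \<longleftrightarrow> continuous_on (closure \<Omega>) p \<and>
     (\<exists>D. continuous_on (closure \<Omega>) D \<and>
          (\<forall>x\<in>\<Omega>. (p has_derivative (\<lambda>y. D x \<bullet> y)) (at x)))"

text \<open>
  For a bounded domain and a continuous exponent this infimum is the minimum over the closure.
\<close>

definition exponent_min :: "'a::euclidean_space set \<Rightarrow> ('a \<Rightarrow> real) \<Rightarrow> real" where
  "exponent_min \<Omega> p = (INF x\<in>closure \<Omega>. p x)"

fun Ck :: "nat \<Rightarrow> ('a::euclidean_space \<Rightarrow> real) \<Rightarrow> bool" where
  "Ck 0 \<phi> = continuous_on UNIV \<phi>"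
| "Ck (Suc n) \<phi> = (\<phi> differentiable_on UNIV \<and>
     (\<forall>b\<in>Basis. Ck n (\<lambda>x. frechet_derivative \<phi> (at x) b)))"

text \<open>
  Test functions are extended by zero to the whole space, hence globally smooth.
\<close>

definition test_functions :: "'a::euclidean_space set \<Rightarrow> ('a \<Rightarrow> real) set" where
  "test_functions S =
     {\<phi>. (\<forall>n. Ck n \<phi>) \<and> compact (closure {x. \<phi> x \<noteq> 0}) \<and> closure {x. \<phi> x \<noteq> 0} \<subseteq> S}"

definition grad :: "('a::euclidean_space \<Rightarrow> real) \<Rightarrow> 'a \<Rightarrow> 'a" where
  "grad \<phi> x = (\<Sum>b\<in>Basis. frechet_derivative \<phi> (at x) b *\<^sub>R b)"

definition locally_integrable ::
    "'a::euclidean_space set \<Rightarrow> ('a \<Rightarrow> 'b::euclidean_space) \<Rightarrow> bool" where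
  "locally_integrable S u \<longleftrightarrow>
     (\<forall>K. compact K \<and> K \<subseteq> S \<longrightarrow> integrable (lebesgue_on K) u)"

definition weak_derivative ::
    "'a::euclidean_space set \<Rightarrow> 'a \<Rightarrow> ('a \<Rightarrow> real) \<Rightarrow> ('a \<Rightarrow> real) \<Rightarrow> bool" where
  "weak_derivative S b u g \<longleftrightarrow> locally_integrable S u \<and> locally_integrable S g \<and>
     (\<forall>\<phi>\<in>test_functions S.
        (\<integral>x. u x * frechet_derivative \<phi> (at x) b \<partial>lebesgue_on S)
          = - (\<integral>x. g x * \<phi> x \<partial>lebesgue_on S))"

definition weak_gradient ::
    "'a::euclidean_space set \<Rightarrow> ('a \<Rightarrow> real) \<Rightarrow> ('a \<Rightarrow> 'a) \<Rightarrow> bool" where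
  "weak_gradient S u G \<longleftrightarrow> (\<forall>b\<in>Basis. weak_derivative S b u (\<lambda>x. G x \<bullet> b))"

text \<open>
  A weak gradient is unique up to null sets, so the choice is immaterial under integrals in \<open>x\<close>.
\<close>

definition wgrad :: "'a::euclidean_space set \<Rightarrow> ('a \<Rightarrow> real) \<Rightarrow> 'a \<Rightarrow> 'a" where
  "wgrad S u = (SOME G. weak_gradient S u G)"

text \<open>
  Elements of these spaces are represented by functions whose values outside the underlying set
  play no role.
\<close>

definition Lpx :: "'a::euclidean_space set \<Rightarrow> ('a \<Rightarrow> real) \<Rightarrow> ('a \<Rightarrow> real) set" where
  "Lpx S p = {u \<in> borel_measurable (lebesgue_on S).
                integrable (lebesgue_on S) (\<lambda>x. \<bar>u x\<bar> powr p x)}"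

definition luxemburg_norm ::
    "'a::euclidean_space set \<Rightarrow> ('a \<Rightarrow> real) \<Rightarrow> ('a \<Rightarrow> real) \<Rightarrow> real" where
  "luxemburg_norm S p u =
     Inf {l. l > 0 \<and> (\<integral>x. \<bar>u x / l\<bar> powr p x \<partial>lebesgue_on S) \<le> 1}"

abbreviation Lr :: "'a::euclidean_space set \<Rightarrow> real \<Rightarrow> ('a \<Rightarrow> real) set" where
  "Lr S r \<equiv> Lpx S (\<lambda>_. r)"

definition Lr_norm :: "'a::euclidean_space set \<Rightarrow> real \<Rightarrow> ('a \<Rightarrow> real) \<Rightarrow> real" where
  "Lr_norm S r u = (\<integral>x. \<bar>u x\<bar> powr r \<partial>lebesgue_on S) powr (1 / r)"

definition Linf :: "'a::euclidean_space set \<Rightarrow> ('a \<Rightarrow> real) set" where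
  "Linf S = {u \<in> borel_measurable (lebesgue_on S). \<exists>C. AE x in lebesgue_on S. \<bar>u x\<bar> \<le> C}"

definition L2_closure :: "'a::euclidean_space set \<Rightarrow> ('a \<Rightarrow> real) set \<Rightarrow> ('a \<Rightarrow> real) set" where
  "L2_closure S A = {u \<in> Lr S 2. \<forall>\<epsilon>>0. \<exists>v\<in>A. Lr_norm S 2 (\<lambda>x. u x - v x) < \<epsilon>}"

definition W1px :: "'a::euclidean_space set \<Rightarrow> ('a \<Rightarrow> real) \<Rightarrow> ('a \<Rightarrow> real) set" where
  "W1px \<Omega> p = {u \<in> Lpx \<Omega> p. \<exists>G. weak_gradient \<Omega> u G \<and> (\<lambda>x. norm (G x)) \<in> Lpx \<Omega> p}"

definition W1px_norm ::
    "'a::euclidean_space set \<Rightarrow> ('a \<Rightarrow> real) \<Rightarrow> ('a \<Rightarrow> real) \<Rightarrow> real" where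
  "W1px_norm \<Omega> p u =
     luxemburg_norm \<Omega> p u + luxemburg_norm \<Omega> p (\<lambda>x. norm (wgrad \<Omega> u x))"

definition W011 :: "'a::euclidean_space set \<Rightarrow> ('a \<Rightarrow> real) set" where
  "W011 \<Omega> = {u \<in> W1px \<Omega> (\<lambda>_. 1).
     \<forall>\<epsilon>>0. \<exists>\<phi>\<in>test_functions \<Omega>.
       (\<integral>x. \<bar>u x - \<phi> x\<bar> \<partial>lebesgue_on \<Omega>)
         + (\<integral>x. norm (wgrad \<Omega> u x - grad \<phi> x) \<partial>lebesgue_on \<Omega>) < \<epsilon>}"

definition W01px :: "'a::euclidean_space set \<Rightarrow> ('a \<Rightarrow> real) \<Rightarrow> ('a \<Rightarrow> real) set" where
  "W01px \<Omega> p = W011 \<Omega> \<inter> W1px \<Omega> p"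

definition Cd0_plus :: "'a::euclidean_space set \<Rightarrow> ('a \<Rightarrow> real) set" where
  "Cd0_plus \<Omega> = {v. continuous_on (closure \<Omega>) v \<and> (\<forall>x\<in>frontier \<Omega>. v x = 0) \<and>
     (\<exists>c1>0. \<exists>c2>0. \<forall>x\<in>\<Omega>. c1 \<le> v x / infdist x (frontier \<Omega>) \<and>
                             v x / infdist x (frontier \<Omega>) \<le> c2)}"

text \<open>
  The Bochner space of (strongly measurable) essentially bounded functions on \<open>(0,T)\<close> with
  values in the normed function space with carrier \<open>X\<close> and norm \<open>N\<close>. The functions \<open>s n\<close> are the
  approximating simple functions of strong measurability.
\<close>

definition Linf_Bochner ::
    "real \<Rightarrow> ('a \<Rightarrow> real) set \<Rightarrow> (('a \<Rightarrow> real) \<Rightarrow> real) \<Rightarrow> (real \<times> 'a \<Rightarrow> real) set" where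
  "Linf_Bochner T X N = {w.
     (\<exists>s :: nat \<Rightarrow> real \<Rightarrow> 'a \<Rightarrow> real.
        (\<forall>n. finite (s n ` {0<..<T}) \<and> s n ` {0<..<T} \<subseteq> X \<and>
             (\<forall>y. {t \<in> {0<..<T}. s n t = y} \<in> sets lebesgue)) \<and>
        (AE t in lebesgue_on {0<..<T}. (\<lambda>n. N (\<lambda>x. w (t, x) - s n t x)) \<longlonglongrightarrow> 0)) \<and>
     (\<exists>C. AE t in lebesgue_on {0<..<T}. (\<lambda>x. w (t, x)) \<in> X \<and> N (\<lambda>x. w (t, x)) \<le> C)}"

definition continuous_into_Lr ::
    "real \<Rightarrow> 'a::euclidean_space set \<Rightarrow> real \<Rightarrow> (real \<times> 'a \<Rightarrow> real) set" where
  "continuous_into_Lr T \<Omega> r = {w.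
     (\<forall>t\<in>{0..T}. (\<lambda>x. w (t, x)) \<in> Lr \<Omega> r \<and>
        ((\<lambda>s. Lr_norm \<Omega> r (\<lambda>x. w (s, x) - w (t, x))) \<longlongrightarrow> 0) (at t within {0..T}))}"

definition f_sign :: "'a set \<Rightarrow> ('a \<Rightarrow> real \<Rightarrow> real) \<Rightarrow> bool" where
  "f_sign \<Omega> f \<longleftrightarrow> (\<forall>x\<in>\<Omega>. \<forall>s\<ge>0. f x s \<ge> 0) \<and> (\<forall>x\<in>\<Omega>. f x 0 = 0) \<and>
     (\<exists>x\<in>\<Omega>. \<exists>s\<ge>0. f x s \<noteq> 0)"

definition f_near_zero :: "'a set \<Rightarrow> real \<Rightarrow> ('a \<Rightarrow> real \<Rightarrow> real) \<Rightarrow> bool" where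
  "f_near_zero \<Omega> q f \<longleftrightarrow>
     (\<forall>M. \<forall>\<^sub>F s in at_right 0. \<forall>x\<in>\<Omega>. M \<le> f x s / s powr (2 * q - 1))"

definition f_monotone :: "'a set \<Rightarrow> real \<Rightarrow> ('a \<Rightarrow> real \<Rightarrow> real) \<Rightarrow> bool" where
  "f_monotone \<Omega> q f \<longleftrightarrow> (\<forall>x\<in>\<Omega>. antimono_on {0<..} (\<lambda>s. f x s / s powr (q - 1)))"

definition p_flux :: "real \<Rightarrow> 'a::euclidean_space \<Rightarrow> 'a" where
  "p_flux r \<xi> = norm \<xi> powr (r - 2) *\<^sub>R \<xi>"

text \<open>
  \<open>neg_p_laplacian \<Omega> p w k\<close>: the distribution \<open>-\<Delta>\<^sub>p\<^sub>(\<^sub>x\<^sub>) w\<close> on \<open>\<Omega>\<close> is the locally integrable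
  function \<open>k\<close>.
\<close>

definition neg_p_laplacian ::
    "'a::euclidean_space set \<Rightarrow> ('a \<Rightarrow> real) \<Rightarrow> ('a \<Rightarrow> real) \<Rightarrow> ('a \<Rightarrow> real) \<Rightarrow> bool" where
  "neg_p_laplacian \<Omega> p w k \<longleftrightarrow> locally_integrable \<Omega> k \<and>
     (\<exists>G. weak_gradient \<Omega> w G \<and> locally_integrable \<Omega> (\<lambda>x. p_flux (p x) (G x)) \<and>
        (\<forall>\<phi>\<in>test_functions \<Omega>.
           (\<integral>x. p_flux (p x) (G x) \<bullet> grad \<phi> x \<partial>lebesgue_on \<Omega>)
             = (\<integral>x. k x * \<phi> x \<partial>lebesgue_on \<Omega>)))"

text \<open>
  The operator \<open>\<R>\<close> as a relation between \<open>v\<close> and its value, the latter being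
  determined only up to null sets.
\<close>

definition R_operator ::
    "'a::euclidean_space set \<Rightarrow> ('a \<Rightarrow> real) \<Rightarrow> real \<Rightarrow> ('a \<Rightarrow> real \<Rightarrow> real) \<Rightarrow>
     ('a \<Rightarrow> real) \<Rightarrow> ('a \<Rightarrow> real) \<Rightarrow> bool" where
  "R_operator \<Omega> p q f v \<zeta> \<longleftrightarrow>
     (\<exists>k. neg_p_laplacian \<Omega> p (\<lambda>x. v x powr (1 / q)) k \<and>
          \<zeta> = (\<lambda>x. k x / v x powr ((q - 1) / q)
                     - f x (v x powr (1 / q)) / v x powr ((q - 1) / q)))"

definition R_domain ::
    "'a::euclidean_space set \<Rightarrow> ('a \<Rightarrow> real) \<Rightarrow> real \<Rightarrow> ('a \<Rightarrow> real \<Rightarrow> real) \<Rightarrow> ('a \<Rightarrow> real) set"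
  where
  "R_domain \<Omega> p q f = {v. (\<forall>x\<in>\<Omega>. v x > 0) \<and> (\<lambda>x. v x powr (1 / q)) \<in> W01px \<Omega> p \<and>
     v \<in> Lr \<Omega> 2 \<and> (\<exists>\<zeta>. R_operator \<Omega> p q f v \<zeta> \<and> \<zeta> \<in> Lr \<Omega> 2)}"

abbreviation QT :: "real \<Rightarrow> 'a set \<Rightarrow> (real \<times> 'a) set" where
  "QT T \<Omega> \<equiv> {0<..<T} \<times> \<Omega>"

text \<open>
  Here \<open>z\<close> is the weak time derivative of \<open>w\<^sup>q\<close> and \<open>G\<close> the weak spatial gradient of \<open>w\<close>, both on
  the space-time cylinder. The homogeneous boundary condition is contained in the membership of
  the time slices in \<open>W01px \<Omega> p\<close>. Since \<open>f\<close> is not assumed measurable, integrability of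
  \<open>f(x,w) \<phi>\<close> is part of the meaning of the integral identity; integrability of the other
  integrands follows from the remaining clauses when the source is in \<open>Linf (QT T \<Omega>)\<close>.
\<close>

definition weak_solution ::
    "real \<Rightarrow> 'a::euclidean_space set \<Rightarrow> ('a \<Rightarrow> real) \<Rightarrow> real \<Rightarrow> ('a \<Rightarrow> real \<Rightarrow> real) \<Rightarrow>
     (real \<times> 'a \<Rightarrow> real) \<Rightarrow> ('a \<Rightarrow> real) \<Rightarrow> (real \<times> 'a \<Rightarrow> real) \<Rightarrow> bool" where
  "weak_solution T \<Omega> p q f k w0 w \<longleftrightarrow>
     (AE y in lebesgue_on (QT T \<Omega>). w y > 0) \<and>
     w \<in> Linf_Bochner T (W01px \<Omega> p) (W1px_norm \<Omega> p) \<and>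
     w \<in> Linf (QT T \<Omega>) \<and>
     (\<forall>r\<ge>1. w \<in> continuous_into_Lr T \<Omega> r) \<and>
     (AE x in lebesgue_on \<Omega>. w (0, x) = w0 x) \<and>
     (\<exists>z G.
        weak_derivative (QT T \<Omega>) (1, 0) (\<lambda>y. w y powr q) z \<and> z \<in> Lr (QT T \<Omega>) 2 \<and>
        (\<forall>b\<in>Basis. weak_derivative (QT T \<Omega>) (0, b) w (\<lambda>y. G y \<bullet> b)) \<and>
        (\<forall>\<phi>\<in>test_functions (QT T \<Omega>).
           integrable (lebesgue_on (QT T \<Omega>)) (\<lambda>(t, x). f x (w (t, x)) * \<phi> (t, x)) \<and>
           (\<integral>y. z y * w y powr (q - 1) * \<phi> y \<partial>lebesgue_on (QT T \<Omega>))
             + (\<integral>(t, x). p_flux (p x) (G (t, x)) \<bullet> grad (\<lambda>x'. \<phi> (t, x')) x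
                  \<partial>lebesgue_on (QT T \<Omega>))
           = (\<integral>y. k y * w y powr (q - 1) * \<phi> y \<partial>lebesgue_on (QT T \<Omega>))
             + (\<integral>(t, x). f x (w (t, x)) * \<phi> (t, x) \<partial>lebesgue_on (QT T \<Omega>))))"

end

theory Submission
  imports Defs
begin

text \<open>
  In the variable \<open>w\<^sup>q\<close> the problem is monotone. Test the equation of \<open>u\<close> with
  \<open>(u\<^sup>q - v\<^sup>q)\<^sup>+ / u\<^sup>q\<^sup>-\<^sup>1\<close>, that of \<open>v\<close> with \<open>(u\<^sup>q - v\<^sup>q)\<^sup>+ / v\<^sup>q\<^sup>-\<^sup>1\<close>, and subtract. The time
  derivatives combine to the derivative of half the integral of \<open>((u\<^sup>q - v\<^sup>q)\<^sup>+)\<^sup>2\<close>. The diffusion terms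
  have a sign by a Picone (Diaz-Saa) inequality, since \<open>q \<le> p(x)\<close>; the sources contribute
  \<open>(h - g) (u\<^sup>q - v\<^sup>q)\<^sup>+ \<le> 0\<close>; and \<open>f(x,u) / u\<^sup>q\<^sup>-\<^sup>1 \<le> f(x,v) / v\<^sup>q\<^sup>-\<^sup>1\<close> where \<open>v < u\<close>. So the integral does
  not increase in time, and it tends to zero at time zero because \<open>u\<^sub>0 \<le> v\<^sub>0\<close>.

  These test functions are not smooth, not compactly supported and not even bounded where \<open>v\<close> degenerates.
  Therefore \<open>v\<close> is replaced by \<open>v + \<epsilon>\<close> in the quotient and the positive part by a \<open>C\<^sup>1\<close> function
  (locale \<open>quotient_tests\<close>, with the inequality \<open>picone_flux\<close>). Smooth functions of the two solutions
  times a compactly supported factor are admissible by mollification (\<open>composed_test\<close>); here the Lipschitz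
  continuity of \<open>p\<close> bounds the modular of a mollified gradient by the mollified modular
  (\<open>mollify_modular\<close>). The compactly supported factor is a boundary cutoff with gradient of order
  \<open>1/\<delta>\<close>. Its error is controlled by the integral of \<open>(u/\<delta>)\<^sup>p + |\<nabla>u|\<^sup>p + |\<nabla>v|\<^sup>p\<close> over the layer of
  width \<open>\<delta>\<close>, which vanishes in the limit (\<open>layer_energy_vanishes\<close>): every point of the layer reaches the boundary along a
  coordinate axis within a multiple of \<open>\<delta>\<close>, and \<open>u\<close> has zero trace. Letting first \<open>\<delta>\<close> and then
  \<open>\<epsilon>\<close> tend to zero gives \<open>comparison_limit\<close>; the chain rule in time and the initial condition then
  give \<open>comparison_core\<close>.

  The last two sections carry this over to the weak solutions of the theorem, by passing to Borel representatives,
  identifying the slices of the space-time gradient with the gradients of the slices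
  (\<open>slice_derivative\<close>) and turning the bound on the Luxemburg norms into a bound on modulars.
\<close>

text \<open>Input shorthands for Borel measurability and for integrability with respect to Lebesgue measure, and infixes for limits of sequences and for scalar multiplication.\<close>

abbreviation (input) borel_funs where "borel_funs \<equiv> borel_measurable borel"
abbreviation (input) lint where "lint \<equiv> integrable lborel"
abbreviation (input) tends (infix "\<rightarrow>" 60) where "X \<rightarrow> L \<equiv> (X \<longlonglongrightarrow> L)"
abbreviation (input) scal (infixr "*#" 75) where "r *# x \<equiv> r *\<^sub>R x"

lemmas BI_integrable_add = Bochner_Integration.integrable_add
lemmas BI_integrable_bound = Bochner_Integration.integrable_bound
lemmas BI_integrable_cong = Bochner_Integration.integrable_cong
lemmas BI_integrable_diff = Bochner_Integration.integrable_diff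
lemmas BI_integrable_sum = Bochner_Integration.integrable_sum
lemmas BI_integral_add = Bochner_Integration.integral_add
lemmas BI_integral_cong = Bochner_Integration.integral_cong
lemmas BI_integral_diff = Bochner_Integration.integral_diff

section \<open>Mollifiers\<close>

lemma Ck_SucI:
 assumes "!!x. (phi has_derivative D x) (at x)" "!!b. b : Basis ==> Ck n (%x. D x b)"
 shows "Ck (Suc n) phi"
proof -
 have "frechet_derivative phi (at x) = D x" for x
  using frechet_derivative_at[OF assms(1)] by simp
 moreover have "phi differentiable_on UNIV"
  using assms(1) by (auto simp: differentiable_on_def differentiable_def)
 ultimately show ?thesis using assms(2) by simp
qed

lemma Ck_SucD:
 assumes "Ck (Suc n) phi"
 shows "(phi has_derivative frechet_derivative phi (at x)) (at x)"
  and "b : Basis ==> Ck n (%x. frechet_derivative phi (at x) b)"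
 using assms by (auto simp: differentiable_on_def frechet_derivative_works)

lemma Ck_pred: "Ck (Suc n) phi ==> Ck n phi"
proof (induction n arbitrary: phi)
 case 0
 then show ?case
  by (auto intro: differentiable_imp_continuous_on)
next
 case (Suc n)
 then show ?case by (metis Ck.simps(2))
qed

lemma Ck_const: "Ck n (%x. c)"
proof (induction n arbitrary: c)
 case (Suc n)
 show ?case by (rule Ck_SucI[where D="%x h. 0"]) (auto intro: Suc)
qed simp

lemma Ck_add: "Ck n f ==> Ck n g ==> Ck n (%x. f x + g x)"
proof (induction n arbitrary: f g)
 case 0
 then show ?case by (auto intro: continuous_on_add)
next
 case (Suc n)
 show ?case
  by (rule Ck_SucI[OF has_derivative_add[OF Ck_SucD(1)[OF Suc.prems(1)] Ck_SucD(1)[OF Suc.prems(2)]]])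
   (intro Suc.IH Ck_SucD(2)[OF Suc.prems(1)] Ck_SucD(2)[OF Suc.prems(2)])
qed

lemma Ck_mult: "Ck n f ==> Ck n g ==> Ck n (%x. f x * g x)"
proof (induction n arbitrary: f g)
 case 0
 then show ?case by (auto intro: continuous_on_mult)
next
 case (Suc n)
 show ?case
  by (rule Ck_SucI[OF has_derivative_mult[OF Ck_SucD(1)[OF Suc.prems(1)] Ck_SucD(1)[OF Suc.prems(2)]]])
   (intro Ck_add Suc.IH Ck_SucD(2)[OF Suc.prems(1)] Ck_SucD(2)[OF Suc.prems(2)]
   Ck_pred[OF Suc.prems(1)] Ck_pred[OF Suc.prems(2)])
qed

lemma Ck_inner: "Ck n (%x. x \<bullet> b)"
proof (cases n)
 case 0
 then show ?thesis by (auto intro!: continuous_intros)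
next
 case (Suc m)
 show ?thesis unfolding Suc
  by (rule Ck_SucI[where D="%x h. h \<bullet> b"]) (auto intro!: derivative_eq_intros Ck_const)
qed

text \<open>The factors \<open>t\<^sup>-\<^sup>m\<close> make the family closed under differentiation, which reduces smoothness at zero to a single difference quotient.\<close>

definition flat_exp :: "nat => real => real" where
 "flat_exp m t = (if t > 0 then exp (- (1/t)) / t ^ m else 0)"

lemma flat_exp_nonneg: "0 <= flat_exp m t"
 by (simp add: flat_exp_def)

lemma flat_exp_le_fact: "flat_exp m t <= fact m"
proof (cases "t > 0")
 case True
 have s: "summable (%n. (1/t) ^ n /\<^sub>R fact n)"
  by (rule sums_summable[OF exp_converges])
 have "(1/t) ^ m /\<^sub>R fact m = (\<Sum>n\<in>{m}. (1/t) ^ n /\<^sub>R fact n)" by simp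
 also have "\<dots> <= exp (1/t)"
  unfolding exp_def using True s by (intro sum_le_suminf) auto
 finally show ?thesis using True
  by (simp add: flat_exp_def exp_minus field_simps power_divide)
qed (simp add: flat_exp_def)

lemma flat_exp_abs: "\<bar>flat_exp m t\<bar> <= fact m"
 using flat_exp_nonneg[of m t] flat_exp_le_fact[of m t] by simp

lemma flat_exp_square: "flat_exp m t = t\<^sup>2 * flat_exp (m + 2) t"
 by (simp add: flat_exp_def power_add power2_eq_square)

lemma flat_exp_has_derivative:
 "(flat_exp m has_real_derivative (flat_exp (m + 2) t - real m * flat_exp (m + 1) t)) (at t)"
proof (cases t "0::real" rule: linorder_cases)
 case less
 have "((%_. 0) has_real_derivative 0) (at t)" by simp
 then have "(flat_exp m has_real_derivative 0) (at t)"
  by (rule DERIV_cong_ev[THEN iffD1, rotated 3])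
   (use less eventually_nhds_in_open[of "{..<0}" t] in \<open>auto elim!: eventually_mono simp: flat_exp_def\<close>)
 then show ?thesis using less by (simp add: flat_exp_def)
next
 case equal
 have "((%h. (flat_exp m (0 + h) - flat_exp m 0) / h) \<longlongrightarrow> 0) (at 0)"
 proof (rule Lim_null_comparison)
  show "\<forall>\<^sub>F h in at 0. norm ((flat_exp m (0 + h) - flat_exp m 0) / h) <= fact (m + 2) * \<bar>h\<bar>"
  proof (rule always_eventually, rule allI)
   fix h :: real
   have "norm ((flat_exp m (0 + h) - flat_exp m 0) / h) = \<bar>h\<bar> * \<bar>flat_exp (m + 2) h\<bar>"
   by (subst flat_exp_square) (simp add: flat_exp_def[of _ 0] abs_mult power2_eq_square)
   also have "\<dots> <= \<bar>h\<bar> * fact (m + 2)"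
   by (intro mult_left_mono flat_exp_abs) auto
   finally show "norm ((flat_exp m (0 + h) - flat_exp m 0) / h) <= fact (m + 2) * \<bar>h\<bar>"
   by (simp add: mult.commute)
  qed
  show "((%h. fact (m + 2) * \<bar>h\<bar>) \<longlongrightarrow> 0) (at (0::real))"
   by (rule tendsto_eq_rhs, (rule tendsto_intros)+) simp
 qed
 then have "(flat_exp m has_real_derivative 0) (at 0)"
  by (simp add: DERIV_def)
 then show ?thesis using equal by (simp add: flat_exp_def)
next
 case greater
 have "((%t. exp (- (1/t)) / t ^ m) has_real_derivative
   (flat_exp (m + 2) t - real m * flat_exp (m + 1) t)) (at t)"
  using greater
  by (cases m) (auto intro!: derivative_eq_intros simp: flat_exp_def field_simps power2_eq_square, case_tac nat, auto)
 then show ?thesis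
  by (rule DERIV_cong_ev[THEN iffD1, rotated 3])
   (use greater eventually_nhds_in_open[of "{0<..}" t] in \<open>auto elim!: eventually_mono simp: flat_exp_def\<close>)
qed

lemma flat_exp_pos: "t > 0 ==> 0 < flat_exp m t"
 by (simp add: flat_exp_def)

lemma continuous_flat_exp: "continuous_on S (flat_exp m)"
 by (meson DERIV_isCont continuous_at_imp_continuous_on flat_exp_has_derivative)

lemma Ck_flat_exp_compose:
 assumes s: "!!n. Ck n s"
 shows "Ck n (%x. flat_exp m (s x))"
proof (induction n arbitrary: m)
 case 0
 have "continuous_on UNIV s" using s[of 0] by simp
 then show ?case
  using continuous_on_compose2[OF continuous_flat_exp[of UNIV m]] by auto
next
 case (Suc n)
 have ds: "(s has_derivative frechet_derivative s (at x)) (at x)" for x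
  by (rule Ck_SucD(1)[OF s])
 have d: "((%x. flat_exp m (s x)) has_derivative
   (%h. (flat_exp (m + 2) (s x) + (- real m) * flat_exp (m + 1) (s x)) * frechet_derivative s (at x) h)) (at x)" for x
  using has_derivative_compose[OF ds[of x] flat_exp_has_derivative[unfolded has_field_derivative_def]]
  by simp
 show ?case
  by (rule Ck_SucI[OF d]) (intro Ck_mult Ck_add Ck_const Suc Ck_SucD(2)[OF s])
qed

definition bump :: "real => 'b::euclidean_space => real" where
 "bump r x = flat_exp 0 (1 - (x \<bullet> x) / r\<^sup>2)"

definition bump_mass :: "'b::euclidean_space itself => real" where
 "bump_mass _ = (\<integral>(x::'b). bump 1 x \<partial>lborel)"

definition moll :: "real => 'b::euclidean_space => real" where
 "moll r x = bump r x / (r ^ DIM('b) * bump_mass TYPE('b))"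

definition moll_grad :: "real => 'b::euclidean_space => 'b" where
 "moll_grad r x = (- 2 * flat_exp 2 (1 - (x \<bullet> x) / r\<^sup>2) / (r\<^sup>2 * (r ^ DIM('b) * bump_mass TYPE('b)))) *# x"

lemma bump_eq_0: "r > 0 ==> norm x >= r ==> bump r x = 0"
proof -
 assume "r > 0" "norm x >= r"
 then have "r\<^sup>2 <= x \<bullet> x"
  unfolding power2_norm_eq_inner[symmetric] by (intro power_mono) auto
 then show ?thesis using \<open>r > 0\<close> by (simp add: bump_def flat_exp_def)
qed

lemma continuous_bump: "r > 0 ==> continuous_on UNIV (bump r)"
 unfolding bump_def[abs_def]
 by (intro continuous_on_compose2[OF continuous_flat_exp[of UNIV]] continuous_intros) auto

lemma integrable_bounded_support:
 fixes f :: "'b::euclidean_space => 'c::euclidean_space"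
 assumes [measurable]: "f : borel_funs" and "bounded S"
  and "!!x. x \<notin> S ==> f x = 0" and "!!x. norm (f x) <= C"
 shows "lint f"
proof -
 obtain R where R: "S \<subseteq> cball 0 R"
  using \<open>bounded S\<close> by (metis bounded_iff mem_cball_0 subsetI)
 have fin: "emeasure lborel (cball (0::'b) R) < \<infinity>"
  by (rule emeasure_bounded_finite) auto
 have "lint (indicator (cball (0::'b) R) :: 'b => real)"
  by (rule integrable_real_indicator[OF _ fin]) simp
 then have i: "lint (%x. C *# (indicator (cball (0::'b) R) x :: real))"
  by (rule integrable_scaleR_right)
 have b: "norm (f x) <= norm (C *# (indicator (cball (0::'b) R) x :: real))" for x
 proof (cases "x : cball 0 R")
  case True
  then show ?thesis using order_trans[OF assms(4) abs_ge_self] by simp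
 next
  case False
  then have "f x = 0" using R by (intro assms(3)) blast
  then show ?thesis by simp
 qed
 show ?thesis
  by (rule BI_integrable_bound[OF i]) (simp, rule AE_I2, rule b)
qed

lemma integrable_bump: "r > 0 ==> lint (bump r)"
 by (rule integrable_bounded_support[where S="cball 0 r" and C=1])
   (use flat_exp_abs[of 0] in \<open>auto intro!: borel_measurable_continuous_onI continuous_bump bump_eq_0\<close>, simp add: bump_def)

lemma bump_nonneg: "0 <= bump r x"
 by (simp add: bump_def flat_exp_nonneg)

lemma bump_mass_pos: "0 < bump_mass TYPE('b::euclidean_space)"
proof -
 have "bump_mass TYPE('b) \<noteq> 0"
 proof
  assume "bump_mass TYPE('b) = 0"
  then have "AE x::'b in lborel. bump 1 x = 0"
   unfolding bump_mass_def using integral_nonneg_eq_0_iff_AE[OF integrable_bump[of 1]] bump_nonneg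
   by (auto simp: bump_nonneg)
  then have "AE x::'b in lborel. x \<notin> ball 0 1"
  proof eventually_elim
   case (elim x)
   show ?case
   proof
   assume "x : ball 0 1"
   then have "x \<bullet> x < 1" using power2_norm_eq_inner[of x] by (simp add: abs_square_less_1 flip: power2_norm_eq_inner)
   then show False using elim flat_exp_pos[of "1 - x \<bullet> x" 0] by (simp add: bump_def)
   qed
  qed
  then have "emeasure lborel (ball (0::'b) 1) = 0"
   by (subst (asm) AE_iff_measurable[of "ball 0 1"]) auto
  then show False
   using content_ball_pos[of 1 "0::'b"] by (simp add: measure_def)
 qed
 moreover have "0 <= bump_mass TYPE('b)"
  unfolding bump_mass_def by (intro integral_nonneg_AE) (auto simp: bump_nonneg)
 ultimately show ?thesis by simp
qed

lemma moll_nonneg: "r > 0 ==> 0 <= moll r x"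
 using bump_mass_pos[where 'b='a] by (simp add: moll_def bump_nonneg)

lemma moll_eq_0: "r > 0 ==> norm x >= r ==> moll r x = 0"
 by (simp add: moll_def bump_eq_0)

lemma moll_minus: "moll r (- x) = moll r x" and moll_grad_minus: "moll_grad r (- x) = - moll_grad r x"
 by (auto simp: moll_def bump_def moll_grad_def)

lemma moll_has_derivative:
 assumes "r > 0"
 shows "(moll r has_derivative (%h. moll_grad r x \<bullet> h)) (at (x::'b::euclidean_space))"
proof -
 have s: "((%x::'b. 1 - (x \<bullet> x) / r\<^sup>2) has_derivative (%h. - (2 * (x \<bullet> h)) / r\<^sup>2)) (at x)"
  unfolding divide_inverse
  by (rule has_derivative_eq_rhs, (rule derivative_intros)+) (auto simp: inner_commute fun_eq_iff)
 have "((%x. flat_exp 0 (1 - (x \<bullet> x) / r\<^sup>2)) has_derivative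
   (%h. flat_exp 2 (1 - (x \<bullet> x) / r\<^sup>2) * (- (2 * (x \<bullet> h)) / r\<^sup>2))) (at x)"
  using has_derivative_compose[OF s flat_exp_has_derivative[of 0, unfolded has_field_derivative_def]]
  by (simp add: numeral_2_eq_2)
 then have "((%x::'b. moll r x) has_derivative
   (%h. flat_exp 2 (1 - (x \<bullet> x) / r\<^sup>2) * (- (2 * (x \<bullet> h)) / r\<^sup>2) / (r ^ DIM('b) * bump_mass TYPE('b)))) (at x)"
  unfolding moll_def bump_def divide_inverse[of _ "r ^ DIM('b) * bump_mass TYPE('b)"]
  by (rule has_derivative_mult_left)
 then show ?thesis
  by (rule has_derivative_eq_rhs) (simp add: moll_grad_def fun_eq_iff)
qed

lemma moll_grad_eq_0: "r > 0 ==> norm x >= r ==> moll_grad r x = 0"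
proof -
 assume "r > 0" "norm x >= r"
 then have "r\<^sup>2 <= x \<bullet> x"
  unfolding power2_norm_eq_inner[symmetric] by (intro power_mono) auto
 then show ?thesis using \<open>r > 0\<close> by (simp add: moll_grad_def flat_exp_def)
qed

lemma continuous_moll_grad: "r > 0 ==> continuous_on UNIV (moll_grad r)"
 unfolding moll_grad_def
 using bump_mass_pos[where 'b='a]
 by (intro continuous_intros continuous_on_compose2[OF continuous_flat_exp[of UNIV]]) auto

lemma continuous_moll: "r > 0 ==> continuous_on UNIV (moll r)"
 by (meson moll_has_derivative has_derivative_continuous_on has_derivative_at_withinI)

lemma moll_grad_bound:
 assumes "r > 0"
 shows "norm (moll_grad r (x::'b::euclidean_space)) <= (4 / bump_mass TYPE('b)) / r ^ (DIM('b) + 1)"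
proof (cases "norm x >= r")
 case True
 then show ?thesis using assms bump_mass_pos[where 'b='b] by (simp add: moll_grad_eq_0)
next
 case False
 let ?m = "bump_mass TYPE('b)"
 have m: "?m > 0" by (rule bump_mass_pos)
 have "norm (moll_grad r x) = 2 * flat_exp 2 (1 - (x \<bullet> x) / r\<^sup>2) / (r\<^sup>2 * (r ^ DIM('b) * ?m)) * norm x"
  using m assms by (simp add: moll_grad_def flat_exp_nonneg abs_mult)
 also have "\<dots> <= 2 * 2 / (r\<^sup>2 * (r ^ DIM('b) * ?m)) * r"
  using False flat_exp_le_fact[of 2 "1 - (x \<bullet> x) / r\<^sup>2"] m assms
  by (intro mult_mono divide_right_mono) (auto simp: fact_numeral flat_exp_nonneg)
 also have "\<dots> = (4 / ?m) / r ^ (DIM('b) + 1)"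
  using m assms by (simp add: field_simps power2_eq_square)
 finally show ?thesis .
qed

lemma Ck_moll: "Ck n (moll r)"
proof -
 have "Ck n (%x::'a. \<Sum>b\<in>A. (x \<bullet> b) * (x \<bullet> b))" if "finite A" for n A
  using that
 proof induction
  case empty
  show ?case using Ck_const[of n 0] by simp
 next
  case (insert b A)
  then show ?case by (auto intro!: Ck_add Ck_mult Ck_inner)
 qed
 note this[OF finite_Basis]
 then have "Ck n (%x::'a. 1 + (- 1 / r\<^sup>2) * (\<Sum>b\<in>Basis. (x \<bullet> b) * (x \<bullet> b)))" for n
  by (intro Ck_add Ck_mult Ck_const)
 moreover have "(%x::'a. 1 + (- 1 / r\<^sup>2) * (\<Sum>b\<in>Basis. (x \<bullet> b) * (x \<bullet> b))) = (%x. 1 - (x \<bullet> x) / r\<^sup>2)"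
  by (simp add: fun_eq_iff flip: euclidean_inner)
 ultimately have "Ck n (%x::'a. 1 - (x \<bullet> x) / r\<^sup>2)" for n
  by metis
 then have "Ck n (%x::'a. (1 / (r ^ DIM('a) * bump_mass TYPE('a))) * flat_exp 0 (1 - (x \<bullet> x) / r\<^sup>2))"
  by (intro Ck_mult Ck_const Ck_flat_exp_compose)
 then show ?thesis
  by (simp add: moll_def[abs_def] bump_def)
qed

lemma moll_mass:
 assumes "r > 0"
 shows "lint (moll r :: 'b::euclidean_space => real)" "(\<integral>(x::'b). moll r x \<partial>lborel) = 1"
proof -
 show "lint (moll r :: 'b => real)"
  unfolding moll_def[abs_def] using integrable_bump[OF assms] by (rule integrable_divide_zero)
 have [measurable]: "bump r : borel_measurable (borel :: 'b measure)"
  by (intro borel_measurable_continuous_onI continuous_bump assms)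
 have "(\<integral>(x::'b). bump r x \<partial>lborel) = (\<integral>(x::'b). bump r x \<partial>density (distr lborel borel (%x. 0 + r *# x)) (%_. ennreal (\<bar>r\<bar>^DIM('b))))"
  by (subst lborel_affine[of r 0]) (use assms in auto)
 also have "\<dots> = (\<integral>(x::'b). r^DIM('b) * bump r (r *# x) \<partial>lborel)"
  using assms by (subst integral_density) (auto simp: integral_distr)
 also have "(%x::'b. bump r (r *# x)) = bump 1"
  using assms by (auto simp: bump_def power2_eq_square fun_eq_iff)
 also have "(\<integral>(x::'b). r^DIM('b) * bump 1 x \<partial>lborel) = r^DIM('b) * bump_mass TYPE('b)"
  by (simp add: bump_mass_def)
 finally show "(\<integral>(x::'b). moll r x \<partial>lborel) = 1"
  using bump_mass_pos[where 'b='b] assms by (simp add: moll_def)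
qed

definition mollify :: "('b::euclidean_space => real) => ('b => 'c::euclidean_space) => 'b => 'c" where
 "mollify k f x = (\<integral>y. k (x - y) *# f y \<partial>lborel)"

lemma uniformly_continuous_compact_support:
 fixes g :: "'b::euclidean_space => 'c::real_normed_vector"
 assumes g: "continuous_on UNIV g" and z: "!!x. norm x >= R ==> g x = 0"
 shows "uniformly_continuous_on UNIV g"
proof (unfold uniformly_continuous_on_def, safe)
 fix e :: real assume "e > 0"
 have "uniformly_continuous_on (cball 0 (R + 1)) g"
  using g by (intro compact_uniformly_continuous) (auto intro: continuous_on_subset)
 then obtain d where d: "d > 0" "!!x y. x : cball 0 (R+1) ==> y : cball 0 (R+1) ==> dist y x < d ==> dist (g y) (g x) < e"
  using \<open>e > 0\<close> unfolding uniformly_continuous_on_def by metis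
 have "dist (g y) (g x) < e" if "dist y x < min d 1" for x y
 proof (cases "x : cball 0 (R+1) & y : cball 0 (R+1)")
  case True then show ?thesis using d that by auto
 next
  case False
  have "\<bar>norm y - norm x\<bar> < 1"
   using that norm_triangle_ineq3[of y x] by (simp add: dist_norm)
  then have "norm x >= R" "norm y >= R" using False by auto
  then show ?thesis using z \<open>e > 0\<close> by simp
 qed
 then show "\<exists>d>0. \<forall>x\<in>UNIV. \<forall>x'\<in>UNIV. dist x' x < d --> dist (g x') (g x) < e"
  using d(1) by (intro exI[of _ "min d 1"]) auto
qed

lemma bounded_compact_support:
 fixes g :: "'b::euclidean_space => 'c::real_normed_vector"
 assumes g: "continuous_on UNIV g" and z: "!!x. norm x >= R ==> g x = 0"
 obtains C where "!!x. norm (g x) <= C"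
proof -
 have "compact (g ` cball 0 R)"
  using g by (intro compact_continuous_image) (auto intro: continuous_on_subset)
 then obtain C where "!!x. x : cball 0 R ==> norm (g x) <= C"
  by (metis compact_imp_bounded bounded_iff imageI)
 then have "norm (g x) <= max C 0" for x
  using z[of x] by (cases "norm x <= R") (auto intro: le_max_iff_disj[THEN iffD2])
 then show thesis by (rule that)
qed

lemma integrable_bounded_scaleR:
 fixes f :: "'b => real" and g :: "'b => 'c::euclidean_space"
 assumes "integrable M f" "g : borel_measurable M" "!!x. norm (g x) <= C"
 shows "integrable M (%x. f x *# g x)"
proof (rule BI_integrable_bound)
 show "integrable M (%x. C * f x)" using assms(1) by simp
 show "(%x. f x *# g x) : borel_measurable M" using assms by measurable
 show "AE x in M. norm (f x *# g x) <= norm (C * f x)"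
  using assms(3) by (auto intro!: AE_I2 mult_mono simp: abs_mult mult.commute[of C] intro: order_trans[OF _ abs_ge_self])
qed

lemma integrable_scaleR_bounded:
 fixes f :: "'b => 'c::euclidean_space" and g :: "'b => real"
 assumes "integrable M f" "g : borel_measurable M" "!!x. \<bar>g x\<bar> <= C"
 shows "integrable M (%x. g x *# f x)"
proof (rule BI_integrable_bound)
 show "integrable M (%x. C *# f x)" using assms(1) by simp
 show "(%x. g x *# f x) : borel_measurable M" using assms by measurable
 show "AE x in M. norm (g x *# f x) <= norm (C *# f x)"
  using assms(3) by (auto intro!: AE_I2 mult_right_mono intro: order_trans[OF _ abs_ge_self])
qed

locale smooth_kernel =
 fixes k :: "'b::euclidean_space => real" and dk :: "'b => 'b" and R :: real
 assumes deriv: "!!x. (k has_derivative (%h. dk x \<bullet> h)) (at x)"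
  and cont: "continuous_on UNIV dk"
  and supp: "!!x. norm x >= R ==> k x = 0" "!!x. norm x >= R ==> dk x = 0"
begin

lemma cont_k: "continuous_on UNIV k"
 by (meson deriv has_derivative_continuous_on has_derivative_at_withinI)

lemma meas [measurable]: "k : borel_funs" "dk : borel_funs"
 by (auto intro!: borel_measurable_continuous_onI cont cont_k)

lemma taylor:
 assumes "e > 0"
 obtains d where "d > 0" "!!z h. norm h < d ==> \<bar>k (z + h) - k z - dk z \<bullet> h\<bar> <= e * norm h"
proof -
 obtain d where d: "d > 0" "!!x y. dist y x < d ==> dist (dk y) (dk x) < e"
  using uniformly_continuous_compact_support[OF cont supp(2)] assms
  unfolding uniformly_continuous_on_def by (metis UNIV_I)
 have "\<bar>k (z + h) - k z - dk z \<bullet> h\<bar> <= e * norm h" if "norm h < d" for z h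
 proof -
  let ?g = "%y. k y - dk z \<bullet> y"
  have "norm (?g (z + h) - ?g z) <= e * norm ((z + h) - z)"
  proof (rule differentiable_bound[where S="ball z d" and f'="%y h. dk y \<bullet> h - dk z \<bullet> h"])
   show "(?g has_derivative (%h. dk y \<bullet> h - dk z \<bullet> h)) (at y within ball z d)" for y
   by (intro derivative_intros has_derivative_at_withinI[OF deriv])
   show "onorm (%h. dk y \<bullet> h - dk z \<bullet> h) <= e" if "y : ball z d" for y
   proof (rule onorm_le)
   fix h
   have "norm (dk y \<bullet> h - dk z \<bullet> h) <= norm (dk y - dk z) * norm h"
   using Cauchy_Schwarz_ineq2[of "dk y - dk z" h] by (simp add: inner_diff_left)
   also have "\<dots> <= e * norm h"
   using d(2)[of y z] that by (intro mult_right_mono) (auto simp: dist_norm norm_minus_commute)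
   finally show "norm (dk y \<bullet> h - dk z \<bullet> h) <= e * norm h" .
   qed
  qed (use that d in \<open>auto simp: dist_norm\<close>)
  then show ?thesis by (simp add: inner_add_right algebra_simps)
 qed
 then show thesis using that d by blast
qed

lemma integrable_kernel:
 assumes "lint f"
 shows "lint (%y. k (x - y) * f y)" "lint (%y. f y *# dk (x - y))"
proof -
 obtain C where "!!x. norm (k x) <= C" using bounded_compact_support[OF cont_k supp(1)] by blast
 then show "lint (%y. k (x - y) * f y)"
  using integrable_scaleR_bounded[OF assms, of "%y. k (x - y)" C] by simp
 obtain C where "!!x. norm (dk x) <= C" using bounded_compact_support[OF cont supp(2)] by blast
 then show "lint (%y. f y *# dk (x - y))"
  using integrable_bounded_scaleR[OF assms, of "%y. dk (x - y)" C] by simp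
qed

lemma mollify_has_derivative:
 assumes f: "lint f"
 shows "(mollify k f has_derivative (%h. (\<integral>y. f y *# dk (x - y) \<partial>lborel) \<bullet> h)) (at x)"
proof (unfold has_derivative_within_alt, safe)
 show "bounded_linear ((\<bullet>) (\<integral>y. f y *# dk (x - y) \<partial>lborel))"
  by (rule bounded_linear_inner_right)
 fix e :: real assume e: "e > 0"
 let ?N = "\<integral>y. \<bar>f y\<bar> \<partial>lborel"
 have N: "?N >= 0" by simp
 have N1: "?N + 1 > 0" "\<not> ?N + 1 < 0" using N by linarith+
 obtain d where d: "d > 0" "!!z h. norm h < d ==> \<bar>k (z + h) - k z - dk z \<bullet> h\<bar> <= e / (?N + 1) * norm h"
  using taylor[of "e / (?N + 1)"] e N by auto
 have "norm (mollify k f y - mollify k f x - (\<integral>y. f y *# dk (x - y) \<partial>lborel) \<bullet> (y - x)) <= e * norm (y - x)"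
  if y: "norm (y - x) < d" for y
 proof -
  have "mollify k f y - mollify k f x - (\<integral>y. f y *# dk (x - y) \<partial>lborel) \<bullet> (y - x)
   = (\<integral>w. (k ((x - w) + (y - x)) - k (x - w) - dk (x - w) \<bullet> (y - x)) * f w \<partial>lborel)"
   unfolding mollify_def
   by (subst integral_inner_left[symmetric], rule integrable_kernel[OF f])
   (simp add: integrable_kernel[OF f] left_diff_distrib mult.commute[of "f _"]
   integrable_inner_left[OF integrable_kernel(2)[OF f], simplified mult.commute[of "f _"] inner_scaleR_left])
  also have "norm \<dots> <= (\<integral>w. (e / (?N + 1) * norm (y - x)) * \<bar>f w\<bar> \<partial>lborel)"
  proof (rule order_trans[OF integral_norm_bound], rule integral_mono')
   show "lint (%w. (e / (?N + 1) * norm (y - x)) * \<bar>f w\<bar>)"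
   using f by simp
   show "norm ((k ((x - w) + (y - x)) - k (x - w) - dk (x - w) \<bullet> (y - x)) * f w) <= e / (?N + 1) * norm (y - x) * \<bar>f w\<bar>" for w
   unfolding real_norm_def abs_mult by (intro mult_right_mono d(2) y) auto
  qed (use e N1 in \<open>auto intro!: divide_nonneg_pos mult_nonneg_nonneg\<close>)
  also have "\<dots> = e * norm (y - x) * (?N / (?N + 1))" by simp
  also have "\<dots> <= e * norm (y - x) * 1"
   using e N1 by (intro mult_left_mono) (simp_all add: divide_le_eq)
  finally show ?thesis by simp
 qed
 then show "\<exists>d>0. \<forall>y\<in>UNIV. norm (y - x) < d --> norm (mollify k f y - mollify k f x - (\<integral>y. f y *# dk (x - y) \<partial>lborel) \<bullet> (y - x)) <= e * norm (y - x)"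
  using d(1) by blast
qed

lemma continuous_mollify_grad:
 assumes f: "lint f"
 shows "continuous_on UNIV (%x. \<integral>y. f y *# dk (x - y) \<partial>lborel)"
proof (unfold continuous_on_iff, safe)
 fix x :: 'b and e :: real assume e: "e > 0"
 let ?N = "\<integral>y. \<bar>f y\<bar> \<partial>lborel"
 have N: "?N >= 0" by simp
 have N1: "?N + 1 > 0" "\<not> ?N + 1 < 0" using N by linarith+
 obtain d where d: "d > 0" "!!x y. dist y x < d ==> dist (dk y) (dk x) < e / (?N + 1)"
  using uniformly_continuous_compact_support[OF cont supp(2)] e N
  unfolding uniformly_continuous_on_def by (metis UNIV_I divide_pos_pos add_nonneg_pos zero_less_one)
 have "dist (\<integral>y. f y *# dk (x' - y) \<partial>lborel) (\<integral>y. f y *# dk (x - y) \<partial>lborel) < e" if "dist x' x < d" for x'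
 proof -
  have "dist (\<integral>y. f y *# dk (x' - y) \<partial>lborel) (\<integral>y. f y *# dk (x - y) \<partial>lborel)
   = norm (\<integral>w. f w *# (dk (x' - w) - dk (x - w)) \<partial>lborel)"
   by (simp add: dist_norm integrable_kernel[OF f] scaleR_diff_right)
  also have "\<dots> <= (\<integral>w. (e / (?N + 1)) * \<bar>f w\<bar> \<partial>lborel)"
  proof (rule order_trans[OF integral_norm_bound], rule integral_mono')
   show "lint (%w. (e / (?N + 1)) * \<bar>f w\<bar>)"
   using f by simp
   show "norm (f w *# (dk (x' - w) - dk (x - w))) <= e / (?N + 1) * \<bar>f w\<bar>" for w
   unfolding norm_scaleR using d(2)[of "x' - w" "x - w"] that
   by (subst mult.commute, intro mult_right_mono) (auto simp: dist_norm)
  qed (use e N1 in \<open>auto intro!: divide_nonneg_pos mult_nonneg_nonneg\<close>)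
  also have "\<dots> = e * (?N / (?N + 1))" by simp
  also have "\<dots> < e * 1"
   using e N1 by (intro mult_strict_left_mono) (simp_all add: divide_less_eq)
  finally show ?thesis by simp
 qed
 then show "\<exists>d>0. \<forall>x'\<in>UNIV. dist x' x < d --> dist (\<integral>y. f y *# dk (x' - y) \<partial>lborel) (\<integral>y. f y *# dk (x - y) \<partial>lborel) < e"
  using d(1) by blast
qed

end

lemma grad_inner:
 assumes "(phi has_derivative D) (at x)"
 shows "grad phi x \<bullet> h = D h"
proof -
 have D: "frechet_derivative phi (at x) = D" using frechet_derivative_at[OF assms] by simp
 interpret bounded_linear D using assms by (rule has_derivative_bounded_linear)
 have "D h = D (\<Sum>b\<in>Basis. (h \<bullet> b) *# b)" by (simp add: euclidean_representation)
 also have "\<dots> = grad phi x \<bullet> h"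
  by (simp add: sum scaleR grad_def D inner_sum_right inner_commute[of "grad phi x"] inner_commute[of "sum _ _"] mult.commute)
 finally show ?thesis by simp
qed

lemma Ck_grad:
 assumes "!!n. Ck n phi"
 shows "(phi has_derivative (%h. grad phi x \<bullet> h)) (at x)" "continuous_on UNIV (grad phi)"
  "b : Basis ==> Ck n (%x. grad phi x \<bullet> b)"
proof -
 note d = Ck_SucD(1)[OF assms]
 show "(phi has_derivative (%h. grad phi x \<bullet> h)) (at x)"
  using d[of x] grad_inner[OF d[of x]] by simp
 show "b : Basis ==> Ck n (%x. grad phi x \<bullet> b)" for b
  using Ck_SucD(2)[OF assms] grad_inner[OF d] by simp
 have "b : Basis ==> continuous_on UNIV (%x. frechet_derivative phi (at x) b)" for b
  using Ck_SucD(2)[OF assms, of b 0] by simp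
 then show "continuous_on UNIV (grad phi)"
  unfolding grad_def[abs_def] by (intro continuous_intros) auto
qed

lemma smooth_kernel_Ck:
 assumes k: "!!n. Ck n k" and s: "!!x. norm x >= R ==> k x = 0"
 shows "smooth_kernel k (grad k) (R + 1)"
proof
 show "(k has_derivative (%h. grad k x \<bullet> h)) (at x)" for x by (rule Ck_grad[OF k])
 show "continuous_on UNIV (grad k)" by (rule Ck_grad[OF k])
 show "k x = 0" if "norm x >= R + 1" for x using s that by auto
 show "grad k x = 0" if "norm x >= R + 1" for x
 proof -
  have "(k has_derivative (%h. 0)) (at x)"
  proof (rule has_derivative_transform_within_open[where s="- cball 0 R" and f="%_. 0"])
   show "x : - cball 0 R" using that by auto
   show "0 = k y" if "y : - cball 0 R" for y using that s[of y] by auto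
  qed auto
  from grad_inner[OF this] show ?thesis by (metis inner_eq_zero_iff)
 qed
qed

lemma Ck_mollify:
 assumes f: "lint f"
  and "!!n. Ck n k" and "!!x. norm x >= R ==> k x = 0"
 shows "Ck n (mollify k f)"
 using assms(2,3)
proof (induction n arbitrary: k R)
 case 0
 interpret smooth_kernel k "grad k" "R + 1" using smooth_kernel_Ck 0 by blast
 show ?case
  using has_derivative_continuous_on[OF has_derivative_at_withinI[OF mollify_has_derivative[OF f]], of UNIV] by simp
next
 case (Suc n)
 interpret smooth_kernel k "grad k" "R + 1" using smooth_kernel_Ck Suc.prems by blast
 show ?case
 proof (rule Ck_SucI[OF mollify_has_derivative[OF f]])
  fix b :: 'a assume b: "b : Basis"
  have "Ck n (mollify (%x. grad k x \<bullet> b) f)"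
   by (rule Suc.IH[where R="R+1"]) (use supp(2) Ck_grad(3)[OF Suc.prems(1) b] in auto)
  moreover have "mollify (%x. grad k x \<bullet> b) f = (%x. (\<integral>y. f y *# grad k (x - y) \<partial>lborel) \<bullet> b)"
   unfolding mollify_def
   by (subst integral_inner_left[symmetric], rule integrable_kernel[OF f])
   (simp add: mult.commute)
  ultimately show "Ck n (%x. (\<integral>y. f y *# grad k (x - y) \<partial>lborel) \<bullet> b)" by simp
 qed
qed

lemma smooth_kernel_moll: "r > 0 ==> smooth_kernel (moll r) (moll_grad r) r"
 by unfold_locales (auto intro: moll_has_derivative continuous_moll_grad moll_eq_0 moll_grad_eq_0)

lemma borel_measurable_moll [measurable]: "r > 0 ==> moll r : borel_funs"
 by (intro borel_measurable_continuous_onI continuous_moll)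

section \<open>Convergence of mollifications in the mean\<close>

lemma nn_integral_translate:
 fixes c :: "'b::euclidean_space"
 assumes [measurable]: "f : borel_funs"
 shows "(\<integral>\<^sup>+x. f (x + c) \<partial>lborel) = (\<integral>\<^sup>+x. f x \<partial>lborel)"
 by (subst (2) lborel_distr_plus[of c, symmetric], subst nn_integral_distr) (simp_all add: add.commute)

lemma nn_integral_reflect:
 fixes c :: "'b::euclidean_space"
 assumes [measurable]: "f : borel_funs"
 shows "(\<integral>\<^sup>+x. f (c - x) \<partial>lborel) = (\<integral>\<^sup>+x. f x \<partial>lborel)"
 by (subst (2) lborel_affine[of "-1" c], simp, subst nn_integral_density, simp_all, subst nn_integral_distr, simp_all)

lemma nn_integral_moll:
 assumes "r > 0"
 shows "(\<integral>\<^sup>+x. ennreal (moll r (x - y)) \<partial>lborel) = 1" "(\<integral>\<^sup>+x. ennreal (moll r (y - x)) \<partial>lborel) = 1"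
proof -
 have m: "moll r : borel_funs" using assms by measurable
 have m': "(%x. ennreal (moll r x)) : borel_funs" using m by measurable
 have 1: "(\<integral>\<^sup>+x. ennreal (moll r (x::'a)) \<partial>lborel) = 1"
  using moll_mass[OF assms, where 'b='a] moll_nonneg[OF assms]
  by (subst nn_integral_eq_integral) auto
 show "(\<integral>\<^sup>+x. ennreal (moll r (x - y)) \<partial>lborel) = 1"
  using nn_integral_translate[of "%x. ennreal (moll r x)" "- y", OF m'] 1 by simp
 show "(\<integral>\<^sup>+x. ennreal (moll r (y - x)) \<partial>lborel) = 1"
  using nn_integral_reflect[of "%x. ennreal (moll r x)" y, OF m'] 1 by simp
qed

lemma borel_measurable_mollify [measurable]:
 fixes f :: "'b::euclidean_space => 'c::euclidean_space"
 assumes [measurable]: "k : borel_funs" "f : borel_funs"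
 shows "mollify k f : borel_funs"
proof -
 have "(%x. \<integral>y. k (x - y) *# f y \<partial>lborel) : borel_funs"
  by (rule lborel.borel_measurable_lebesgue_integral) measurable
 then show ?thesis by (simp add: mollify_def[abs_def])
qed

lemma nn_integral_moll_convolution:
 fixes g :: "'b::euclidean_space => ennreal"
 assumes r: "r > 0" and [measurable]: "g : borel_funs"
 shows "(\<integral>\<^sup>+x. \<integral>\<^sup>+y. ennreal (moll r (x - y)) * g y \<partial>lborel \<partial>lborel) = (\<integral>\<^sup>+y. g y \<partial>lborel)"
proof -
 have [measurable]: "moll r : borel_measurable (borel :: 'b measure)" using r by measurable
 have "(\<integral>\<^sup>+x. \<integral>\<^sup>+y. ennreal (moll r (x - y)) * g y \<partial>lborel \<partial>lborel) =
   (\<integral>\<^sup>+y. \<integral>\<^sup>+x. ennreal (moll r (x - y)) * g y \<partial>lborel \<partial>lborel)"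
  by (rule lborel_pair.Fubini') measurable
 also have "\<dots> = (\<integral>\<^sup>+y. g y \<partial>lborel)"
  by (simp add: nn_integral_multc nn_integral_moll r)
 finally show ?thesis .
qed

lemma norm_mollify_le:
 fixes f :: "'b::euclidean_space => 'c::euclidean_space"
 assumes r: "r > 0" and [measurable]: "f : borel_funs"
 shows "ennreal (norm (mollify (moll r) f x)) <= (\<integral>\<^sup>+y. ennreal (moll r (x - y)) * ennreal (norm (f y)) \<partial>lborel)"
proof -
 have [measurable]: "moll r : borel_measurable (borel :: 'b measure)" using r by measurable
 have "ennreal (norm (mollify (moll r) f x)) <= (\<integral>\<^sup>+y. norm (moll r (x - y) *# f y) \<partial>lborel)"
 proof (cases "lint (%y. moll r (x - y) *# f y)")
  case True
  then show ?thesis unfolding mollify_def by (rule integral_norm_bound_ennreal)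
 next
  case False
  then show ?thesis by (simp add: mollify_def not_integrable_integral_eq)
 qed
 moreover have "ennreal (norm (moll r (x - y) *# f y)) = ennreal (moll r (x - y)) * ennreal (norm (f y))" for y
  using moll_nonneg[OF r, of "x - y"] by (simp add: ennreal_mult)
 ultimately show ?thesis by simp
qed

lemma nn_integral_mollify_le:
 fixes f :: "'b::euclidean_space => 'c::euclidean_space"
 assumes r: "r > 0" and [measurable]: "f : borel_funs"
 shows "(\<integral>\<^sup>+x. norm (mollify (moll r) f x) \<partial>lborel) <= (\<integral>\<^sup>+x. norm (f x) \<partial>lborel)"
proof -
 have "(\<integral>\<^sup>+x. norm (mollify (moll r) f x) \<partial>lborel) <= (\<integral>\<^sup>+x. \<integral>\<^sup>+y. ennreal (moll r (x - y)) * ennreal (norm (f y)) \<partial>lborel \<partial>lborel)"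
  by (intro nn_integral_mono norm_mollify_le r assms)
 then show ?thesis by (subst (asm) nn_integral_moll_convolution[OF r]) auto
qed

lemma integrable_moll_scaleR:
 fixes f :: "'b::euclidean_space => 'c::euclidean_space"
 assumes r: "r > 0" and f: "lint f"
 shows "lint (%y. moll r (x - y) *# f y)"
proof -
 interpret smooth_kernel "moll r :: 'b => real" "moll_grad r" r by (rule smooth_kernel_moll[OF r])
 obtain C where "!!x::'b. norm (moll r x) <= C" using bounded_compact_support[OF cont_k supp(1)] by blast
 then show ?thesis
  using integrable_scaleR_bounded[OF f, of "%y. moll r (x - y)" C] by simp
qed

lemma integrable_mollify:
 fixes f :: "'b::euclidean_space => 'c::euclidean_space"
 assumes r: "r > 0" and f: "lint f"
 shows "lint (mollify (moll r) f)"
proof (rule integrableI_bounded)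
 have [measurable]: "f : borel_funs" using f by auto
 have [measurable]: "moll r : borel_measurable (borel :: 'b measure)" using r by measurable
 show "mollify (moll r) f : borel_measurable lborel" by simp
 show "(\<integral>\<^sup>+x. norm (mollify (moll r) f x) \<partial>lborel) < \<infinity>"
  using nn_integral_mollify_le[OF r, of f] f
  by (auto simp: integrable_iff_bounded intro: le_less_trans)
qed

lemma mollify_add:
 assumes r: "r > 0" and "lint f" "lint g"
 shows "mollify (moll r) (%x. f x + g x) y = mollify (moll r) f y + mollify (moll r) g y"
 unfolding mollify_def by (simp add: scaleR_add_right integrable_moll_scaleR assms)

lemma mollify_diff:
 assumes r: "r > 0" and "lint f" "lint g"
 shows "mollify (moll r) (%x. f x - g x) y = mollify (moll r) f y - mollify (moll r) g y"
 unfolding mollify_def by (simp add: scaleR_diff_right integrable_moll_scaleR assms)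

definition rad :: "nat => real" where "rad n = inverse (real (Suc n))"

lemma rad_pos [simp]: "0 < rad n" and rad_le_1: "rad n <= 1" and rad_tendsto: "rad \<rightarrow> 0"
 using LIMSEQ_inverse_real_of_nat by (auto simp: rad_def[abs_def] inverse_le_1_iff)

lemma rad_eventually: "e > 0 ==> \<forall>\<^sub>F n in sequentially. rad n < e"
 using order_tendstoD(2)[OF rad_tendsto] by auto

abbreviation moll_err :: "('b::euclidean_space => 'c::euclidean_space) => nat => ennreal" where
 "moll_err f n \<equiv> (\<integral>\<^sup>+x. norm (mollify (moll (rad n)) f x - f x) \<partial>lborel)"

lemma moll_err_approx:
 fixes f g :: "'b::euclidean_space => 'c::euclidean_space"
 assumes f: "lint f" and g: "lint g"
 shows "moll_err f n <= 2 * (\<integral>\<^sup>+x. norm (f x - g x) \<partial>lborel) + moll_err g n"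
proof -
 note r = rad_pos[of n]
 have [measurable]: "f : borel_funs" "g : borel_funs" using f g by auto
 have [measurable]: "moll (rad n) : borel_measurable (borel :: 'b measure)" using r by measurable
 have "norm (mollify (moll (rad n)) f x - f x) <= norm (mollify (moll (rad n)) (%x. f x - g x) x) +
  norm (mollify (moll (rad n)) g x - g x) + norm (f x - g x)" for x
  unfolding mollify_diff[OF r f g] by norm
 then have "ennreal (norm (mollify (moll (rad n)) f x - f x)) <= ennreal (norm (mollify (moll (rad n)) (%x. f x - g x) x)) +
  ennreal (norm (mollify (moll (rad n)) g x - g x)) + ennreal (norm (f x - g x))" for x
  by (simp flip: ennreal_plus)
 then have "moll_err f n <= (\<integral>\<^sup>+x. ennreal (norm (mollify (moll (rad n)) (%x. f x - g x) x)) +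
  ennreal (norm (mollify (moll (rad n)) g x - g x)) + ennreal (norm (f x - g x)) \<partial>lborel)"
  by (intro nn_integral_mono)
 also have "\<dots> = (\<integral>\<^sup>+x. ennreal (norm (mollify (moll (rad n)) (%x. f x - g x) x)) \<partial>lborel) + moll_err g n + (\<integral>\<^sup>+x. norm (f x - g x) \<partial>lborel)"
  by (simp add: nn_integral_add)
 also have "\<dots> <= (\<integral>\<^sup>+x. norm (f x - g x) \<partial>lborel) + moll_err g n + (\<integral>\<^sup>+x. norm (f x - g x) \<partial>lborel)"
  by (intro add_right_mono nn_integral_mollify_le r) measurable
 finally show ?thesis by (simp add: mult_2 ac_simps)
qed

definition moll_conv :: "('b::euclidean_space => 'c::euclidean_space) => bool" where
 "moll_conv f \<longleftrightarrow> (\<forall>e>0. \<forall>\<^sub>F n in sequentially. moll_err f n <= ennreal e)"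

lemma moll_conv_approx:
 fixes f :: "'b::euclidean_space => 'c::euclidean_space"
 assumes f: "lint f"
  and g: "!!e. e > 0 ==> \<exists>g. lint g & moll_conv g & (\<integral>\<^sup>+x. norm (f x - g x) \<partial>lborel) <= ennreal e"
 shows "moll_conv f"
 unfolding moll_conv_def
proof safe
 fix e :: real assume e: "e > 0"
 then obtain g where g: "lint g" "moll_conv g" "(\<integral>\<^sup>+x. norm (f x - g x) \<partial>lborel) <= ennreal (e/3)"
  using g[of "e/3"] by auto
 have "\<forall>\<^sub>F n in sequentially. moll_err g n <= ennreal (e/3)"
  using g(2) e unfolding moll_conv_def by (auto dest: spec[of _ "e/3"])
 then show "\<forall>\<^sub>F n in sequentially. moll_err f n <= ennreal e"
 proof eventually_elim
  case (elim n)
  have "moll_err f n <= 2 * (\<integral>\<^sup>+x. norm (f x - g x) \<partial>lborel) + moll_err g n"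
   by (rule moll_err_approx[OF f g(1)])
  also have "\<dots> <= 2 * ennreal (e/3) + ennreal (e/3)"
   by (intro add_mono mult_left_mono g elim) auto
  also have "\<dots> = ennreal e" using e
   by (simp add: ennreal_mult'[symmetric] ennreal_plus[symmetric] flip: ennreal_numeral del: ennreal_plus)
  finally show ?case .
 qed
qed

lemma moll_conv_open:
 fixes U :: "'b::euclidean_space set" and c :: "'c::euclidean_space"
 assumes U: "open U" and fin: "emeasure lborel U < \<infinity>"
 shows "moll_conv (%x. indicator U x *# c)"
proof -
 have [measurable]: "U : sets borel" using U by simp
 define a where "a n = mollify (moll (rad n)) (indicator U :: 'b => real)" for n
 have iU: "lint (indicator U :: 'b => real)"
  using fin by (intro integrable_real_indicator) auto
 have ia: "lint (a n)" for n
  unfolding a_def by (rule integrable_mollify[OF rad_pos iU])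
 have [measurable]: "a n : borel_funs" for n using ia by auto
 have a0: "0 <= a n x" for n x
  unfolding a_def mollify_def by (intro integral_nonneg_AE) (auto simp: moll_nonneg)
 have ea: "ennreal (a n x) = (\<integral>\<^sup>+y. ennreal (moll (rad n) (x - y)) * ennreal (indicator U y) \<partial>lborel)" for n x
  unfolding a_def mollify_def
  using integrable_moll_scaleR[OF rad_pos iU]
  by (subst nn_integral_eq_integral[symmetric]) (auto simp: moll_nonneg ennreal_mult')
 have "(\<integral>\<^sup>+x. ennreal (a n x) \<partial>lborel) = emeasure lborel U" for n
  unfolding ea by (subst nn_integral_moll_convolution) (auto simp: ennreal_indicator)
 then have Ia: "(\<integral>x. a n x \<partial>lborel) = measure lborel U" for n
  by (subst integral_eq_nn_integral) (auto simp: a0 measure_def)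
 define m where "m n x = max 0 (indicator U x - a n x)" for n x
 have im: "lint (m n)" for n
  unfolding m_def using iU ia by (intro integrable_max BI_integrable_diff) auto
 have "(%n. \<integral>x. m n x \<partial>lborel) \<rightarrow> (\<integral>x. 0 \<partial>(lborel :: 'b measure))"
 proof (rule integral_dominated_convergence[where w="indicator U"])
  show "AE x in lborel. (%n. m n x) \<rightarrow> 0"
  proof (rule AE_I2)
   fix x :: 'b
   show "(%n. m n x) \<rightarrow> 0"
   proof (cases "x : U")
   case True
   then obtain e where e: "e > 0" "ball x e \<subseteq> U" using U openE by blast
   have "\<forall>\<^sub>F n in sequentially. m n x = 0"
   using rad_eventually[OF e(1)]
   proof eventually_elim
   case (elim n)
   have "ennreal (a n x) = (\<integral>\<^sup>+y. ennreal (moll (rad n) (x - y)) \<partial>lborel)"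
   unfolding ea
   proof (rule nn_integral_cong)
   fix y
   show "ennreal (moll (rad n) (x - y)) * ennreal (indicator U y) = ennreal (moll (rad n) (x - y))"
   proof (cases "y : U")
   case False
   then have "norm (x - y) >= rad n" using e elim by (force simp: dist_norm)
   then show ?thesis by (simp add: moll_eq_0)
   qed simp
   qed
   then have "a n x = 1"
   using nn_integral_moll(2)[of "rad n" x] by (simp add: ennreal_eq_1)
   then show ?case by (simp add: m_def True)
   qed
   then show ?thesis by (rule tendsto_eventually)
   next
   case False
   then have "m n x = 0" for n using a0[of n x] by (simp add: m_def)
   then show ?thesis by simp
   qed
  qed
  show "AE x in lborel. norm (m n x) <= indicator U x" for n
   using a0 by (intro AE_I2) (auto simp: m_def split: split_indicator)
 qed (use iU im in auto)
 then have lim: "(%n. norm c * (2 * (\<integral>x. m n x \<partial>lborel))) \<rightarrow> 0"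
  by (auto intro!: tendsto_eq_intros)
 have err: "moll_err (%x. indicator U x *# c) n = ennreal (norm c * (2 * (\<integral>x. m n x \<partial>lborel)))" for n
 proof -
  have "mollify (moll (rad n)) (%x. indicator U x *# c) x = a n x *# c" for x
   unfolding a_def mollify_def using integrable_moll_scaleR[OF rad_pos iU, of n x]
   by (subst integral_scaleR_left[symmetric]) auto
  then have "norm (mollify (moll (rad n)) (%x. indicator U x *# c) x - indicator U x *# c) = norm c * ((a n x - indicator U x) + 2 * m n x)" for x
   by (cases "a n x <= indicator U x") (simp_all add: m_def max_def flip: scaleR_diff_left)
  then have "moll_err (%x. indicator U x *# c) n = (\<integral>\<^sup>+x. ennreal (norm c * ((a n x - indicator U x) + 2 * m n x)) \<partial>lborel)"
   by simp
  also have "\<dots> = ennreal (\<integral>x. norm c * ((a n x - indicator U x) + 2 * m n x) \<partial>lborel)"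
  proof (rule nn_integral_eq_integral)
   show "lint (%x. norm c * ((a n x - indicator U x) + 2 * m n x))"
   using ia iU im by (intro integrable_mult_right BI_integrable_add BI_integrable_diff) auto
   show "AE x in lborel. 0 <= norm c * ((a n x - indicator U x) + 2 * m n x)"
   by (intro AE_I2 mult_nonneg_nonneg) (auto simp: m_def max_def)
  qed
  also have "(\<integral>x. norm c * ((a n x - indicator U x) + 2 * m n x) \<partial>lborel) = norm c * (2 * (\<integral>x. m n x \<partial>lborel))"
   using ia iU im Ia by simp
  finally show ?thesis .
 qed
 show ?thesis
  unfolding moll_conv_def err
 proof safe
  fix e :: real assume "e > 0"
  from order_tendstoD(2)[OF lim this]
  show "\<forall>\<^sub>F n in sequentially. ennreal (norm c * (2 * (\<integral>x. m n x \<partial>lborel))) <= ennreal e"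
   by eventually_elim (intro ennreal_leI, simp)
 qed
qed

lemma moll_conv_integrable:
 fixes f :: "'b::euclidean_space => 'c::euclidean_space"
 assumes "lint f"
 shows "moll_conv f"
 using assms
proof (induction rule: integrable_induct)
 case (base A c)
 then have [measurable]: "A : sets borel" by simp
 have fA: "emeasure lborel A < \<infinity>" using base by simp
 show ?case
 proof (rule moll_conv_approx)
  show "lint (%x. indicator A x *# c)"
   using fA by (intro integrable_scaleR_left integrable_real_indicator) auto
  fix e :: real assume e: "e > 0"
  have "A : sets lebesgue" by simp
  moreover have "0 < e / (norm c + 1)" using e by (intro divide_pos_pos add_nonneg_pos) auto
  ultimately obtain U where U: "open U" "A \<subseteq> U" "emeasure lebesgue (U - A) < ennreal (e / (norm c + 1))"
   by (rule sets_lebesgue_outer_open)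
  then have [measurable]: "U : sets borel" by simp
  have UA: "emeasure lborel (U - A) <= ennreal (e / (norm c + 1))"
   using U(3) by (auto simp: emeasure_completion)
  have "emeasure lborel U <= emeasure lborel A + emeasure lborel (U - A)"
   using U(2) by (intro order_trans[OF _ emeasure_subadditive]) (auto intro!: emeasure_mono)
  also have "\<dots> < \<infinity>" using fA UA by (auto intro: le_less_trans)
  finally have fU: "emeasure lborel U < \<infinity>" .
  have "lint (%x. indicator U x *# c)"
   using fU by (intro integrable_scaleR_left integrable_real_indicator) auto
  moreover have "(\<integral>\<^sup>+x. norm (indicator A x *# c - indicator U x *# c) \<partial>lborel) <= ennreal e"
  proof -
   have "(\<integral>\<^sup>+x. norm (indicator A x *# c - indicator U x *# c) \<partial>lborel) = (\<integral>\<^sup>+x. ennreal (norm c) * indicator (U - A) x \<partial>lborel)"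
   using U(2) by (intro nn_integral_cong) (auto split: split_indicator)
   also have "\<dots> = ennreal (norm c) * emeasure lborel (U - A)"
   by (subst nn_integral_cmult_indicator) auto
   also have "\<dots> <= ennreal (norm c) * ennreal (e / (norm c + 1))"
   by (intro mult_left_mono UA) auto
   also have "\<dots> = ennreal (norm c * (e / (norm c + 1)))" using e by (subst ennreal_mult) (simp_all add: add_nonneg_nonneg)
   also have "\<dots> <= ennreal e"
   proof (rule ennreal_leI)
   have p: "0 < norm c + 1" by (intro add_nonneg_pos) auto
   have "norm c * e <= e * (norm c + 1)" using e by (simp add: algebra_simps)
   then show "norm c * (e / (norm c + 1)) <= e" by (simp add: pos_divide_le_eq[OF p])
   qed
   finally show ?thesis .
  qed
  ultimately show "\<exists>g. lint g & moll_conv g & (\<integral>\<^sup>+x. norm (indicator A x *# c - g x) \<partial>lborel) <= ennreal e"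
   using moll_conv_open[OF U(1) fU] by blast
 qed
next
 case (add f g)
 have "moll_err (%x. f x + g x) n <= moll_err f n + moll_err g n" for n
 proof -
  note r = rad_pos[of n]
  have [measurable]: "f : borel_funs" "g : borel_funs" using add by auto
  have [measurable]: "moll (rad n) : borel_measurable (borel :: 'b measure)" using r by measurable
  have "norm (mollify (moll (rad n)) (%x. f x + g x) x - (f x + g x)) <= norm (mollify (moll (rad n)) f x - f x) +
   norm (mollify (moll (rad n)) g x - g x)" for x
   unfolding mollify_add[OF r add.hyps] by norm
  then have "moll_err (%x. f x + g x) n <= (\<integral>\<^sup>+x. ennreal (norm (mollify (moll (rad n)) f x - f x)) +
   ennreal (norm (mollify (moll (rad n)) g x - g x)) \<partial>lborel)"
   by (intro nn_integral_mono) (simp flip: ennreal_plus)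
  also have "\<dots> = moll_err f n + moll_err g n"
   by (simp add: nn_integral_add)
  finally show ?thesis .
 qed
 note le = this
 show ?case
  unfolding moll_conv_def
 proof safe
  fix e :: real assume e: "e > 0"
  have "\<forall>\<^sub>F n in sequentially. moll_err f n <= ennreal (e/2)" "\<forall>\<^sub>F n in sequentially. moll_err g n <= ennreal (e/2)"
   using add e unfolding moll_conv_def by (auto dest: spec[of _ "e/2"])
  then show "\<forall>\<^sub>F n in sequentially. moll_err (%x. f x + g x) n <= ennreal e"
  proof eventually_elim
   case (elim n)
   have "moll_err (%x. f x + g x) n <= ennreal (e/2) + ennreal (e/2)"
   by (rule order_trans[OF le add_mono[OF elim]])
   also have "\<dots> = ennreal e" using e by (simp flip: ennreal_plus)
   finally show ?case .
  qed
 qed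
next
 case (lim f s)
 show ?case
 proof (rule moll_conv_approx[OF lim.hyps(4)])
  fix e :: real assume e: "e > 0"
  have [measurable]: "f : borel_funs" "!!i. s i : borel_funs" using lim by auto
  have "(%i. \<integral>\<^sup>+x. norm (f x - s i x) \<partial>lborel) \<rightarrow> 0"
  proof (rule nn_integral_dominated_convergence_norm[where w="%x. 2 * norm (f x)"])
   show "AE x in lborel. norm (s i x) <= 2 * norm (f x)" for i using lim.hyps(3) by (intro AE_I2) auto
   show "AE x in lborel. (%i. s i x) \<rightarrow> f x" using lim.hyps(2) by (intro AE_I2) auto
   show "(\<integral>\<^sup>+x. ennreal (2 * norm (f x)) \<partial>lborel) < \<infinity>"
   proof -
   have "lint (%x. 2 * norm (f x))" using lim.hyps(4) by (intro integrable_mult_right integrable_norm)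
   then have "(\<integral>\<^sup>+x. ennreal (2 * norm (f x)) \<partial>lborel) = ennreal (\<integral>x. 2 * norm (f x) \<partial>lborel)"
   by (rule nn_integral_eq_integral) auto
   then show ?thesis by simp
   qed
  qed auto
  then have "\<forall>\<^sub>F i in sequentially. (\<integral>\<^sup>+x. norm (f x - s i x) \<partial>lborel) < ennreal e"
   using e by (intro order_tendstoD(2)) auto
  then obtain i where "(\<integral>\<^sup>+x. norm (f x - s i x) \<partial>lborel) < ennreal e"
   by (auto simp: eventually_sequentially)
  then show "\<exists>g. lint g & moll_conv g & (\<integral>\<^sup>+x. norm (f x - g x) \<partial>lborel) <= ennreal e"
   using lim.hyps(1) lim.IH by (intro exI[of _ "s i"]) auto
 qed
qed

text \<open>Mollification contracts the \<open>L\<^sup>1\<close> norm, so it suffices to treat a dense class; indicators of open sets of finite measure generate one.\<close>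

theorem mollify_L1:
 fixes f :: "'b::euclidean_space => 'c::euclidean_space"
 assumes f: "lint f"
 shows "(%n. \<integral>x. norm (mollify (moll (rad n)) f x - f x) \<partial>lborel) \<rightarrow> 0"
proof -
 have i: "lint (%x. norm (mollify (moll (rad n)) f x - f x))" for n
  by (intro integrable_norm BI_integrable_diff integrable_mollify f rad_pos)
 show ?thesis
 proof (rule tendstoI)
  fix e :: real assume e: "e > 0"
  then have "\<forall>\<^sub>F n in sequentially. moll_err f n <= ennreal (e/2)"
   using moll_conv_integrable[OF f] unfolding moll_conv_def by (auto dest: spec[of _ "e/2"])
  then show "\<forall>\<^sub>F n in sequentially. dist (\<integral>x. norm (mollify (moll (rad n)) f x - f x) \<partial>lborel) 0 < e"
  proof eventually_elim
   case (elim n)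
   then have "(\<integral>x. norm (mollify (moll (rad n)) f x - f x) \<partial>lborel) <= e/2"
   using nn_integral_eq_integral[OF i[of n]] e by (simp add: ennreal_le_iff)
   then show ?case using e by (simp add: integral_nonneg_AE)
  qed
 qed
qed

section \<open>Borel representatives and local integrability\<close>

lemma AE_lebesgue_on_iff:
 assumes "S : sets borel"
 shows "(AE x in lebesgue_on S. P x) \<longleftrightarrow> (AE x in lborel. x : S --> P x)"
 using assms by (subst AE_restrict_space_iff) (simp_all add: AE_completion_iff)

lemma borel_representative:
 fixes f :: "'b::euclidean_space => 'c::euclidean_space"
 assumes S: "S : sets borel" and f: "f : borel_measurable (lebesgue_on S)"
 obtains f' where "f' : borel_funs" "!!x. x \<notin> S ==> f' x = 0" "AE x in lborel. x : S --> f' x = f x"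
proof -
 have [measurable]: "S : sets borel" by fact
 have m: "(%x. indicator S x *# f x) : borel_measurable lebesgue"
  using f S by (subst (asm) borel_measurable_restrict_space_iff) auto
 have "\<exists>g. g : borel_measurable lborel & (AE x in lborel. indicator S x * (f x \<bullet> b) = (g x :: real))" for b
 proof -
  have "(%x. (indicator S x *# f x) \<bullet> b) : borel_measurable lebesgue" using m by measurable
  from completion_ex_borel_measurable_real[OF this] show ?thesis by auto
 qed
 then obtain g where g: "!!b. g b : borel_measurable lborel" "!!b. AE x in lborel. indicator S x * (f x \<bullet> b) = g b x"
  by metis
 have [measurable]: "g b : borel_funs" for b using g(1)[of b] by simp
 define f' where "f' x = indicator S x *# (\<Sum>b\<in>Basis. g b x *# b)" for x
 show thesis
 proof
  show "f' : borel_funs" unfolding f'_def by measurable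
  show "f' x = 0" if "x \<notin> S" for x using that by (simp add: f'_def)
  have "AE x in lborel. \<forall>b\<in>Basis. indicator S x * (f x \<bullet> b) = g b x"
   using g(2) by (subst AE_ball_countable) (auto intro: countable_finite)
  then show "AE x in lborel. x : S --> f' x = f x"
  proof eventually_elim
   case (elim x)
   show ?case
   proof
   assume x: "x : S"
   then have "g b x = f x \<bullet> b" if "b : Basis" for b using elim that by auto
   then show "f' x = f x" using x by (simp add: f'_def euclidean_representation)
   qed
  qed
 qed
qed

lemma borel_measurable_lebesgue_AE:
 fixes f g :: "'b::euclidean_space => 'c::euclidean_space"
 assumes g: "g : borel_funs" and ae: "AE x in lborel. f x = g x"
 shows "f : borel_measurable lebesgue"
proof (rule borel_measurableI)
 fix A :: "'c set" assume "open A"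
 then have A: "A : sets borel" by simp
 have "g -` A \<inter> space borel : sets borel" by (rule measurable_sets[OF g A])
 then have B: "g -` A : sets lebesgue" by simp
 have "AE x in lebesgue. x : g -` A \<longleftrightarrow> x : f -` A \<inter> space lebesgue"
  using ae unfolding AE_completion_iff by eventually_elim auto
 then show "f -` A \<inter> space lebesgue : sets lebesgue"
  by (rule completion.in_sets_AE[OF _ B]) auto
qed

lemma lebesgue_on_representative:
 fixes f f' :: "'b::euclidean_space => 'c::euclidean_space"
 assumes S: "S : sets borel" and f': "f' : borel_funs" "!!x. x \<notin> S ==> f' x = 0"
  and ae: "AE x in lborel. x : S --> f' x = f x"
 shows "integral\<^sup>L (lebesgue_on S) f = integral\<^sup>L lborel f'"
  and "integrable (lebesgue_on S) f \<longleftrightarrow> lint f'"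
  and "f : borel_measurable (lebesgue_on S)"
proof -
 have ae': "AE x in lborel. indicator S x *# f x = f' x"
  using ae by eventually_elim (auto simp: f'(2) split: split_indicator)
 have m: "(%x. indicator S x *# f x) : borel_measurable lebesgue"
  by (rule borel_measurable_lebesgue_AE[OF f'(1) ae'])
 have m': "f' : borel_measurable lebesgue" using f'(1) by (rule borel_measurable_lebesgue_AE) auto
 have ae'': "AE x in lebesgue. indicator S x *# f x = f' x"
  using ae' by (simp add: AE_completion_iff)
 show "f : borel_measurable (lebesgue_on S)"
  using m S by (subst borel_measurable_restrict_space_iff) auto
 have "integral\<^sup>L (lebesgue_on S) f = integral\<^sup>L lebesgue (%x. indicator S x *# f x)"
  using S by (subst integral_restrict_space) auto
 also have "\<dots> = integral\<^sup>L lebesgue f'" by (rule integral_cong_AE[OF m m' ae''])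
 also have "\<dots> = integral\<^sup>L lborel f'" using f'(1) by (intro integral_completion) simp
 finally show "integral\<^sup>L (lebesgue_on S) f = integral\<^sup>L lborel f'" .
 have "integrable (lebesgue_on S) f \<longleftrightarrow> integrable lebesgue (%x. indicator S x *# f x)"
  using S by (subst integrable_restrict_space) auto
 also have "\<dots> \<longleftrightarrow> integrable lebesgue f'" by (rule integrable_cong_AE[OF m m' ae''])
 also have "\<dots> \<longleftrightarrow> lint f'" using f'(1) by (intro integrable_completion) simp
 finally show "integrable (lebesgue_on S) f \<longleftrightarrow> lint f'" .
qed

definition loc_int :: "'b::euclidean_space set => ('b => 'c::euclidean_space) => bool" where
 "loc_int S f \<longleftrightarrow> f : borel_funs & (\<forall>K. compact K --> K \<subseteq> S --> lint (%x. indicator K x *# f x))"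

lemma loc_int_borel: "loc_int S f ==> f : borel_funs"
 by (simp add: loc_int_def)

lemma integrable_imp_loc_int: "lint f ==> loc_int S f"
 unfolding loc_int_def using integrable_mult_indicator[of _ lborel f] by (auto intro!: borel_closed compact_imp_closed)

lemma loc_int_diff: "loc_int S f ==> loc_int S g ==> loc_int S (%x. f x - g x)"
 by (auto simp: loc_int_def scaleR_diff_right)

lemma compact_Union_closed_measurable:
 fixes f :: "'b::euclidean_space => 'c::euclidean_space"
 assumes S: "open S" and f: "!!K. compact K ==> K \<subseteq> S ==> integrable (lebesgue_on K) f"
 shows "f : borel_measurable (lebesgue_on S)"
proof -
 obtain C where C: "!!n. compact(C n)" "!!n. C n \<subseteq> S" "!!n. C n \<subseteq> interior(C(Suc n))" "\<Union>(range C) = S"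
   "!!K. [|compact K; K \<subseteq> S|] ==> \<exists>N. \<forall>n\<ge>N. K \<subseteq> (C n)"
  by (rule open_Union_compact_subsets[OF S]) (rule that)
 have "(%x. indicator S x *# f x) : borel_measurable lebesgue"
 proof (rule borel_measurable_LIMSEQ_metric)
  show "(%x. indicator (C n) x *# f x) : borel_measurable lebesgue" for n
  proof -
   have "f : borel_measurable (lebesgue_on (C n))" using f[OF C(1,2)] by auto
   then show ?thesis using C(1)[THEN compact_imp_closed]
   by (subst (asm) borel_measurable_restrict_space_iff) auto
  qed
  show "(%n. indicator (C n) x *# f x) \<rightarrow> indicator S x *# f x" for x
  proof (cases "x : S")
   case True
   then obtain N where "\<forall>n\<ge>N. {x} \<subseteq> C n" using C(5)[of "{x}"] by auto
   then have "\<forall>\<^sub>F n in sequentially. indicator (C n) x *# f x = indicator S x *# f x"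
   using True by (auto simp: eventually_sequentially intro!: exI[of _ N])
   then show ?thesis by (rule tendsto_eventually)
  next
   case False
   then have "indicator (C n) x *# f x = indicator S x *# f x" for n using C(2)[of n] by (auto simp: indicator_def)
   then show ?thesis by (simp only:) simp
  qed
 qed
 then show ?thesis using S by (subst borel_measurable_restrict_space_iff) auto
qed

lemma locally_integrable_representative:
 fixes f :: "'b::euclidean_space => 'c::euclidean_space"
 assumes S: "open S" and f: "locally_integrable S f"
 obtains f' where "loc_int S f'" "!!x. x \<notin> S ==> f' x = 0" "AE x in lborel. x : S --> f' x = f x"
proof -
 have m: "f : borel_measurable (lebesgue_on S)"
  by (rule compact_Union_closed_measurable[OF S]) (use f in \<open>auto simp: locally_integrable_def\<close>)
 obtain f' where f': "f' : borel_funs" "!!x. x \<notin> S ==> f' x = 0" "AE x in lborel. x : S --> f' x = f x"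
  by (rule borel_representative[OF borel_open[OF S] m]) (rule that)
 have "lint (%x. indicator K x *# f' x)" if K: "compact K" "K \<subseteq> S" for K
 proof -
  have [measurable]: "K : sets borel" using K by (simp add: compact_imp_closed)
  have "integrable (lebesgue_on K) f" using f K by (auto simp: locally_integrable_def)
  then show ?thesis
  proof (subst (asm) lebesgue_on_representative(2)[where f'="%x. indicator K x *# f' x"])
   show "(%x. indicator K x *# f' x) : borel_funs" using f'(1) by measurable
   show "AE x in lborel. x : K --> indicator K x *# f' x = f x"
   using f'(3) by eventually_elim (use K in auto)
  qed auto
 qed
 then show thesis using f' that by (auto simp: loc_int_def)
qed

lemma locally_integrable_iff_loc_int:
 fixes f f' :: "'b::euclidean_space => 'c::euclidean_space"
 assumes f': "f' : borel_funs" and ae: "AE x in lborel. x : S --> f' x = f x"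
 shows "locally_integrable S f \<longleftrightarrow> loc_int S f'"
proof -
 have "integrable (lebesgue_on K) f \<longleftrightarrow> lint (%x. indicator K x *# f' x)" if K: "compact K" "K \<subseteq> S" for K
 proof (rule lebesgue_on_representative(2))
  show [measurable]: "K : sets borel" using K by (simp add: compact_imp_closed)
  show "(%x. indicator K x *# f' x) : borel_funs" using f' by measurable
  show "AE x in lborel. x : K --> indicator K x *# f' x = f x"
   using ae by eventually_elim (use K in auto)
 qed auto
 then show ?thesis using f' by (auto simp: locally_integrable_def loc_int_def)
qed

lemma compact_neighbourhood:
 fixes K :: "'b::euclidean_space set"
 assumes "compact K" "open S" "K \<subseteq> S"
 obtains K' e where "compact K'" "K' \<subseteq> S" "e > 0" "!!x. x : K ==> cball x e \<subseteq> K'"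
proof -
 obtain e where e: "e > 0"  "(\<Union>x\<in>K. cball x e) \<subseteq> S"
  using compact_subset_open_imp_cball_epsilon_subset[OF assms] by blast
 have "(\<Union>x\<in>K. cball x e) = (\<Union>x\<in>K. \<Union>y\<in>cball 0 e. {x + y})"
 proof -
  have "cball x e = (\<Union>y\<in>cball 0 e. {x + y})" for x :: 'b
  proof safe
   fix y assume "y : cball x e"
   then have "y = x + (y - x)" "y - x : cball 0 e" by (auto simp: dist_norm norm_minus_commute)
   then show "y : (\<Union>y\<in>cball 0 e. {x + y})" by blast
  qed (auto simp: dist_norm)
  then show ?thesis by (intro SUP_cong refl)
 qed
 then have c: "compact (\<Union>x\<in>K. cball x e)"
  using compact_sums'[OF assms(1) compact_cball[of 0 e]] by simp
 show thesis
  by (rule that[OF c e(2) e(1)]) blast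
qed

lemma mollify_local:
 assumes r: "r > 0" and K: "cball x r \<subseteq> K"
 shows "mollify (moll r) f x = mollify (moll r) (%y. indicator K y *# f y) x"
 unfolding mollify_def
proof (rule BI_integral_cong)
 show "moll r (x - y) *# f y = moll r (x - y) *# (indicator K y *# f y)" for y
 proof (cases "y : K")
  case False
  then have "norm (x - y) >= r" using K by (force simp: dist_norm)
  then show ?thesis by (simp add: moll_eq_0 r)
 qed simp
qed simp

text \<open>The fundamental lemma of the calculus of variations, in the form in which uniqueness of weak derivatives and the identification of slices use it.\<close>

lemma loc_int_AE_zero:
 fixes f :: "'b::euclidean_space => 'c::euclidean_space"
 assumes S: "open S" and f: "loc_int S f"
  and z: "!!n. AE x in lborel. cball x (rad n) \<subseteq> S --> mollify (moll (rad n)) f x = 0"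
 shows "AE x in lborel. x : S --> f x = 0"
proof -
 obtain C where C: "!!n. compact(C n)" "!!n. C n \<subseteq> S" "!!n. C n \<subseteq> interior(C(Suc n))" "\<Union>(range C) = S"
  by (rule open_Union_compact_subsets[OF S]) (rule that)
 have "AE x in lborel. x : C m --> f x = 0" for m
 proof -
  obtain K e where K: "compact K" "K \<subseteq> S" "e > 0" "!!x. x : C m ==> cball x e \<subseteq> K"
   using compact_neighbourhood[OF C(1) S C(2)] by metis
  define g where "g x = indicator K x *# f x" for x
  have g: "lint g" unfolding g_def using f K by (simp add: loc_int_def)
  have [measurable]: "C m : sets borel" using C(1) by (simp add: compact_imp_closed)
  have ig: "lint (%x. norm (mollify (moll (rad n)) g x - g x))" for n
   by (intro integrable_norm BI_integrable_diff integrable_mollify g rad_pos)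
  have ic: "lint (%x. indicator (C m) x *# norm (g x))"
   using integrable_mult_indicator[OF _ integrable_norm[OF g], of "C m"] by simp
  have "\<forall>\<^sub>F n in sequentially. (\<integral>x. indicator (C m) x *# norm (g x) \<partial>lborel) <= (\<integral>x. norm (mollify (moll (rad n)) g x - g x) \<partial>lborel)"
   using rad_eventually[OF K(3)]
  proof eventually_elim
   case (elim n)
   show ?case
   proof (rule integral_mono_AE[OF ic ig])
   show "AE x in lborel. indicator (C m) x *# norm (g x) <= norm (mollify (moll (rad n)) g x - g x)"
   using z[of n]
   proof eventually_elim
   case e2: (elim x)
   show ?case
   proof (cases "x : C m")
   case True
   then have "cball x (rad n) \<subseteq> K" using K(4)[OF True] elim by (meson dual_order.trans less_imp_le subset_cball)
   then have "mollify (moll (rad n)) g x = 0"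
   using e2 K(2) mollify_local[OF rad_pos, of x n K f] by (auto simp: g_def[abs_def])
   then show ?thesis by (simp add: indicator_le_1 mult_left_le_one_le)
   qed simp
   qed
   qed
  qed
  then have "(\<integral>x. indicator (C m) x *# norm (g x) \<partial>lborel) <= 0"
   by (intro tendsto_lowerbound[OF mollify_L1[OF g]]) auto
  moreover have "0 <= (\<integral>x. indicator (C m) x *# norm (g x) \<partial>lborel)" by (intro integral_nonneg_AE) auto
  ultimately have "(\<integral>x. indicator (C m) x *# norm (g x) \<partial>lborel) = 0" by (rule antisym)
  then have "AE x in lborel. indicator (C m) x *# norm (g x) = 0"
   using integral_nonneg_eq_0_iff_AE[OF ic] by auto
  then show ?thesis
  proof eventually_elim
   case (elim x)
   show ?case
   proof
   assume x: "x : C m"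
   then have "x : K" using K(3) K(4)[of x] by (meson centre_in_cball less_imp_le subsetD)
   then show "f x = 0" using elim x by (simp add: g_def)
   qed
  qed
 qed
 then have "AE x in lborel. \<forall>m. x : C m --> f x = 0" unfolding AE_all_countable by blast
 then show ?thesis by eventually_elim (use C(4) in auto)
qed

section \<open>Weak derivatives and continuously differentiable test functions\<close>

text \<open>The weak form of \<open>div V = A\<close>. It covers weak derivatives (\<open>V = u b\<close>) as well as the parabolic equation, whose flux has no time component because the time derivative is part of \<open>A\<close>.\<close>

definition weak_div :: "'b::euclidean_space set => ('b => 'b) => ('b => real) => bool" where
 "weak_div S V A \<longleftrightarrow> loc_int S V & loc_int S A &
   (\<forall>phi\<in>test_functions S. (\<integral>x. A x * phi x + V x \<bullet> grad phi x \<partial>lborel) = 0)"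

text \<open>The gradient is carried along because products and compositions provide it explicitly.\<close>

definition C1_test :: "'b::euclidean_space set => ('b => real) => ('b => 'b) => bool" where
 "C1_test K phi dphi \<longleftrightarrow> compact K & (\<forall>x. (phi has_derivative (%h. dphi x \<bullet> h)) (at x)) & continuous_on UNIV dphi &
   (\<forall>x. x \<notin> K --> phi x = 0)"

lemma C1_test_grad_zero:
 assumes "C1_test K phi dphi" "x \<notin> K"
 shows "dphi x = 0"
proof -
 have "(phi has_derivative (%h. 0)) (at x)"
 proof (rule has_derivative_transform_within_open[where s="- K" and f="%_. 0"])
  show "open (- K)" using assms by (auto simp: C1_test_def intro: compact_imp_closed)
 qed (use assms in \<open>auto simp: C1_test_def\<close>)
 moreover have "(phi has_derivative (%h. dphi x \<bullet> h)) (at x)" using assms by (auto simp: C1_test_def)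
 ultimately have "(%h. dphi x \<bullet> h) = (%h. 0)" by (rule has_derivative_unique[rotated])
 then show ?thesis by (metis inner_eq_zero_iff)
qed

lemma C1_test_kernel:
 assumes "C1_test K phi dphi"
 obtains R where "R > 0" "smooth_kernel phi dphi R"
proof -
 obtain B where B: "!!x. x : K ==> norm x <= B"
  using assms by (metis C1_test_def compact_imp_bounded bounded_iff)
 have out: "x \<notin> K" if "norm x >= \<bar>B\<bar> + 1" for x using B[of x] that by auto
 have "smooth_kernel phi dphi (\<bar>B\<bar> + 1)"
 proof
  show "phi x = 0" if "norm x >= \<bar>B\<bar> + 1" for x using out[OF that] assms by (simp add: C1_test_def)
  show "dphi x = 0" if "norm x >= \<bar>B\<bar> + 1" for x using out[OF that] C1_test_grad_zero[OF assms] by simp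
 qed (use assms in \<open>auto simp: C1_test_def\<close>)
 then show thesis using that[of "\<bar>B\<bar> + 1"] by auto
qed

lemma lborel_integral_reflect:
 fixes f :: "'b::euclidean_space => 'c::euclidean_space"
 assumes [measurable]: "f : borel_funs"
 shows "(\<integral>x. f (c - x) \<partial>lborel) = (\<integral>x. f x \<partial>lborel)"
 by (subst (2) lborel_affine[of "-1" c], simp, subst integral_density, simp_all, subst integral_distr, simp_all)

lemma moll_average_uniform:
 fixes g :: "'b::euclidean_space => 'c::euclidean_space"
 assumes g: "continuous_on UNIV g" and z: "!!x. norm x >= R ==> g x = 0" and e: "e > 0"
 shows "\<forall>\<^sub>F n in sequentially. \<forall>x. norm (mollify (moll (rad n)) g x - g x) <= e"
proof -
 have [measurable]: "g : borel_funs" using g by (rule borel_measurable_continuous_onI)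
 have ig: "lint g"
  using bounded_compact_support[OF g z] z
  by (metis integrable_bounded_support[of g "cball 0 R"] \<open>g : borel_funs\<close> bounded_cball mem_cball_0 linear)
 obtain d where d: "d > 0" "!!x y. dist y x < d ==> dist (g y) (g x) < e"
  using uniformly_continuous_compact_support[OF g z] e
  unfolding uniformly_continuous_on_def by (metis UNIV_I)
 show ?thesis using rad_eventually[OF d(1)]
 proof eventually_elim
  case (elim n)
  show ?case
  proof
   fix x :: 'b
   have im: "lint (%y. moll (rad n) (x - y))"
   using nn_integral_moll(2)[OF rad_pos, of n x] borel_measurable_moll[OF rad_pos[of n]]
   by (intro integrableI_nn_integral_finite[where x=1]) (auto simp: moll_nonneg)
   have m1: "(\<integral>y. moll (rad n) (x - y) \<partial>lborel) = 1"
   using nn_integral_moll(2)[OF rad_pos, of n x] nn_integral_eq_integral[OF im]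
   by (auto simp: moll_nonneg)
   have "mollify (moll (rad n)) g x - g x = (\<integral>y. moll (rad n) (x - y) *# (g y - g x) \<partial>lborel)"
   unfolding mollify_def using integrable_moll_scaleR[OF rad_pos ig, of n x] im m1
   by (simp add: scaleR_diff_right)
   also have "norm \<dots> <= (\<integral>y. e * moll (rad n) (x - y) \<partial>lborel)"
   proof (rule order_trans[OF integral_norm_bound], rule integral_mono')
   show "lint (%y. e * moll (rad n) (x - y))" using im by simp
   show "norm (moll (rad n) (x - y) *# (g y - g x)) <= e * moll (rad n) (x - y)" for y
   proof (cases "dist y x < rad n")
   case True
   then have "norm (g y - g x) <= e" using d(2)[of y x] elim by (simp add: dist_norm)
   then show ?thesis using moll_nonneg[OF rad_pos, of n "x - y"]
   by (simp add: mult.commute[of e] mult_left_mono)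
   next
   case False
   then show ?thesis by (simp add: moll_eq_0 dist_norm norm_minus_commute)
   qed
   show "0 <= e * moll (rad n) (x - y)" for y using e by (simp add: moll_nonneg)
   qed
   also have "\<dots> = e" using m1 by simp
   finally show "norm (mollify (moll (rad n)) g x - g x) <= e" .
  qed
 qed
qed

lemma C1_test_integrable:
 assumes "C1_test K phi dphi"
 shows "lint phi" "phi : borel_funs" "dphi : borel_funs"
proof -
 obtain R where "smooth_kernel phi dphi R" using C1_test_kernel[OF assms] by blast
 then interpret smooth_kernel phi dphi R .
 show "phi : borel_funs" "dphi : borel_funs" by auto
 obtain C where C: "!!x. norm (phi x) <= C" using bounded_compact_support[OF cont_k supp(1)] by blast
 show "lint phi"
  by (rule integrable_bounded_support[where S=K and C=C])
   (use assms C in \<open>auto simp: C1_test_def compact_imp_bounded\<close>)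
qed

lemma mollify_C1_grad:
 assumes t: "C1_test K phi dphi" and r: "r > 0"
 shows "(mollify (moll r) phi has_derivative (%h. mollify (moll r) dphi x \<bullet> h)) (at x)"
proof -
 obtain R where "smooth_kernel phi dphi R" using C1_test_kernel[OF t] by blast
 then interpret smooth_kernel phi dphi R .
 have [measurable]: "moll r : borel_measurable (borel :: 'a measure)" using r by measurable
 have 1: "mollify phi (moll r) = mollify (moll r) phi"
 proof
  fix x
  have "mollify (moll r) phi x = (\<integral>y. moll r (x - (x - y)) *# phi (x - y) \<partial>lborel)"
   unfolding mollify_def by (subst lborel_integral_reflect[of _ x, symmetric]) simp_all
  then show "mollify phi (moll r) x = mollify (moll r) phi x"
   by (simp add: mollify_def mult.commute)
 qed
 have 2: "(\<integral>y. moll r y *# dphi (x - y) \<partial>lborel) = mollify (moll r) dphi x"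
 proof -
  have "mollify (moll r) dphi x = (\<integral>y. moll r (x - (x - y)) *# dphi (x - y) \<partial>lborel)"
   unfolding mollify_def by (subst lborel_integral_reflect[of _ x, symmetric]) simp_all
  then show ?thesis by simp
 qed
 show ?thesis using mollify_has_derivative[OF moll_mass(1)[OF r], of x] unfolding 1 2 .
qed

lemma mollify_support:
 assumes r: "r > 0" and "!!y. dist x y < r ==> f y = 0"
 shows "mollify (moll r) f x = 0"
proof -
 have "moll r (x - y) *# f y = 0" for y
  using assms(2)[of y] moll_eq_0[OF r, of "x - y"] by (cases "dist x y < r") (auto simp: dist_norm)
 then have "(%y. moll r (x - y) *# f y) = (%_. 0)" by (rule ext)
 then show ?thesis unfolding mollify_def by simp
qed

text \<open>Test functions of class \<open>C\<^sup>1\<close> become smooth by mollification, and their gradients converge uniformly.\<close>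

lemma weak_div_C1_test:
 assumes S: "open S" and w: "weak_div S V A" and t: "C1_test K phi dphi" and KS: "K \<subseteq> S"
 shows "lint (%x. A x * phi x + V x \<bullet> dphi x)" "(\<integral>x. A x * phi x + V x \<bullet> dphi x \<partial>lborel) = 0"
proof -
 have [measurable]: "A : borel_funs" "V : borel_funs" using w by (auto simp: weak_div_def loc_int_def)
 note [measurable] = C1_test_integrable(2,3)[OF t]
 have cK: "compact K" using t by (simp add: C1_test_def)
 obtain R where R: "R > 0" "smooth_kernel phi dphi R" using C1_test_kernel[OF t] by blast
 interpret smooth_kernel phi dphi R by (rule R)
 obtain K' e where K': "compact K'" "K' \<subseteq> S" "e > 0" "!!x. x : K ==> cball x e \<subseteq> K'"
  using compact_neighbourhood[OF cK S KS] by metis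
 have [measurable]: "K' : sets borel" using K' by (simp add: compact_imp_closed)
 obtain C1 where C1: "!!x. norm (phi x) <= C1" using bounded_compact_support[OF cont_k supp(1)] by blast
 obtain C2 where C2: "!!x. norm (dphi x) <= C2" using bounded_compact_support[OF cont supp(2)] by blast
 define \<Phi> where "\<Phi> n = mollify (moll (rad n)) phi" for n
 define D where "D n = mollify (moll (rad n)) dphi" for n
 have [measurable]: "\<Phi> n : borel_funs" "D n : borel_funs" for n
  unfolding \<Phi>_def D_def by (intro borel_measurable_mollify borel_measurable_moll; simp)+
 have \<Phi>: "(\<Phi> n has_derivative (%h. D n x \<bullet> h)) (at x)" for n x
  unfolding \<Phi>_def D_def by (rule mollify_C1_grad[OF t rad_pos])
 have gr: "grad (\<Phi> n) x = D n x" for n x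
  using grad_inner[OF \<Phi>[of n x]] by (metis inner_commute vector_eq_ldot)
 have Ck: "Ck m (\<Phi> n)" for m n
  unfolding \<Phi>_def by (rule Ck_mollify[OF C1_test_integrable(1)[OF t] Ck_moll moll_eq_0[OF rad_pos]])
 have u1: "\<forall>\<^sub>F n in sequentially. \<forall>x. norm (\<Phi> n x - phi x) <= e" if "e > 0" for e
  unfolding \<Phi>_def by (rule moll_average_uniform[OF cont_k supp(1) that])
 have u2: "\<forall>\<^sub>F n in sequentially. \<forall>x. norm (D n x - dphi x) <= e" if "e > 0" for e
  unfolding D_def by (rule moll_average_uniform[OF cont supp(2) that])
 have "\<forall>\<^sub>F n in sequentially. rad n < e & (\<forall>x. norm (\<Phi> n x - phi x) <= 1) & (\<forall>x. norm (D n x - dphi x) <= 1)"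
  using rad_eventually[OF K'(3)] u1[OF zero_less_one] u2[OF zero_less_one] by eventually_elim auto
 then obtain N where N: "!!n. n >= N ==> rad n < e" "!!n x. n >= N ==> norm (\<Phi> n x - phi x) <= 1" "!!n x. n >= N ==> norm (D n x - dphi x) <= 1"
  unfolding eventually_sequentially by blast
 have out: "\<Phi> n x = 0 & D n x = 0" if "n >= N" "x \<notin> K'" for n x
 proof -
  have "y \<notin> K" if "dist x y < rad n" for y
   using K'(4)[of y] N(1)[OF \<open>n >= N\<close>] that \<open>x \<notin> K'\<close> by (force simp: dist_commute)
  then have "phi y = 0" "dphi y = 0" if "dist x y < rad n" for y
   using t C1_test_grad_zero[OF t] that by (auto simp: C1_test_def)
  then show ?thesis unfolding \<Phi>_def D_def by (auto intro: mollify_support)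
 qed
 have zero: "(\<integral>x. A x * \<Phi> n x + V x \<bullet> D n x \<partial>lborel) = 0" if "n >= N" for n
 proof -
  have sub: "closure {x. \<Phi> n x \<noteq> 0} \<subseteq> K'"
   by (rule closure_minimal) (use out[OF that] K' in \<open>auto intro: compact_imp_closed\<close>)
  then have "compact (closure {x. \<Phi> n x \<noteq> 0})"
   using K'(1) compact_Int_closed[of K' "closure {x. \<Phi> n x \<noteq> 0}"] by (simp add: Int_absorb1)
  then have "\<Phi> n : test_functions S"
   using Ck sub K'(2) by (auto simp: test_functions_def)
  then show ?thesis using w gr by (auto simp: weak_div_def)
 qed
 let ?f = "%n x. A x * \<Phi> (n + N) x + V x \<bullet> D (n + N) x"
 let ?w = "%x. (C1 + 1) * (indicator K' x * \<bar>A x\<bar>) + (C2 + 1) * (indicator K' x * norm (V x))"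
 have iA: "lint (%x. indicator K' x *# A x)" and iV: "lint (%x. indicator K' x *# V x)"
  using w K' by (auto simp: weak_div_def loc_int_def)
 have iw: "lint ?w"
  using integrable_norm[OF iA] integrable_norm[OF iV] by (intro BI_integrable_add integrable_mult_right) (auto simp: abs_mult)
 have lim: "AE x in lborel. (%n. ?f n x) \<rightarrow> A x * phi x + V x \<bullet> dphi x"
 proof (rule AE_I2)
  fix x
  have "(%n. \<Phi> n x) \<rightarrow> phi x"
  proof (rule tendstoI)
   fix e :: real assume "e > 0"
   then show "\<forall>\<^sub>F n in sequentially. dist (\<Phi> n x) (phi x) < e"
   using u1[of "e/2"] by (auto elim!: eventually_mono simp: dist_norm dest!: spec[of _ x])
  qed
  moreover have "(%n. D n x) \<rightarrow> dphi x"
  proof (rule tendstoI)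
   fix e :: real assume "e > 0"
   then have "\<forall>\<^sub>F n in sequentially. \<forall>x. norm (D n x - dphi x) <= e/2" by (intro u2) auto
   then show "\<forall>\<^sub>F n in sequentially. dist (D n x) (dphi x) < e"
   proof eventually_elim
   case (elim n)
   then show ?case using \<open>e > 0\<close> by (auto simp: dist_norm dest!: spec[of _ x])
   qed
  qed
  ultimately have "(%n. A x * \<Phi> n x + V x \<bullet> D n x) \<rightarrow> A x * phi x + V x \<bullet> dphi x"
   by (intro tendsto_intros)
  then show "(%n. ?f n x) \<rightarrow> A x * phi x + V x \<bullet> dphi x"
   by (rule LIMSEQ_ignore_initial_segment)
 qed
 have dom: "AE x in lborel. norm (?f n x) <= ?w x" for n
 proof (rule AE_I2)
  fix x
  show "norm (?f n x) <= ?w x"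
  proof (cases "x : K'")
   case True
   have "\<bar>\<Phi> (n+N) x\<bar> <= C1 + 1" "norm (D (n+N) x) <= C2 + 1"
   using N(2)[of "n+N" x] N(3)[of "n+N" x] C1[of x] C2[of x] norm_triangle_sub[of "D (n+N) x" "dphi x"] by auto
   then have "\<bar>A x * \<Phi> (n+N) x\<bar> <= (C1 + 1) * \<bar>A x\<bar>" "\<bar>V x \<bullet> D (n+N) x\<bar> <= (C2 + 1) * norm (V x)"
   by (auto simp: abs_mult mult.commute[of "_ + 1"]
   intro!: mult_left_mono order_trans[OF Cauchy_Schwarz_ineq2[of "V x" "D (n+N) x"]])
   then show ?thesis using True by auto
  next
   case False
   then show ?thesis using out[of "n+N" x] by simp
  qed
 qed
 have m: "(%x. A x * phi x + V x \<bullet> dphi x) : borel_measurable lborel" "?f n : borel_measurable lborel" for n by simp_all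
 show "lint (%x. A x * phi x + V x \<bullet> dphi x)"
  by (rule integrable_dominated_convergence[OF m iw lim dom])
 have "(%n. integral\<^sup>L lborel (?f n)) \<rightarrow> (\<integral>x. A x * phi x + V x \<bullet> dphi x \<partial>lborel)"
  by (rule integral_dominated_convergence[OF m iw lim dom])
 moreover have "(%n. integral\<^sup>L lborel (?f n)) = (%n. 0)" using zero by auto
 ultimately have "(%n. 0) \<rightarrow> (\<integral>x. A x * phi x + V x \<bullet> dphi x \<partial>lborel)" by (simp only:)
 then show "(\<integral>x. A x * phi x + V x \<bullet> dphi x \<partial>lborel) = 0"
  by (rule LIMSEQ_unique[OF _ tendsto_const])
qed

lemma moll_C1_test:
 assumes r: "r > 0"
 shows "C1_test (cball x r) (%y. moll r (x - y)) (%y. - moll_grad r (x - y))"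
 unfolding C1_test_def
proof safe
 show "((%y. moll r (x - y)) has_derivative (%h. - moll_grad r (x - y) \<bullet> h)) (at y)" for y
 proof -
  have "((%y. x - y) has_derivative (%h. - h)) (at y)" by (auto intro!: derivative_eq_intros)
  from has_derivative_compose[OF this moll_has_derivative[OF r]] show ?thesis by simp
 qed
 show "continuous_on UNIV (%y. - moll_grad r (x - y))"
  by (intro continuous_intros continuous_on_compose2[OF continuous_moll_grad[OF r]]) auto
 show "moll r (x - y) = 0" if "y \<notin> cball x r" for y
  using that by (intro moll_eq_0[OF r]) (auto simp: dist_norm)
qed auto

abbreviation wderiv :: "'b::euclidean_space set => 'b => ('b => real) => ('b => real) => bool" where
 "wderiv S b u g \<equiv> weak_div S (%x. u x *# b) g"

lemma wderiv_mollify: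
 assumes S: "open S" and w: "wderiv S b u g" and u: "lint u" and r: "r > 0" and x: "cball x r \<subseteq> S"
 shows "(\<integral>y. u y *# moll_grad r (x - y) \<partial>lborel) \<bullet> b = mollify (moll r) g x"
proof -
 interpret smooth_kernel "moll r :: 'a => real" "moll_grad r" r by (rule smooth_kernel_moll[OF r])
 note t = weak_div_C1_test[OF S w moll_C1_test[OF r] x]
 have i1: "lint (%y. (u y *# moll_grad r (x - y)) \<bullet> b)"
  by (intro integrable_inner_left integrable_kernel u)
 have i2: "lint (%y. g y * moll r (x - y))"
 proof -
  have "lint (%y. (g y * moll r (x - y) + u y *# b \<bullet> - moll_grad r (x - y)) + (u y *# moll_grad r (x - y)) \<bullet> b)"
   by (intro BI_integrable_add i1 t(1))
  then show ?thesis by (simp add: inner_commute)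
 qed
 have "(\<integral>y. g y * moll r (x - y) \<partial>lborel) = (\<integral>y. (g y * moll r (x - y) + u y *# b \<bullet> - moll_grad r (x - y)) + (u y *# moll_grad r (x - y)) \<bullet> b \<partial>lborel)"
  by (intro BI_integral_cong) (auto simp: inner_commute)
 also have "\<dots> = (\<integral>y. (u y *# moll_grad r (x - y)) \<bullet> b \<partial>lborel)"
  using t(2) by (subst BI_integral_add[OF t(1) i1]) simp
 also have "\<dots> = (\<integral>y. u y *# moll_grad r (x - y) \<partial>lborel) \<bullet> b"
  by (intro integral_inner_left integrable_kernel u)
 finally show ?thesis by (simp add: mollify_def mult.commute)
qed

lemma wderiv_mollify_eq:
 assumes S: "open S" and w: "wderiv S b u g" and w': "wderiv S b u g'" and r: "r > 0" and x: "cball x r \<subseteq> S"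
 shows "mollify (moll r) g x = mollify (moll r) g' x"
proof -
 let ?V = "%y. u y *# b" and ?d = "%y. - moll_grad r (x - y)"
 note t = weak_div_C1_test[OF S w moll_C1_test[OF r] x]
 note t' = weak_div_C1_test[OF S w' moll_C1_test[OF r] x]
 have i: "lint (%y. moll r (x - y) *# g y)" if "wderiv S b u g" for g
 proof -
  interpret smooth_kernel "moll r :: 'a => real" "moll_grad r" r by (rule smooth_kernel_moll[OF r])
  obtain C where C: "!!x::'a. norm (moll r x) <= C" using bounded_compact_support[OF cont_k supp(1)] by blast
  have "lint (%y. moll r (x - y) *# (indicator (cball x r) y *# g y))"
   by (rule integrable_scaleR_bounded[where C=C]) (use that x C in \<open>auto simp: weak_div_def loc_int_def\<close>)
  moreover have "moll r (x - y) *# (indicator (cball x r) y *# g y) = moll r (x - y) *# g y" for y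
   by (cases "y : cball x r") (auto simp: dist_norm moll_eq_0[OF r])
  ultimately show ?thesis by (simp only:)
 qed
 have "mollify (moll r) g x - mollify (moll r) g' x = (\<integral>y. moll r (x - y) *# g y - moll r (x - y) *# g' y \<partial>lborel)"
  unfolding mollify_def using i[OF w] i[OF w'] by simp
 also have "\<dots> = (\<integral>y. (g y * moll r (x - y) + ?V y \<bullet> ?d y) - (g' y * moll r (x - y) + ?V y \<bullet> ?d y) \<partial>lborel)"
  by (intro BI_integral_cong) (auto simp: mult.commute)
 also have "\<dots> = 0"
  using t(2) t'(2) by (subst BI_integral_diff[OF t(1) t'(1)]) simp
 finally show ?thesis by simp
qed

lemma mollify_loc_diff:
 fixes f g :: "'b::euclidean_space => 'c::euclidean_space"
 assumes r: "r > 0" and f: "loc_int S f" "loc_int S g" and x: "cball x r \<subseteq> S"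
 shows "mollify (moll r) (%y. f y - g y) x = mollify (moll r) f x - mollify (moll r) g x"
proof -
 let ?i = "indicator (cball x r) :: 'b => real"
 have i: "lint (%y. ?i y *# f y)" "lint (%y. ?i y *# g y)"
  using f x by (auto simp: loc_int_def)
 have "mollify (moll r) (%y. f y - g y) x = mollify (moll r) (%y. ?i y *# f y - ?i y *# g y) x"
  by (subst mollify_local[OF r order_refl]) (simp add: scaleR_diff_right)
 also have "\<dots> = mollify (moll r) f x - mollify (moll r) g x"
  by (subst mollify_diff[OF r i]) (simp flip: mollify_local[OF r order_refl])
 finally show ?thesis .
qed

lemma wderiv_unique:
 assumes S: "open S" and w: "wderiv S b u g" and w': "wderiv S b u g'"
 shows "AE x in lborel. x : S --> g x = g' x"
proof -
 have "AE x in lborel. x : S --> (%x. g x - g' x) x = 0"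
 proof (rule loc_int_AE_zero[OF S])
  show "loc_int S (%x. g x - g' x)" using w w' by (intro loc_int_diff) (auto simp: weak_div_def)
  show "AE x in lborel. cball x (rad n) \<subseteq> S --> mollify (moll (rad n)) (%x. g x - g' x) x = 0" for n
   using wderiv_mollify_eq[OF S w w' rad_pos, of _ n] mollify_loc_diff[OF rad_pos, of S g g' _ n] w w'
   by (auto simp: weak_div_def)
 qed
 then show ?thesis by eventually_elim auto
qed

section \<open>Mollification of gradients with a variable exponent\<close>

lemma dominated_convergence_L1:
 fixes f :: "'x => real" and s :: "nat => 'x => real"
 assumes [measurable]: "f : borel_measurable M" "!!n. s n : borel_measurable M"
  and lim: "AE x in M. (%n. s n x) \<rightarrow> f x"
  and dom: "!!n. AE x in M. \<bar>s n x\<bar> <= g n x"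
  and ig: "!!n. integrable M (g n)" "integrable M G"
  and L1: "(%n. \<integral>x. \<bar>g n x - G x\<bar> \<partial>M) \<rightarrow> 0"
 shows "integrable M f" "(%n. integral\<^sup>L M (s n)) \<rightarrow> integral\<^sup>L M f"
proof -
 have [measurable]: "G : borel_measurable M" "g n : borel_measurable M" for n using ig by auto
 obtain r :: "nat => nat" where r: "strict_mono r" "AE x in M. (%n. g (r n) x - G x) \<rightarrow> 0"
  using tendsto_L1_AE_subseq[of M "%n x. g n x - G x"] ig L1 by auto
 have dom': "AE x in M. \<forall>n. \<bar>s n x\<bar> <= g n x" using dom by (simp add: AE_all_countable)
 have fG: "AE x in M. \<bar>f x\<bar> <= G x"
  using r(2) lim dom'
 proof eventually_elim
  case (elim x)
  have "(%n. \<bar>s (r n) x\<bar>) \<rightarrow> \<bar>f x\<bar>"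
   using LIMSEQ_subseq_LIMSEQ[OF elim(2) r(1)] by (auto simp: o_def intro: tendsto_rabs)
  moreover have "(%n. g (r n) x) \<rightarrow> G x" using elim(1) by (simp add: LIM_zero_iff)
  ultimately show ?case using elim(3) by (auto intro: LIMSEQ_le)
 qed
 show if': "integrable M f"
  using fG by (intro BI_integrable_bound[OF ig(2)]) auto
 define c where "c n x = max (- G x) (min (G x) (s n x))" for n x
 have [measurable]: "c n : borel_measurable M" for n unfolding c_def by measurable
 have cG: "AE x in M. norm (c n x) <= G x" for n
  using fG by eventually_elim (auto simp: c_def)
 have ic: "integrable M (c n)" for n
  using cG[of n] by (intro BI_integrable_bound[OF ig(2)]) auto
 have isn: "integrable M (s n)" for n
  using dom[of n] by (intro BI_integrable_bound[OF ig(1)[of n]]) auto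
 have "(%n. integral\<^sup>L M (c n)) \<rightarrow> integral\<^sup>L M f"
 proof (rule integral_dominated_convergence[OF _ _ ig(2) _ cG])
  show "AE x in M. (%n. c n x) \<rightarrow> f x"
   using fG lim
  proof eventually_elim
   case (elim x)
   have "(%n. c n x) \<rightarrow> max (- G x) (min (G x) (f x))"
   unfolding c_def by (intro tendsto_max tendsto_min tendsto_const elim)
   also have "max (- G x) (min (G x) (f x)) = f x" using elim by auto
   finally show ?case .
  qed
 qed auto
 moreover have "(%n. integral\<^sup>L M (s n) - integral\<^sup>L M (c n)) \<rightarrow> 0"
 proof (rule Lim_null_comparison[OF always_eventually L1], rule allI)
  fix n
  have "norm (integral\<^sup>L M (s n) - integral\<^sup>L M (c n)) = norm (\<integral>x. s n x - c n x \<partial>M)"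
   using isn ic by simp
  also have "\<dots> <= (\<integral>x. \<bar>g n x - G x\<bar> \<partial>M)"
  proof (rule order_trans[OF integral_norm_bound integral_mono_AE])
   show "integrable M (%x. norm (s n x - c n x))" using isn ic by simp
   show "integrable M (%x. \<bar>g n x - G x\<bar>)" using ig by simp
   show "AE x in M. norm (s n x - c n x) <= \<bar>g n x - G x\<bar>"
   using fG dom[of n] by eventually_elim (auto simp: c_def max_def min_def)
  qed
  finally show "norm (integral\<^sup>L M (s n) - integral\<^sup>L M (c n)) <= (\<integral>x. \<bar>g n x - G x\<bar> \<partial>M)" .
 qed
 ultimately show "(%n. integral\<^sup>L M (s n)) \<rightarrow> integral\<^sup>L M f"
  using tendsto_add by fastforce
qed

text \<open>Jensen's inequality with the exponent frozen at \<open>p0\<close>. Freezing costs the factor \<open>K\<close>, which bounds \<open>\<kappa> powr (p0 - p)\<close> for large averages \<open>\<kappa>\<close>.\<close>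

lemma average_power:
 fixes g p :: "'x => real"
 assumes [measurable]: "g : borel_measurable \<nu>" "p : borel_measurable \<nu>"
  and A: "A >= 1" "emeasure \<nu> (space \<nu>) <= ennreal A"
  and g0: "!!y. 0 <= g y" and l: "0 <= kap" "ennreal kap <= (\<integral>\<^sup>+y. g y \<partial>\<nu>)"
  and p: "!!y. 1 <= p y" "!!y. p y <= P" "p0 >= 0"
  and K: "K > 0" "AE y in \<nu>. kap >= 1 --> kap powr (p0 - p y) <= K"
 shows "ennreal (kap powr p0) <= 1 + ennreal (2 * (2 * A) powr P * K) * (\<integral>\<^sup>+y. g y powr p y \<partial>\<nu>)"
proof (cases "kap >= 1")
 case False
 then have "kap powr p0 <= 1" using l p(3) by (intro powr_le1) auto
 then have "ennreal (kap powr p0) <= 1" by simp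
 then show ?thesis by (rule order_trans) simp
next
 case True
 define a where "a = kap / (2 * A)"
 have a: "a > 0" using True A by (simp add: a_def)
 define c where "c = (2 * A) powr P * K * kap powr (1 - p0)"
 have c: "c > 0" using A K True by (simp add: c_def)
 let ?I = "\<integral>\<^sup>+y. g y powr p y \<partial>\<nu>"
 have pt: "AE y in \<nu>. ennreal (g y) <= ennreal a + ennreal c * ennreal (g y powr p y)"
  using K(2)
 proof eventually_elim
  case (elim y)
  have "g y <= a + c * g y powr p y"
  proof (cases "g y <= a")
   case True
   moreover have "0 <= c * g y powr p y" using c by simp
   ultimately show ?thesis by linarith
  next
   case False
   then have gy: "g y > 0" using a by simp
   have "a powr (1 - p y) = (2 * A) powr (p y - 1) * (kap powr (p0 - p y) * kap powr (1 - p0))"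
   proof -
   have "a powr (1 - p y) = kap powr (1 - p y) / (2 * A) powr (1 - p y)"
   using True A by (simp add: a_def powr_divide)
   also have "\<dots> = (2 * A) powr (p y - 1) * kap powr (1 - p y)"
   using powr_minus[of "2 * A" "1 - p y"] by (simp add: field_simps)
   also have "kap powr (1 - p y) = kap powr (p0 - p y) * kap powr (1 - p0)"
   by (simp flip: powr_add)
   finally show ?thesis .
   qed
   also have "\<dots> <= (2 * A) powr P * (K * kap powr (1 - p0))"
   proof (intro mult_mono)
   show "(2 * A) powr (p y - 1) <= (2 * A) powr P" using A p(2)[of y] by (intro powr_mono) auto
   show "kap powr (p0 - p y) <= K" using elim True by simp
   qed (use K in auto)
   finally have ac: "a powr (1 - p y) <= c" by (simp add: c_def mult.assoc)
   have geq: "g y = g y powr p y * g y powr (1 - p y)"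
   using gy by (simp flip: powr_add)
   have "g y powr (1 - p y) <= a powr (1 - p y)"
   using False a p(1)[of y] by (intro powr_mono2') auto
   also have "\<dots> <= c" by (rule ac)
   finally have gc: "g y powr (1 - p y) <= c" .
   have "g y <= c * g y powr p y"
   using mult_left_mono[OF gc, of "g y powr p y"] geq by (simp add: mult.commute)
   then show ?thesis using a by simp
  qed
  then have "ennreal (g y) <= ennreal (a + c * g y powr p y)" by (rule ennreal_leI)
  then show ?case using a c by (simp add: ennreal_mult)
 qed
 have "ennreal kap <= (\<integral>\<^sup>+y. ennreal a + ennreal c * ennreal (g y powr p y) \<partial>\<nu>)"
  using l(2) nn_integral_mono_AE[OF pt] by (rule order_trans)
 also have "\<dots> = ennreal a * emeasure \<nu> (space \<nu>) + ennreal c * ?I"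
  by (simp add: nn_integral_add nn_integral_cmult)
 also have "\<dots> <= ennreal a * ennreal A + ennreal c * ?I"
  by (intro add_right_mono mult_left_mono A) auto
 also have "ennreal a * ennreal A = ennreal (kap / 2)"
  using a A by (simp add: a_def flip: ennreal_mult)
 finally have main: "ennreal kap <= ennreal (kap / 2) + ennreal c * ?I" .
 show ?thesis
 proof (cases "?I = \<infinity>")
  case True
  have "0 < 2 * (2 * A) powr P * K" using A K by simp
  then show ?thesis unfolding True using A(1) K(1) by (simp add: ennreal_mult_top)
 next
  case False
  then obtain s where s: "s >= 0" "?I = ennreal s" by (cases ?I) auto
  have "kap <= kap / 2 + c * s"
   using main s c l by (simp add: ennreal_le_iff flip: ennreal_mult ennreal_plus)
  then have "kap <= 2 * c * s" by simp
  have "kap powr p0 = kap * kap powr (p0 - 1)" using True by (simp add: powr_mult_base)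
  also have "\<dots> <= (2 * c * s) * kap powr (p0 - 1)" using \<open>kap <= 2 * c * s\<close> by (rule mult_right_mono) simp
  also have "\<dots> = (2 * (2 * A) powr P * K * s) * (kap powr (1 - p0) * kap powr (p0 - 1))" by (simp add: c_def)
  also have "kap powr (1 - p0) * kap powr (p0 - 1) = 1" using True by (simp flip: powr_add)
  finally have "ennreal (kap powr p0) <= ennreal (2 * (2 * A) powr P * K * s)" by (intro ennreal_leI) simp
  also have "\<dots> <= 1 + ennreal (2 * (2 * A) powr P * K) * ?I"
   using s A K by (simp add: ennreal_mult)
  finally show ?thesis .
 qed
qed

text \<open>An average over radius \<open>r\<close> is at most of order \<open>r\<^sup>-\<^sup>m\<close>, while the exponent oscillates by at most \<open>L r\<close>; and \<open>r\<^sup>-\<^sup>m\<^sup>L\<^sup>r\<close> is bounded.\<close>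

lemma power_radius_bounded:
 fixes C L m r kap :: real
 assumes r: "0 < r" "r <= 1" and L: "L >= 0" and m: "m >= 0" and C: "C >= 1"
  and l: "1 <= kap" "kap <= C / r powr m" and d: "d <= L * r"
 shows "kap powr d <= C powr L * exp (m * L)"
proof -
 have "kap powr d <= kap powr (L * r)" using l d by (intro powr_mono) auto
 also have "\<dots> <= (C / r powr m) powr (L * r)" using l r L by (intro powr_mono2) auto
 also have "\<dots> = C powr (L * r) * r powr (- (m * (L * r)))"
  using C r by (simp add: powr_divide powr_powr powr_minus_divide)
 also have "\<dots> <= C powr L * exp (m * L)"
 proof (intro mult_mono)
  show "C powr (L * r) <= C powr L" using C r L by (intro powr_mono mult_left_le) auto
  have "- ln r * r <= 1"
  proof -
   have "ln (1 / r) <= 1 / r - 1" using r by (intro ln_le_minus_one) auto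
   then have "- ln r <= 1 / r - 1" using r by (simp add: ln_div)
   then have "- ln r * r <= (1 / r - 1) * r" using r by (intro mult_right_mono) auto
   also have "\<dots> <= 1" using r by (simp add: left_diff_distrib)
   finally show ?thesis .
  qed
  then have "(m * L) * (- ln r * r) <= m * L * 1" using m L by (intro mult_left_mono) auto
  then show "r powr (- (m * (L * r))) <= exp (m * L)"
   using r by (simp add: powr_def algebra_simps)
 qed auto
 finally show ?thesis .
qed

lemma borel_fst_snd [measurable]:
 "(fst :: 'b::euclidean_space \<times> 'c::euclidean_space => 'b) : borel_funs"
 "(snd :: 'b::euclidean_space \<times> 'c::euclidean_space => 'c) : borel_funs"
 by (auto intro!: borel_measurable_continuous_onI continuous_intros)

lemma norm_snd_le_norm: "norm (snd z) <= norm z"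
 using norm_snd_le[of "snd z" "fst z"] by simp

locale cylinder =
 fixes Om :: "'a::euclidean_space set" and p :: "'a => real" and P L T :: real
 assumes open_Om: "open Om" and bounded_Om: "bounded Om" and T: "T > 0"
  and p_meas [measurable]: "p : borel_funs"
  and p_gt: "!!x. 1 < p x" and p_le: "!!x. p x <= P"
  and L: "L >= 0" and p_lip: "!!x y. closed_segment x y \<subseteq> Om ==> \<bar>p x - p y\<bar> <= L * dist x y"
begin

abbreviation Q :: "(real \<times> 'a) set" where "Q \<equiv> QT T Om"

lemma open_Q: "open Q" by (intro open_Times open_Om) auto

lemma bounded_Q: "bounded Q" by (intro bounded_Times bounded_Om) auto

lemma Q_meas [measurable]: "Q : sets borel" using open_Q by simp

lemma Om_meas [measurable]: "Om : sets borel" using open_Om by simp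

definition state :: "real => (real \<times> 'a => real) => (real \<times> 'a => 'a) => bool" where
 "state M u G \<longleftrightarrow> u : borel_funs & G : borel_funs &
  (\<forall>y. 0 <= u y & u y <= M) & (\<forall>y. y \<notin> Q --> u y = 0 & G y = 0) &
  lint (%y. norm (G y) powr p (snd y)) &
  (\<forall>b\<in>Basis. wderiv Q (0, b) u (%y. G y \<bullet> b))"

lemma integrable_Q: "lint (indicator Q :: _ => real)"
proof (rule integrable_real_indicator)
 show "emeasure lborel Q < \<infinity>" by (rule emeasure_bounded_finite[OF bounded_Q])
qed simp

lemma stateD:
 assumes "state M u G"
 shows "u : borel_funs" "G : borel_funs" "0 <= u y" "u y <= M" "y \<notin> Q ==> u y = 0"
  "y \<notin> Q ==> G y = 0" "lint (%y. norm (G y) powr p (snd y))"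
  "b : Basis ==> wderiv Q (0, b) u (%y. G y \<bullet> b)"
  "lint u" "lint G"
proof -
 show [measurable]: "u : borel_funs" "G : borel_funs"
  and b: "0 <= u y" "u y <= M" "y \<notin> Q ==> u y = 0"
  "y \<notin> Q ==> G y = 0" and i: "lint (%y. norm (G y) powr p (snd y))"
  and "b : Basis ==> wderiv Q (0, b) u (%y. G y \<bullet> b)" for y b
  using assms by (auto simp: state_def simp del: split_paired_All)
 show "lint u"
  by (rule integrable_bounded_support[OF _ bounded_Q, where C=M]) (use b in auto)
 show "lint G"
 proof (rule BI_integrable_bound)
  show "lint (%y. indicator Q y + norm (G y) powr p (snd y))"
   by (intro BI_integrable_add integrable_Q i)
  show "AE y in lborel. norm (G y) <= norm (indicator Q y + norm (G y) powr p (snd y))"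
  proof (rule AE_I2)
   fix y
   show "norm (G y) <= norm (indicator Q y + norm (G y) powr p (snd y))"
   proof (cases "y : Q")
   case True
   have "norm (G y) <= 1 + norm (G y) powr p (snd y)"
   proof (cases "norm (G y) <= 1")
   case False
   then have "norm (G y) powr 1 <= norm (G y) powr p (snd y)"
   using p_gt[of "snd y"] by (intro powr_mono) auto
   then show ?thesis using False by simp
   qed (auto intro: add_increasing2)
   then show ?thesis using True by simp
   qed (simp add: b)
  qed
 qed simp
qed

lemma state_mollify_grad:
 assumes s: "state M u G" and r: "r > 0" and y: "cball y r \<subseteq> Q"
 shows "snd (\<integral>w. u w *# moll_grad r (y - w) \<partial>lborel) = mollify (moll r) G y"
proof (rule euclidean_eqI)
 fix b :: 'a assume b: "b : Basis"
 have "snd (\<integral>w. u w *# moll_grad r (y - w) \<partial>lborel) \<bullet> b = (\<integral>w. u w *# moll_grad r (y - w) \<partial>lborel) \<bullet> (0, b)"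
  by (simp add: inner_prod_def)
 also have "\<dots> = mollify (moll r) (%y. G y \<bullet> b) y"
  by (rule wderiv_mollify[OF open_Q stateD(8)[OF s b] stateD(9)[OF s] r y])
 also have "\<dots> = mollify (moll r) G y \<bullet> b"
  unfolding mollify_def by (subst integral_inner_left[symmetric], rule integrable_moll_scaleR[OF r stateD(10)[OF s]]) simp
 finally show "snd (\<integral>w. u w *# moll_grad r (y - w) \<partial>lborel) \<bullet> b = mollify (moll r) G y \<bullet> b" .
qed

text \<open>The gradient of the mollified bounded function is at most of order \<open>1/r\<close>, so that freezing the exponent at the centre costs only a constant.\<close>

lemma mollify_modular:
 assumes s: "state M u G"
 obtains K where "K > 0" "!!r y. 0 < r ==> r <= 1 ==> cball y r \<subseteq> Q ==>
  norm (mollify (moll r) G y) powr p (snd y) <= 1 + K * mollify (moll r) (%y. norm (G y) powr p (snd y)) y"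
proof -
 note [measurable] = stateD(1,2)[OF s]
 define m where "m = real (DIM(real \<times> 'a) + 1)"
 define C where "C = max 1 ((\<integral>y. \<bar>u y\<bar> \<partial>lborel) * (4 / bump_mass TYPE(real \<times> 'a)))"
 define K0 where "K0 = C powr L * exp (m * L)"
 have "K0 > 0" by (auto simp: K0_def C_def)
 have main: "norm (mollify (moll r) G y) powr p (snd y) <= 1 + (2 * (2 * 1) powr P * K0) * mollify (moll r) (%y. norm (G y) powr p (snd y)) y"
  if r: "0 < r" "r <= 1" and y: "cball y r \<subseteq> Q" for r y
 proof -
  have [measurable]: "moll r : borel_measurable (borel :: (real \<times> 'a) measure)" using r by measurable
  define \<nu> where "\<nu> = density lborel (%w. ennreal (moll r (y - w)))"
  let ?l = "norm (mollify (moll r) G y)"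
  have bound: "?l <= C / r powr m"
  proof -
   have "?l <= norm (\<integral>w. u w *# moll_grad r (y - w) \<partial>lborel)"
   unfolding state_mollify_grad[OF s r(1) y, symmetric] by (rule norm_snd_le_norm)
   also have "\<dots> <= (\<integral>w. ((4 / bump_mass TYPE(real \<times> 'a)) / r ^ (DIM(real \<times> 'a) + 1)) * \<bar>u w\<bar> \<partial>lborel)"
   proof (rule order_trans[OF integral_norm_bound], rule integral_mono')
   show "lint (%w. ((4 / bump_mass TYPE(real \<times> 'a)) / r ^ (DIM(real \<times> 'a) + 1)) * \<bar>u w\<bar>)"
   using stateD(9)[OF s] by (intro integrable_mult_right integrable_abs)
   show "norm (u w *# moll_grad r (y - w)) <= ((4 / bump_mass TYPE(real \<times> 'a)) / r ^ (DIM(real \<times> 'a) + 1)) * \<bar>u w\<bar>" for w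
   unfolding norm_scaleR by (subst mult.commute, intro mult_right_mono moll_grad_bound[OF r(1)]) auto
   show "0 <= ((4 / bump_mass TYPE(real \<times> 'a)) / r ^ (DIM(real \<times> 'a) + 1)) * \<bar>u w\<bar>" for w
   using bump_mass_pos[where 'b="real \<times> 'a"] r by (intro mult_nonneg_nonneg divide_nonneg_pos) auto
   qed
   also have "\<dots> = ((\<integral>y. \<bar>u y\<bar> \<partial>lborel) * (4 / bump_mass TYPE(real \<times> 'a))) / r powr m"
   using r unfolding m_def by (subst powr_realpow) auto
   also have "\<dots> <= C / r powr m" unfolding C_def by (intro divide_right_mono) auto
   finally show ?thesis .
  qed
  have "ennreal (?l powr p (snd y)) <= 1 + ennreal (2 * (2 * 1) powr P * K0) * (\<integral>\<^sup>+w. norm (G w) powr p (snd w) \<partial>\<nu>)"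
  proof (rule average_power)
   show "(%w. norm (G w)) : borel_measurable \<nu>" "(%w. p (snd w)) : borel_measurable \<nu>"
   by (simp_all add: \<nu>_def)
   show "emeasure \<nu> (space \<nu>) <= ennreal 1"
   unfolding \<nu>_def by (subst emeasure_density) (auto simp: nn_integral_moll r)
   have "ennreal ?l <= (\<integral>\<^sup>+w. ennreal (moll r (y - w)) * ennreal (norm (G w)) \<partial>lborel)"
   by (rule norm_mollify_le[OF r(1)]) simp
   also have "\<dots> = (\<integral>\<^sup>+w. norm (G w) \<partial>\<nu>)"
   unfolding \<nu>_def by (subst nn_integral_density) auto
   finally show "ennreal ?l <= (\<integral>\<^sup>+w. norm (G w) \<partial>\<nu>)" .
   show "AE w in \<nu>. 1 <= ?l --> ?l powr (p (snd y) - p (snd w)) <= K0"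
   unfolding \<nu>_def
   proof (subst AE_density, simp, rule AE_I2, intro impI)
   fix w assume w: "0 < ennreal (moll r (y - w))" and l: "1 <= ?l"
   have d: "dist y w < r" using w moll_eq_0[OF r(1), of "y - w"] by (force simp: dist_norm not_le[symmetric])
   have "closed_segment (snd y) (snd w) \<subseteq> Om"
   proof
   fix z assume "z : closed_segment (snd y) (snd w)"
   then have "dist (snd y) z <= dist (snd y) (snd w)"
   using dist_in_closed_segment by (metis dist_commute)
   also have "\<dots> <= r" using d dist_snd_le[of y w] by simp
   finally have "(fst y, z) : cball y r" by (simp add: dist_prod_def)
   then show "z : Om" using y by auto
   qed
   then have "p (snd y) - p (snd w) <= L * dist (snd y) (snd w)" using p_lip by fastforce
   also have "\<dots> <= L * r" using d dist_snd_le[of y w] L by (intro mult_left_mono) auto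
   finally show "?l powr (p (snd y) - p (snd w)) <= K0"
   unfolding K0_def using r L l bound by (intro power_radius_bounded[where r=r]) (auto simp: m_def C_def)
   qed
  qed (use p_gt p_le \<open>K0 > 0\<close> in \<open>auto intro: less_imp_le order_trans[OF zero_le_one less_imp_le]\<close>)
  also have "(\<integral>\<^sup>+w. norm (G w) powr p (snd w) \<partial>\<nu>) = ennreal (mollify (moll r) (%y. norm (G y) powr p (snd y)) y)"
  proof -
   have "(\<integral>\<^sup>+w. norm (G w) powr p (snd w) \<partial>\<nu>) = (\<integral>\<^sup>+w. ennreal (moll r (y - w) *# (norm (G w) powr p (snd w))) \<partial>lborel)"
   unfolding \<nu>_def by (subst nn_integral_density) (auto simp: ennreal_mult moll_nonneg r)
   also have "\<dots> = ennreal (mollify (moll r) (%y. norm (G y) powr p (snd y)) y)"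
   unfolding mollify_def
   by (intro nn_integral_eq_integral integrable_moll_scaleR[OF r(1) stateD(7)[OF s]]) (auto simp: moll_nonneg r)
   finally show ?thesis .
  qed
  finally have "ennreal (?l powr p (snd y)) <= ennreal (1 + (2 * (2 * 1) powr P * K0) * mollify (moll r) (%y. norm (G y) powr p (snd y)) y)"
  proof (rule ord_le_eq_trans)
   have "0 <= mollify (moll r) (%y. norm (G y) powr p (snd y)) y"
   unfolding mollify_def by (intro integral_nonneg_AE) (auto simp: moll_nonneg r)
   then show "1 + ennreal (2 * (2 * 1) powr P * K0) * ennreal (mollify (moll r) (%y. norm (G y) powr p (snd y)) y) = ennreal (1 + (2 * (2 * 1) powr P * K0) * mollify (moll r) (%y. norm (G y) powr p (snd y)) y)"
   using \<open>K0 > 0\<close> by (subst ennreal_plus) (auto simp: ennreal_mult)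
  qed
  moreover have "0 <= 1 + (2 * (2 * 1) powr P * K0) * mollify (moll r) (%y. norm (G y) powr p (snd y)) y"
   unfolding mollify_def using \<open>K0 > 0\<close> r
   by (intro add_nonneg_nonneg mult_nonneg_nonneg integral_nonneg_AE) (auto simp: moll_nonneg)
  ultimately show ?thesis by (simp add: ennreal_le_iff)
 qed
 show thesis by (rule that[OF _ main]) (use \<open>K0 > 0\<close> in auto)
qed

end

section \<open>Functions of two solutions as test functions\<close>

lemma C1_test_zero: "C1_test K phi dphi ==> x \<notin> K ==> phi x = 0"
 by (simp add: C1_test_def)

lemma L1_sum_subseq:
 fixes f1 f2 :: "'b::euclidean_space => real" and f3 f4 :: "'b => 'c::euclidean_space"
 assumes i: "lint f1" "lint f2" "lint f3" "lint f4"
 obtains r where "strict_mono r"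
  "AE y in lborel. (%n. mollify (moll (rad (r n))) f1 y) \<rightarrow> f1 y & (%n. mollify (moll (rad (r n))) f2 y) \<rightarrow> f2 y &
   (%n. mollify (moll (rad (r n))) f3 y) \<rightarrow> f3 y & (%n. mollify (moll (rad (r n))) f4 y) \<rightarrow> f4 y"
proof -
 let ?e = "%n y. norm (mollify (moll (rad n)) f1 y - f1 y) + norm (mollify (moll (rad n)) f2 y - f2 y) +
  (norm (mollify (moll (rad n)) f3 y - f3 y) + norm (mollify (moll (rad n)) f4 y - f4 y))"
 have ii: "lint (%y. norm (mollify (moll (rad n)) f1 y - f1 y))"
   "lint (%y. norm (mollify (moll (rad n)) f2 y - f2 y))"
   "lint (%y. norm (mollify (moll (rad n)) f3 y - f3 y))"
   "lint (%y. norm (mollify (moll (rad n)) f4 y - f4 y))" for n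
  using i by (auto intro!: integrable_norm integrable_mollify BI_integrable_diff)
 have ie: "lint (?e n)" for n by (intro BI_integrable_add ii)
 have "(%n. \<integral>y. norm (?e n y) \<partial>lborel) \<rightarrow> 0"
 proof -
  have "(\<integral>y. norm (?e n y) \<partial>lborel) = (\<integral>y. norm (mollify (moll (rad n)) f1 y - f1 y) \<partial>lborel) +
   (\<integral>y. norm (mollify (moll (rad n)) f2 y - f2 y) \<partial>lborel) +
   ((\<integral>y. norm (mollify (moll (rad n)) f3 y - f3 y) \<partial>lborel) +
   (\<integral>y. norm (mollify (moll (rad n)) f4 y - f4 y) \<partial>lborel))" for n
  proof -
   have "(\<integral>y. norm (?e n y) \<partial>lborel) = (\<integral>y. ?e n y \<partial>lborel)" by (intro BI_integral_cong) auto
   then show ?thesis by (simp only: BI_integral_add BI_integrable_add ii)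
  qed
  moreover have "(%n. (\<integral>y. norm (mollify (moll (rad n)) f1 y - f1 y) \<partial>lborel) +
   (\<integral>y. norm (mollify (moll (rad n)) f2 y - f2 y) \<partial>lborel) +
   ((\<integral>y. norm (mollify (moll (rad n)) f3 y - f3 y) \<partial>lborel) +
   (\<integral>y. norm (mollify (moll (rad n)) f4 y - f4 y) \<partial>lborel))) \<rightarrow> 0 + 0 + (0 + 0)"
   by (intro tendsto_add mollify_L1 i)
  ultimately show ?thesis by simp
 qed
 from tendsto_L1_AE_subseq[OF ie this] obtain r where r: "strict_mono r" "AE y in lborel. (%n. ?e (r n) y) \<rightarrow> 0" by auto
 have sq: "X \<rightarrow> a" if "(%n. E n) \<rightarrow> 0" "!!n. norm (X n - a) <= E n" for X :: "nat => 'z::real_normed_vector" and a E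
  using Lim_null_comparison[of "%n. X n - a" E sequentially] that by (auto simp: LIM_zero_iff)
 show thesis
 proof (rule that[OF r(1)])
  show "AE y in lborel. (%n. mollify (moll (rad (r n))) f1 y) \<rightarrow> f1 y & (%n. mollify (moll (rad (r n))) f2 y) \<rightarrow> f2 y &
   (%n. mollify (moll (rad (r n))) f3 y) \<rightarrow> f3 y & (%n. mollify (moll (rad (r n))) f4 y) \<rightarrow> f4 y"
   using r(2)
  proof eventually_elim
   case (elim y)
   show ?case by (intro conjI; rule sq[OF elim]) auto
  qed
 qed
qed

context cylinder begin

lemma mollify_range:
 assumes s: "state M u G" and r: "r > 0"
 shows "0 <= mollify (moll r) u y" "mollify (moll r) u y <= M"
proof -
 note [measurable] = stateD(1,2)[OF s]
 have [measurable]: "moll r : borel_measurable (borel :: (real \<times> 'a) measure)" using r by measurable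
 have i: "lint (%w. moll r (y - w) * u w)"
  using integrable_moll_scaleR[OF r stateD(9)[OF s], of y] by simp
 have im: "lint (%w. moll r (y - w))"
  using nn_integral_moll(2)[OF r, of y]
  by (intro integrableI_nn_integral_finite[where x=1]) (auto simp: moll_nonneg r)
 have m1: "(\<integral>w. moll r (y - w) \<partial>lborel) = 1"
  using nn_integral_moll(2)[OF r, of y] nn_integral_eq_integral[OF im]
  by (auto simp: moll_nonneg r)
 show "0 <= mollify (moll r) u y"
  unfolding mollify_def by (intro integral_nonneg_AE) (auto simp: moll_nonneg r stateD(3)[OF s])
 have "moll r (y - w) * u w <= M * moll r (y - w)" for w
  using mult_left_mono[OF stateD(4)[OF s, of w] moll_nonneg[OF r, of "y - w"]] by (simp add: mult.commute)
 then have "mollify (moll r) u y <= (\<integral>w. M * moll r (y - w) \<partial>lborel)"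
  unfolding mollify_def real_scaleR_def using im by (intro integral_mono i integrable_mult_right)
 then show "mollify (moll r) u y <= M" by (simp add: m1)
qed

text \<open>Mollify both functions. The mollified gradients converge in the mean and their modulars are dominated by a sequence converging in \<open>L\<^sup>1\<close>; with the Young inequality for the flux this permits passage to the limit.\<close>

lemma composed_test:
 fixes Psi Psi1 Psi2 :: "real \<times> real => real"
 assumes w: "weak_div Q (%y. (0, B y)) A"
  and B: "!!y s. y : Q ==> s >= 0 ==> norm (B y) * s <= e y + s powr p (snd y)" and e: "lint e"
  and B_meas: "B : borel_funs"
  and su: "state M u Gu" and sv: "state M v Gv"
  and Psi: "!!a b. a : {0..M} ==> b : {0..M} ==> (Psi has_derivative (%h. Psi1 (a, b) * fst h + Psi2 (a, b) * snd h)) (at (a, b))"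
  and cPsi: "continuous_on ({0..M} \<times> {0..M}) Psi1" "continuous_on ({0..M} \<times> {0..M}) Psi2"
  and t: "C1_test K \<theta> d\<theta>" and KQ: "K \<subseteq> Q"
 defines "F \<equiv> (%y. A y * (Psi (u y, v y) * \<theta> y) + B y \<bullet> (\<theta> y *# (Psi1 (u y, v y) *# Gu y + Psi2 (u y, v y) *# Gv y) + Psi (u y, v y) *# snd (d\<theta> y)))"
 shows "lint F" "integral\<^sup>L lborel F = 0"
proof -
 let ?I = "{0..M} \<times> {0..M}"
 note [measurable] = stateD(1,2)[OF su] stateD(1,2)[OF sv] B_meas C1_test_integrable(2,3)[OF t]
 have A_loc: "loc_int Q A" using w by (simp add: weak_div_def)
 then have [measurable]: "A : borel_funs" by (simp add: loc_int_def)
 have M: "0 <= M" using stateD(3,4)[OF su, of undefined] by simp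
 have cK: "compact K" using t by (simp add: C1_test_def)
 then have [measurable]: "K : sets borel" by (simp add: compact_imp_closed)
 have c0: "continuous_on ?I Psi"
  by (rule continuous_at_imp_continuous_on) (auto intro!: has_derivative_continuous[OF Psi])
 have bd: "\<exists>C. C > 0 & (\<forall>z\<in>?I. \<bar>f z\<bar> <= C)" if "continuous_on ?I f" for f :: "real \<times> real => real"
 proof -
  have "compact (f ` ?I)" using that by (intro compact_continuous_image compact_Times) auto
  then obtain C where "!!z. z : ?I ==> \<bar>f z\<bar> <= C" by (metis compact_imp_bounded bounded_iff imageI real_norm_def)
  then show ?thesis by (intro exI[of _ "\<bar>C\<bar> + 1"]) fastforce
 qed
 obtain C0 where C0: "C0 > 0" "!!z. z : ?I ==> \<bar>Psi z\<bar> <= C0" using bd[OF c0] by auto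
 obtain C1 where C1: "C1 > 0" "!!z. z : ?I ==> \<bar>Psi1 z\<bar> <= C1" using bd[OF cPsi(1)] by auto
 obtain C2 where C2: "C2 > 0" "!!z. z : ?I ==> \<bar>Psi2 z\<bar> <= C2" using bd[OF cPsi(2)] by auto
 obtain R where R: "R > 0" "smooth_kernel \<theta> d\<theta> R" using C1_test_kernel[OF t] by blast
 interpret th: smooth_kernel \<theta> d\<theta> R by (rule R)
 obtain C3 where C3: "!!x. \<bar>\<theta> x\<bar> <= C3" using bounded_compact_support[OF th.cont_k th.supp(1)] by auto
 obtain C4 where C4: "!!x. norm (d\<theta> x) <= C4" using bounded_compact_support[OF th.cont th.supp(2)] by blast
 have C34: "C3 >= 0" "C4 >= 0" using C3[of 0] C4[of 0] norm_ge_zero[of "d\<theta> 0"] by linarith+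
 obtain dlt where dlt: "dlt > 0" "(\<Union>x\<in>K. cball x dlt) \<subseteq> Q"
  using compact_subset_open_imp_cball_epsilon_subset[OF cK open_Q KQ] by blast
 obtain Ku where Ku: "Ku > 0" "!!r y. 0 < r ==> r <= 1 ==> cball y r \<subseteq> Q ==>
  norm (mollify (moll r) Gu y) powr p (snd y) <= 1 + Ku * mollify (moll r) (%y. norm (Gu y) powr p (snd y)) y"
  by (rule mollify_modular[OF su]) (rule that)
 obtain Kv where Kv: "Kv > 0" "!!r y. 0 < r ==> r <= 1 ==> cball y r \<subseteq> Q ==>
  norm (mollify (moll r) Gv y) powr p (snd y) <= 1 + Kv * mollify (moll r) (%y. norm (Gv y) powr p (snd y)) y"
  by (rule mollify_modular[OF sv]) (rule that)
 obtain r where r: "strict_mono r"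
  "AE y in lborel. (%n. mollify (moll (rad (r n))) u y) \<rightarrow> u y & (%n. mollify (moll (rad (r n))) v y) \<rightarrow> v y &
   (%n. mollify (moll (rad (r n))) Gu y) \<rightarrow> Gu y & (%n. mollify (moll (rad (r n))) Gv y) \<rightarrow> Gv y"
  using L1_sum_subseq[OF stateD(9)[OF su] stateD(9)[OF sv] stateD(10)[OF su] stateD(10)[OF sv]] by blast
 obtain N where N: "!!n. n >= N ==> rad n < dlt"
  using rad_eventually[OF dlt(1)] unfolding eventually_sequentially by blast
 define m where "m n = r (n + N)" for n
 have m_ge: "m n >= n + N" for n unfolding m_def using seq_suble[OF r(1)] .
 define rho where "rho n = rad (m n)" for n
 have rho: "0 < rho n" "rho n <= 1" for n by (auto simp: rho_def rad_le_1)
 have rhoK: "cball y (rho n) \<subseteq> Q" if "y : K" for n y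
 proof -
  have "rho n < dlt" unfolding rho_def using m_ge[of n] by (intro N) simp
  then have "cball y (rho n) \<subseteq> cball y dlt" by (intro subset_cball) simp
  then show ?thesis using dlt(2) that by blast
 qed
 have [measurable]: "moll (rho n) : borel_measurable (borel :: (real \<times> 'a) measure)" for n using rho by measurable
 define un vn where "un n = mollify (moll (rho n)) u" and "vn n = mollify (moll (rho n)) v" for n
 define Gun Gvn where "Gun n = mollify (moll (rho n)) Gu" and "Gvn n = mollify (moll (rho n)) Gv" for n
 define Eu Ev where "Eu y = norm (Gu y) powr p (snd y)" and "Ev y = norm (Gv y) powr p (snd y)" for y
 define Dun Dvn where "Dun n x = (\<integral>y. u y *# moll_grad (rho n) (x - y) \<partial>lborel)"
  and "Dvn n x = (\<integral>y. v y *# moll_grad (rho n) (x - y) \<partial>lborel)" for n x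
 have [measurable]: "un n : borel_funs" "vn n : borel_funs" "Gun n : borel_funs" "Gvn n : borel_funs" for n
  unfolding un_def vn_def Gun_def Gvn_def by simp_all
 have rng: "(un n y, vn n y) : ?I" "(u y, v y) : ?I" for n y
  using mollify_range[OF su rho(1)] mollify_range[OF sv rho(1)] stateD(3,4)[OF su] stateD(3,4)[OF sv] by (auto simp: un_def vn_def)
 have sk: "smooth_kernel (moll (rho n) :: real \<times> 'a => real) (moll_grad (rho n)) (rho n)" for n
  by (rule smooth_kernel_moll[OF rho(1)])
 have dun: "(un n has_derivative (%h. Dun n x \<bullet> h)) (at x)" and dvn: "(vn n has_derivative (%h. Dvn n x \<bullet> h)) (at x)" for n x
  unfolding un_def Dun_def vn_def Dvn_def
  by (rule smooth_kernel.mollify_has_derivative[OF sk stateD(9)[OF su]], rule smooth_kernel.mollify_has_derivative[OF sk stateD(9)[OF sv]])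
 have cD: "continuous_on UNIV (Dun n)" "continuous_on UNIV (Dvn n)" for n
  unfolding Dun_def Dvn_def
  by (rule smooth_kernel.continuous_mollify_grad[OF sk stateD(9)[OF su]], rule smooth_kernel.continuous_mollify_grad[OF sk stateD(9)[OF sv]])
 have cu: "continuous_on UNIV (un n)" "continuous_on UNIV (vn n)" for n
  by (rule has_derivative_continuous_on[OF has_derivative_at_withinI[OF dun]],
   rule has_derivative_continuous_on[OF has_derivative_at_withinI[OF dvn]])
 have sD: "snd (Dun n y) = Gun n y" "snd (Dvn n y) = Gvn n y" if "y : K" for n y
  unfolding Dun_def Dvn_def Gun_def Gvn_def
  by (rule state_mollify_grad[OF su rho(1) rhoK[OF that]], rule state_mollify_grad[OF sv rho(1) rhoK[OF that]])
 define phi where "phi n y = Psi (un n y, vn n y) * \<theta> y" for n y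
 define dphi where "dphi n y = \<theta> y *# (Psi1 (un n y, vn n y) *# Dun n y + Psi2 (un n y, vn n y) *# Dvn n y) + Psi (un n y, vn n y) *# d\<theta> y" for n y
 have cc: "continuous_on UNIV (%y. f (un n y, vn n y))" if "continuous_on ?I f" for f :: "real \<times> real => real" and n
  by (rule continuous_on_compose2[OF that]) (use rng(1) in \<open>auto intro!: continuous_intros cu\<close>)
 have C1n: "C1_test K (phi n) (dphi n)" for n
  unfolding C1_test_def
 proof (intro conjI allI impI)
  show "compact K" by (rule cK)
  fix x
  have h1: "((%y. (un n y, vn n y)) has_derivative (%h. (Dun n x \<bullet> h, Dvn n x \<bullet> h))) (at x)"
   by (intro has_derivative_Pair dun dvn)
  have h2: "(Psi has_derivative (%h. Psi1 (un n x, vn n x) * fst h + Psi2 (un n x, vn n x) * snd h)) (at (un n x, vn n x))"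
   using rng(1)[of n x] by (intro Psi) auto
  have "((%y. Psi (un n y, vn n y)) has_derivative (%h. Psi1 (un n x, vn n x) * (Dun n x \<bullet> h) + Psi2 (un n x, vn n x) * (Dvn n x \<bullet> h))) (at x)"
   using has_derivative_compose[OF h1 h2] by simp
  from has_derivative_mult[OF this th.deriv[of x]]
  show "(phi n has_derivative (%h. dphi n x \<bullet> h)) (at x)"
   unfolding phi_def dphi_def by (rule has_derivative_eq_rhs) (auto simp: algebra_simps inner_simps)
 next
  show "continuous_on UNIV (dphi n)"
   unfolding dphi_def by (intro continuous_intros cc c0 cPsi cD th.cont th.cont_k)
  show "phi n x = 0" if "x \<notin> K" for x using C1_test_zero[OF t that] by (simp add: phi_def)
 qed
 define Fn where "Fn n y = A y * (Psi (un n y, vn n y) * \<theta> y) + B y \<bullet> (\<theta> y *# (Psi1 (un n y, vn n y) *# Gun n y + Psi2 (un n y, vn n y) *# Gvn n y) + Psi (un n y, vn n y) *# snd (d\<theta> y))" for n y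
 have Fn_eq: "Fn n = (%y. A y * phi n y + (0, B y) \<bullet> dphi n y)" for n
 proof
  fix y
  show "Fn n y = A y * phi n y + (0, B y) \<bullet> dphi n y"
  proof (cases "y : K")
   case True
   then show ?thesis by (simp add: Fn_def phi_def dphi_def inner_prod_def sD)
  next
   case False
   then have "\<theta> y = 0" "d\<theta> y = 0" using C1_test_zero[OF t] C1_test_grad_zero[OF t] by auto
   then show ?thesis by (simp add: Fn_def phi_def dphi_def)
  qed
 qed
 have Fn0: "lint (Fn n)" "integral\<^sup>L lborel (Fn n) = 0" for n
  unfolding Fn_eq by (rule weak_div_C1_test[OF open_Q w C1n KQ])+
 have iE: "lint Eu" "lint Ev"
  unfolding Eu_def Ev_def by (rule stateD(7)[OF su], rule stateD(7)[OF sv])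
 define g where "g n y = C0 * C3 * (indicator K y * \<bar>A y\<bar>) + (C3 * C1 + C3 * C2 + C0 * C4) * (indicator K y * (\<bar>e y\<bar> + 1)) +
   (C3 * C1 * Ku * \<bar>mollify (moll (rho n)) Eu y\<bar> + C3 * C2 * Kv * \<bar>mollify (moll (rho n)) Ev y\<bar>)" for n y
 define G where "G y = C0 * C3 * (indicator K y * \<bar>A y\<bar>) + (C3 * C1 + C3 * C2 + C0 * C4) * (indicator K y * (\<bar>e y\<bar> + 1)) +
   (C3 * C1 * Ku * \<bar>Eu y\<bar> + C3 * C2 * Kv * \<bar>Ev y\<bar>)" for y
 have iA: "lint (%y. indicator K y * \<bar>A y\<bar>)"
  using integrable_norm[of lborel "%y. indicator K y *# A y"] A_loc cK KQ by (auto simp: loc_int_def abs_mult)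
 have ie: "lint (%y. indicator K y * (\<bar>e y\<bar> + 1))"
 proof -
  have "lint (%y. indicator K y *# \<bar>e y\<bar> + indicator K y)"
   using e cK by (intro BI_integrable_add integrable_mult_indicator integrable_abs integrable_real_indicator emeasure_compact_finite) auto
  then show ?thesis by (simp add: distrib_left)
 qed
 have iM: "lint (mollify (moll (rho n)) Eu)" "lint (mollify (moll (rho n)) Ev)" for n
  by (intro integrable_mollify rho iE)+
 have ig: "lint (g n)" for n
  unfolding g_def by (intro BI_integrable_add integrable_mult_right integrable_abs iA ie iM)
 have iG: "lint G"
  unfolding G_def by (intro BI_integrable_add integrable_mult_right integrable_abs iA ie iE)
 have L1: "(%n. \<integral>y. \<bar>g n y - G y\<bar> \<partial>lborel) \<rightarrow> 0"
 proof (rule Lim_null_comparison[OF always_eventually], rule allI)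
  fix n
  have id: "lint (%y. \<bar>mollify (moll (rho n)) Eu y - Eu y\<bar>)" "lint (%y. \<bar>mollify (moll (rho n)) Ev y - Ev y\<bar>)"
   by (intro integrable_abs BI_integrable_diff iM iE)+
  have "norm (\<integral>y. \<bar>g n y - G y\<bar> \<partial>lborel) = (\<integral>y. \<bar>g n y - G y\<bar> \<partial>lborel)" by (simp add: integral_nonneg_AE)
  also have "\<dots> <= (\<integral>y. C3 * C1 * Ku * \<bar>mollify (moll (rho n)) Eu y - Eu y\<bar> + C3 * C2 * Kv * \<bar>mollify (moll (rho n)) Ev y - Ev y\<bar> \<partial>lborel)"
  proof (rule integral_mono)
   show "lint (%y. \<bar>g n y - G y\<bar>)" using ig iG by simp
   show "lint (%y. C3 * C1 * Ku * \<bar>mollify (moll (rho n)) Eu y - Eu y\<bar> + C3 * C2 * Kv * \<bar>mollify (moll (rho n)) Ev y - Ev y\<bar>)"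
   by (intro BI_integrable_add integrable_mult_right id)
   fix y
   have "g n y - G y = C3 * C1 * Ku * (\<bar>mollify (moll (rho n)) Eu y\<bar> - \<bar>Eu y\<bar>) + C3 * C2 * Kv * (\<bar>mollify (moll (rho n)) Ev y\<bar> - \<bar>Ev y\<bar>)"
   by (simp add: g_def G_def algebra_simps)
   also have "\<bar>\<dots>\<bar> <= C3 * C1 * Ku * \<bar>\<bar>mollify (moll (rho n)) Eu y\<bar> - \<bar>Eu y\<bar>\<bar> + C3 * C2 * Kv * \<bar>\<bar>mollify (moll (rho n)) Ev y\<bar> - \<bar>Ev y\<bar>\<bar>"
   using C34 C1(1) C2(1) Ku(1) Kv(1) by (intro order_trans[OF abs_triangle_ineq]) (simp add: abs_mult)
   also have "\<dots> <= C3 * C1 * Ku * \<bar>mollify (moll (rho n)) Eu y - Eu y\<bar> + C3 * C2 * Kv * \<bar>mollify (moll (rho n)) Ev y - Ev y\<bar>"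
   using C34 C1(1) C2(1) Ku(1) Kv(1) by (intro add_mono mult_left_mono abs_triangle_ineq3) auto
   finally show "\<bar>g n y - G y\<bar> <= C3 * C1 * Ku * \<bar>mollify (moll (rho n)) Eu y - Eu y\<bar> + C3 * C2 * Kv * \<bar>mollify (moll (rho n)) Ev y - Ev y\<bar>" .
  qed
  also have "\<dots> = C3 * C1 * Ku * (\<integral>y. norm (mollify (moll (rho n)) Eu y - Eu y) \<partial>lborel) + C3 * C2 * Kv * (\<integral>y. norm (mollify (moll (rho n)) Ev y - Ev y) \<partial>lborel)"
   using id by (subst BI_integral_add) auto
  finally show "norm (\<integral>y. \<bar>g n y - G y\<bar> \<partial>lborel) <= C3 * C1 * Ku * (\<integral>y. norm (mollify (moll (rho n)) Eu y - Eu y) \<partial>lborel) + C3 * C2 * Kv * (\<integral>y. norm (mollify (moll (rho n)) Ev y - Ev y) \<partial>lborel)" .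
 next
  have sm: "strict_mono m" using r(1) by (auto simp: m_def strict_mono_def)
  have "(%n. \<integral>y. norm (mollify (moll (rho n)) f y - f y) \<partial>lborel) \<rightarrow> 0" if "lint f" for f :: "real \<times> 'a => real"
   using LIMSEQ_subseq_LIMSEQ[OF mollify_L1[OF that] sm] by (simp add: o_def rho_def)
  note this[OF iE(1)] this[OF iE(2)]
  then have "(%n. C3 * C1 * Ku * (\<integral>y. norm (mollify (moll (rho n)) Eu y - Eu y) \<partial>lborel) + C3 * C2 * Kv * (\<integral>y. norm (mollify (moll (rho n)) Ev y - Ev y) \<partial>lborel)) \<rightarrow> C3 * C1 * Ku * 0 + C3 * C2 * Kv * 0"
   by (intro tendsto_intros)
  then show "(%n. C3 * C1 * Ku * (\<integral>y. norm (mollify (moll (rho n)) Eu y - Eu y) \<partial>lborel) + C3 * C2 * Kv * (\<integral>y. norm (mollify (moll (rho n)) Ev y - Ev y) \<partial>lborel)) \<rightarrow> 0"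
   by simp
 qed
 have dom: "\<bar>Fn n y\<bar> <= g n y" for n y
 proof (cases "y : K")
  case False
  then have "\<theta> y = 0" "d\<theta> y = 0" using C1_test_zero[OF t] C1_test_grad_zero[OF t] by auto
  then have "Fn n y = 0" by (simp add: Fn_def)
  then show ?thesis using C34 C1(1) C2(1) C0(1) Ku(1) Kv(1) by (simp add: g_def False)
 next
  case True
  have yQ: "y : Q" using True KQ by auto
  note Psib = C0(2)[OF rng(1)[of n y]] C1(2)[OF rng(1)[of n y]] C2(2)[OF rng(1)[of n y]]
  have bu: "norm (B y) * norm (Gun n y) <= (\<bar>e y\<bar> + 1) + Ku * \<bar>mollify (moll (rho n)) Eu y\<bar>"
  proof -
   have "norm (B y) * norm (Gun n y) <= e y + norm (Gun n y) powr p (snd y)" by (rule B[OF yQ]) simp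
   also have "\<dots> <= \<bar>e y\<bar> + (1 + Ku * mollify (moll (rho n)) Eu y)"
   unfolding Gun_def Eu_def[abs_def] by (intro add_mono Ku(2) rho rhoK True) auto
   also have "\<dots> <= (\<bar>e y\<bar> + 1) + Ku * \<bar>mollify (moll (rho n)) Eu y\<bar>" using Ku(1) by (simp add: mult_left_mono)
   finally show ?thesis .
  qed
  have bv: "norm (B y) * norm (Gvn n y) <= (\<bar>e y\<bar> + 1) + Kv * \<bar>mollify (moll (rho n)) Ev y\<bar>"
  proof -
   have "norm (B y) * norm (Gvn n y) <= e y + norm (Gvn n y) powr p (snd y)" by (rule B[OF yQ]) simp
   also have "\<dots> <= \<bar>e y\<bar> + (1 + Kv * mollify (moll (rho n)) Ev y)"
   unfolding Gvn_def Ev_def[abs_def] by (intro add_mono Kv(2) rho rhoK True) auto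
   also have "\<dots> <= (\<bar>e y\<bar> + 1) + Kv * \<bar>mollify (moll (rho n)) Ev y\<bar>" using Kv(1) by (simp add: mult_left_mono)
   finally show ?thesis .
  qed
  have b1: "norm (B y) <= \<bar>e y\<bar> + 1" using B[OF yQ, of 1] by simp
  have t1: "\<bar>A y * (Psi (un n y, vn n y) * \<theta> y)\<bar> <= C0 * C3 * \<bar>A y\<bar>"
  proof -
   have "\<bar>Psi (un n y, vn n y)\<bar> * \<bar>\<theta> y\<bar> <= C0 * C3" using Psib C3[of y] C0(1) by (intro mult_mono) auto
   from mult_left_mono[OF this, of "\<bar>A y\<bar>"] show ?thesis by (simp add: abs_mult mult.commute)
  qed
  have t2: "\<bar>B y \<bullet> (\<theta> y *# (Psi1 (un n y, vn n y) *# Gun n y))\<bar> <= C3 * C1 * ((\<bar>e y\<bar> + 1) + Ku * \<bar>mollify (moll (rho n)) Eu y\<bar>)"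
  proof -
   have "\<bar>B y \<bullet> (\<theta> y *# (Psi1 (un n y, vn n y) *# Gun n y))\<bar> = (\<bar>\<theta> y\<bar> * \<bar>Psi1 (un n y, vn n y)\<bar>) * \<bar>B y \<bullet> Gun n y\<bar>" by (simp add: abs_mult)
   also have "\<dots> <= (C3 * C1) * ((\<bar>e y\<bar> + 1) + Ku * \<bar>mollify (moll (rho n)) Eu y\<bar>)"
   using Psib C3[of y] C1(1) C34 order_trans[OF Cauchy_Schwarz_ineq2 bu] by (intro mult_mono) auto
   finally show ?thesis .
  qed
  have t3: "\<bar>B y \<bullet> (\<theta> y *# (Psi2 (un n y, vn n y) *# Gvn n y))\<bar> <= C3 * C2 * ((\<bar>e y\<bar> + 1) + Kv * \<bar>mollify (moll (rho n)) Ev y\<bar>)"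
  proof -
   have "\<bar>B y \<bullet> (\<theta> y *# (Psi2 (un n y, vn n y) *# Gvn n y))\<bar> = (\<bar>\<theta> y\<bar> * \<bar>Psi2 (un n y, vn n y)\<bar>) * \<bar>B y \<bullet> Gvn n y\<bar>" by (simp add: abs_mult)
   also have "\<dots> <= (C3 * C2) * ((\<bar>e y\<bar> + 1) + Kv * \<bar>mollify (moll (rho n)) Ev y\<bar>)"
   using Psib C3[of y] C2(1) C34 order_trans[OF Cauchy_Schwarz_ineq2 bv] by (intro mult_mono) auto
   finally show ?thesis .
  qed
  have t4: "\<bar>B y \<bullet> (Psi (un n y, vn n y) *# snd (d\<theta> y))\<bar> <= C0 * C4 * (\<bar>e y\<bar> + 1)"
  proof -
   have "\<bar>B y \<bullet> snd (d\<theta> y)\<bar> <= norm (B y) * norm (snd (d\<theta> y))" by (rule Cauchy_Schwarz_ineq2)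
   also have "\<dots> <= (\<bar>e y\<bar> + 1) * C4" using b1 C4[of y] norm_snd_le_norm[of "d\<theta> y"] by (intro mult_mono) auto
   finally have "\<bar>Psi (un n y, vn n y)\<bar> * \<bar>B y \<bullet> snd (d\<theta> y)\<bar> <= C0 * ((\<bar>e y\<bar> + 1) * C4)"
   using Psib C0(1) by (intro mult_mono) auto
   then show ?thesis by (simp add: abs_mult mult_ac)
  qed
  have abs4: "\<bar>a\<bar> <= a' ==> \<bar>b\<bar> <= b' ==> \<bar>c\<bar> <= c' ==> \<bar>d\<bar> <= d' ==> \<bar>a + b + c + d\<bar> <= a' + b' + c' + d'"
   for a b c d a' b' c' d' :: real by linarith
  have "Fn n y = A y * (Psi (un n y, vn n y) * \<theta> y) + B y \<bullet> (\<theta> y *# (Psi1 (un n y, vn n y) *# Gun n y))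
   + B y \<bullet> (\<theta> y *# (Psi2 (un n y, vn n y) *# Gvn n y)) + B y \<bullet> (Psi (un n y, vn n y) *# snd (d\<theta> y))"
   by (simp add: Fn_def inner_add_right scaleR_add_right)
  then have "\<bar>Fn n y\<bar> <= C0 * C3 * \<bar>A y\<bar> + C3 * C1 * ((\<bar>e y\<bar> + 1) + Ku * \<bar>mollify (moll (rho n)) Eu y\<bar>) +
   C3 * C2 * ((\<bar>e y\<bar> + 1) + Kv * \<bar>mollify (moll (rho n)) Ev y\<bar>) + C0 * C4 * (\<bar>e y\<bar> + 1)"
   using abs4[OF t1 t2 t3 t4] by (simp only:)
  also have "\<dots> = g n y" using True by (simp add: g_def algebra_simps)
  finally show ?thesis .
 qed
 have lim: "AE y in lborel. (%n. Fn n y) \<rightarrow> F y"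
  using r(2)
 proof eventually_elim
  case (elim y)
  have sub: "(%n. X (r n)) \<rightarrow> a ==> (%n. X (m n)) \<rightarrow> a" for X :: "nat => 'z::topological_space" and a
   using LIMSEQ_ignore_initial_segment[of "%n. X (r n)" a N] by (simp add: m_def)
  have l: "(%n. un n y) \<rightarrow> u y" "(%n. vn n y) \<rightarrow> v y" "(%n. Gun n y) \<rightarrow> Gu y" "(%n. Gvn n y) \<rightarrow> Gv y"
   unfolding un_def vn_def Gun_def Gvn_def rho_def
   using elim by (auto intro!: sub[of "%k. mollify (moll (rad k)) _ y"])
  have lc: "(%n. f (un n y, vn n y)) \<rightarrow> f (u y, v y)" if "continuous_on ?I f" for f :: "real \<times> real => real"
   by (rule continuous_on_tendsto_compose[OF that]) (use rng l in \<open>auto intro!: tendsto_Pair\<close>)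
  show ?case
   unfolding Fn_def F_def by (intro tendsto_intros lc c0 cPsi l)
 qed
 have mFn: "Fn n : borel_measurable lborel" for n using Fn0(1) by auto
 have mF: "F : borel_measurable lborel"
 proof -
  have "(%y. f (u y, v y)) : borel_funs" if "continuous_on ?I f" for f :: "real \<times> real => real"
  proof -
   have "(%z. if z : ?I then f z else 0) : borel_funs"
   by (rule borel_measurable_continuous_on_if[OF _ that continuous_on_const]) (auto intro!: borel_closed closed_Times)
   from measurable_compose[OF _ this, of "%y. (u y, v y)" borel] have "(%y. if (u y, v y) : ?I then f (u y, v y) else 0) : borel_funs"
   by measurable
   then show ?thesis using rng(2) by simp
  qed
  note [measurable] = this[OF c0] this[OF cPsi(1)] this[OF cPsi(2)]
  show ?thesis unfolding F_def by measurable
 qed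
 show "lint F"
  by (rule dominated_convergence_L1(1)[OF mF mFn lim AE_I2[OF dom] ig iG L1])
 have "(%n. integral\<^sup>L lborel (Fn n)) \<rightarrow> integral\<^sup>L lborel F"
  by (rule dominated_convergence_L1(2)[OF mF mFn lim AE_I2[OF dom] ig iG L1])
 then have "(%n. 0) \<rightarrow> integral\<^sup>L lborel F" by (simp only: Fn0(2))
 then show "integral\<^sup>L lborel F = 0" by (rule LIMSEQ_unique[OF _ tendsto_const])
qed

end

section \<open>Zero traces and boundary layers\<close>

lemma open_segment_region:
 fixes b :: "'a::euclidean_space"
 assumes "open Om"
 shows "open {(x, r::real). closed_segment x (x + r *# b) \<subseteq> Om}"
proof (rule Topological_Spaces.openI)
 fix z assume "z : {(x, r::real). closed_segment x (x + r *# b) \<subseteq> Om}"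
 then obtain x r where z: "z = (x, r)" and sub: "closed_segment x (x + r *# b) \<subseteq> Om" by auto
 obtain e where e: "e > 0" "(\<Union>y\<in>closed_segment x (x + r *# b). cball y e) \<subseteq> Om"
  using compact_subset_open_imp_cball_epsilon_subset[OF compact_segment assms sub] by blast
 define d where "d = e / (2 * (norm b + 1))"
 have nb: "norm b + 1 > 0" by (simp add: add_nonneg_pos)
 have "e / (2 * z) * z = e / 2" if "z > 0" for z :: real using that by simp
 from this[OF nb] have d: "d > 0" "d * (norm b + 1) = e / 2" using e nb by (simp_all add: d_def)
 show "\<exists>T. open T & z : T & T \<subseteq> {(x, r). closed_segment x (x + r *# b) \<subseteq> Om}"
 proof (intro exI conjI)
  show "open (ball x d \<times> ball r d)" by (intro open_Times) auto
  show "z : ball x d \<times> ball r d" using d z by auto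
  show "ball x d \<times> ball r d \<subseteq> {(x, r). closed_segment x (x + r *# b) \<subseteq> Om}"
  proof (safe)
   fix x' r' w assume x': "x' : ball x d" and r': "r' : ball r d" and w: "w : closed_segment x' (x' + r' *# b)"
   then obtain u where u: "0 <= u" "u <= 1" "w = (1 - u) *# x' + u *# (x' + r' *# b)"
   by (auto simp: in_segment)
   define y where "y = (1 - u) *# x + u *# (x + r *# b)"
   have y: "y : closed_segment x (x + r *# b)" using u by (auto simp: in_segment y_def)
   have "y - w = (x - x') + (u * (r - r')) *# b" by (simp add: y_def u algebra_simps)
   then have "norm (y - w) <= norm (x - x') + norm ((u * (r - r')) *# b)" by (metis norm_triangle_ineq)
   also have "\<dots> <= d + d * norm b"
   proof (rule add_mono)
   show "norm (x - x') <= d" using x' by (simp add: dist_norm)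
   have "\<bar>u\<bar> * \<bar>r - r'\<bar> <= 1 * d" using u r' by (intro mult_mono) (auto simp: dist_real_def)
   then show "norm ((u * (r - r')) *# b) <= d * norm b" by (simp add: abs_mult mult_right_mono)
   qed
   also have "\<dots> = e / 2" using d(2) by (simp add: algebra_simps)
   finally have "w : cball y e" using e by (simp add: dist_norm)
   then show "w : Om" using e(2) y by blast
  qed
 qed
qed

text \<open>The fundamental theorem of calculus along the segment up to its first exit from the open set, where the function vanishes.\<close>

lemma exit_line_integral:
 fixes phi :: "'a::euclidean_space => real"
 assumes Om: "open Om" and d: "!!x. (phi has_derivative (%h. dphi x \<bullet> h)) (at x)" and c: "continuous_on UNIV dphi"
  and z: "!!x. x \<notin> Om ==> phi x = 0" and x: "x : Om" and s0: "s0 >= 0" "x + s0 *# e \<notin> Om" and e: "norm e = 1"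
 shows "ennreal \<bar>phi x\<bar> <= (\<integral>\<^sup>+r. indicator {0..s0} r * (indicator {r. closed_segment x (x + r *# e) \<subseteq> Om} r * ennreal (norm (dphi (x + r *# e)))) \<partial>lborel)"
proof -
 define Z where "Z = {s\<in>{0..s0}. x + s *# e \<notin> Om}"
 have "closed Z"
 proof -
  have "Z = {0..s0} \<inter> (%s. x + s *# e) -` (- Om)" by (auto simp: Z_def)
  moreover have "closed ({0..s0} \<inter> (%s. x + s *# e) -` (- Om))"
   using Om by (intro continuous_closed_preimage continuous_intros) (auto simp: closed_Compl)
  ultimately show ?thesis by simp
 qed
 moreover have "bounded Z" by (rule bounded_subset[of "{0..s0}"]) (auto simp: Z_def)
 ultimately have cZ: "compact Z" by (simp add: compact_eq_bounded_closed)
 have nZ: "Z \<noteq> {}" using s0 by (auto simp: Z_def)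
 from compact_attains_inf[OF cZ nZ] obtain s where s: "s : Z" "!!t. t : Z ==> s <= t" by auto
 have s': "0 <= s" "s <= s0" "x + s *# e \<notin> Om" using s(1) by (auto simp: Z_def)
 have seg: "closed_segment x (x + r *# e) \<subseteq> Om" if r: "0 <= r" "r < s" for r
 proof
  fix w assume "w : closed_segment x (x + r *# e)"
  then obtain u where u: "0 <= u" "u <= 1" "w = (1 - u) *# x + u *# (x + r *# e)" by (auto simp: in_segment)
  have w: "w = x + (u * r) *# e" by (simp add: u algebra_simps)
  have "u * r <= r" using u r by (simp add: mult_left_le_one_le)
  then have "u * r < s" "0 <= u * r" "u * r <= s0" using u r s' by (auto intro: mult_nonneg_nonneg)
  then have "u * r \<notin> Z" using s(2)[of "u * r"] by auto
  then show "w : Om" using \<open>0 <= u * r\<close> \<open>u * r <= s0\<close> by (auto simp: Z_def w)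
 qed
 let ?F = "%r. phi (x + r *# e)" and ?f = "%r. dphi (x + r *# e) \<bullet> e"
 have "has_bochner_integral lborel (%r. indicator {0..s} r *# ?f r) (?F s - ?F 0)"
 proof (rule has_bochner_integral_FTC_Icc[OF s'(1)])
  fix r :: real
  have "((%r. x + r *# e) has_derivative (%h. h *# e)) (at r)" by (auto intro!: derivative_eq_intros)
  from has_derivative_compose[OF this d]
  have "(?F has_derivative (%h. h *# (dphi (x + r *# e) \<bullet> e))) (at r)" by simp
  then show "(?F has_vector_derivative ?f r) (at r within {0..s})"
   unfolding has_vector_derivative_def by (rule has_derivative_at_withinI)
 next
  show "continuous_on {0..s} ?f"
   by (intro continuous_intros continuous_on_compose2[OF c]) auto
 qed
 then have i: "lint (%r. indicator {0..s} r *# ?f r)" and v: "(\<integral>r. indicator {0..s} r *# ?f r \<partial>lborel) = ?F s - ?F 0"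
  by (auto simp: has_bochner_integral_iff)
 have "?F s = 0" by (rule z[OF s'(3)])
 then have "ennreal \<bar>phi x\<bar> = ennreal (norm (\<integral>r. indicator {0..s} r *# ?f r \<partial>lborel))" unfolding v by simp
 also have "\<dots> <= (\<integral>\<^sup>+r. norm (indicator {0..s} r *# ?f r) \<partial>lborel)" by (rule integral_norm_bound_ennreal[OF i])
 also have "\<dots> <= (\<integral>\<^sup>+r. indicator {0..s0} r * (indicator {r. closed_segment x (x + r *# e) \<subseteq> Om} r * ennreal (norm (dphi (x + r *# e)))) \<partial>lborel)"
 proof (rule nn_integral_mono_AE)
  have "AE r in lborel. r \<noteq> s" by (rule AE_lborel_singleton)
  then show "AE r in lborel. ennreal (norm (indicator {0..s} r *# ?f r)) <= indicator {0..s0} r * (indicator {r. closed_segment x (x + r *# e) \<subseteq> Om} r * ennreal (norm (dphi (x + r *# e))))"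
  proof eventually_elim
   case (elim r)
   show ?case
   proof (cases "r : {0..s}")
   case True
   have "\<bar>?f r\<bar> <= norm (dphi (x + r *# e))" using Cauchy_Schwarz_ineq2[of "dphi (x + r *# e)" e] e by simp
   then show ?thesis using True elim s' seg[of r] by (simp add: ennreal_leI)
   qed simp
  qed
 qed
 finally show ?thesis .
qed

locale exit_cylinder = cylinder +
 fixes C dlt0 :: real
 assumes C: "C >= 1" and dlt0: "0 < dlt0" "dlt0 <= 1"
  and exit: "!!x dlt. 0 < dlt ==> dlt < dlt0 ==> x : Om ==> infdist x (frontier Om) < dlt ==>
   \<exists>b\<in>Basis. \<exists>s. \<bar>s\<bar> <= C * dlt & x + s *# b : frontier Om"
  and frontier_ne: "frontier Om \<noteq> {}"
begin

definition layer :: "real => 'a set" where "layer d = {x\<in>Om. infdist x (frontier Om) < d}"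

lemma layer_meas [measurable]: "layer d : sets borel"
proof -
 have "layer d = Om \<inter> (%x. infdist x (frontier Om)) -` {..<d}" by (auto simp: layer_def)
 moreover have "open (Om \<inter> (%x. infdist x (frontier Om)) -` {..<d})"
  by (intro continuous_open_preimage open_Om continuous_intros)
 ultimately show ?thesis by simp
qed

definition line_int :: "real => 'a => ('a => ennreal) => 'a => ennreal" where
 "line_int d b g x = (\<integral>\<^sup>+r. indicator {- (C * d)..C * d} r * (indicator {(x, r). closed_segment x (x + r *# b) \<subseteq> Om} (x, r) * g (x + r *# b)) \<partial>lborel)"

lemma seg_meas [measurable]: "{(x, r::real). closed_segment x (x + r *# b) \<subseteq> Om} : sets borel"
 by (intro borel_open open_segment_region open_Om)

lemma seg_ind_meas [measurable]: "(%z. indicator {(x, r::real). closed_segment x (x + r *# b) \<subseteq> Om} z :: ennreal) : borel_funs"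
 by (intro borel_measurable_indicator seg_meas)

lemma seg_ind_meas' [measurable]:
 "(%r. indicator {(x, r::real). closed_segment x (x + r *# b) \<subseteq> Om} (x, r) :: ennreal) : borel_funs"
 "(%(x, r). indicator {(x, r::real). closed_segment x (x + r *# b) \<subseteq> Om} (x, r) :: ennreal) : borel_measurable (borel \<Otimes>\<^sub>M borel)"
 "(%(r, x). indicator {(x, r::real). closed_segment x (x + r *# b) \<subseteq> Om} (x, r) :: ennreal) : borel_measurable (borel \<Otimes>\<^sub>M borel)"
proof -
 note m = seg_ind_meas[of b]
 have "(%r. (x, r::real)) : borel \<rightarrow>\<^sub>M (borel :: ('a \<times> real) measure)"
  by (intro borel_measurable_continuous_onI continuous_intros)
 from measurable_compose[OF this m]
 show "(%r. indicator {(x, r::real). closed_segment x (x + r *# b) \<subseteq> Om} (x, r) :: ennreal) : borel_funs" by simp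
 show "(%(x, r). indicator {(x, r::real). closed_segment x (x + r *# b) \<subseteq> Om} (x, r) :: ennreal) : borel_measurable (borel \<Otimes>\<^sub>M borel)"
  using m by (simp add: borel_prod case_prod_eta)
 have "(%z. (snd z, fst z)) : (borel :: (real \<times> 'a) measure) \<rightarrow>\<^sub>M (borel :: ('a \<times> real) measure)"
  by (intro borel_measurable_continuous_onI continuous_intros)
 from measurable_compose[OF this m]
 show "(%(r, x). indicator {(x, r::real). closed_segment x (x + r *# b) \<subseteq> Om} (x, r) :: ennreal) : borel_measurable (borel \<Otimes>\<^sub>M borel)"
  by (simp add: borel_prod case_prod_beta')
qed

lemma line_int_meas [measurable]:
 assumes [measurable]: "g : borel_funs"
 shows "line_int d b g : borel_funs"
 unfolding line_int_def[abs_def]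
 by (rule lborel.borel_measurable_nn_integral) (use seg_ind_meas'(2)[of b] in \<open>simp add: case_prod_beta'\<close>)

lemma line_int_add:
 assumes [measurable]: "f : borel_funs" "g : borel_funs"
 shows "line_int d b (%x. f x + g x) x = line_int d b f x + line_int d b g x"
 unfolding line_int_def by (subst nn_integral_add[symmetric]) (auto simp: distrib_left)

lemma nn_integral_line_int:
 assumes g [measurable]: "g : borel_funs" and d: "d > 0" and b: "b : Basis"
 shows "(\<integral>\<^sup>+x. indicator (layer d) x * line_int d b g x \<partial>lborel) <= ennreal (2 * C * d) * (\<integral>\<^sup>+x. indicator (layer ((C + 1) * d)) x * g x \<partial>lborel)"
proof -
 let ?seg = "%x r. indicator {(x, r). closed_segment x (x + r *# b) \<subseteq> Om} (x, r) :: ennreal"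
 let ?I = "{- (C * d)..C * d}"
 let ?G = "%x. indicator (layer ((C + 1) * d)) x * g x"
 have [measurable]: "(%(x, r). ?seg x r) : borel_measurable (borel \<Otimes>\<^sub>M borel)" by (rule seg_ind_meas')
 have le: "indicator (layer d) x * (indicator ?I r * (?seg x r * g (x + r *# b))) <= indicator ?I r * ?G (x + r *# b)" for x r
 proof (cases "x : layer d & r : ?I & closed_segment x (x + r *# b) \<subseteq> Om")
  case True
  have "infdist (x + r *# b) (frontier Om) <= infdist x (frontier Om) + dist (x + r *# b) x" by (rule infdist_triangle)
  also have "\<dots> < d + C * d" using True b by (intro add_less_le_mono) (auto simp: layer_def dist_norm)
  finally have "x + r *# b : layer ((C + 1) * d)" using True by (auto simp: layer_def algebra_simps)
  then show ?thesis using True by simp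
 qed (auto simp: indicator_def)
 have "(\<integral>\<^sup>+x. indicator (layer d) x * line_int d b g x \<partial>lborel) = (\<integral>\<^sup>+x. \<integral>\<^sup>+r. indicator (layer d) x * (indicator ?I r * (?seg x r * g (x + r *# b))) \<partial>lborel \<partial>lborel)"
  unfolding line_int_def by (subst nn_integral_cmult) (auto intro!: borel_measurable_times_ennreal seg_ind_meas'(1))
 also have "\<dots> <= (\<integral>\<^sup>+x. \<integral>\<^sup>+r. indicator ?I r * ?G (x + r *# b) \<partial>lborel \<partial>lborel)"
  by (intro nn_integral_mono le)
 also have "\<dots> = (\<integral>\<^sup>+r. \<integral>\<^sup>+x. indicator ?I r * ?G (x + r *# b) \<partial>lborel \<partial>lborel)"
  by (rule lborel_pair.Fubini') measurable
 also have "\<dots> = (\<integral>\<^sup>+r. indicator ?I r * (\<integral>\<^sup>+x. ?G (x + r *# b) \<partial>lborel) \<partial>lborel)"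
  by (subst nn_integral_cmult) measurable
 also have "\<dots> = (\<integral>\<^sup>+r. (\<integral>\<^sup>+x. ?G x \<partial>lborel) * indicator ?I r \<partial>lborel)"
  by (subst nn_integral_translate[of ?G]) (auto simp: mult.commute)
 also have "\<dots> = (\<integral>\<^sup>+x. ?G x \<partial>lborel) * emeasure lborel ?I" by (rule nn_integral_cmult_indicator) simp
 also have "emeasure lborel ?I = ennreal (2 * C * d)" using C d by (subst emeasure_lborel_Icc) auto
 finally show ?thesis by (simp add: mult.commute)
qed

lemma layer_pointwise:
 assumes d: "!!x. (phi has_derivative (%h. dphi x \<bullet> h)) (at x)" and c: "continuous_on UNIV dphi"
  and z: "!!x. x \<notin> Om ==> phi x = 0" and dlt: "0 < dlt" "dlt < dlt0" and x: "x : layer dlt"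
 shows "ennreal \<bar>phi x\<bar> <= (\<Sum>b\<in>Basis. line_int dlt b (%x. norm (dphi x)) x)"
proof -
 have x': "x : Om" "infdist x (frontier Om) < dlt" using x by (auto simp: layer_def)
 obtain b s where b: "b : Basis" and s: "\<bar>s\<bar> <= C * dlt" "x + s *# b : frontier Om" using exit[OF dlt x'] by auto
 have out: "x + s *# b \<notin> Om" using s(2) open_Om by (auto simp: frontier_def interior_open)
 have "ennreal \<bar>phi x\<bar> <= line_int dlt b (%x. norm (dphi x)) x"
 proof (cases "s >= 0")
  case True
  have "ennreal \<bar>phi x\<bar> <= (\<integral>\<^sup>+r. indicator {0..s} r * (indicator {r. closed_segment x (x + r *# b) \<subseteq> Om} r * ennreal (norm (dphi (x + r *# b)))) \<partial>lborel)"
   by (rule exit_line_integral[OF open_Om d c z x'(1) True out]) (use b in auto)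
  also have "\<dots> <= line_int dlt b (%x. norm (dphi x)) x"
   unfolding line_int_def by (intro nn_integral_mono) (use s in \<open>auto split: split_indicator\<close>)
  finally show ?thesis .
 next
  case False
  have "ennreal \<bar>phi x\<bar> <= (\<integral>\<^sup>+r. indicator {0..- s} r * (indicator {r. closed_segment x (x + r *# (- b)) \<subseteq> Om} r * ennreal (norm (dphi (x + r *# (- b))))) \<partial>lborel)"
   by (rule exit_line_integral[OF open_Om d c z x'(1)]) (use b out False in auto)
  also have "\<dots> <= (\<integral>\<^sup>+r. indicator {- (C * dlt)..C * dlt} (0 - r) * (indicator {(x, r). closed_segment x (x + r *# b) \<subseteq> Om} (x, 0 - r) * ennreal (norm (dphi (x + (0 - r) *# b)))) \<partial>lborel)"
   by (intro nn_integral_mono) (use s in \<open>auto split: split_indicator\<close>)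
  also have "\<dots> = line_int dlt b (%x. norm (dphi x)) x"
   unfolding line_int_def
  proof (rule nn_integral_reflect)
   have [measurable]: "dphi : borel_funs" using c by (rule borel_measurable_continuous_onI)
   have [measurable]: "(%r. dphi (x + r *# b)) : borel_funs" by measurable
   show "(%r. indicator {- (C * dlt)..C * dlt} r * (indicator {(x, r). closed_segment x (x + r *# b) \<subseteq> Om} (x, r) * ennreal (norm (dphi (x + r *# b))))) : borel_funs"
   by (intro borel_measurable_times_ennreal seg_ind_meas'(1)) measurable
  qed
  finally show ?thesis .
 qed
 also have "\<dots> <= (\<Sum>b\<in>Basis. line_int dlt b (%x. norm (dphi x)) x)" using b by (intro member_le_sum) auto
 finally show ?thesis .
qed

text \<open>Approximability by test functions of the open set in the \<open>W\<^sup>1\<^sup>,\<^sup>1\<close> distance.\<close>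

definition zero_trace :: "('a => real) => ('a => 'a) => bool" where
 "zero_trace u g \<longleftrightarrow> (\<forall>e>0. \<exists>phi\<in>test_functions Om.
   (\<integral>\<^sup>+x. indicator Om x * ennreal \<bar>u x - phi x\<bar> \<partial>lborel) <= ennreal e & (\<integral>\<^sup>+x. indicator Om x * ennreal (norm (g x - grad phi x)) \<partial>lborel) <= ennreal e)"

lemma zero_trace_layer:
 assumes [measurable]: "u : borel_funs" "g : borel_funs"
  and t: "zero_trace u g" and dlt: "0 < dlt" "dlt < dlt0"
 shows "AE x in lborel. x : layer dlt --> ennreal \<bar>u x\<bar> <= (\<Sum>b\<in>Basis. line_int dlt b (%x. norm (g x)) x)"
proof -
 define P where "P n phi \<longleftrightarrow> phi : test_functions Om &
   (\<integral>\<^sup>+x. indicator Om x * ennreal \<bar>u x - phi x\<bar> \<partial>lborel) <= ennreal (rad n) & (\<integral>\<^sup>+x. indicator Om x * ennreal (norm (g x - grad phi x)) \<partial>lborel) <= ennreal (rad n)" for n phi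
 have "\<exists>phi. P n phi" for n
  using t rad_pos[of n] unfolding zero_trace_def P_def by blast
 then obtain phi where "!!n. P n (phi n)" by metis
 then have phi: "!!n. phi n : test_functions Om"
  "!!n. (\<integral>\<^sup>+x. indicator Om x * ennreal \<bar>u x - phi n x\<bar> \<partial>lborel) <= ennreal (rad n)"
  "!!n. (\<integral>\<^sup>+x. indicator Om x * ennreal (norm (g x - grad (phi n) x)) \<partial>lborel) <= ennreal (rad n)" unfolding P_def by auto
 have Ck: "Ck m (phi n)" for m n using phi(1) by (auto simp: test_functions_def)
 have out: "phi n x = 0" if "x \<notin> Om" for n x
  using phi(1)[of n] that closure_subset[of "{x. phi n x \<noteq> 0}"] by (auto simp: test_functions_def)
 note d = Ck_grad(1)[OF Ck] and c = Ck_grad(2)[OF Ck]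
 have [measurable]: "grad (phi n) : borel_funs" for n by (rule borel_measurable_continuous_onI[OF c])
 have [measurable]: "phi n : borel_funs" for n
  by (rule borel_measurable_continuous_onI) (use Ck[of 0 n] in simp)
 define e where "e n x = indicator (layer dlt) x * ennreal \<bar>u x - phi n x\<bar> + (\<Sum>b\<in>Basis. indicator (layer dlt) x * line_int dlt b (%x. indicator Om x * ennreal (norm (g x - grad (phi n) x))) x)" for n x
 have [measurable]: "e n : borel_funs" for n unfolding e_def by measurable
 have bound: "ennreal \<bar>u x\<bar> <= e n x + (\<Sum>b\<in>Basis. line_int dlt b (%x. norm (g x)) x)" if x: "x : layer dlt" for x n
 proof -
  have tri: "ennreal \<bar>u x\<bar> <= ennreal \<bar>u x - phi n x\<bar> + ennreal \<bar>phi n x\<bar>"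
   unfolding ennreal_plus[OF abs_ge_zero abs_ge_zero, symmetric] by (rule ennreal_leI) linarith
  have "ennreal \<bar>phi n x\<bar> <= (\<Sum>b\<in>Basis. line_int dlt b (%x. norm (grad (phi n) x)) x)"
   by (rule layer_pointwise[OF d c out dlt x])
  also have "\<dots> <= (\<Sum>b\<in>Basis. line_int dlt b (%x. indicator Om x * ennreal (norm (g x - grad (phi n) x)) + norm (g x)) x)"
  proof (rule sum_mono)
   fix b :: 'a
   show "line_int dlt b (%x. norm (grad (phi n) x)) x <= line_int dlt b (%x. indicator Om x * ennreal (norm (g x - grad (phi n) x)) + norm (g x)) x"
   unfolding line_int_def
   proof (rule nn_integral_mono, rule mult_left_mono)
   fix r :: real
   show "indicator {(x, r). closed_segment x (x + r *# b) \<subseteq> Om} (x, r) * ennreal (norm (grad (phi n) (x + r *# b))) <=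
   indicator {(x, r). closed_segment x (x + r *# b) \<subseteq> Om} (x, r) * (indicator Om (x + r *# b) * ennreal (norm (g (x + r *# b) - grad (phi n) (x + r *# b))) + ennreal (norm (g (x + r *# b))))"
   proof (cases "closed_segment x (x + r *# b) \<subseteq> Om")
   case True
   then have "x + r *# b : Om" by auto
   moreover have "norm (grad (phi n) (x + r *# b)) <= norm (g (x + r *# b) - grad (phi n) (x + r *# b)) + norm (g (x + r *# b))"
   using norm_triangle_ineq4[of "g (x + r *# b)" "g (x + r *# b) - grad (phi n) (x + r *# b)"] by simp
   ultimately show ?thesis using True by (simp flip: ennreal_plus)
   qed simp
   qed simp
  qed
  also have "\<dots> = (\<Sum>b\<in>Basis. line_int dlt b (%x. indicator Om x * ennreal (norm (g x - grad (phi n) x))) x) + (\<Sum>b\<in>Basis. line_int dlt b (%x. norm (g x)) x)"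
   by (simp add: line_int_add sum.distrib)
  finally have "ennreal \<bar>u x\<bar> <= ennreal \<bar>u x - phi n x\<bar> + ((\<Sum>b\<in>Basis. line_int dlt b (%x. indicator Om x * ennreal (norm (g x - grad (phi n) x))) x) + (\<Sum>b\<in>Basis. line_int dlt b (%x. norm (g x)) x))"
   by (rule order_trans[OF tri add_left_mono])
  then show ?thesis using x by (simp add: e_def add.assoc)
 qed
 define K where "K = 1 + real DIM('a) * (2 * C * dlt)"
 have Ie: "(\<integral>\<^sup>+x. e n x \<partial>lborel) <= ennreal (K * rad n)" for n
 proof -
  have "(\<integral>\<^sup>+x. e n x \<partial>lborel) = (\<integral>\<^sup>+x. indicator (layer dlt) x * ennreal \<bar>u x - phi n x\<bar> \<partial>lborel) +
   (\<Sum>b\<in>Basis. \<integral>\<^sup>+x. indicator (layer dlt) x * line_int dlt b (%x. indicator Om x * ennreal (norm (g x - grad (phi n) x))) x \<partial>lborel)"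
  proof -
   have m1: "(%x. indicator (layer dlt) x * ennreal \<bar>u x - phi n x\<bar>) : borel_measurable lborel" by measurable
   have m2: "(%x. indicator (layer dlt) x * line_int dlt b (%x. indicator Om x * ennreal (norm (g x - grad (phi n) x))) x) : borel_measurable lborel" for b
   by measurable
   show ?thesis unfolding e_def
   by (simp only: nn_integral_add[OF m1 borel_measurable_sum[OF m2]] nn_integral_sum[OF m2])
  qed
  also have "\<dots> <= ennreal (rad n) + (\<Sum>b\<in>(Basis :: 'a set). ennreal (2 * C * dlt) * ennreal (rad n))"
  proof (intro add_mono sum_mono)
   show "(\<integral>\<^sup>+x. indicator (layer dlt) x * ennreal \<bar>u x - phi n x\<bar> \<partial>lborel) <= ennreal (rad n)"
   by (rule order_trans[OF nn_integral_mono phi(2)]) (auto simp: layer_def split: split_indicator)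
   fix b :: 'a assume b: "b : Basis"
   have "(\<integral>\<^sup>+x. indicator (layer dlt) x * line_int dlt b (%x. indicator Om x * ennreal (norm (g x - grad (phi n) x))) x \<partial>lborel) \<le>
   ennreal (2 * C * dlt) * (\<integral>\<^sup>+x. indicator (layer ((C + 1) * dlt)) x * (indicator Om x * ennreal (norm (g x - grad (phi n) x))) \<partial>lborel)"
   by (rule nn_integral_line_int[OF _ dlt(1) b]) measurable
   also have "\<dots> <= ennreal (2 * C * dlt) * ennreal (rad n)"
   by (intro mult_left_mono order_trans[OF nn_integral_mono phi(3)]) (auto split: split_indicator)
   finally show "(\<integral>\<^sup>+x. indicator (layer dlt) x * line_int dlt b (%x. indicator Om x * ennreal (norm (g x - grad (phi n) x))) x \<partial>lborel) <= ennreal (2 * C * dlt) * ennreal (rad n)" .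
  qed
  also have "\<dots> = ennreal (rad n) + ennreal (real DIM('a)) * (ennreal (2 * C * dlt) * ennreal (rad n))"
   by (simp add: ennreal_of_nat_eq_real_of_nat)
  also have "\<dots> = ennreal (K * rad n)"
  proof -
   have nn: "0 <= 2 * C * dlt" "0 <= rad n" "0 <= real DIM('a)" "0 <= real DIM('a) * ((2 * C * dlt) * rad n)"
   using C dlt less_imp_le[OF rad_pos[of n]] by (auto intro!: mult_nonneg_nonneg)
   have "K * rad n = rad n + real DIM('a) * ((2 * C * dlt) * rad n)" by (simp add: K_def algebra_simps)
   then show ?thesis using nn by (simp only: ennreal_plus[OF nn(2,4)] ennreal_mult mult_nonneg_nonneg)
  qed
  finally show ?thesis .
 qed
 have "(\<integral>\<^sup>+x. (INF n. e n x) \<partial>lborel) = 0"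
 proof (rule ccontr)
  assume "(\<integral>\<^sup>+x. (INF n. e n x) \<partial>lborel) \<noteq> 0"
  then have pos: "0 < (\<integral>\<^sup>+x. (INF n. e n x) \<partial>lborel)" by (simp add: zero_less_iff_neq_zero)
  have "(%n. ennreal (K * rad n)) \<rightarrow> ennreal (K * 0)" by (intro tendsto_ennrealI tendsto_intros rad_tendsto)
  then have "\<forall>\<^sub>F n in sequentially. ennreal (K * rad n) < (\<integral>\<^sup>+x. (INF n. e n x) \<partial>lborel)"
   using pos by (intro order_tendstoD(2)) auto
  then obtain n where "ennreal (K * rad n) < (\<integral>\<^sup>+x. (INF n. e n x) \<partial>lborel)" by (auto simp: eventually_sequentially)
  also have "\<dots> <= (\<integral>\<^sup>+x. e n x \<partial>lborel)" by (intro nn_integral_mono INF_lower) auto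
  also have "\<dots> <= ennreal (K * rad n)" by (rule Ie)
  finally show False by simp
 qed
 then have "AE x in lborel. (INF n. e n x) = 0" by (subst (asm) nn_integral_0_iff_AE) auto
 then show ?thesis
 proof eventually_elim
  case (elim x)
  show ?case
  proof
   assume x: "x : layer dlt"
   show "ennreal \<bar>u x\<bar> <= (\<Sum>b\<in>Basis. line_int dlt b (%x. norm (g x)) x)" (is "_ <= ?S")
   proof (rule ennreal_le_epsilon)
   fix eps :: real assume "eps > 0"
   then have "(INF n. e n x) < ennreal eps" using elim by simp
   then obtain n where "e n x < ennreal eps" by (auto simp: INF_less_iff)
   then have "e n x + ?S <= ?S + ennreal eps" by (subst add.commute, intro add_left_mono less_imp_le)
   then show "ennreal \<bar>u x\<bar> <= ?S + ennreal eps" using bound[OF x, of n] by (rule order_trans[rotated])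
   qed
  qed
 qed
qed

end

context exit_cylinder begin

text \<open>Hardy's inequality in a boundary layer, with a variable exponent: the function is bounded by a line integral of its gradient of length at most \<open>C \<delta>\<close>, to which the frozen-exponent inequality applies.\<close>

lemma zero_trace_layer_power:
 fixes M :: real
 obtains K where "K > 0" "!!u g dlt. u : borel_funs ==> g : borel_funs ==> zero_trace u g ==>
   (\<forall>x. 0 <= u x & u x <= M) ==> 0 < dlt ==> dlt < dlt0 ==>
   (\<integral>\<^sup>+x. indicator (layer dlt) x * ennreal ((u x / dlt) powr p x) \<partial>lborel) \<le>
   ennreal K * (\<integral>\<^sup>+x. indicator (layer ((C + 1) * dlt)) x * (1 + ennreal (norm (g x) powr p x)) \<partial>lborel)"
proof -
 define N where "N = real DIM('a)"
 have N: "N >= 1" by (simp add: N_def Suc_leI)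
 define K0 where "K0 = (max 1 M) powr (L * C) * exp (1 * (L * C))"
 have K0: "K0 > 0" by (simp add: K0_def)
 define K1 where "K1 = 2 * (2 * (2 * C)) powr P * K0"
 have K1: "K1 > 0" using K0 C by (simp add: K1_def)
 define K where "K = N powr P * (1 + K1 * N * (2 * C))"
 have K: "K > 0" unfolding K_def using N K1 C by (intro mult_pos_pos add_pos_nonneg mult_nonneg_nonneg) auto
 show thesis
 proof (rule that[OF K])
  fix u :: "'a => real" and g :: "'a => 'a" and dlt :: real
  assume [measurable]: "u : borel_funs" "g : borel_funs" and t: "zero_trace u g"
   and u': "\<forall>x. 0 <= u x & u x <= M" and dlt: "0 < dlt" "dlt < dlt0"
  have u: "0 <= u x & u x <= M" for x using u' by blast
  let ?G = "%x. ennreal (norm (g x) powr p x)"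
  have pt: "ennreal ((u x / dlt) powr p x) <= ennreal (N powr P) * (1 + ennreal (K1 / dlt) * (\<Sum>b\<in>Basis. line_int dlt b ?G x))"
   if x: "x : layer dlt" and le: "ennreal \<bar>u x\<bar> <= (\<Sum>b\<in>Basis. line_int dlt b (%x. norm (g x)) x)" for x
  proof -
   let ?S = "%b. line_int dlt b (%x. ennreal (norm (g x))) x"
   obtain b where b: "b : Basis" "!!b'. b' : Basis ==> ?S b' <= ?S b"
   proof -
   have "finite (?S ` Basis)" "?S ` Basis \<noteq> {}" by auto
   from Max_in[OF this] obtain b where b: "Max (?S ` Basis) = ?S b" "b : Basis" by (rule imageE)
   show thesis
   proof (rule that[OF b(2)])
   fix b' :: 'a assume "b' : Basis"
   then show "?S b' <= ?S b" unfolding b(1)[symmetric] by (intro Max_ge) auto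
   qed
   qed
   have "ennreal (u x) <= (\<Sum>b\<in>Basis. ?S b)" using le u[of x] by simp
   also have "\<dots> <= of_nat (card (Basis :: 'a set)) * ?S b" by (intro sum_bounded_above b)
   finally have ub: "ennreal (u x) <= ennreal N * ?S b" by (simp add: N_def ennreal_of_nat_eq_real_of_nat)
   define kap where "kap = u x / (N * dlt)"
   have kap: "0 <= kap" using u[of x] N dlt by (simp add: kap_def)
   let ?I = "{- (C * dlt)..C * dlt}"
   let ?seg = "%r. indicator {(x, r). closed_segment x (x + r *# b) \<subseteq> Om} (x, r) :: ennreal"
   note [measurable] = seg_ind_meas'(1)[of b x]
   define \<nu> where "\<nu> = density lborel (%r. ennreal (1 / dlt) * (indicator ?I r * ?seg r))"
   have dens: "(\<integral>\<^sup>+r. ennreal (f (x + r *# b)) \<partial>\<nu>) = ennreal (1 / dlt) * line_int dlt b (%x. ennreal (f x)) x"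
   if [measurable]: "f : borel_funs" for f
   unfolding \<nu>_def line_int_def by (subst nn_integral_density) (auto simp: nn_integral_cmult mult.assoc)
   have "ennreal (kap powr p x) <= 1 + ennreal (2 * (2 * (2 * C)) powr P * K0) * (\<integral>\<^sup>+r. norm (g (x + r *# b)) powr p (x + r *# b) \<partial>\<nu>)"
   proof (rule average_power)
   show "(%r. norm (g (x + r *# b))) : borel_measurable \<nu>" "(%r. p (x + r *# b)) : borel_measurable \<nu>"
   by (simp_all add: \<nu>_def)
   show "emeasure \<nu> (space \<nu>) <= ennreal (2 * C)"
   proof -
   have "emeasure \<nu> (space \<nu>) = (\<integral>\<^sup>+r. ennreal (1 / dlt) * (indicator ?I r * ?seg r) \<partial>lborel)"
   unfolding \<nu>_def by (subst emeasure_density) auto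
   also have "\<dots> <= (\<integral>\<^sup>+r. ennreal (1 / dlt) * indicator ?I r \<partial>lborel)"
   by (intro nn_integral_mono) (auto split: split_indicator)
   also have "\<dots> = ennreal (1 / dlt) * emeasure lborel ?I" by (rule nn_integral_cmult_indicator) simp
   also have "emeasure lborel ?I = ennreal (2 * C * dlt)" using C dlt by (subst emeasure_lborel_Icc) auto
   also have "ennreal (1 / dlt) * ennreal (2 * C * dlt) = ennreal (2 * C)" using C dlt by (simp flip: ennreal_mult)
   finally show ?thesis .
   qed
   have "ennreal kap = ennreal (1 / (N * dlt)) * ennreal (u x)" using N dlt u[of x] by (simp add: kap_def flip: ennreal_mult)
   also have "\<dots> <= ennreal (1 / (N * dlt)) * (ennreal N * ?S b)" by (intro mult_left_mono ub) auto
   also have "\<dots> = ennreal (1 / dlt) * ?S b" using N dlt by (simp add: ennreal_mult[symmetric] mult.assoc[symmetric])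
   also have "\<dots> = (\<integral>\<^sup>+r. norm (g (x + r *# b)) \<partial>\<nu>)" by (rule dens[symmetric]) measurable
   finally show "ennreal kap <= (\<integral>\<^sup>+r. norm (g (x + r *# b)) \<partial>\<nu>)" .
   show "AE r in \<nu>. 1 <= kap --> kap powr (p x - p (x + r *# b)) <= K0"
   unfolding \<nu>_def
   proof (subst AE_density, simp, rule AE_I2, intro impI)
   fix r assume r: "0 < ennreal (1 / dlt) * (indicator ?I r * ?seg r)" and k: "1 <= kap"
   have rI: "r : ?I" and sg: "closed_segment x (x + r *# b) \<subseteq> Om" using r by (cases "r : ?I"; cases "closed_segment x (x + r *# b) \<subseteq> Om"; simp)+
   have "p x - p (x + r *# b) <= L * dist x (x + r *# b)" using p_lip[OF sg] by simp
   also have "dist x (x + r *# b) = \<bar>r\<bar>" using b by (simp add: dist_norm)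
   also have "L * \<bar>r\<bar> <= L * (C * dlt)" using rI L by (intro mult_left_mono) auto
   finally have d: "p x - p (x + r *# b) <= (L * C) * dlt" by (simp add: mult.assoc)
   have "kap <= u x / dlt" unfolding kap_def using N dlt u[of x] by (intro divide_left_mono) auto
   also have "\<dots> <= max 1 M / dlt powr 1" using u[of x] dlt by (auto intro!: divide_right_mono)
   finally show "kap powr (p x - p (x + r *# b)) <= K0"
   unfolding K0_def using dlt dlt0 L C k d by (intro power_radius_bounded[where r=dlt]) auto
   qed
   qed (use p_gt p_le K0 C kap in \<open>auto intro: less_imp_le order_trans[OF zero_le_one less_imp_le]\<close>)
   also have "(\<integral>\<^sup>+r. norm (g (x + r *# b)) powr p (x + r *# b) \<partial>\<nu>) = ennreal (1 / dlt) * line_int dlt b ?G x"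
   by (rule dens) measurable
   finally have kp: "ennreal (kap powr p x) <= 1 + ennreal K1 * (ennreal (1 / dlt) * line_int dlt b ?G x)" by (simp add: K1_def)
   have "ennreal K1 * (ennreal (1 / dlt) * line_int dlt b ?G x) = ennreal (K1 / dlt) * line_int dlt b ?G x"
   using K1 dlt by (simp add: mult.assoc[symmetric] ennreal_mult[symmetric])
   also have "\<dots> <= ennreal (K1 / dlt) * (\<Sum>b\<in>Basis. line_int dlt b ?G x)"
   using b by (intro mult_left_mono member_le_sum) auto
   finally have kp': "ennreal (kap powr p x) <= 1 + ennreal (K1 / dlt) * (\<Sum>b\<in>Basis. line_int dlt b ?G x)"
   using kp by (meson add_left_mono order_trans)
   have "u x / dlt = N * kap" using N by (simp add: kap_def)
   then have "(u x / dlt) powr p x = N powr p x * kap powr p x" using N kap by (simp add: powr_mult)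
   also have "\<dots> <= N powr P * kap powr p x" using N p_le[of x] by (intro mult_right_mono powr_mono) auto
   finally have "ennreal ((u x / dlt) powr p x) <= ennreal (N powr P * kap powr p x)" by (rule ennreal_leI)
   also have "\<dots> = ennreal (N powr P) * ennreal (kap powr p x)" by (simp add: ennreal_mult)
   also have "\<dots> <= ennreal (N powr P) * (1 + ennreal (K1 / dlt) * (\<Sum>b\<in>Basis. line_int dlt b ?G x))"
   by (intro mult_left_mono kp') auto
   finally show ?thesis .
  qed
  let ?J = "\<integral>\<^sup>+x. indicator (layer ((C + 1) * dlt)) x * ?G x \<partial>lborel"
  let ?E = "\<integral>\<^sup>+x. indicator (layer ((C + 1) * dlt)) x \<partial>lborel"
  have "(\<integral>\<^sup>+x. indicator (layer dlt) x * ennreal ((u x / dlt) powr p x) \<partial>lborel) \<le>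
   (\<integral>\<^sup>+x. ennreal (N powr P) * (indicator (layer dlt) x + ennreal (K1 / dlt) * (\<Sum>b\<in>Basis. indicator (layer dlt) x * line_int dlt b ?G x)) \<partial>lborel)"
  proof (rule nn_integral_mono_AE)
   have "AE x in lborel. x : layer dlt --> ennreal \<bar>u x\<bar> <= (\<Sum>b\<in>Basis. line_int dlt b (%x. norm (g x)) x)"
   by (rule zero_trace_layer[OF _ _ t dlt]) measurable
   then show "AE x in lborel. indicator (layer dlt) x * ennreal ((u x / dlt) powr p x) <=
   ennreal (N powr P) * (indicator (layer dlt) x + ennreal (K1 / dlt) * (\<Sum>b\<in>Basis. indicator (layer dlt) x * line_int dlt b ?G x))"
   proof eventually_elim
   case (elim x)
   then show ?case using pt[of x] by (cases "x : layer dlt") auto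
   qed
  qed
  also have "\<dots> = ennreal (N powr P) * (emeasure lborel (layer dlt) + ennreal (K1 / dlt) * (\<Sum>b\<in>Basis. \<integral>\<^sup>+x. indicator (layer dlt) x * line_int dlt b ?G x \<partial>lborel))"
  proof -
   have m: "(%x. indicator (layer dlt) x * line_int dlt b ?G x) : borel_measurable lborel" for b by measurable
   have ms: "(%x. \<Sum>b\<in>Basis. indicator (layer dlt) x * line_int dlt b ?G x) : borel_measurable lborel"
   by (rule borel_measurable_sum[OF m])
   have m2: "(%x. ennreal (K1 / dlt) * (\<Sum>b\<in>Basis. indicator (layer dlt) x * line_int dlt b ?G x)) : borel_measurable lborel"
   using ms by measurable
   have m1: "(indicator (layer dlt) :: 'a => ennreal) : borel_measurable lborel" by measurable
   have e: "(\<integral>\<^sup>+x. indicator (layer dlt) x \<partial>lborel) = emeasure lborel (layer dlt)" by simp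
   show ?thesis
   by (simp only: nn_integral_cmult[OF borel_measurable_add[OF m1 m2]] nn_integral_add[OF m1 m2] nn_integral_cmult[OF ms] nn_integral_sum[OF m] e)
  qed
  also have "\<dots> <= ennreal (N powr P) * (?E + ennreal (K1 / dlt) * (\<Sum>b\<in>(Basis :: 'a set). ennreal (2 * C * dlt) * ?J))"
  proof (intro mult_left_mono add_mono sum_mono)
   have "layer dlt \<subseteq> layer ((C + 1) * dlt)"
   proof
   fix x assume "x : layer dlt"
   moreover have "dlt <= (C + 1) * dlt" using C dlt by (simp add: distrib_right)
   ultimately show "x : layer ((C + 1) * dlt)" by (auto simp: layer_def)
   qed
   then show "emeasure lborel (layer dlt) <= ?E" by (simp add: emeasure_mono)
   fix b :: 'a assume b: "b : Basis"
   show "(\<integral>\<^sup>+x. indicator (layer dlt) x * line_int dlt b ?G x \<partial>lborel) <= ennreal (2 * C * dlt) * ?J"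
   by (rule nn_integral_line_int[OF _ dlt(1) b]) measurable
  qed auto
  also have "\<dots> = ennreal (N powr P) * (?E + ennreal (K1 * N * (2 * C)) * ?J)"
  proof -
   have "ennreal (K1 / dlt) * (\<Sum>b\<in>(Basis :: 'a set). ennreal (2 * C * dlt) * ?J) = (ennreal (K1 / dlt) * (ennreal N * ennreal (2 * C * dlt))) * ?J"
   by (simp add: N_def ennreal_of_nat_eq_real_of_nat mult.assoc)
   also have "ennreal (K1 / dlt) * (ennreal N * ennreal (2 * C * dlt)) = ennreal (K1 * N * (2 * C))"
   using K1 N C dlt by (subst ennreal_mult[symmetric], simp, simp, subst ennreal_mult[symmetric], simp_all)
   finally show ?thesis by simp
  qed
  also have "\<dots> <= ennreal (N powr P) * (ennreal (1 + K1 * N * (2 * C)) * ?E + ennreal (1 + K1 * N * (2 * C)) * ?J)"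
  proof (intro mult_left_mono add_mono mult_right_mono)
   have "1 <= ennreal (1 + K1 * N * (2 * C))" using K1 N C by (simp add: ennreal_ge_1)
   from mult_right_mono[OF this, of ?E] show "?E <= ennreal (1 + K1 * N * (2 * C)) * ?E" by simp
  qed (auto intro: ennreal_leI)
  also have "\<dots> = ennreal K * (?E + ?J)"
  proof -
   have "ennreal K = ennreal (N powr P) * ennreal (1 + K1 * N * (2 * C))"
   unfolding K_def by (rule ennreal_mult') simp
   then show ?thesis by (simp only: distrib_left mult.assoc)
  qed
  also have "?E + ?J = (\<integral>\<^sup>+x. indicator (layer ((C + 1) * dlt)) x * (1 + ?G x) \<partial>lborel)"
   by (subst nn_integral_add[symmetric]) (auto simp: distrib_left)
  finally show "(\<integral>\<^sup>+x. indicator (layer dlt) x * ennreal ((u x / dlt) powr p x) \<partial>lborel) \<le>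
   ennreal K * (\<integral>\<^sup>+x. indicator (layer ((C + 1) * dlt)) x * (1 + ?G x) \<partial>lborel)" .
 qed
qed

text \<open>The layers shrink to the empty set, so the gradient energy over them tends to zero, and it controls the scaled function slice by slice.\<close>

lemma layer_energy_vanishes:
 assumes s: "state M u G" and t: "AE t in lborel. t : {0<..<T} --> zero_trace (%x. u (t, x)) (%x. G (t, x))"
  and dlt: "!!n. 0 < dlt n" "dlt \<rightarrow> 0"
 shows "\<forall>\<^sub>F n in sequentially. lint (%y. indicator ({0<..<T} \<times> layer (dlt n)) y * ((u y / dlt n) powr p (snd y)))"
  and "(%n. \<integral>y. indicator ({0<..<T} \<times> layer (dlt n)) y * ((u y / dlt n) powr p (snd y)) \<partial>lborel) \<rightarrow> 0"
proof -
 note [measurable] = stateD(1,2)[OF s]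
 obtain K where K: "K > 0" "!!u g dlt. u : borel_funs ==> g : borel_funs ==> zero_trace u g ==>
   (\<forall>x. 0 <= u x & u x <= M) ==> 0 < dlt ==> dlt < dlt0 ==>
   (\<integral>\<^sup>+x. indicator (layer dlt) x * ennreal ((u x / dlt) powr p x) \<partial>lborel) \<le>
   ennreal K * (\<integral>\<^sup>+x. indicator (layer ((C + 1) * dlt)) x * (1 + ennreal (norm (g x) powr p x)) \<partial>lborel)"
  by (rule zero_trace_layer_power[of M]) (rule that)
 define lay where "lay d = {0<..<T} \<times> layer d" for d
 have lay_m [measurable]: "lay d : sets borel" for d
  unfolding lay_def by (intro borel_Times) auto
 define f where "f n y = indicator (lay (dlt n)) y * ((u y / dlt n) powr p (snd y))" for n y
 define h where "h y = 1 + norm (G y) powr p (snd y)" for y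
 define H where "H n y = indicator (lay ((C + 1) * dlt n)) y * h y" for n y
 have [measurable]: "f n : borel_funs" "h : borel_funs" "H n : borel_funs" for n
  unfolding f_def h_def H_def by measurable
 have h0: "0 <= h y" for y by (simp add: h_def)
 have layQ: "lay d \<subseteq> Q" for d by (auto simp: lay_def layer_def)
 have iH0: "lint (%y. indicator Q y * h y)"
 proof -
  have "lint (%y. indicator Q y + indicator Q y *# (norm (G y) powr p (snd y)))"
   by (intro BI_integrable_add integrable_Q integrable_mult_indicator stateD(7)[OF s]) auto
  then show ?thesis by (simp add: h_def distrib_left)
 qed
 have H_le: "norm (H n y) <= indicator Q y * h y" for n y
  using layQ[of "(C + 1) * dlt n"] h0[of y] by (auto simp: H_def indicator_def)
 have limH: "(%n. integral\<^sup>L lborel (H n)) \<rightarrow> (\<integral>y. 0 \<partial>(lborel :: (real \<times> 'a) measure))"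
 proof (rule integral_dominated_convergence[OF _ _ iH0 _ AE_I2[OF H_le]])
  show "AE y in lborel. (%n. H n y) \<rightarrow> 0"
  proof (rule AE_I2)
   fix y :: "real \<times> 'a"
   show "(%n. H n y) \<rightarrow> 0"
   proof (cases "snd y : Om")
   case True
   then have "snd y \<notin> frontier Om" using open_Om by (auto simp: frontier_def interior_open)
   then have "infdist (snd y) (frontier Om) > 0"
   using in_closed_iff_infdist_zero[OF frontier_closed frontier_ne, of "snd y"] infdist_nonneg[of "snd y" "frontier Om"] by auto
   moreover have "(%n. (C + 1) * dlt n) \<rightarrow> (C + 1) * 0" by (intro tendsto_intros dlt)
   ultimately have "\<forall>\<^sub>F n in sequentially. (C + 1) * dlt n < infdist (snd y) (frontier Om)"
   by (intro order_tendstoD(2)) auto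
   then have "\<forall>\<^sub>F n in sequentially. H n y = 0"
   by eventually_elim (auto simp: H_def lay_def layer_def indicator_def)
   then show ?thesis by (rule tendsto_eventually)
   next
   case False
   then have "H n y = 0" for n by (auto simp: H_def lay_def layer_def indicator_def)
   then show ?thesis by simp
   qed
  qed
 qed auto
 have main: "(\<integral>\<^sup>+y. ennreal (f n y) \<partial>lborel) <= ennreal (K * integral\<^sup>L lborel (H n))" if "dlt n < dlt0" for n
 proof -
  have slice: "indicator (lay d) (t, x) = (indicator {0<..<T} t * indicator (layer d) x :: ennreal)" for d t x
   by (auto simp: lay_def indicator_def)
  have ef: "ennreal (f n (t, x)) = indicator {0<..<T} t * (indicator (layer (dlt n)) x * ennreal ((u (t, x) / dlt n) powr p x))" for t x
   by (auto simp: f_def lay_def indicator_def)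
  have eH: "ennreal (H n (t, x)) = indicator {0<..<T} t * (indicator (layer ((C + 1) * dlt n)) x * (1 + ennreal (norm (G (t, x)) powr p x)))" for t x
   by (auto simp: H_def h_def lay_def indicator_def)
  have ut: "(%x. u (t, x)) : borel_funs" and Gt: "(%x. G (t, x)) : borel_funs" for t
  proof -
   have "(%x. (t, x)) : (borel :: 'a measure) \<rightarrow>\<^sub>M (borel :: (real \<times> 'a) measure)"
   by (intro borel_measurable_continuous_onI continuous_intros)
   from measurable_compose[OF this] show "(%x. u (t, x)) : borel_funs" "(%x. G (t, x)) : borel_funs" by auto
  qed
  have fub: "(\<integral>\<^sup>+y. w y \<partial>lborel) = (\<integral>\<^sup>+t. \<integral>\<^sup>+x. w (t, x) \<partial>lborel \<partial>lborel)" if [measurable]: "w : borel_funs" for w :: "real \<times> 'a => ennreal"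
  proof -
   have "w : borel_measurable (lborel \<Otimes>\<^sub>M lborel)" using that by (simp add: lborel_prod)
   from lborel.nn_integral_fst[OF this] show ?thesis by (simp add: lborel_prod)
  qed
  have "(\<integral>\<^sup>+y. ennreal (f n y) \<partial>lborel) = (\<integral>\<^sup>+t. \<integral>\<^sup>+x. ennreal (f n (t, x)) \<partial>lborel \<partial>lborel)" by (rule fub) measurable
  also have "\<dots> <= (\<integral>\<^sup>+t. ennreal K * (\<integral>\<^sup>+x. ennreal (H n (t, x)) \<partial>lborel) \<partial>lborel)"
  proof (rule nn_integral_mono_AE)
   show "AE t in lborel. (\<integral>\<^sup>+x. ennreal (f n (t, x)) \<partial>lborel) <= ennreal K * (\<integral>\<^sup>+x. ennreal (H n (t, x)) \<partial>lborel)"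
   using t
   proof eventually_elim
   case (elim t)
   show ?case
   proof (cases "t : {0<..<T}")
   case True
   then have "zero_trace (%x. u (t, x)) (%x. G (t, x))" using elim by simp
   from K(2)[OF ut Gt this _ dlt(1) that] stateD(3,4)[OF s]
   show ?thesis using True by (simp add: ef eH)
   next
   case False
   then show ?thesis by (simp add: ef)
   qed
   qed
  qed
  also have "\<dots> = ennreal K * (\<integral>\<^sup>+t. \<integral>\<^sup>+x. ennreal (H n (t, x)) \<partial>lborel \<partial>lborel)"
  proof (rule nn_integral_cmult)
   have "(%y. ennreal (H n y)) : borel_measurable (lborel \<Otimes>\<^sub>M lborel)" by (simp add: lborel_prod)
   from lborel.borel_measurable_nn_integral_fst[OF this]
   show "(%t. \<integral>\<^sup>+x. ennreal (H n (t, x)) \<partial>lborel) : borel_measurable lborel" .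
  qed
  also have "(\<integral>\<^sup>+t. \<integral>\<^sup>+x. ennreal (H n (t, x)) \<partial>lborel \<partial>lborel) = (\<integral>\<^sup>+y. ennreal (H n y) \<partial>lborel)"
   by (rule fub[symmetric]) measurable
  also have "\<dots> = ennreal (integral\<^sup>L lborel (H n))"
  proof (rule nn_integral_eq_integral)
   show "lint (H n)"
   by (rule BI_integrable_bound[OF iH0]) (simp, rule AE_I2, rule order_trans[OF H_le], simp)
  qed (auto simp: H_def h0)
  finally show ?thesis using K(1) by (simp add: ennreal_mult')
 qed
 have ev: "\<forall>\<^sub>F n in sequentially. dlt n < dlt0" using order_tendstoD(2)[OF dlt(2) dlt0(1)] .
 have int: "lint (f n)" if "dlt n < dlt0" for n
  by (rule integrableI_nonneg) (use main[OF that] in \<open>auto simp: f_def intro: le_less_trans\<close>)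
 have bd: "norm (integral\<^sup>L lborel (f n)) <= K * integral\<^sup>L lborel (H n)" if "dlt n < dlt0" for n
 proof -
  have p0: "0 <= f n y" for y by (simp add: f_def)
  have "ennreal (integral\<^sup>L lborel (f n)) <= ennreal (K * integral\<^sup>L lborel (H n))"
   using main[OF that] nn_integral_eq_integral[OF int[OF that]] p0 by simp
  moreover have "0 <= integral\<^sup>L lborel (H n)" by (intro integral_nonneg_AE) (auto simp: H_def h0)
  moreover have "0 <= integral\<^sup>L lborel (f n)" by (intro integral_nonneg_AE) (auto simp: p0)
  ultimately show ?thesis using K(1) by (simp add: ennreal_le_iff)
 qed
 show "\<forall>\<^sub>F n in sequentially. lint (%y. indicator ({0<..<T} \<times> layer (dlt n)) y * ((u y / dlt n) powr p (snd y)))"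
  using ev by eventually_elim (use int in \<open>auto simp: f_def[abs_def] lay_def\<close>)
 have "(%n. integral\<^sup>L lborel (f n)) \<rightarrow> 0"
 proof (rule Lim_null_comparison)
  show "\<forall>\<^sub>F n in sequentially. norm (integral\<^sup>L lborel (f n)) <= K * integral\<^sup>L lborel (H n)"
   using ev by eventually_elim (rule bd)
  show "(%n. K * integral\<^sup>L lborel (H n)) \<rightarrow> 0" using tendsto_mult_left[OF limH, of K] by simp
 qed
 then show "(%n. \<integral>y. indicator ({0<..<T} \<times> layer (dlt n)) y * ((u y / dlt n) powr p (snd y)) \<partial>lborel) \<rightarrow> 0"
  by (simp add: f_def[abs_def] lay_def)
qed

end

section \<open>The Picone inequality for regularised quotients\<close>

lemma weighted_young:
 fixes y z q :: real
 assumes "y > 0" "z > 0" "q > 1"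
 shows "q * y powr (q - 1) * z <= z powr q + (q - 1) * y powr q"
proof -
 have "(z powr q) powr (1/q) * (y powr q) powr ((q-1)/q) <= (1/q) * z powr q + ((q-1)/q) * y powr q"
  using assms by (intro Youngs_inequality_0) (auto simp: field_simps)
 moreover have "(z powr q) powr (1/q) = z" "(y powr q) powr ((q-1)/q) = y powr (q - 1)"
  using assms by (simp_all add: powr_powr)
 ultimately have "z * y powr (q - 1) <= (z powr q + (q-1) * y powr q) / q" by (simp add: add_divide_distrib)
 then show ?thesis using assms by (simp add: field_simps)
qed

lemma picone_core:
 fixes x z s q r :: real
 assumes x: "x >= 0" and z: "z >= 0" and s: "s > 0" and q: "1 < q" "q <= r"
 shows "q * s powr (q - 1) * (x powr (r - 1) * z) + q * s powr (1 - q) * (z powr (r - 1) * x)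
   <= x powr r + z powr r + (q - 1) * s powr q * x powr r + (q - 1) * s powr (- q) * z powr r"
proof (cases "x = 0 \<or> z = 0")
 case True
 then show ?thesis using x z s q by (auto intro!: add_nonneg_nonneg mult_nonneg_nonneg)
next
 case False
 then have x: "x > 0" and z: "z > 0" using x z by auto
 have half: "q * s powr (q - 1) * (x powr (r - 1) * z) <= x powr (r - q) * z powr q + (q - 1) * s powr q * x powr r"
  if "x > 0" "z > 0" "s > 0" for x z s :: real
 proof -
  have "q * (s * x) powr (q - 1) * z <= z powr q + (q - 1) * (s * x) powr q"
   using that q by (intro weighted_young) auto
  then have "x powr (r - q) * (q * (s * x) powr (q - 1) * z) <= x powr (r - q) * (z powr q + (q - 1) * (s * x) powr q)"
   by (rule mult_left_mono) simp
  moreover have "x powr (r - q) * x powr (q - 1) = x powr (r - 1)" "x powr (r - q) * x powr q = x powr r"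
   by (simp_all flip: powr_add)
  ultimately show ?thesis using that by (simp add: powr_mult algebra_simps)
 qed
 have re: "x powr (r - q) * z powr q + z powr (r - q) * x powr q <= x powr r + z powr r"
 proof -
  have "0 <= (x powr (r - q) - z powr (r - q)) * (x powr q - z powr q)"
  proof (cases "x <= z")
   case True
   have "x powr (r - q) <= z powr (r - q)" "x powr q <= z powr q"
   using True x q by (auto intro!: powr_mono2)
   then show ?thesis by (intro mult_nonpos_nonpos) auto
  next
   case False
   then have "z powr (r - q) <= x powr (r - q)" "z powr q <= x powr q"
   using z q by (auto intro!: powr_mono2)
   then show ?thesis by (intro mult_nonneg_nonneg) auto
  qed
  moreover have "x powr (r - q) * x powr q = x powr r" "z powr (r - q) * z powr q = z powr r"
   by (simp_all flip: powr_add)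
  ultimately show ?thesis by (simp add: algebra_simps)
 qed
 have "1 / s > 0" using s by simp
 from half[OF x z s] half[OF z x this] re
 show ?thesis using s by (simp add: powr_divide powr_minus_divide[symmetric] minus_diff_eq)
qed

lemma p_flux_inner_self: "r > 1 ==> p_flux r \<xi> \<bullet> \<xi> = norm \<xi> powr r"
proof -
 have "norm \<xi> powr (r - 2) * (norm \<xi> * norm \<xi>) = norm \<xi> powr r" if "norm \<xi> > 0"
  using that powr_add[of "norm \<xi>" "r - 2" 2] by (simp add: power2_eq_square)
 then show ?thesis
  by (cases "\<xi> = 0") (auto simp: p_flux_def power2_norm_eq_inner[symmetric] power2_eq_square)
qed

lemma norm_p_flux: "r > 1 ==> norm (p_flux r \<xi>) = norm \<xi> powr (r - 1)"
 by (cases "\<xi> = 0") (use powr_add[of "norm \<xi>" "r - 2" 1] in \<open>auto simp: p_flux_def\<close>)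

lemma p_flux_young:
 assumes "r > 1" "s >= 0"
 shows "norm (p_flux r \<xi>) * s <= norm \<xi> powr r + s powr r"
proof -
 have "norm \<xi> powr (r - 1) * s <= norm \<xi> powr r + s powr r"
 proof (cases "norm \<xi> <= s")
  case True
  then have "norm \<xi> powr (r - 1) * s <= s powr (r - 1) * s" using assms by (intro mult_right_mono powr_mono2) auto
  also have "\<dots> = s powr r" using assms powr_mult_base[of s "r - 1"] by (simp add: mult.commute)
  finally show ?thesis by (simp add: add_increasing)
 next
  case False
  then have "norm \<xi> powr (r - 1) * s <= norm \<xi> powr (r - 1) * norm \<xi>" using assms by (intro mult_left_mono) auto
  also have "\<dots> = norm \<xi> powr r" using powr_mult_base[of "norm \<xi>" "r - 1"] by (simp add: mult.commute)
  finally show ?thesis by (simp add: add_increasing2)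
 qed
 then show ?thesis using assms by (simp add: norm_p_flux)
qed

text \<open>Young's inequality makes the main terms nonnegative because \<open>q\<close> does not exceed the exponent. The loss comes only from regularising the positive part and is proportional to \<open>\<kappa>\<close>.\<close>

lemma picone_flux:
 fixes \<xi> zet :: "'a::euclidean_space"
 assumes a: "a > 0" and b: "b > 0" and q: "1 < q" "q <= r"
  and D: "0 <= D" and H: "\<bar>(a powr q - b powr q) * D - H\<bar> <= kap"
 shows "- ((q - 1) * kap * (a powr (- q) * norm \<xi> powr r + b powr (- q) * norm zet powr r)) \<le>
   p_flux r \<xi> \<bullet> ((D * q - (q - 1) * H * a powr (- q)) *# \<xi> + (- (D * q * b powr (q - 1) * a powr (1 - q))) *# zet)
   - p_flux r zet \<bullet> ((D * q * a powr (q - 1) * b powr (1 - q)) *# \<xi> + (- (D * q) - (q - 1) * H * b powr (- q)) *# zet)"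
proof -
 define X Z where "X = norm \<xi> powr r" and "Z = norm zet powr r"
 define A1 A2 where "A1 = p_flux r \<xi> \<bullet> zet" and "A2 = p_flux r zet \<bullet> \<xi>"
 have r: "r > 1" using q by simp
 have XZ: "0 <= X" "0 <= Z" by (auto simp: X_def Z_def)
 let ?s = "b / a"
 have s: "?s > 0" using a b by simp
 have pd: "?s powr c = b powr c * a powr (- c)" for c using a b by (simp add: powr_divide powr_minus_divide)
 have ss: "?s powr (q - 1) = b powr (q - 1) * a powr (1 - q)" "?s powr (1 - q) = a powr (q - 1) * b powr (1 - q)"
  "?s powr q = b powr q * a powr (- q)" "?s powr (- q) = a powr q * b powr (- q)"
  using pd[of "q - 1"] pd[of "1 - q"] pd[of q] pd[of "- q"] by (simp_all add: mult.commute)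
 have A: "A1 <= norm \<xi> powr (r - 1) * norm zet" "A2 <= norm zet powr (r - 1) * norm \<xi>"
  unfolding A1_def A2_def using norm_cauchy_schwarz[of "p_flux r \<xi>" zet] norm_cauchy_schwarz[of "p_flux r zet" \<xi>]
  by (simp_all add: norm_p_flux r)
 have "q * ?s powr (q - 1) * A1 + q * ?s powr (1 - q) * A2 <=
  q * ?s powr (q - 1) * (norm \<xi> powr (r - 1) * norm zet) + q * ?s powr (1 - q) * (norm zet powr (r - 1) * norm \<xi>)"
  using A q by (intro add_mono mult_left_mono) auto
 also have "\<dots> <= X + Z + (q - 1) * ?s powr q * X + (q - 1) * ?s powr (- q) * Z"
  unfolding X_def Z_def by (rule picone_core) (use s q in auto)
 finally have br: "0 <= X + Z + (q - 1) * (b powr q * a powr (- q)) * X + (q - 1) * (a powr q * b powr (- q)) * Z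
   - q * (b powr (q - 1) * a powr (1 - q)) * A1 - q * (a powr (q - 1) * b powr (1 - q)) * A2" (is "0 <= ?B")
  unfolding ss by simp
 have one: "a powr q * a powr (- q) = 1" "b powr q * b powr (- q) = 1" using a b by (simp_all flip: powr_add)
 let ?S = "a powr q - b powr q" and ?C = "a powr (- q) * X - b powr (- q) * Z"
 have "p_flux r \<xi> \<bullet> ((D * q - (q - 1) * H * a powr (- q)) *# \<xi> + (- (D * q * b powr (q - 1) * a powr (1 - q))) *# zet)
   - p_flux r zet \<bullet> ((D * q * a powr (q - 1) * b powr (1 - q)) *# \<xi> + (- (D * q) - (q - 1) * H * b powr (- q)) *# zet)
  = (D * q - (q - 1) * H * a powr (- q)) * X - D * q * b powr (q - 1) * a powr (1 - q) * A1
   - (D * q * a powr (q - 1) * b powr (1 - q) * A2 + (- (D * q) - (q - 1) * H * b powr (- q)) * Z)"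
  by (simp add: inner_add_right inner_diff_right p_flux_inner_self[OF r] X_def Z_def A1_def A2_def)
 also have "\<dots> = D * ?B + (q - 1) * (?S * D - H) * ?C"
 proof -
  have "?S * ?C = (a powr q * a powr (- q)) * X + (b powr q * b powr (- q)) * Z - a powr q * b powr (- q) * Z - b powr q * a powr (- q) * X"
   by (simp add: algebra_simps)
  then have sc: "?S * ?C = X + Z - a powr q * b powr (- q) * Z - b powr q * a powr (- q) * X" by (simp add: one)
  have "D * ?B + (q - 1) * (?S * D - H) * ?C = D * ?B + (q - 1) * D * (?S * ?C) - (q - 1) * H * ?C"
   by (simp add: algebra_simps)
  then show ?thesis unfolding sc by (simp add: algebra_simps)
 qed
 finally have eq: "p_flux r \<xi> \<bullet> ((D * q - (q - 1) * H * a powr (- q)) *# \<xi> + (- (D * q * b powr (q - 1) * a powr (1 - q))) *# zet)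
   - p_flux r zet \<bullet> ((D * q * a powr (q - 1) * b powr (1 - q)) *# \<xi> + (- (D * q) - (q - 1) * H * b powr (- q)) *# zet)
   = D * ?B + (q - 1) * (?S * D - H) * ?C" .
 have "\<bar>(?S * D - H) * ?C\<bar> <= kap * (a powr (- q) * X + b powr (- q) * Z)"
 proof -
  have "\<bar>?C\<bar> <= a powr (- q) * X + b powr (- q) * Z"
  proof -
   have "0 <= a powr (- q) * X" "0 <= b powr (- q) * Z" using XZ by auto
   then show ?thesis by linarith
  qed
  then show ?thesis unfolding abs_mult using H by (intro mult_mono) auto
 qed
 then have "- (kap * (a powr (- q) * X + b powr (- q) * Z)) <= (?S * D - H) * ?C" by linarith
 from mult_left_mono[OF this, of "q - 1"] q
 have "- ((q - 1) * kap * (a powr (- q) * X + b powr (- q) * Z)) <= (q - 1) * (?S * D - H) * ?C" by (simp add: mult.assoc)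
 moreover have "0 <= D * ?B" using D br by (rule mult_nonneg_nonneg)
 ultimately show ?thesis unfolding eq X_def Z_def by linarith
qed

definition pos_reg :: "real => real => real" where
 "pos_reg kap s = sqrt ((max 0 s)\<^sup>2 + kap\<^sup>2) - kap"

definition pos_reg' :: "real => real => real" where
 "pos_reg' kap s = max 0 s / sqrt ((max 0 s)\<^sup>2 + kap\<^sup>2)"

lemma max0_square_deriv: "((%s. (max 0 s)\<^sup>2) has_real_derivative 2 * max 0 s) (at s)"
proof (cases s "0::real" rule: linorder_cases)
 case less
 have "((%_. 0) has_real_derivative 0) (at s)" by simp
 then have "((%s. (max 0 s)\<^sup>2) has_real_derivative 0) (at s)"
  by (rule DERIV_cong_ev[THEN iffD1, rotated 3])
   (use less eventually_nhds_in_open[of "{..<0}" s] in \<open>auto elim!: eventually_mono\<close>)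
 then show ?thesis using less by simp
next
 case equal
 have "((%h. ((max 0 (0 + h))\<^sup>2 - (max 0 0)\<^sup>2) / h) \<longlongrightarrow> 0) (at (0::real))"
 proof (rule Lim_null_comparison)
  show "\<forall>\<^sub>F h in at 0. norm (((max 0 (0 + h))\<^sup>2 - (max 0 0)\<^sup>2) / h) <= \<bar>h::real\<bar>"
   by (intro always_eventually allI) (auto simp: max_def power2_eq_square)
  show "((%h. \<bar>h\<bar>) \<longlongrightarrow> 0) (at (0::real))"
   by (rule tendsto_eq_rhs, (rule tendsto_intros)+) simp
 qed
 then show ?thesis using equal by (simp add: DERIV_def)
next
 case greater
 have "((%s. s\<^sup>2) has_real_derivative 2 * s) (at s)" by (auto intro!: derivative_eq_intros)
 then have "((%s. (max 0 s)\<^sup>2) has_real_derivative 2 * s) (at s)"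
  by (rule DERIV_cong_ev[THEN iffD1, rotated 3])
   (use greater eventually_nhds_in_open[of "{0<..}" s] in \<open>auto elim!: eventually_mono\<close>)
 then show ?thesis using greater by simp
qed

lemma pos_reg_deriv:
 assumes "kap > 0"
 shows "(pos_reg kap has_real_derivative pos_reg' kap s) (at s)"
proof -
 have p: "(max 0 s)\<^sup>2 + kap\<^sup>2 > 0" using assms by (intro add_nonneg_pos) auto
 have "((%s. (max 0 s)\<^sup>2 + kap\<^sup>2) has_real_derivative 2 * max 0 s) (at s)"
  by (rule DERIV_cong[OF DERIV_add[OF max0_square_deriv DERIV_const]]) simp
 from DERIV_chain2[OF DERIV_real_sqrt[OF p] this]
 have "((%s. sqrt ((max 0 s)\<^sup>2 + kap\<^sup>2)) has_real_derivative pos_reg' kap s) (at s)"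
  by (rule DERIV_cong) (simp add: pos_reg'_def field_simps)
 from DERIV_diff[OF this DERIV_const[of kap]] show ?thesis by (simp add: pos_reg_def[abs_def])
qed

lemma continuous_pos_reg':
 assumes "kap > 0"
 shows "continuous_on S (pos_reg' kap)"
proof -
 have "(max 0 s)\<^sup>2 + kap\<^sup>2 > 0" for s :: real using assms by (intro add_nonneg_pos) auto
 then have "0 < sqrt ((max 0 s)\<^sup>2 + kap\<^sup>2)" for s :: real by (simp only: real_sqrt_gt_0_iff)
 then have "sqrt ((max 0 s)\<^sup>2 + kap\<^sup>2) \<noteq> 0" for s :: real by (metis less_irrefl)
 then show ?thesis unfolding pos_reg'_def by (intro continuous_intros) (use assms in auto)
qed

lemma pos_reg_nonpos: "kap > 0 ==> s <= 0 ==> pos_reg kap s = 0" "kap > 0 ==> s <= 0 ==> pos_reg' kap s = 0"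
 by (auto simp: pos_reg_def pos_reg'_def max_def)

lemma pos_reg_bounds:
 assumes k: "kap > 0"
 shows "0 <= pos_reg kap s" "pos_reg kap s <= max 0 s" "max 0 s - kap <= pos_reg kap s"
  "0 <= pos_reg' kap s" "\<bar>s * pos_reg' kap s - pos_reg kap s\<bar> <= kap"
proof -
 let ?m = "max 0 s" and ?r = "sqrt ((max 0 s)\<^sup>2 + kap\<^sup>2)"
 have r1: "?r >= kap" using k by (intro real_le_rsqrt) auto
 have r2: "?r >= ?m" by (intro real_le_rsqrt) auto
 have r3: "?r <= ?m + kap" using k by (intro real_le_lsqrt) (auto simp: power2_sum)
 show "0 <= pos_reg kap s" "pos_reg kap s <= max 0 s" "max 0 s - kap <= pos_reg kap s" using r1 r2 r3 by (auto simp: pos_reg_def)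
 show "0 <= pos_reg' kap s" by (simp add: pos_reg'_def)
 have rp: "?r > 0" using r1 k by linarith
 have sq: "?r * ?r = ?m\<^sup>2 + kap\<^sup>2" by simp
 have "s * pos_reg' kap s = ?m\<^sup>2 / ?r" by (auto simp: pos_reg'_def max_def power2_eq_square)
 also have "\<dots> = ?r - kap\<^sup>2 / ?r"
 proof -
  have "m / R = R - k / R" if "R > 0" "R * R = m + k" for R m k :: real using that by (simp add: field_simps)
  from this[OF rp sq] show ?thesis .
 qed
 finally have e: "s * pos_reg' kap s - pos_reg kap s = kap - kap\<^sup>2 / ?r" by (simp add: pos_reg_def)
 have "kap\<^sup>2 / ?r <= kap\<^sup>2 / kap" using r1 k mult_pos_pos[OF rp k] by (intro divide_left_mono) auto
 then have "0 <= kap - kap\<^sup>2 / ?r" using k by (simp add: power2_eq_square)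
 moreover have "0 <= kap\<^sup>2 / ?r" by simp
 ultimately show "\<bar>s * pos_reg' kap s - pos_reg kap s\<bar> <= kap" unfolding e by linarith
qed

locale quotient_tests =
 fixes q eps kap M :: real
 assumes q: "q > 1" and eps: "eps > 0" and kap: "kap > 0"
begin

abbreviation pa :: "real \<times> real => real" where "pa z \<equiv> max 0 (fst z)"
abbreviation pb :: "real \<times> real => real" where "pb z \<equiv> snd z + eps"

definition "gap z = pa z powr q - pb z powr q"
definition "Psiu z = pos_reg kap (gap z) * pa z powr (1 - q)"
definition "Psiu1 z = pos_reg' kap (gap z) * q - (q - 1) * pos_reg kap (gap z) * pa z powr (- q)"
definition "Psiu2 z = - (pos_reg' kap (gap z) * q * pb z powr (q - 1) * pa z powr (1 - q))"
definition "Psiv z = pos_reg kap (gap z) * pb z powr (1 - q)"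
definition "Psiv1 z = pos_reg' kap (gap z) * q * pa z powr (q - 1) * pb z powr (1 - q)"
definition "Psiv2 z = - (pos_reg' kap (gap z) * q) - (q - 1) * pos_reg kap (gap z) * pb z powr (- q)"

lemma gap_nonpos: "snd z > - eps ==> fst z <= snd z + eps ==> gap z <= 0"
 using q by (auto simp: gap_def max_def intro!: powr_mono2)

lemma gap_zero:
 assumes "snd z > - eps" "fst z <= snd z + eps"
 shows "Psiu z = 0" "Psiu1 z = 0" "Psiu2 z = 0" "Psiv z = 0" "Psiv1 z = 0" "Psiv2 z = 0"
 using pos_reg_nonpos[OF kap gap_nonpos[OF assms]]
 by (auto simp: Psiu_def Psiu1_def Psiu2_def Psiv_def Psiv1_def Psiv2_def)

definition "low = {z :: real \<times> real. snd z > - eps & fst z < snd z + eps}"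
definition "high = {z :: real \<times> real. snd z > - eps & 0 < fst z}"

lemma open_low: "open low" and open_high: "open high"
proof -
 have "low = {z. - eps < snd z} \<inter> {z. fst z < snd z + eps}" "high = {z. - eps < snd z} \<inter> {z. 0 < fst z}"
  by (auto simp: low_def high_def)
 then show "open low" "open high"
  by (auto intro!: open_Int open_Collect_less continuous_intros)
qed

lemma square_cover: "{0..M} \<times> {0..M} \<subseteq> low \<union> high"
 using eps by (auto simp: low_def high_def)

lemma powr_fst_deriv: "0 < fst z ==> ((%z. pa z powr c) has_derivative (%h. c * pa z powr (c - 1) * fst h)) (at z)"
proof -
 assume z: "0 < fst z"
 have "((%z. fst z powr c) has_derivative (%h. (c * fst z powr (c - 1)) * fst h)) (at z)"
  using has_derivative_compose[OF has_derivative_fst[OF has_derivative_ident] has_real_derivative_powr[OF z, of c, unfolded has_field_derivative_def], of UNIV]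
  by simp
 then have "((%z. fst z powr c) has_derivative (%h. c * pa z powr (c - 1) * fst h)) (at z)" using z by (simp add: max_def)
 then show ?thesis
  by (rule has_derivative_transform_within_open[where s="{z. 0 < fst z}"])
   (use z in \<open>auto intro!: open_Collect_less continuous_intros simp: max_def\<close>)
qed

lemma powr_snd_deriv: "- eps < snd z ==> ((%z. pb z powr c) has_derivative (%h. c * pb z powr (c - 1) * snd h)) (at z)"
proof -
 assume z: "- eps < snd z"
 have p: "0 < pb z" using z by simp
 have "((%z::real\<times>real. pb z) has_derivative (%h. snd h)) (at z)" by (auto intro!: derivative_eq_intros)
 from has_derivative_compose[OF this has_real_derivative_powr[OF p, of c, unfolded has_field_derivative_def]]
 show ?thesis by simp
qed

lemma Psiu_deriv_high: "z : high ==> (Psiu has_derivative (%h. Psiu1 z * fst h + Psiu2 z * snd h)) (at z)"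
 and Psiv_deriv_high: "z : high ==> (Psiv has_derivative (%h. Psiv1 z * fst h + Psiv2 z * snd h)) (at z)"
proof -
 assume z: "z : high"
 then have z': "0 < fst z" "- eps < snd z" by (auto simp: high_def)
 have pz: "0 < pa z" "0 < pb z" using z' by auto
 have g: "(gap has_derivative (%h. q * pa z powr (q - 1) * fst h - q * pb z powr (q - 1) * snd h)) (at z)"
  unfolding gap_def[abs_def] by (intro has_derivative_diff powr_fst_deriv powr_snd_deriv z')
 have H: "((%z. pos_reg kap (gap z)) has_derivative (%h. pos_reg' kap (gap z) * (q * pa z powr (q - 1) * fst h - q * pb z powr (q - 1) * snd h))) (at z)"
  using has_derivative_compose[OF g pos_reg_deriv[OF kap, unfolded has_field_derivative_def]] by simp
 have e1: "pa z powr (q - 1) * pa z powr (1 - q) = 1" "pb z powr (q - 1) * pb z powr (1 - q) = 1" using pz by (simp_all flip: powr_add)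
 have "(Psiu has_derivative (%h. pos_reg kap (gap z) * ((1 - q) * pa z powr (1 - q - 1) * fst h) +
   pos_reg' kap (gap z) * (q * pa z powr (q - 1) * fst h - q * pb z powr (q - 1) * snd h) * pa z powr (1 - q))) (at z)"
  unfolding Psiu_def[abs_def] by (rule has_derivative_mult[OF H powr_fst_deriv[OF z'(1)]])
 then show "(Psiu has_derivative (%h. Psiu1 z * fst h + Psiu2 z * snd h)) (at z)"
 proof (rule has_derivative_eq_rhs, intro ext)
  fix h
  have "pos_reg kap (gap z) * ((1 - q) * pa z powr (1 - q - 1) * fst h) +
   pos_reg' kap (gap z) * (q * pa z powr (q - 1) * fst h - q * pb z powr (q - 1) * snd h) * pa z powr (1 - q)
   = pos_reg kap (gap z) * ((1 - q) * pa z powr (- q) * fst h) + pos_reg' kap (gap z) * q * (pa z powr (q - 1) * pa z powr (1 - q)) * fst h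
   - pos_reg' kap (gap z) * q * pb z powr (q - 1) * pa z powr (1 - q) * snd h"
   by (simp add: algebra_simps)
  then show "pos_reg kap (gap z) * ((1 - q) * pa z powr (1 - q - 1) * fst h) +
   pos_reg' kap (gap z) * (q * pa z powr (q - 1) * fst h - q * pb z powr (q - 1) * snd h) * pa z powr (1 - q) = Psiu1 z * fst h + Psiu2 z * snd h"
   unfolding e1 by (simp add: Psiu1_def Psiu2_def algebra_simps)
 qed
 have "(Psiv has_derivative (%h. pos_reg kap (gap z) * ((1 - q) * pb z powr (1 - q - 1) * snd h) +
   pos_reg' kap (gap z) * (q * pa z powr (q - 1) * fst h - q * pb z powr (q - 1) * snd h) * pb z powr (1 - q))) (at z)"
  unfolding Psiv_def[abs_def] by (rule has_derivative_mult[OF H powr_snd_deriv[OF z'(2)]])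
 then show "(Psiv has_derivative (%h. Psiv1 z * fst h + Psiv2 z * snd h)) (at z)"
 proof (rule has_derivative_eq_rhs, intro ext)
  fix h
  have "pos_reg kap (gap z) * ((1 - q) * pb z powr (1 - q - 1) * snd h) +
   pos_reg' kap (gap z) * (q * pa z powr (q - 1) * fst h - q * pb z powr (q - 1) * snd h) * pb z powr (1 - q)
   = pos_reg kap (gap z) * ((1 - q) * pb z powr (- q) * snd h) - pos_reg' kap (gap z) * q * (pb z powr (q - 1) * pb z powr (1 - q)) * snd h
   + pos_reg' kap (gap z) * q * pa z powr (q - 1) * pb z powr (1 - q) * fst h"
   by (simp add: algebra_simps)
  then show "pos_reg kap (gap z) * ((1 - q) * pb z powr (1 - q - 1) * snd h) +
   pos_reg' kap (gap z) * (q * pa z powr (q - 1) * fst h - q * pb z powr (q - 1) * snd h) * pb z powr (1 - q) = Psiv1 z * fst h + Psiv2 z * snd h"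
   unfolding e1 by (simp add: Psiv1_def Psiv2_def algebra_simps)
 qed
qed

lemma deriv_low:
 assumes "z : low"
 shows "(Psiu has_derivative (%h. Psiu1 z * fst h + Psiu2 z * snd h)) (at z)" "(Psiv has_derivative (%h. Psiv1 z * fst h + Psiv2 z * snd h)) (at z)"
proof -
 have z: "w : low ==> snd w > - eps & fst w <= snd w + eps" for w by (auto simp: low_def)
 have "(Psiu has_derivative (%h. 0)) (at z)" "(Psiv has_derivative (%h. 0)) (at z)"
  by (rule has_derivative_transform_within_open[OF has_derivative_const open_low assms], use z gap_zero in auto)+
 then show "(Psiu has_derivative (%h. Psiu1 z * fst h + Psiu2 z * snd h)) (at z)" "(Psiv has_derivative (%h. Psiv1 z * fst h + Psiv2 z * snd h)) (at z)"
  using z[OF assms] gap_zero[of z] by auto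
qed

lemma Psi_deriv:
 assumes "a : {0..M}" "b : {0..M}"
 shows "(Psiu has_derivative (%h. Psiu1 (a, b) * fst h + Psiu2 (a, b) * snd h)) (at (a, b))"
  "(Psiv has_derivative (%h. Psiv1 (a, b) * fst h + Psiv2 (a, b) * snd h)) (at (a, b))"
 using square_cover assms deriv_low[of "(a, b)"] Psiu_deriv_high[of "(a, b)"] Psiv_deriv_high[of "(a, b)"] by blast+

lemma Psi_cont:
 "continuous_on ({0..M} \<times> {0..M}) Psiu1" "continuous_on ({0..M} \<times> {0..M}) Psiu2"
 "continuous_on ({0..M} \<times> {0..M}) Psiv1" "continuous_on ({0..M} \<times> {0..M}) Psiv2"
proof -
 have gc: "continuous_on high gap"
  unfolding gap_def using q by (intro continuous_intros) (auto simp: high_def)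
 have c: "continuous_on high (%z. pos_reg kap (gap z))" "continuous_on high (%z. pos_reg' kap (gap z))"
 proof -
  have "continuous_on UNIV (pos_reg kap)" by (meson DERIV_isCont continuous_at_imp_continuous_on pos_reg_deriv[OF kap])
  from continuous_on_compose2[OF this gc] show "continuous_on high (%z. pos_reg kap (gap z))" by auto
  from continuous_on_compose2[OF continuous_pos_reg'[OF kap, of UNIV] gc] show "continuous_on high (%z. pos_reg' kap (gap z))" by auto
 qed
 have pw: "continuous_on high (%z. pa z powr k)" "continuous_on high (%z. pb z powr k)" for k
  by (intro continuous_intros; auto simp: high_def)+
 have ch: "continuous_on high Psiu1" "continuous_on high Psiu2" "continuous_on high Psiv1" "continuous_on high Psiv2"
  unfolding Psiu1_def Psiu2_def Psiv1_def Psiv2_def by (intro continuous_intros c pw)+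
 have z: "w : low ==> snd w > - eps & fst w <= snd w + eps" for w by (auto simp: low_def)
 have cl: "continuous_on low Psiu1" "continuous_on low Psiu2" "continuous_on low Psiv1" "continuous_on low Psiv2"
  using gap_zero z by (auto cong: continuous_on_cong)
 have "continuous_on (low \<union> high) f" if "continuous_on low f" "continuous_on high f" for f :: "real \<times> real => real"
  using that open_low open_high by (intro continuous_on_open_Un)
 then show "continuous_on ({0..M} \<times> {0..M}) Psiu1" "continuous_on ({0..M} \<times> {0..M}) Psiu2"
 "continuous_on ({0..M} \<times> {0..M}) Psiv1" "continuous_on ({0..M} \<times> {0..M}) Psiv2"
  using ch cl by (auto intro!: continuous_on_subset[OF _ square_cover])
qed

end

section \<open>Cutoff functions and the comparison setting\<close>

lemma product_test:
 fixes eta :: "real => real" and zet :: "'a::euclidean_space => real"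
 assumes t: "C1_test K1 eta deta" "C1_test K2 zet dzet"
 shows "C1_test (K1 \<times> K2) (%y. eta (fst y) * zet (snd y)) (%y. (deta (fst y) * zet (snd y), eta (fst y) *# dzet (snd y)))"
proof -
 have d1: "(eta has_derivative (%h. deta x * h)) (at x)" for x using t(1) by (simp add: C1_test_def)
 have d2: "(zet has_derivative (%h. dzet x \<bullet> h)) (at x)" for x using t(2) by (simp add: C1_test_def)
 have c: "continuous_on UNIV deta" "continuous_on UNIV dzet" using t by (auto simp: C1_test_def)
 have c0: "continuous_on UNIV eta" "continuous_on UNIV zet"
  by (rule has_derivative_continuous_on[OF has_derivative_at_withinI[OF d1]],
   rule has_derivative_continuous_on[OF has_derivative_at_withinI[OF d2]])
 show ?thesis
  unfolding C1_test_def
 proof (intro conjI allI impI)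
  show "compact (K1 \<times> K2)" using t by (intro compact_Times) (auto simp: C1_test_def)
  fix y :: "real \<times> 'a"
  have f1: "((%y::real \<times> 'a. fst y) has_derivative fst) (at y)" and f2: "((%y::real \<times> 'a. snd y) has_derivative snd) (at y)"
   by (auto intro!: derivative_eq_intros)
  have e1: "((%y::real \<times> 'a. eta (fst y)) has_derivative (%h. deta (fst y) * fst h)) (at y)"
   using has_derivative_compose[OF f1 d1] by simp
  have e2: "((%y::real \<times> 'a. zet (snd y)) has_derivative (%h. dzet (snd y) \<bullet> snd h)) (at y)"
   using has_derivative_compose[OF f2 d2] by simp
  show "((%y. eta (fst y) * zet (snd y)) has_derivative (%h. (deta (fst y) * zet (snd y), eta (fst y) *# dzet (snd y)) \<bullet> h)) (at y)"
   using has_derivative_mult[OF e1 e2] by (rule has_derivative_eq_rhs) (auto simp: inner_prod_def)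
 next
  show "continuous_on UNIV (%y::real \<times> 'a. (deta (fst y) * zet (snd y), eta (fst y) *# dzet (snd y)))"
   by (intro continuous_intros continuous_on_compose2[OF c(1)] continuous_on_compose2[OF c(2)] continuous_on_compose2[OF c0(1)] continuous_on_compose2[OF c0(2)]) auto
 next
  fix y assume "y \<notin> K1 \<times> K2"
  then show "eta (fst y) * zet (snd y) = 0"
   using C1_test_zero[OF t(1), of "fst y"] C1_test_zero[OF t(2), of "snd y"] by (cases y) auto
 qed
qed

lemma C1_test_bounded:
 assumes "C1_test K phi dphi"
 obtains B where "B > 0" "!!x. \<bar>phi x\<bar> <= B" "!!x. norm (dphi x) <= B"
proof -
 obtain R where "smooth_kernel phi dphi R" using C1_test_kernel[OF assms] by blast
 then interpret smooth_kernel phi dphi R .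
 obtain C where C: "!!x. norm (phi x) <= C" using bounded_compact_support[OF cont_k supp(1)] by blast
 obtain D where D: "!!x. norm (dphi x) <= D" using bounded_compact_support[OF cont supp(2)] by blast
 show thesis
 proof (rule that[of "\<bar>C\<bar> + \<bar>D\<bar> + 1"])
  show "\<bar>phi x\<bar> <= \<bar>C\<bar> + \<bar>D\<bar> + 1" for x using C[of x] by auto
  show "norm (dphi x) <= \<bar>C\<bar> + \<bar>D\<bar> + 1" for x using D[of x] by auto
 qed auto
qed

context exit_cylinder begin

lemma inner_set_compact:
 assumes "d > 0"
 shows "compact {x\<in>Om. infdist x (frontier Om) >= d}"
proof -
 have "{x\<in>Om. infdist x (frontier Om) >= d} = closure Om \<inter> {x. d <= infdist x (frontier Om)}"
 proof -
  have "x : Om" if "x : closure Om" "d <= infdist x (frontier Om)" for x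
  proof (rule ccontr)
   assume "x \<notin> Om"
   then have "x : frontier Om" using that open_Om by (simp add: frontier_def interior_open)
   then show False using that assms by simp
  qed
  then show ?thesis using closure_subset[of Om] by auto
 qed
 moreover have "closed {x. d <= infdist x (frontier Om)}"
  by (intro closed_Collect_le continuous_intros)
 moreover have "compact (closure Om)" using bounded_Om by (simp add: compact_closure)
 ultimately show ?thesis by (simp add: compact_Int_closed)
qed

lemma near_inner_point:
 assumes y: "y : Om" and d: "dist x y < infdist y (frontier Om)"
 shows "x : Om" "infdist x (frontier Om) >= infdist y (frontier Om) - dist x y"
proof -
 show "infdist x (frontier Om) >= infdist y (frontier Om) - dist x y"
  using infdist_triangle[of y "frontier Om" x] by (simp add: dist_commute)
 show "x : Om"
 proof (rule ccontr)
  assume x: "x \<notin> Om"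
  have "ball y (infdist y (frontier Om)) \<inter> frontier Om \<noteq> {}"
  proof (rule connected_Int_frontier)
   show "connected (ball y (infdist y (frontier Om)))" by simp
   have "infdist y (frontier Om) > 0" using d zero_le_dist[of x y] by linarith
   then show "ball y (infdist y (frontier Om)) \<inter> Om \<noteq> {}" using y by (metis centre_in_ball disjoint_iff)
   show "ball y (infdist y (frontier Om)) - Om \<noteq> {}" using x d by (metis DiffI dist_commute empty_iff mem_ball)
  qed
  then obtain w where "w : frontier Om" "dist y w < infdist y (frontier Om)" by auto
  then show False using infdist_le[of w "frontier Om" y] by simp
 qed
qed

definition cutoff :: "real => real => 'a set => ('a => real) => ('a => 'a) => bool" where
 "cutoff c d K zet dzet \<longleftrightarrow> C1_test K zet dzet & K \<subseteq> Om & (\<forall>x. 0 <= zet x & zet x <= 1) &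
   (\<forall>x\<in>Om. d <= infdist x (frontier Om) --> zet x = 1) & (\<forall>x. norm (dzet x) <= c / d) & (\<forall>x. dzet x \<noteq> 0 --> x : layer d)"

text \<open>Mollifying the indicator of an inner set at a scale proportional to \<open>d\<close> gives gradients of order \<open>1/d\<close>.\<close>

lemma cutoff_exists:
 obtains c where "c > 0" "!!d. d > 0 ==> \<exists>K zet dzet. cutoff c d K zet dzet"
proof -
 define V where "V = measure lborel (ball (0::'a) 1)"
 have V: "V > 0" unfolding V_def by (rule content_ball_pos) simp
 define m where "m = bump_mass TYPE('a)"
 have m: "m > 0" unfolding m_def by (rule bump_mass_pos)
 have "\<exists>K zet dzet. cutoff (16 * V / m) d K zet dzet" if d: "d > 0" for d
 proof -
  define r where "r = d / 4"
  have r: "r > 0" using d by (simp add: r_def)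
  define D where "D = {x\<in>Om. infdist x (frontier Om) >= d / 2}"
  define K where "K = {x\<in>Om. infdist x (frontier Om) >= d / 4}"
  have cD: "compact D" and cK: "compact K" unfolding D_def K_def using inner_set_compact[of "d / 2"] inner_set_compact[of "d / 4"] d by simp_all
  have [measurable]: "D : sets borel" using cD by (simp add: compact_imp_closed)
  have iD: "lint (indicator D :: 'a => real)"
   using emeasure_compact_finite[OF cD] by (intro integrable_real_indicator) auto
  interpret k: smooth_kernel "moll r :: 'a => real" "moll_grad r" r by (rule smooth_kernel_moll[OF r])
  define zet where "zet = mollify (moll r) (indicator D :: 'a => real)"
  define dzet where "dzet x = (\<integral>y. indicator D y *# moll_grad r (x - y) \<partial>lborel)" for x
  have der: "(zet has_derivative (%h. dzet x \<bullet> h)) (at x)" for x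
   unfolding zet_def dzet_def by (rule k.mollify_has_derivative[OF iD])
  have zero: "zet x = 0" if "x \<notin> K" for x
   unfolding zet_def
  proof (rule mollify_support[OF r])
   fix y assume y: "dist x y < r"
   show "indicator D y = (0::real)"
   proof (rule ccontr)
   assume "indicator D y \<noteq> (0::real)"
   then have "y : Om" "infdist y (frontier Om) >= d / 2" by (auto simp: D_def indicator_def split: if_splits)
   then have "x : K" using near_inner_point[of y x] y d by (auto simp: K_def r_def)
   then show False using that by simp
   qed
  qed
  have t: "C1_test K zet dzet"
   unfolding C1_test_def using cK der zero k.continuous_mollify_grad[OF iD] by (auto simp: dzet_def)
  have im: "lint (%y. moll r (x - y))" for x :: 'a
   using nn_integral_moll(2)[OF r, of x] k.meas
   by (intro integrableI_nn_integral_finite[where x=1]) (auto simp: moll_nonneg r)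
  have m1: "(\<integral>y. moll r (x - y) \<partial>lborel) = 1" for x :: 'a
   using nn_integral_moll(2)[OF r, of x] nn_integral_eq_integral[OF im]
   by (auto simp: moll_nonneg r)
  have iDm: "lint (%y. moll r (x - y) * indicator D y)" for x
   using integrable_moll_scaleR[OF r iD, of x] by simp
  have range: "0 <= zet x & zet x <= 1" for x
  proof
   show "0 <= zet x" unfolding zet_def mollify_def by (intro integral_nonneg_AE) (auto simp: moll_nonneg r)
   have "zet x <= (\<integral>y. moll r (x - y) \<partial>lborel)"
   unfolding zet_def mollify_def real_scaleR_def by (intro integral_mono im iDm) (auto simp: moll_nonneg r indicator_def)
   then show "zet x <= 1" by (simp add: m1)
  qed
  have one: "zet x = 1" if x: "x : Om" "3 * d / 4 <= infdist x (frontier Om)" for x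
  proof -
   have "moll r (x - y) * indicator D y = moll r (x - y)" for y
   proof (cases "y : D")
   case False
   have "norm (x - y) >= r"
   proof (rule ccontr)
   assume "\<not> norm (x - y) >= r"
   then have "dist y x < r" by (simp add: dist_norm norm_minus_commute)
   then have "y : D" using near_inner_point[OF x(1), of y] x(2) d by (auto simp: D_def r_def)
   then show False using False by simp
   qed
   then show ?thesis by (simp add: moll_eq_0 r)
   qed simp
   then show ?thesis unfolding zet_def mollify_def real_scaleR_def by (simp only: m1)
  qed
  have lay: "x : layer d" if "dzet x \<noteq> 0" for x
  proof (rule ccontr)
   assume nl: "x \<notin> layer d"
   have "x : K" using C1_test_grad_zero[OF t, of x] that by auto
   then have x: "x : Om" "d <= infdist x (frontier Om)" using nl by (auto simp: K_def layer_def)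
   have "(zet has_derivative (%h. 0)) (at x)"
   proof (rule has_derivative_transform_within_open[OF has_derivative_const open_ball])
   show "x : ball x (d / 4)" using d by simp
   show "1 = zet y" if "y : ball x (d / 4)" for y
   using near_inner_point[OF x(1), of y] x(2) d that by (intro one[symmetric]) (auto simp: dist_commute)
   qed
   then have "(%h. dzet x \<bullet> h) = (%h. 0)" using der by (rule has_derivative_unique[rotated])
   then show False using that by (metis inner_eq_zero_iff)
  qed
  have bound: "norm (dzet x) <= (16 * V / m) / d" for x
  proof -
   let ?c = "(4 / m) / r ^ (DIM('a) + 1)"
   have ib: "lint (indicator (ball x r) :: 'a => real)"
   by (intro integrable_real_indicator emeasure_bounded_finite) auto
   have "norm (dzet x) <= (\<integral>y. ?c * indicator (ball x r) y \<partial>lborel)"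
   unfolding dzet_def
   proof (rule order_trans[OF integral_norm_bound], rule integral_mono')
   show "lint (%y. ?c * indicator (ball x r) y)" using ib by simp
   show "norm (indicator D y *# moll_grad r (x - y)) <= ?c * indicator (ball x r) y" for y
   proof (cases "y : ball x r")
   case True
   then show ?thesis using moll_grad_bound[OF r, of "x - y"] m r unfolding m_def[symmetric]
   by (auto simp: indicator_def)
   next
   case False
   then have "moll_grad r (x - y) = 0" by (intro moll_grad_eq_0[OF r]) (auto simp: dist_norm)
   then show ?thesis using False by simp
   qed
   show "0 <= ?c * indicator (ball x r) y" for y using m r by (auto simp: indicator_def)
   qed
   also have "\<dots> = ?c * measure lborel (ball x r)" by simp
   also have "measure lborel (ball x r) = V * r ^ DIM('a)"
   using r by (simp add: V_def content_ball)
   also have "?c * (V * r ^ DIM('a)) = (16 * V / m) / d"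
   using r d m by (simp add: r_def field_simps)
   finally show ?thesis .
  qed
  have "K \<subseteq> Om" by (auto simp: K_def)
  then show ?thesis unfolding cutoff_def
   using t range one lay bound d by (intro exI[of _ K] exI[of _ zet] exI[of _ dzet]) auto
 qed
 then show thesis using V m by (intro that[of "16 * V / m"]) auto
qed

lemma layer_pair_measurable [measurable]: "{0<..<T} \<times> layer d : sets borel"
 by (intro borel_Times) auto

lemma layer_integral_vanishes:
 fixes g :: "real \<times> 'a => real"
 assumes g: "lint g" and dlt: "dlt \<rightarrow> 0"
 shows "lint (%y. indicator ({0<..<T} \<times> layer (dlt n)) y * g y)"
  and "(%n. \<integral>y. indicator ({0<..<T} \<times> layer (dlt n)) y * g y \<partial>lborel) \<rightarrow> 0"
proof -
 have [measurable]: "g : borel_funs" using g by auto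
 show "lint (%y. indicator ({0<..<T} \<times> layer (dlt n)) y * g y)"
  using integrable_mult_indicator[OF _ g, of "{0<..<T} \<times> layer (dlt n)"] by simp
 have "(%n. \<integral>y. indicator ({0<..<T} \<times> layer (dlt n)) y * g y \<partial>lborel) \<rightarrow> (\<integral>y. 0 \<partial>(lborel :: (real \<times> 'a) measure))"
 proof (rule integral_dominated_convergence[where w="%y. \<bar>g y\<bar>"])
  show "AE y in lborel. (%n. indicator ({0<..<T} \<times> layer (dlt n)) y * g y) \<rightarrow> 0"
  proof (rule AE_I2)
   fix y :: "real \<times> 'a"
   show "(%n. indicator ({0<..<T} \<times> layer (dlt n)) y * g y) \<rightarrow> 0"
   proof (cases "snd y : Om")
   case True
   then have "snd y \<notin> frontier Om" using open_Om by (auto simp: frontier_def interior_open)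
   then have "infdist (snd y) (frontier Om) > 0"
   using in_closed_iff_infdist_zero[OF frontier_closed frontier_ne, of "snd y"] infdist_nonneg[of "snd y" "frontier Om"] by auto
   then have "\<forall>\<^sub>F n in sequentially. dlt n < infdist (snd y) (frontier Om)"
   by (intro order_tendstoD(2)[OF dlt]) auto
   then have "\<forall>\<^sub>F n in sequentially. indicator ({0<..<T} \<times> layer (dlt n)) y * g y = 0"
   by eventually_elim (auto simp: layer_def indicator_def)
   then show ?thesis by (rule tendsto_eventually)
   next
   case False
   then have "indicator ({0<..<T} \<times> layer (dlt n)) y * g y = 0" for n by (auto simp: layer_def indicator_def)
   then show ?thesis by (simp only:) simp
   qed
  qed
 qed (use g in \<open>auto simp: indicator_def\<close>)
 then show "(%n. \<integral>y. indicator ({0<..<T} \<times> layer (dlt n)) y * g y \<partial>lborel) \<rightarrow> 0" by simp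
qed

end

locale comparison_setting = exit_cylinder +
 fixes q :: real
 assumes q: "1 < q" and q_le: "!!x. q <= p x"
begin

definition sol :: "real => (real \<times> 'a => real) => (real \<times> 'a => 'a) => (real \<times> 'a => real) => (real \<times> 'a => real) => (real \<times> 'a => real) => bool" where
 "sol M u G z k F \<longleftrightarrow> state M u G & (AE y in lborel. y : Q --> 0 < u y) & lint z & lint k &
   F : borel_funs & (\<forall>y. 0 <= F y) &
   weak_div Q (%y. (0, p_flux (p (snd y)) (G y))) (%y. z y * u y powr (q - 1) - k y * u y powr (q - 1) - F y)"

definition trace0 :: "(real \<times> 'a => real) => (real \<times> 'a => 'a) => bool" where
 "trace0 u G \<longleftrightarrow> (AE t in lborel. t : {0<..<T} --> zero_trace (%x. u (t, x)) (%x. G (t, x)))"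

lemma solD:
 assumes "sol M u G z k F"
 shows "state M u G" "AE y in lborel. y : Q --> 0 < u y" "lint z" "lint k"
  "F : borel_funs" "0 <= F y"
  "weak_div Q (%y. (0, p_flux (p (snd y)) (G y))) (%y. z y * u y powr (q - 1) - k y * u y powr (q - 1) - F y)"
 using assms by (auto simp: sol_def simp del: split_paired_All)

lemma flux_meas:
 fixes G :: "real \<times> 'a => 'a"
 assumes [measurable]: "G : borel_funs"
 shows "(%y. p_flux (p (snd y)) (G y)) : borel_funs"
 unfolding p_flux_def by measurable

definition cut_fun :: "real \<times> (nat => 'a set) \<times> (nat => 'a => real) \<times> (nat => 'a => 'a)" where
 "cut_fun = (SOME (c, K, zet, dzet). c > 0 & (\<forall>n. cutoff c (rad n) (K n) (zet n) (dzet n)))"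

definition "cut_c = fst cut_fun"
definition "cut_K = fst (snd cut_fun)"
definition "zet = fst (snd (snd cut_fun))"
definition "dzet = snd (snd (snd cut_fun))"

lemma cut: "cut_c > 0" "cutoff cut_c (rad n) (cut_K n) (zet n) (dzet n)"
proof -
 obtain c where c: "c > 0" "!!d. d > 0 ==> \<exists>K zet dzet. cutoff c d K zet dzet" using cutoff_exists by blast
 define S where "S n w \<longleftrightarrow> cutoff c (rad n) (fst w) (fst (snd w)) (snd (snd w))" for n w
 have "\<forall>n. \<exists>w. S n w"
 proof
  fix n
  obtain K zet dzet where "cutoff c (rad n) K zet dzet" using c(2)[OF rad_pos] by blast
  then show "\<exists>w. S n w" unfolding S_def by (intro exI[of _ "(K, zet, dzet)"]) simp
 qed
 then obtain w where w: "!!n. S n (w n)" by metis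
 let ?P = "%(c, K, zet, dzet). c > 0 & (\<forall>n. cutoff c (rad n) (K n) (zet n) (dzet n))"
 have "?P (c, %n. fst (w n), %n. fst (snd (w n)), %n. snd (snd (w n)))" using w c(1) by (simp add: S_def)
 then have "?P cut_fun" unfolding cut_fun_def by (rule someI)
 then have "cut_c > 0 & (\<forall>n. cutoff cut_c (rad n) (cut_K n) (zet n) (dzet n))"
  by (simp add: cut_c_def cut_K_def zet_def dzet_def case_prod_beta)
 then show "cut_c > 0" "cutoff cut_c (rad n) (cut_K n) (zet n) (dzet n)" by auto
qed

lemma cutD:
 shows "C1_test (cut_K n) (zet n) (dzet n)" "cut_K n \<subseteq> Om" "0 <= zet n x" "zet n x <= 1"
  "norm (dzet n x) <= cut_c / rad n" "dzet n x \<noteq> 0 ==> x : layer (rad n)"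
  "x \<notin> Om ==> zet n x = 0" "zet n : borel_funs"
proof -
 note c = cut(2)[of n, unfolded cutoff_def]
 show t: "C1_test (cut_K n) (zet n) (dzet n)" "cut_K n \<subseteq> Om" "0 <= zet n x" "zet n x <= 1"
  "norm (dzet n x) <= cut_c / rad n" "dzet n x \<noteq> 0 ==> x : layer (rad n)" using c by auto
 show "x \<notin> Om ==> zet n x = 0" using C1_test_zero[OF t(1), of x] t(2) by auto
 show "zet n : borel_funs" by (rule C1_test_integrable(2)[OF t(1)])
qed

lemma cut_lim:
 assumes "x : Om"
 shows "(%n. zet n x) \<rightarrow> 1"
proof -
 have "x \<notin> frontier Om" using assms open_Om by (auto simp: frontier_def interior_open)
 then have "infdist x (frontier Om) > 0"
  using in_closed_iff_infdist_zero[OF frontier_closed frontier_ne, of x] infdist_nonneg[of x "frontier Om"] by auto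
 from rad_eventually[OF this] have "\<forall>\<^sub>F n in sequentially. zet n x = 1"
  by eventually_elim (use cut(2) assms in \<open>auto simp: cutoff_def\<close>)
 then show ?thesis by (rule tendsto_eventually)
qed

definition time_test :: "real set => (real => real) => (real => real) => bool" where
 "time_test K eta deta \<longleftrightarrow> C1_test K eta deta & K \<subseteq> {0<..<T} & (\<forall>t. 0 <= eta t)"

lemma test_product:
 assumes "time_test K eta deta"
 shows "C1_test (K \<times> cut_K n) (%y. eta (fst y) * zet n (snd y)) (%y. (deta (fst y) * zet n (snd y), eta (fst y) *# dzet n (snd y)))"
  "K \<times> cut_K n \<subseteq> Q" "eta : borel_funs" "!!t. t \<notin> {0<..<T} ==> eta t = 0"
proof -
 have t: "C1_test K eta deta" "K \<subseteq> {0<..<T}" using assms by (auto simp: time_test_def)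
 show "C1_test (K \<times> cut_K n) (%y. eta (fst y) * zet n (snd y)) (%y. (deta (fst y) * zet n (snd y), eta (fst y) *# dzet n (snd y)))"
  by (rule product_test[OF t(1) cutD(1)])
 show "K \<times> cut_K n \<subseteq> Q" using t(2) cutD(2)[of n] by auto
 show "eta : borel_funs" by (rule C1_test_integrable(2)[OF t(1)])
 show "eta s = 0" if "s \<notin> {0<..<T}" for s
  by (rule C1_test_zero[OF t(1)]) (use t(2) that in blast)
qed

definition energy :: "(real \<times> 'a => 'a) => real \<times> 'a => real" where
 "energy G y = norm (G y) powr p (snd y)"

definition resid :: "nat => (real \<times> 'a => real) => (real \<times> 'a => 'a) => real \<times> 'a => real" where
 "resid n u G y = indicator ({0<..<T} \<times> layer (rad n)) y * energy G y + indicator ({0<..<T} \<times> layer (rad n)) y * (u y / rad n) powr p (snd y)"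

lemma resid_nonneg: "0 <= resid n u G y"
 by (simp add: resid_def energy_def)

lemma resid_vanishes:
 assumes su: "state M u Gu" and tr: "trace0 u Gu" and sv: "state M' v G"
 shows "\<forall>\<^sub>F n in sequentially. lint (resid n u G)" "(%n. integral\<^sup>L lborel (resid n u G)) \<rightarrow> 0"
proof -
 have iE: "lint (energy G)" unfolding energy_def by (rule stateD(7)[OF sv])
 note a = layer_integral_vanishes[OF iE rad_tendsto]
 note b = layer_energy_vanishes[OF su tr[unfolded trace0_def] rad_pos rad_tendsto]
 show int: "\<forall>\<^sub>F n in sequentially. lint (resid n u G)"
  using b(1) by eventually_elim (unfold resid_def, intro BI_integrable_add a(1), simp)
 have "\<forall>\<^sub>F n in sequentially. (\<integral>y. indicator ({0<..<T} \<times> layer (rad n)) y * energy G y \<partial>lborel) + (\<integral>y. indicator ({0<..<T} \<times> layer (rad n)) y * (u y / rad n) powr p (snd y) \<partial>lborel) = integral\<^sup>L lborel (resid n u G)"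
  using b(1) by eventually_elim (unfold resid_def, subst BI_integral_add[OF a(1)], simp_all)
 then show "(%n. integral\<^sup>L lborel (resid n u G)) \<rightarrow> 0"
  by (rule Lim_transform_eventually[rotated]) (use tendsto_add[OF a(2) b(2)] in simp)
qed

lemma flux_layer_bound:
 assumes u: "0 <= u y" and eta: "!!t. \<bar>eta t\<bar> <= B" "!!t. t \<notin> {0<..<T} ==> eta t = 0"
 shows "\<bar>u y * (p_flux (p (snd y)) (G y) \<bullet> (eta (fst y) *# dzet n (snd y)))\<bar> <= B * cut_c * resid n u G y"
proof (cases "fst y : {0<..<T} & dzet n (snd y) \<noteq> 0")
 case False
 have "B >= 0" using eta(1)[of 0] by simp
 then show ?thesis using False eta(2)[of "fst y"] resid_nonneg[of n u G y] cut(1) by (auto simp: mult_nonneg_nonneg)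
next
 case True
 then have lay: "y : {0<..<T} \<times> layer (rad n)" using cutD(6)[of n "snd y"] by (cases y) auto
 let ?N = "norm (p_flux (p (snd y)) (G y))"
 have B: "B >= 0" using eta(1)[of 0] by simp
 have "\<bar>p_flux (p (snd y)) (G y) \<bullet> dzet n (snd y)\<bar> <= ?N * (cut_c / rad n)"
  using order_trans[OF Cauchy_Schwarz_ineq2 mult_left_mono[OF cutD(5)[of n "snd y"], of ?N]] by simp
 then have "\<bar>eta (fst y)\<bar> * \<bar>p_flux (p (snd y)) (G y) \<bullet> dzet n (snd y)\<bar> <= B * (?N * (cut_c / rad n))"
  using eta(1) B by (intro mult_mono) auto
 then have "u y * (\<bar>eta (fst y)\<bar> * \<bar>p_flux (p (snd y)) (G y) \<bullet> dzet n (snd y)\<bar>) <= u y * (B * (?N * (cut_c / rad n)))"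
  using u by (rule mult_left_mono)
 then have "\<bar>u y * (p_flux (p (snd y)) (G y) \<bullet> (eta (fst y) *# dzet n (snd y)))\<bar> <= (B * cut_c) * (?N * (u y / rad n))"
  using u by (simp add: abs_mult mult_ac)
 also have "?N * (u y / rad n) <= norm (G y) powr p (snd y) + (u y / rad n) powr p (snd y)"
  using u by (intro p_flux_young p_gt) (auto intro: divide_nonneg_pos)
 also have "\<dots> = resid n u G y" using lay by (simp add: resid_def energy_def)
 finally show ?thesis using B cut(1) by (simp add: mult_left_mono)
qed

end

section \<open>The integrated comparison\<close>

context comparison_setting begin

lemma energy_integrable: "state M u G ==> lint (energy G)"
 unfolding energy_def by (rule stateD(7))

lemma energy_nonneg: "0 <= energy G y"
 by (simp add: energy_def)

lemma integrable_bounded_mult: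
 fixes f g :: "real \<times> 'a => real"
 assumes "lint f" "g : borel_funs" "!!y. \<bar>g y\<bar> <= B"
 shows "lint (%y. f y * g y)"
 using integrable_scaleR_bounded[OF assms(1), of g B] assms(2,3) by (simp add: mult.commute)

lemma comp_fst_meas: "eta : borel_funs ==> (%y::real \<times> 'a. eta (fst y)) : borel_funs"
 "zet' : borel_funs ==> (%y::real \<times> 'a. zet' (snd y)) : borel_funs" for eta :: "real => real" and zet' :: "'a => real"
 by (auto intro: measurable_compose[OF borel_fst_snd(1)] measurable_compose[OF borel_fst_snd(2)])

text \<open>Testing with the solution itself, cut off at the boundary, bounds the integrals of the nonnegative function \<open>F u\<close> uniformly; Fatou gives the limit.\<close>

lemma source_integrable:
 assumes s: "sol M u G z k F" and tr: "trace0 u G" and t: "time_test K eta deta"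
 shows "lint (%y. indicator Q y * (F y * u y) * eta (fst y))"
proof -
 note sD = solD[OF s] and stD = stateD[OF solD(1)[OF s]]
 note tp = test_product[OF t]
 note [measurable] = stD(1,2) sD(5) tp(3) cutD(8) borel_measurable_integrable[OF sD(3), simplified] borel_measurable_integrable[OF sD(4), simplified]
 have eta0: "0 <= eta s" for s using t by (simp add: time_test_def)
 obtain B where B: "B > 0" "!!s. \<bar>eta s\<bar> <= B" using C1_test_bounded[of K eta deta] t unfolding time_test_def by metis
 have M: "M >= 0" using stD(3,4)[of undefined] by linarith
 define th where "th n y = eta (fst y) * zet n (snd y)" for n and y :: "real \<times> 'a"
 have th0: "0 <= th n y" "th n y <= B" for n y
  using eta0 B(2)[of "fst y"] cutD(3,4)[of n "snd y"] mult_mono[of "eta (fst y)" B "zet n (snd y)" 1] B(1) unfolding th_def by auto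
 let ?B = "%y. p_flux (p (snd y)) (G y)"
 let ?A = "%y. z y * u y powr (q - 1) - k y * u y powr (q - 1) - F y"
 define Fn where "Fn n y = ?A y * (u y * th n y) + ?B y \<bullet> (th n y *# (1 *# G y + 0 *# G y) + u y *# (eta (fst y) *# dzet n (snd y)))" for n y
 have Fn: "lint (Fn n)" "integral\<^sup>L lborel (Fn n) = 0" for n
 proof -
  have "lint (Fn n) & integral\<^sup>L lborel (Fn n) = 0"
   using composed_test[where Psi=fst and ?Psi1.0="%_. 1" and ?Psi2.0="%_. 0" and e="energy G", OF sD(7) _ energy_integrable[OF sD(1)] flux_meas[OF stD(2)] sD(1) sD(1) _ _ _ tp(1)[of n] tp(2)]
   unfolding Fn_def th_def energy_def by (simp add: p_flux_young p_gt has_derivative_fst[OF has_derivative_ident])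
  then show "lint (Fn n)" "integral\<^sup>L lborel (Fn n) = 0" by auto
 qed
 define W where "W y = (\<bar>z y\<bar> + \<bar>k y\<bar>) * (M powr q * B) + B * energy G y" for y
 have iW: "lint W" unfolding W_def
  by (intro BI_integrable_add integrable_mult_left integrable_mult_right integrable_abs sD(3,4) energy_integrable[OF sD(1)])
 have upper: "F y * u y * th n y <= W y + B * cut_c * resid n u G y - Fn n y" for n y
 proof -
  have uq: "u y powr (q - 1) * u y = u y powr q" using stD(3)[of y] powr_mult_base[of "u y" "q - 1"] by (simp add: mult.commute)
  have "Fn n y = (z y - k y) * u y powr q * th n y - F y * u y * th n y + energy G y * th n y + u y * (?B y \<bullet> (eta (fst y) *# dzet n (snd y)))"
   by (simp add: Fn_def inner_add_right p_flux_inner_self p_gt energy_def uq[symmetric] algebra_simps)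
  then have eq: "F y * u y * th n y = (z y - k y) * u y powr q * th n y + energy G y * th n y + u y * (?B y \<bullet> (eta (fst y) *# dzet n (snd y))) - Fn n y" by simp
  have "\<bar>z y - k y\<bar> * (u y powr q * th n y) <= (\<bar>z y\<bar> + \<bar>k y\<bar>) * (M powr q * B)"
   using th0[of n y] stD(3,4)[of y] q B(1) by (intro mult_mono powr_mono2) auto
  moreover have "(z y - k y) * u y powr q * th n y <= \<bar>z y - k y\<bar> * (u y powr q * th n y)"
   using th0[of n y] by (simp add: mult.assoc mult_right_mono)
  moreover have "energy G y * th n y <= B * energy G y"
   using th0[of n y] energy_nonneg[of G y] by (subst mult.commute, intro mult_right_mono)
  moreover have "u y * (?B y \<bullet> (eta (fst y) *# dzet n (snd y))) <= B * cut_c * resid n u G y"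
   using flux_layer_bound[of u y eta B G n] stD(3)[of y] B(2) tp(4) by force
  ultimately show ?thesis unfolding eq W_def by linarith
 qed
 note R = resid_vanishes[OF sD(1) tr sD(1)]
 have "\<forall>\<^sub>F n in sequentially. integral\<^sup>L lborel (resid n u G) < 1" using R(2) by (rule order_tendstoD) simp
 with R(1) have ev: "\<forall>\<^sub>F n in sequentially. (\<integral>\<^sup>+y. ennreal (F y * u y * th n y) \<partial>lborel) <= ennreal (integral\<^sup>L lborel W + B * cut_c)"
 proof eventually_elim
  case (elim n)
  have i: "lint (%y. W y + B * cut_c * resid n u G y - Fn n y)"
   by (intro BI_integrable_add BI_integrable_diff integrable_mult_right iW Fn elim)
  have nn: "0 <= F y * u y * th n y" for y using sD(6) stD(3) th0 by simp
  have "(\<integral>\<^sup>+y. ennreal (F y * u y * th n y) \<partial>lborel) <= (\<integral>\<^sup>+y. ennreal (W y + B * cut_c * resid n u G y - Fn n y) \<partial>lborel)"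
   by (intro nn_integral_mono ennreal_leI upper)
  also have "\<dots> = ennreal (\<integral>y. W y + B * cut_c * resid n u G y - Fn n y \<partial>lborel)"
   by (rule nn_integral_eq_integral[OF i]) (intro AE_I2 order_trans[OF nn upper])
  also have "(\<integral>y. W y + B * cut_c * resid n u G y - Fn n y \<partial>lborel) = integral\<^sup>L lborel W + B * cut_c * integral\<^sup>L lborel (resid n u G) - 0"
   using iW Fn elim(1) by (simp add: integrable_mult_right)
  also have "ennreal \<dots> <= ennreal (integral\<^sup>L lborel W + B * cut_c)"
  proof -
   have "B * cut_c * integral\<^sup>L lborel (resid n u G) <= B * cut_c * 1" using elim(2) B(1) cut(1) by (intro mult_left_mono) auto
   then show ?thesis by (intro ennreal_leI) simp
  qed
  finally show ?case .
 qed
 let ?g = "%y. indicator Q y * (F y * u y) * eta (fst y)"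
 show ?thesis
 proof (rule integrableI_nonneg)
  show "?g : borel_measurable lborel" by measurable
  show "AE y in lborel. 0 <= ?g y" using sD(6) stD(3) eta0 by (intro AE_I2) simp
  have "(\<integral>\<^sup>+y. ennreal (?g y) \<partial>lborel) <= (\<integral>\<^sup>+y. liminf (%n. ennreal (F y * u y * th n y)) \<partial>lborel)"
  proof (rule nn_integral_mono)
   fix y :: "real \<times> 'a"
   show "ennreal (?g y) <= liminf (%n. ennreal (F y * u y * th n y))"
   proof (cases "y : Q")
   case True
   then have "(%n. ennreal (F y * u y * th n y)) \<rightarrow> ennreal (F y * u y * (eta (fst y) * 1))"
   unfolding th_def by (intro tendsto_ennrealI tendsto_intros cut_lim) auto
   then show ?thesis using True lim_imp_Liminf[OF sequentially_bot, of "%n. ennreal (F y * u y * th n y)"] by simp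
   qed simp
  qed
  also have "\<dots> <= liminf (%n. \<integral>\<^sup>+y. ennreal (F y * u y * th n y) \<partial>lborel)"
  proof (rule nn_integral_liminf)
   show "(%y. ennreal (F y * u y * th n y)) : borel_measurable lborel" for n
   unfolding th_def using comp_fst_meas(2)[OF cutD(8)[of n]] comp_fst_meas(1)[OF tp(3)] by measurable
  qed
  also have "\<dots> <= liminf (%n::nat. ennreal (integral\<^sup>L lborel W + B * cut_c))" by (rule Liminf_mono[OF ev])
  also have "\<dots> = ennreal (integral\<^sup>L lborel W + B * cut_c)" by (simp add: Liminf_const)
  finally show "(\<integral>\<^sup>+y. ennreal (?g y) \<partial>lborel) < \<infinity>" by (simp add: le_less_trans)
 qed
qed

definition comp_H :: "real => (real \<times> 'a => real) => (real \<times> 'a => real) => real \<times> 'a => real" where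
 "comp_H eps u v y = pos_reg (eps powr (q + 1)) (u y powr q - (v y + eps) powr q)"

definition comp_a :: "real => (real \<times> 'a => real) => real \<times> 'a => real" where
 "comp_a eps v y = (v y / (v y + eps)) powr (q - 1)"

text \<open>All terms of the difference of the two tested identities except those with the gradient of the cutoff. The reaction terms are compared through the order hypothesis; replacing \<open>v\<close> by \<open>v + \<epsilon>\<close> leaves the error with the factor \<open>1 - comp_a\<close>.\<close>

lemma comp_pointwise:
 fixes Gu Gv :: "real \<times> 'a => 'a"
 assumes eps: "eps > 0" and th: "0 <= th" and u: "0 < u y" "u y <= M" and v: "0 < v y"
  and F: "0 <= Fu y" "0 <= Fv y" "v y < u y ==> Fu y * v y powr (q - 1) <= Fv y * u y powr (q - 1)"
 defines "z \<equiv> (u y, v y)"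
 shows "(((zu y - h y) - (zv y - g y) * comp_a eps v y) * comp_H eps u v y - Fu y * u y * (1 - comp_a eps v y)
   - (q - 1) * eps * (energy Gu y + energy Gv y)) * th <=
  (zu y * u y powr (q - 1) - h y * u y powr (q - 1) - Fu y) * (quotient_tests.Psiu q eps (eps powr (q + 1)) z * th)
   - (zv y * v y powr (q - 1) - g y * v y powr (q - 1) - Fv y) * (quotient_tests.Psiv q eps (eps powr (q + 1)) z * th)
   + th * (p_flux (p (snd y)) (Gu y) \<bullet> (quotient_tests.Psiu1 q eps (eps powr (q + 1)) z *# Gu y + quotient_tests.Psiu2 q eps (eps powr (q + 1)) z *# Gv y))
   - th * (p_flux (p (snd y)) (Gv y) \<bullet> (quotient_tests.Psiv1 q eps (eps powr (q + 1)) z *# Gu y + quotient_tests.Psiv2 q eps (eps powr (q + 1)) z *# Gv y))" (is "?L * th <= ?R")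
  and "0 <= quotient_tests.Psiu q eps (eps powr (q + 1)) z" "quotient_tests.Psiu q eps (eps powr (q + 1)) z <= u y"
  "0 <= quotient_tests.Psiv q eps (eps powr (q + 1)) z" "quotient_tests.Psiv q eps (eps powr (q + 1)) z <= (M powr (q - 1) * eps powr (1 - q)) * u y"
proof -
 let ?kap = "eps powr (q + 1)"
 have kap: "?kap > 0" using eps by simp
 interpret T: quotient_tests q eps ?kap M by unfold_locales (use q eps in auto)
 let ?b = "v y + eps"
 have b: "?b > 0" "eps <= ?b" using v eps by auto
 have gap: "T.gap z = u y powr q - ?b powr q" using u by (simp add: T.gap_def z_def max_def)
 define H D where "H = pos_reg ?kap (u y powr q - ?b powr q)" and "D = pos_reg' ?kap (u y powr q - ?b powr q)"
 have Hc: "comp_H eps u v y = H" by (simp add: comp_H_def H_def)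
 have H0: "0 <= H" unfolding H_def by (rule pos_reg_bounds[OF kap])
 have Hu: "H <= u y powr q"
  unfolding H_def by (rule order_trans[OF pos_reg_bounds(2)[OF kap]]) simp
 have D0: "0 <= D" unfolding D_def by (rule pos_reg_bounds[OF kap])
 have HD: "\<bar>(u y powr q - ?b powr q) * D - H\<bar> <= ?kap" unfolding H_def D_def by (rule pos_reg_bounds[OF kap])
 have P: "T.Psiu z = H * u y powr (1 - q)" "T.Psiu1 z = D * q - (q - 1) * H * u y powr (- q)"
   "T.Psiu2 z = - (D * q * ?b powr (q - 1) * u y powr (1 - q))"
   "T.Psiv z = H * ?b powr (1 - q)" "T.Psiv1 z = D * q * u y powr (q - 1) * ?b powr (1 - q)"
   "T.Psiv2 z = - (D * q) - (q - 1) * H * ?b powr (- q)"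
  unfolding T.Psiu_def T.Psiu1_def T.Psiu2_def T.Psiv_def T.Psiv1_def T.Psiv2_def gap H_def D_def using u by (simp_all add: z_def max_def)
 have a01: "0 <= comp_a eps v y" "comp_a eps v y <= 1"
  using v eps q unfolding comp_a_def by (auto intro!: powr_le1)
 have ac: "comp_a eps v y = v y powr (q - 1) * ?b powr (1 - q)"
  unfolding comp_a_def using v b powr_minus_divide[of ?b "q - 1"] by (simp add: powr_divide)
 have uu: "u y powr (q - 1) * u y powr (1 - q) = 1" "u y powr q * u y powr (1 - q) = u y" "u y powr (q - 1) * u y = u y powr q"
  using u powr_mult_base[of "u y" "q - 1"] by (simp_all add: mult.commute flip: powr_add)
 have Pu: "H * u y powr (1 - q) <= u y" using mult_right_mono[OF Hu, of "u y powr (1 - q)"] uu(2) by simp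
 show "0 <= T.Psiu z" "T.Psiu z <= u y" "0 <= T.Psiv z" unfolding P using H0 Pu by auto
 show "T.Psiv z <= (M powr (q - 1) * eps powr (1 - q)) * u y"
 proof -
  have "H * ?b powr (1 - q) <= u y powr q * eps powr (1 - q)"
   using Hu eps b q by (intro mult_mono powr_mono2') auto
  also have "u y powr q = u y powr (q - 1) * u y" using uu(3) by simp
  also have "u y powr (q - 1) * u y * eps powr (1 - q) <= M powr (q - 1) * u y * eps powr (1 - q)"
   using u q by (intro mult_right_mono powr_mono2) auto
  finally show ?thesis unfolding P by (simp add: mult_ac)
 qed
 have E: "0 <= energy Gu y" "0 <= energy Gv y" by (simp_all add: energy_nonneg)
 show "?L * th <= ?R"
 proof (cases "u y <= ?b")
  case True
  have zz: "T.Psiu z = 0" "T.Psiu1 z = 0" "T.Psiu2 z = 0" "T.Psiv z = 0" "T.Psiv1 z = 0" "T.Psiv2 z = 0"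
   using T.gap_zero[of z] True v eps by (auto simp: z_def)
  have "H = 0" using zz(4) b unfolding P by auto
  have "0 <= Fu y * u y * (1 - comp_a eps v y)" "0 <= (q - 1) * eps * (energy Gu y + energy Gv y)"
   using F u a01 q eps E by (auto intro!: mult_nonneg_nonneg)
  then have "?L <= 0" unfolding Hc \<open>H = 0\<close> by simp
  then have "?L * th <= 0" using th by (rule mult_nonpos_nonneg)
  then show ?thesis unfolding zz by simp
 next
  case False
  then have ub: "u y > ?b" by simp
  have "- ((q - 1) * ?kap * (u y powr (- q) * norm (Gu y) powr p (snd y) + ?b powr (- q) * norm (Gv y) powr p (snd y))) <=
   p_flux (p (snd y)) (Gu y) \<bullet> (T.Psiu1 z *# Gu y + T.Psiu2 z *# Gv y) - p_flux (p (snd y)) (Gv y) \<bullet> (T.Psiv1 z *# Gu y + T.Psiv2 z *# Gv y)" (is "_ <= ?I")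
   unfolding P by (rule picone_flux[OF u(1) b(1) q q_le D0 HD])
  moreover have "(q - 1) * ?kap * (u y powr (- q) * energy Gu y + ?b powr (- q) * energy Gv y) <= (q - 1) * eps * (energy Gu y + energy Gv y)"
  proof -
   have "u y powr (- q) <= eps powr (- q)" "?b powr (- q) <= eps powr (- q)"
   using ub b eps q by (auto intro!: powr_mono2')
   then have "u y powr (- q) * energy Gu y + ?b powr (- q) * energy Gv y <= eps powr (- q) * energy Gu y + eps powr (- q) * energy Gv y"
   using E by (intro add_mono mult_right_mono) auto
   then have "(q - 1) * ?kap * (u y powr (- q) * energy Gu y + ?b powr (- q) * energy Gv y) <= (q - 1) * ?kap * (eps powr (- q) * energy Gu y + eps powr (- q) * energy Gv y)"
   using q by (intro mult_left_mono) auto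
   also have "\<dots> = (q - 1) * (?kap * eps powr (- q)) * (energy Gu y + energy Gv y)" by (simp add: algebra_simps)
   also have "?kap * eps powr (- q) = eps" using eps by (simp flip: powr_add)
   finally show ?thesis .
  qed
  ultimately have I: "- ((q - 1) * eps * (energy Gu y + energy Gv y)) <= ?I" unfolding energy_def by linarith
  have src: "Fu y * (H * u y powr (1 - q)) - Fv y * (H * ?b powr (1 - q)) <= Fu y * u y * (1 - comp_a eps v y)"
  proof -
   have "Fu y * v y powr (q - 1) <= Fv y * u y powr (q - 1)" using F(3) ub eps by simp
   from mult_right_mono[OF this, of "u y powr (1 - q) * (H * ?b powr (1 - q))"] H0
   have "Fu y * v y powr (q - 1) * (u y powr (1 - q) * (H * ?b powr (1 - q))) <= Fv y * (u y powr (q - 1) * u y powr (1 - q)) * (H * ?b powr (1 - q))"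
   by (simp add: mult_ac)
   then have "Fu y * (H * u y powr (1 - q)) * comp_a eps v y <= Fv y * (H * ?b powr (1 - q))"
   unfolding uu ac by (simp add: mult_ac)
   then have "Fu y * (H * u y powr (1 - q)) - Fv y * (H * ?b powr (1 - q)) <= Fu y * (H * u y powr (1 - q)) * (1 - comp_a eps v y)"
   by (simp add: algebra_simps)
   also have "\<dots> <= Fu y * u y * (1 - comp_a eps v y)" using Pu F a01 by (intro mult_right_mono mult_left_mono) auto
   finally show ?thesis .
  qed
  have "?R = ((zu y - h y) * (u y powr (q - 1) * u y powr (1 - q)) * H - Fu y * (H * u y powr (1 - q))
   - ((zv y - g y) * comp_a eps v y * H - Fv y * (H * ?b powr (1 - q))) + ?I) * th"
   unfolding P(1,4) ac by (simp add: algebra_simps)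
  also have "\<dots> = ((zu y - h y) * H - (zv y - g y) * comp_a eps v y * H - (Fu y * (H * u y powr (1 - q)) - Fv y * (H * ?b powr (1 - q))) + ?I) * th"
   unfolding uu by (simp add: algebra_simps)
  also have "\<dots> >= ?L * th"
  proof (rule mult_right_mono[OF _ th])
   have "((zu y - h y) - (zv y - g y) * comp_a eps v y) * H = (zu y - h y) * H - (zv y - g y) * comp_a eps v y * H" by (simp add: algebra_simps)
   then show "?L <= (zu y - h y) * H - (zv y - g y) * comp_a eps v y * H - (Fu y * (H * u y powr (1 - q)) - Fv y * (H * ?b powr (1 - q))) + ?I"
   unfolding Hc using src I by linarith
  qed
  finally show ?thesis .
 qed
qed

end

context comparison_setting begin

lemma comp_bounds:
 assumes "state M u Gu" "state M v Gv" "eps > 0"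
 shows "0 <= comp_H eps u v y" "comp_H eps u v y <= M powr q" "0 <= comp_a eps v y" "comp_a eps v y <= 1"
  "comp_H eps u v : borel_funs" "comp_a eps v : borel_funs"
proof -
 note [measurable] = stateD(1)[OF assms(1)] stateD(1)[OF assms(2)]
 have kap: "eps powr (q + 1) > 0" using assms(3) by simp
 show "0 <= comp_H eps u v y" unfolding comp_H_def by (rule pos_reg_bounds[OF kap])
 have "comp_H eps u v y <= max 0 (u y powr q - (v y + eps) powr q)" unfolding comp_H_def by (rule pos_reg_bounds[OF kap])
 also have "\<dots> <= u y powr q" by simp
 also have "\<dots> <= M powr q" using stateD(3,4)[OF assms(1), of y] q by (intro powr_mono2) auto
 finally show "comp_H eps u v y <= M powr q" .
 have "0 <= v y / (v y + eps)" "v y / (v y + eps) <= 1" using stateD(3)[OF assms(2), of y] assms(3) by auto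
 then show "0 <= comp_a eps v y" "comp_a eps v y <= 1"
  unfolding comp_a_def using q powr_mono2[of "q - 1" "v y / (v y + eps)" 1] by (simp_all del: abs_divide)
 show "comp_H eps u v : borel_funs" unfolding comp_H_def[abs_def] pos_reg_def by measurable
 show "comp_a eps v : borel_funs" unfolding comp_a_def[abs_def] by measurable
qed

definition comp_X where
 "comp_X eps u v Gu Gv zu zv h g Fu y = ((zu y - h y) - (zv y - g y) * comp_a eps v y) * comp_H eps u v y
   - Fu y * u y * (1 - comp_a eps v y) - (q - 1) * eps * (energy Gu y + energy Gv y)"

lemma comp_X_dominated:
 assumes su: "sol M u Gu zu h Fu" and sv: "sol M v Gv zv g Fv" and tr: "trace0 u Gu" and t: "time_test K eta deta"
 obtains W where "lint W"
  "!!eps y. 0 < eps ==> eps <= 1 ==> \<bar>indicator Q y * comp_X eps u v Gu Gv zu zv h g Fu y * eta (fst y)\<bar> <= W y"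
  "!!eps. 0 < eps ==> (%y. indicator Q y * comp_X eps u v Gu Gv zu zv h g Fu y * eta (fst y)) : borel_funs"
proof -
 note uD = solD[OF su] and vD = solD[OF sv]
 note us = stateD[OF uD(1)] and vs = stateD[OF vD(1)]
 have eta0: "0 <= eta s" for s using t by (simp add: time_test_def)
 obtain B where B: "B > 0" "!!s. \<bar>eta s\<bar> <= B" using C1_test_bounded[of K eta deta] t unfolding time_test_def by metis
 note [measurable] = us(1,2) vs(1,2) uD(5) vD(5) comp_fst_meas(1)[OF test_product(3)[OF t]]
  borel_measurable_integrable[OF uD(3), simplified] borel_measurable_integrable[OF uD(4), simplified]
  borel_measurable_integrable[OF vD(3), simplified] borel_measurable_integrable[OF vD(4), simplified]
 define W where "W y = (\<bar>zu y\<bar> + \<bar>h y\<bar> + (\<bar>zv y\<bar> + \<bar>g y\<bar>)) * (M powr q * B) + indicator Q y * (Fu y * u y) * eta (fst y) + ((q - 1) * B) * (energy Gu y + energy Gv y)" for y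
 show thesis
 proof (rule that[of W])
  show "lint W" unfolding W_def
   by (intro BI_integrable_add integrable_mult_left integrable_mult_right integrable_abs uD(3,4) vD(3,4)
   energy_integrable[OF uD(1)] energy_integrable[OF vD(1)] source_integrable[OF su tr t])
  fix eps :: real
  assume eps: "0 < eps"
  note cb = comp_bounds[OF uD(1) vD(1) eps]
  note [measurable] = cb(5,6)
  have [measurable]: "energy Gu : borel_funs" "energy Gv : borel_funs"
   unfolding energy_def[abs_def] by measurable
  show "(%y. indicator Q y * comp_X eps u v Gu Gv zu zv h g Fu y * eta (fst y)) : borel_funs"
   unfolding comp_X_def by measurable
  fix y
  assume eps1: "eps <= 1"
  show "\<bar>indicator Q y * comp_X eps u v Gu Gv zu zv h g Fu y * eta (fst y)\<bar> <= W y"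
  proof (cases "y : Q")
   case False
   then show ?thesis unfolding W_def using B(1) energy_nonneg q by (auto intro!: add_nonneg_nonneg mult_nonneg_nonneg)
  next
   case True
   let ?a = "comp_a eps v y" and ?H = "comp_H eps u v y" and ?e = "eta (fst y)"
   have e: "0 <= ?e" "?e <= B" using eta0 B(2)[of "fst y"] by auto
   have E: "0 <= energy Gu y + energy Gv y" using energy_nonneg by (intro add_nonneg_nonneg)
   have n1: "\<bar>((zu y - h y) - (zv y - g y) * ?a) * ?H * ?e\<bar> <= (\<bar>zu y\<bar> + \<bar>h y\<bar> + (\<bar>zv y\<bar> + \<bar>g y\<bar>)) * (M powr q * B)"
   proof -
   have "\<bar>(zv y - g y) * ?a\<bar> <= \<bar>zv y - g y\<bar> * 1" unfolding abs_mult using cb(3,4)[of y] by (intro mult_left_mono) auto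
   moreover have "\<bar>a - b - x\<bar> <= \<bar>a\<bar> + \<bar>b\<bar> + (\<bar>c\<bar> + \<bar>d\<bar>)" if "\<bar>x\<bar> <= \<bar>c - d\<bar> * 1" for a b c d x :: real
   using that abs_triangle_ineq4[of c d] abs_triangle_ineq4[of a b] abs_triangle_ineq4[of "a - b" x] by linarith
   ultimately have "\<bar>(zu y - h y) - (zv y - g y) * ?a\<bar> <= \<bar>zu y\<bar> + \<bar>h y\<bar> + (\<bar>zv y\<bar> + \<bar>g y\<bar>)" by blast
   moreover have "\<bar>?H * ?e\<bar> <= M powr q * B" unfolding abs_mult using cb(1,2)[of y] e by (intro mult_mono) auto
   ultimately have "\<bar>(zu y - h y) - (zv y - g y) * ?a\<bar> * \<bar>?H * ?e\<bar> <= (\<bar>zu y\<bar> + \<bar>h y\<bar> + (\<bar>zv y\<bar> + \<bar>g y\<bar>)) * (M powr q * B)"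
   by (intro mult_mono) auto
   then show ?thesis by (simp add: abs_mult mult.assoc)
   qed
   have n2: "\<bar>Fu y * u y * (1 - ?a) * ?e\<bar> <= Fu y * u y * ?e"
   proof -
   have "0 <= Fu y * u y" using uD(6) us(3) by simp
   then have "Fu y * u y * (1 - ?a) <= Fu y * u y * 1" "0 <= Fu y * u y * (1 - ?a)"
   using cb(3,4)[of y] mult_left_mono[of "1 - ?a" 1 "Fu y * u y"] mult_nonneg_nonneg[of "Fu y * u y" "1 - ?a"] by (simp_all del: mult_nonneg_nonneg)
   then show ?thesis using e by (simp add: abs_mult mult_right_mono)
   qed
   have n3: "\<bar>(q - 1) * eps * (energy Gu y + energy Gv y) * ?e\<bar> <= ((q - 1) * B) * (energy Gu y + energy Gv y)"
   proof -
   have "eps * ?e <= 1 * B" using eps eps1 e by (intro mult_mono) auto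
   then have "(q - 1) * (energy Gu y + energy Gv y) * (eps * ?e) <= (q - 1) * (energy Gu y + energy Gv y) * B"
   using q E by (intro mult_left_mono mult_nonneg_nonneg) auto
   moreover have "0 <= (q - 1) * (energy Gu y + energy Gv y) * (eps * ?e)" using q E eps e by (intro mult_nonneg_nonneg) auto
   ultimately show ?thesis by (simp add: mult_ac)
   qed
   have eq: "indicator Q y * comp_X eps u v Gu Gv zu zv h g Fu y * ?e = ((zu y - h y) - (zv y - g y) * ?a) * ?H * ?e - Fu y * u y * (1 - ?a) * ?e - (q - 1) * eps * (energy Gu y + energy Gv y) * ?e"
   using True by (simp add: comp_X_def left_diff_distrib)
   have abs3: "\<bar>a - b - c\<bar> <= a' + b' + c'" if "\<bar>a\<bar> <= a'" "\<bar>b\<bar> <= b'" "\<bar>c\<bar> <= c'" for a b c a' b' c' :: real using that by linarith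
   have "W y = (\<bar>zu y\<bar> + \<bar>h y\<bar> + (\<bar>zv y\<bar> + \<bar>g y\<bar>)) * (M powr q * B) + Fu y * u y * ?e + ((q - 1) * B) * (energy Gu y + energy Gv y)"
   using True by (simp add: W_def)
   then show ?thesis using abs3[OF n1 n2 n3] eq by (simp only:)
  qed
 qed
qed

text \<open>Letting the boundary cutoff tend to one: the terms with its gradient are bounded by the residual energies of the boundary layer.\<close>

lemma comparison_eps:
 assumes su: "sol M u Gu zu h Fu" and sv: "sol M v Gv zv g Fv" and tr: "trace0 u Gu" and t: "time_test K eta deta"
  and eps: "0 < eps" "eps <= 1"
  and order: "AE y in lborel. y : Q --> v y < u y --> Fu y * v y powr (q - 1) <= Fv y * u y powr (q - 1)"
 shows "(\<integral>y. indicator Q y * comp_X eps u v Gu Gv zu zv h g Fu y * eta (fst y) \<partial>lborel) <= 0"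
proof -
 note uD = solD[OF su] and vD = solD[OF sv]
 note us = stateD[OF uD(1)] and vs = stateD[OF vD(1)]
 note tp = test_product[OF t]
 have eta0: "0 <= eta s" for s using t by (simp add: time_test_def)
 obtain B where B: "B > 0" "!!s. \<bar>eta s\<bar> <= B" using C1_test_bounded[of K eta deta] t unfolding time_test_def by metis
 let ?kap = "eps powr (q + 1)"
 interpret TT: quotient_tests q eps ?kap M by unfold_locales (use q eps in auto)
 define X where "X = comp_X eps u v Gu Gv zu zv h g Fu"
 obtain W where W: "lint W" "!!y. \<bar>indicator Q y * X y * eta (fst y)\<bar> <= W y"
  "(%y. indicator Q y * X y * eta (fst y)) : borel_funs"
 proof (rule comp_X_dominated[OF su sv tr t])
  fix W
  assume "lint W"
   "!!eps y. 0 < eps ==> eps <= 1 ==> \<bar>indicator Q y * comp_X eps u v Gu Gv zu zv h g Fu y * eta (fst y)\<bar> <= W y"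
   "!!eps. 0 < eps ==> (%y. indicator Q y * comp_X eps u v Gu Gv zu zv h g Fu y * eta (fst y)) : borel_funs"
  with eps show thesis by (intro that[of W]) (simp_all only: X_def)
 qed
 define th where "th n y = eta (fst y) * zet n (snd y)" for n and y :: "real \<times> 'a"
 have th0: "0 <= th n y" for n y using eta0 cutD(3)[of n "snd y"] unfolding th_def by auto
 let ?w = "%n y. eta (fst y) *# dzet n (snd y)"
 let ?Bu = "%y. p_flux (p (snd y)) (Gu y)" and ?Bv = "%y. p_flux (p (snd y)) (Gv y)"
 let ?Au = "%y. zu y * u y powr (q - 1) - h y * u y powr (q - 1) - Fu y"
 let ?Av = "%y. zv y * v y powr (q - 1) - g y * v y powr (q - 1) - Fv y"
 let ?z = "%y. (u y, v y)"
 define Pu where "Pu n y = ?Au y * (TT.Psiu (?z y) * th n y) + ?Bu y \<bullet> (th n y *# (TT.Psiu1 (?z y) *# Gu y + TT.Psiu2 (?z y) *# Gv y) + TT.Psiu (?z y) *# ?w n y)" for n y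
 define Pv where "Pv n y = ?Av y * (TT.Psiv (?z y) * th n y) + ?Bv y \<bullet> (th n y *# (TT.Psiv1 (?z y) *# Gu y + TT.Psiv2 (?z y) *# Gv y) + TT.Psiv (?z y) *# ?w n y)" for n y
 have Pu: "lint (Pu n) & integral\<^sup>L lborel (Pu n) = 0" for n
  using composed_test[where Psi=TT.Psiu and ?Psi1.0=TT.Psiu1 and ?Psi2.0=TT.Psiu2 and e="energy Gu", OF uD(7) _ energy_integrable[OF uD(1)] flux_meas[OF us(2)] uD(1) vD(1) TT.Psi_deriv(1) TT.Psi_cont(1,2) tp(1)[of n] tp(2)]
  unfolding Pu_def th_def energy_def by (simp add: p_flux_young p_gt)
 have Pv: "lint (Pv n) & integral\<^sup>L lborel (Pv n) = 0" for n
  using composed_test[where Psi=TT.Psiv and ?Psi1.0=TT.Psiv1 and ?Psi2.0=TT.Psiv2 and e="energy Gv", OF vD(7) _ energy_integrable[OF vD(1)] flux_meas[OF vs(2)] uD(1) vD(1) TT.Psi_deriv(2) TT.Psi_cont(3,4) tp(1)[of n] tp(2)]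
  unfolding Pv_def th_def energy_def by (simp add: p_flux_young p_gt)
 define c where "c = M powr (q - 1) * eps powr (1 - q)"
 have c: "c >= 0" by (simp add: c_def)
 have lower: "AE y in lborel. indicator Q y * X y * eta (fst y) * zet n (snd y) - B * cut_c * resid n u Gu y - c * (B * cut_c) * resid n u Gv y <= Pu n y - Pv n y" for n
  using order uD(2) vD(2)
 proof eventually_elim
  case (elim y)
  have r0: "0 <= B * cut_c * resid n u Gu y" "0 <= c * (B * cut_c) * resid n u Gv y"
   using B(1) cut(1) c resid_nonneg[of n u Gu y] resid_nonneg[of n u Gv y] by (auto intro!: mult_nonneg_nonneg)
  show ?case
  proof (cases "y : Q")
   case False
   then have "eta (fst y) = 0 \<or> (zet n (snd y) = 0 & dzet n (snd y) = 0)"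
   using tp(4)[of "fst y"] cutD(7)[of "snd y" n] cutD(6)[of n "snd y"] by (cases y) (auto simp: layer_def)
   then have "Pu n y = 0" "Pv n y = 0" by (auto simp: Pu_def Pv_def th_def)
   then show ?thesis using False r0 by simp
  next
   case True
   have uv: "0 < u y" "0 < v y" using elim True by auto
   have ord: "v y < u y ==> Fu y * v y powr (q - 1) <= Fv y * u y powr (q - 1)" using elim True by auto
   note cp = comp_pointwise(1)[where eps=eps and th="th n y" and u=u and v=v and y=y and M=M and Fu=Fu and Fv=Fv and zu=zu and h=h and zv=zv and g=g and Gu=Gu and Gv=Gv,
   OF eps(1) th0[of n y] uv(1) us(4)[of y] uv(2) uD(6)[of y] vD(6)[of y] ord]
   comp_pointwise(2-)[where eps=eps and th="th n y" and u=u and v=v and y=y and M=M and Fu=Fu and Fv=Fv,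
   OF eps(1) th0[of n y] uv(1) us(4)[of y] uv(2) uD(6)[of y] vD(6)[of y] ord]
   have b1: "\<bar>TT.Psiu (?z y) * (?Bu y \<bullet> ?w n y)\<bar> <= B * cut_c * resid n u Gu y"
   proof -
   have "\<bar>TT.Psiu (?z y) * (?Bu y \<bullet> ?w n y)\<bar> <= \<bar>u y * (?Bu y \<bullet> ?w n y)\<bar>"
   unfolding abs_mult using cp(2,3) uv by (intro mult_right_mono) auto
   also have "\<dots> <= B * cut_c * resid n u Gu y"
   by (rule flux_layer_bound) (use uv B(2) tp(4) in auto)
   finally show ?thesis .
   qed
   have b2: "\<bar>TT.Psiv (?z y) * (?Bv y \<bullet> ?w n y)\<bar> <= c * (B * cut_c) * resid n u Gv y"
   proof -
   have "\<bar>TT.Psiv (?z y) * (?Bv y \<bullet> ?w n y)\<bar> <= c * \<bar>u y * (?Bv y \<bullet> ?w n y)\<bar>"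
   unfolding abs_mult mult.assoc[symmetric] using cp(4,5) uv c unfolding c_def[symmetric] by (intro mult_right_mono) auto
   also have "\<bar>u y * (?Bv y \<bullet> ?w n y)\<bar> <= B * cut_c * resid n u Gv y"
   by (rule flux_layer_bound) (use uv B(2) tp(4) in auto)
   finally show ?thesis using c by (simp add: mult_left_mono mult.assoc)
   qed
   have "Pu n y - Pv n y = (?Au y * (TT.Psiu (?z y) * th n y) - ?Av y * (TT.Psiv (?z y) * th n y)
   + th n y * (?Bu y \<bullet> (TT.Psiu1 (?z y) *# Gu y + TT.Psiu2 (?z y) *# Gv y))
   - th n y * (?Bv y \<bullet> (TT.Psiv1 (?z y) *# Gu y + TT.Psiv2 (?z y) *# Gv y)))
   + TT.Psiu (?z y) * (?Bu y \<bullet> ?w n y) - TT.Psiv (?z y) * (?Bv y \<bullet> ?w n y)"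
   unfolding Pu_def Pv_def by (simp only: inner_add_right inner_scaleR_right) (simp add: algebra_simps)?
   moreover have "X y * th n y <= ?Au y * (TT.Psiu (?z y) * th n y) - ?Av y * (TT.Psiv (?z y) * th n y)
   + th n y * (?Bu y \<bullet> (TT.Psiu1 (?z y) *# Gu y + TT.Psiu2 (?z y) *# Gv y))
   - th n y * (?Bv y \<bullet> (TT.Psiv1 (?z y) *# Gu y + TT.Psiv2 (?z y) *# Gv y))"
   unfolding X_def comp_X_def by (rule cp(1))
   moreover have "indicator Q y * X y * eta (fst y) * zet n (snd y) = X y * th n y" using True by (simp add: th_def mult.assoc)
   ultimately show ?thesis using b1 b2 by linarith
  qed
 qed
 let ?X = "%y. indicator Q y * X y * eta (fst y)"
 have iX: "lint ?X"
  by (rule BI_integrable_bound[OF W(1)]) (use W(3) in simp, rule AE_I2, use W(2) in \<open>auto intro: order_trans[OF _ abs_ge_self]\<close>)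
 have iXn: "lint (%y. ?X y * zet n (snd y))" for n
  by (rule integrable_bounded_mult[OF iX comp_fst_meas(2)[OF cutD(8)], of _ 1]) (use cutD(3,4) in auto)
 have lim: "(%n. \<integral>y. ?X y * zet n (snd y) \<partial>lborel) \<rightarrow> integral\<^sup>L lborel ?X"
 proof (rule integral_dominated_convergence[where w="%y. \<bar>?X y\<bar>"])
  show "AE y in lborel. (%n. ?X y * zet n (snd y)) \<rightarrow> ?X y"
  proof (rule AE_I2)
   fix y
   show "(%n. ?X y * zet n (snd y)) \<rightarrow> ?X y"
   proof (cases "snd y : Om")
   case True
   from tendsto_mult_left[OF cut_lim[OF True], of "?X y"] show ?thesis by simp
   next
   case False
   then have "?X y = 0" by (cases y) auto
   then show ?thesis by (simp only: mult_zero_left tendsto_const)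
   qed
  qed
  show "AE y in lborel. norm (?X y * zet n (snd y)) <= \<bar>?X y\<bar>" for n
   using cutD(3,4)[of n] by (intro AE_I2) (simp add: abs_mult mult_left_le)
 qed (use iX iXn in auto)
 note Ru = resid_vanishes[OF uD(1) tr uD(1)] and Rv = resid_vanishes[OF uD(1) tr vD(1)]
 have "\<forall>\<^sub>F n in sequentially. (\<integral>y. ?X y * zet n (snd y) \<partial>lborel) <= B * cut_c * integral\<^sup>L lborel (resid n u Gu) + c * (B * cut_c) * integral\<^sup>L lborel (resid n u Gv)"
  using Ru(1) Rv(1)
 proof eventually_elim
  case (elim n)
  have i: "lint (%y. ?X y * zet n (snd y) - B * cut_c * resid n u Gu y - c * (B * cut_c) * resid n u Gv y)"
   by (intro BI_integrable_diff iXn integrable_mult_right elim)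
  have "(\<integral>y. ?X y * zet n (snd y) - B * cut_c * resid n u Gu y - c * (B * cut_c) * resid n u Gv y \<partial>lborel) <= (\<integral>y. Pu n y - Pv n y \<partial>lborel)"
   by (rule integral_mono_AE[OF i _ lower]) (use Pu Pv in auto)
  also have "\<dots> = 0" using Pu[of n] Pv[of n] by simp
  finally show ?case using iXn[of n] elim by (simp add: integrable_mult_right)
 qed
 moreover have "(%n. B * cut_c * integral\<^sup>L lborel (resid n u Gu) + c * (B * cut_c) * integral\<^sup>L lborel (resid n u Gv)) \<rightarrow> B * cut_c * 0 + c * (B * cut_c) * 0"
  by (intro tendsto_intros Ru(2) Rv(2))
 ultimately have "integral\<^sup>L lborel ?X <= B * cut_c * 0 + c * (B * cut_c) * 0"
  using lim by (intro tendsto_le[OF sequentially_bot]) auto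
 then show ?thesis by (simp add: X_def)
qed

text \<open>With \<open>\<kappa> = \<epsilon>\<^sup>q\<^sup>+\<^sup>1\<close> all errors vanish as \<open>\<epsilon>\<close> tends to zero, by dominated convergence.\<close>

lemma comparison_limit:
 assumes su: "sol M u Gu zu h Fu" and sv: "sol M v Gv zv g Fv" and tr: "trace0 u Gu" and t: "time_test K eta deta"
  and order: "AE y in lborel. y : Q --> v y < u y --> Fu y * v y powr (q - 1) <= Fv y * u y powr (q - 1)"
  and hg: "AE y in lborel. y : Q --> h y <= g y"
 shows "(\<integral>y. indicator Q y * ((zu y - zv y) * max 0 (u y powr q - v y powr q)) * eta (fst y) \<partial>lborel) <= 0"
proof -
 note uD = solD[OF su] and vD = solD[OF sv]
 note us = stateD[OF uD(1)] and vs = stateD[OF vD(1)]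
 have eta0: "0 <= eta s" for s using t by (simp add: time_test_def)
 obtain B where B: "B > 0" "!!s. \<bar>eta s\<bar> <= B" using C1_test_bounded[of K eta deta] t unfolding time_test_def by metis
 note [measurable] = us(1) vs(1) comp_fst_meas(1)[OF test_product(3)[OF t]]
  borel_measurable_integrable[OF uD(3), simplified] borel_measurable_integrable[OF uD(4), simplified]
  borel_measurable_integrable[OF vD(3), simplified] borel_measurable_integrable[OF vD(4), simplified]
 obtain W where W: "lint W"
  "!!eps y. 0 < eps ==> eps <= 1 ==> \<bar>indicator Q y * comp_X eps u v Gu Gv zu zv h g Fu y * eta (fst y)\<bar> <= W y"
  "!!eps. 0 < eps ==> (%y. indicator Q y * comp_X eps u v Gu Gv zu zv h g Fu y * eta (fst y)) : borel_funs"
  by (rule comp_X_dominated[OF su sv tr t]) (rule that)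
 define Y where "Y y = max 0 (u y powr q - v y powr q)" for y
 have [measurable]: "Y : borel_funs" unfolding Y_def by measurable
 have Yb: "0 <= Y y" "Y y <= M powr q" for y
 proof -
  have "u y powr q <= M powr q" using us(3,4)[of y] q by (intro powr_mono2) auto
  moreover have "0 <= v y powr q" by simp
  ultimately have "u y powr q - v y powr q <= M powr q" by linarith
  then show "0 <= Y y" "Y y <= M powr q" unfolding Y_def by auto
 qed
 let ?X = "%n y. indicator Q y * comp_X (rad n) u v Gu Gv zu zv h g Fu y * eta (fst y)"
 let ?L = "%y. indicator Q y * (((zu y - h y) - (zv y - g y)) * Y y) * eta (fst y)"
 have lim: "(%n. integral\<^sup>L lborel (?X n)) \<rightarrow> integral\<^sup>L lborel ?L"
 proof (rule integral_dominated_convergence[OF _ _ W(1)])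
  show "?L : borel_measurable lborel" by measurable
  show "?X n : borel_measurable lborel" for n using W(3)[OF rad_pos] by simp
  show "AE y in lborel. norm (?X n y) <= W y" for n using W(2)[OF rad_pos rad_le_1] by (intro AE_I2) simp
  show "AE y in lborel. (%n. ?X n y) \<rightarrow> ?L y"
   using uD(2) vD(2)
  proof eventually_elim
   case (elim y)
   show ?case
   proof (cases "y : Q")
   case True
   then have uv: "0 < u y" "0 < v y" using elim by auto
   have r: "(%n. v y + rad n) \<rightarrow> v y + 0" by (intro tendsto_intros rad_tendsto)
   have "(%n. v y / (v y + rad n)) \<rightarrow> v y / (v y + 0)" using uv by (intro tendsto_divide tendsto_const r) auto
   then have "(%n. comp_a (rad n) v y) \<rightarrow> (v y / (v y + 0)) powr (q - 1)"
   unfolding comp_a_def using uv by (intro tendsto_powr tendsto_const) auto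
   then have a: "(%n. comp_a (rad n) v y) \<rightarrow> 1" using uv by simp
   have pq: "(%n. (v y + rad n) powr q) \<rightarrow> (v y + 0) powr q" using uv by (intro tendsto_powr tendsto_const r) auto
   have S: "(%n. max 0 (u y powr q - (v y + rad n) powr q)) \<rightarrow> Y y"
   using tendsto_max[OF tendsto_const tendsto_diff[OF tendsto_const pq]] by (simp add: Y_def)
   have "(%n. comp_H (rad n) u v y - max 0 (u y powr q - (v y + rad n) powr q)) \<rightarrow> 0"
   proof (rule Lim_null_comparison[OF always_eventually rad_tendsto], rule allI)
   fix n
   have kap: "rad n powr (q + 1) > 0" using rad_pos[of n] by (simp only: powr_gt_zero)
   have "rad n powr (q + 1) <= rad n powr 1" using rad_pos[of n] rad_le_1[of n] q by (intro powr_mono') (simp_all add: less_imp_le)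
   then have "rad n powr (q + 1) <= rad n" using powr_one[OF less_imp_le[OF rad_pos[of n]]] by (simp only:)
   then show "norm (comp_H (rad n) u v y - max 0 (u y powr q - (v y + rad n) powr q)) <= rad n"
   using pos_reg_bounds(2,3)[OF kap, of "u y powr q - (v y + rad n) powr q"] unfolding comp_H_def by simp
   qed
   from tendsto_add[OF this S] have H: "(%n. comp_H (rad n) u v y) \<rightarrow> Y y" by simp
   have "(%n. comp_X (rad n) u v Gu Gv zu zv h g Fu y) \<rightarrow> ((zu y - h y) - (zv y - g y) * 1) * Y y - Fu y * u y * (1 - 1) - (q - 1) * 0 * (energy Gu y + energy Gv y)"
   unfolding comp_X_def by (intro tendsto_intros a H rad_tendsto)
   then have "(%n. indicator Q y * comp_X (rad n) u v Gu Gv zu zv h g Fu y * eta (fst y)) \<rightarrow> indicator Q y * (((zu y - h y) - (zv y - g y) * 1) * Y y - Fu y * u y * (1 - 1) - (q - 1) * 0 * (energy Gu y + energy Gv y)) * eta (fst y)"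
   by (intro tendsto_intros)
   then show ?thesis by simp
   qed simp
  qed
 qed
 have "integral\<^sup>L lborel ?L <= 0"
  by (rule tendsto_upperbound[OF lim always_eventually sequentially_bot]) (use comparison_eps[OF su sv tr t rad_pos rad_le_1 order] in blast)
 moreover have "(\<integral>y. indicator Q y * ((zu y - zv y) * Y y) * eta (fst y) \<partial>lborel) <= integral\<^sup>L lborel ?L"
 proof (rule integral_mono_AE)
  have b: "\<bar>indicator Q y * Y y * eta (fst y)\<bar> <= M powr q * B" for y
  proof (cases "y : Q")
   case True
   then show ?thesis using Yb[of y] B(2)[of "fst y"] by (simp add: abs_mult mult_mono)
  qed (use B(1) in simp)
  have m: "(%y. indicator Q y * Y y * eta (fst y)) : borel_funs" by measurable
  have "lint (%y. (zu y - zv y) * (indicator Q y * Y y * eta (fst y)))"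
   by (rule integrable_bounded_mult[OF _ m b]) (intro BI_integrable_diff uD vD)
  then show "lint (%y. indicator Q y * ((zu y - zv y) * Y y) * eta (fst y))" by (simp add: mult_ac)
  have "lint (%y. ((zu y - h y) - (zv y - g y)) * (indicator Q y * Y y * eta (fst y)))"
   by (rule integrable_bounded_mult[OF _ m b]) (intro BI_integrable_diff uD vD)
  then show "lint ?L" by (simp add: mult_ac)
  show "AE y in lborel. indicator Q y * ((zu y - zv y) * Y y) * eta (fst y) <= ?L y"
   using hg
  proof eventually_elim
   case (elim y)
   show ?case
   proof (cases "y : Q")
   case True
   then have "(zu y - zv y) * (Y y * eta (fst y)) <= ((zu y - h y) - (zv y - g y)) * (Y y * eta (fst y))"
   using elim Yb eta0 by (intro mult_right_mono mult_nonneg_nonneg) auto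
   then show ?thesis using True by (simp add: mult_ac)
   qed simp
  qed
 qed
 ultimately show ?thesis unfolding Y_def by linarith
qed

end

section \<open>Chain rule in time and comparison\<close>

lemma integral_C1_grad_zero:
 fixes phi :: "'b::euclidean_space => real"
 assumes t: "C1_test K phi dphi"
 shows "lint dphi" "(\<integral>y. dphi y \<partial>lborel) = 0"
proof -
 obtain R where R: "R > 0" "smooth_kernel phi dphi R" using C1_test_kernel[OF t] by blast
 interpret smooth_kernel phi dphi R by (rule R)
 obtain C where C: "!!x. norm (dphi x) <= C" using bounded_compact_support[OF cont supp(2)] by blast
 show "lint dphi"
  by (rule integrable_bounded_support[where S="cball 0 R" and C=C]) (use C supp(2) in auto)
 define f where "f = (indicator (ball 0 (R + 1)) :: 'b => real)"
 have f: "lint f" unfolding f_def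
  by (intro integrable_real_indicator emeasure_bounded_finite) auto
 have const: "mollify phi f x = (\<integral>y. phi y \<partial>lborel)" if "x : ball 0 1" for x
 proof -
  have "phi (x - y) * f y = phi (x - y)" for y
  proof (cases "norm (x - y) < R")
   case True
   then have "norm y < R + 1" using that norm_triangle_sub[of y x] by (simp add: norm_minus_commute)
   then show ?thesis by (simp add: f_def)
  qed (simp add: supp(1))
  then have "mollify phi f x = (\<integral>y. phi (x - y) \<partial>lborel)" unfolding mollify_def by (simp only: real_scaleR_def)
  also have "\<dots> = (\<integral>y. phi y \<partial>lborel)" by (rule lborel_integral_reflect) simp
  finally show ?thesis .
 qed
 have "(mollify phi f has_derivative (%h. 0)) (at 0)"
  by (rule has_derivative_transform_within_open[OF has_derivative_const open_ball, of 0 0 1]) (use const in auto)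
 from has_derivative_unique[OF mollify_has_derivative[OF f] this]
 have "(\<integral>y. f y *# dphi (0 - y) \<partial>lborel) = 0" by (metis inner_eq_zero_iff)
 moreover have "f y *# dphi (0 - y) = dphi (0 - y)" for y
  using supp(2)[of "- y"] by (cases "norm y < R + 1") (auto simp: f_def)
 moreover have "(\<integral>y. dphi (0 - y) \<partial>lborel) = (\<integral>y. dphi y \<partial>lborel)" by (rule lborel_integral_reflect) simp
 ultimately show "(\<integral>y. dphi y \<partial>lborel) = 0" by (simp only:)
qed

text \<open>The chain rule for the square of the positive part, which is \<open>C\<^sup>1\<close>, under a directional weak derivative.\<close>

lemma positive_part_square_test:
 fixes Y y' :: "'b::euclidean_space => real"
 assumes S: "open S" and w: "wderiv S b Y y'" and Y: "lint Y" "!!x. \<bar>Y x\<bar> <= B" and y': "lint y'"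
  and t: "C1_test K \<theta> d\<theta>" and KS: "K \<subseteq> S"
 shows "(\<integral>x. 2 * max 0 (Y x) * \<theta> x * y' x + (max 0 (Y x))\<^sup>2 * (d\<theta> x \<bullet> b) \<partial>lborel) = 0"
proof -
 have cK: "compact K" using t by (simp add: C1_test_def)
 then have [measurable]: "K : sets borel" by (simp add: compact_imp_closed)
 note [measurable] = borel_measurable_integrable[OF Y(1), simplified] borel_measurable_integrable[OF y', simplified] C1_test_integrable(2,3)[OF t]
 have B0: "B >= 0" using Y(2)[of 0] by linarith
 obtain C where C: "C > 0" "!!x. \<bar>\<theta> x\<bar> <= C" "!!x. norm (d\<theta> x) <= C" by (rule C1_test_bounded[OF t]) (rule that)
 obtain dlt where dlt: "dlt > 0" "(\<Union>x\<in>K. cball x dlt) \<subseteq> S"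
  using compact_subset_open_imp_cball_epsilon_subset[OF cK S KS] by blast
 obtain r where r: "strict_mono r" "AE x in lborel. (%n. mollify (moll (rad (r n))) Y x) \<rightarrow> Y x & (%n. mollify (moll (rad (r n))) y' x) \<rightarrow> y' x &
   (%n. mollify (moll (rad (r n))) Y x) \<rightarrow> Y x & (%n. mollify (moll (rad (r n))) Y x) \<rightarrow> Y x"
  by (rule L1_sum_subseq[OF Y(1) y' Y(1) Y(1)]) (rule that)
 obtain N where N: "!!n. n >= N ==> rad n < dlt"
  using rad_eventually[OF dlt(1)] unfolding eventually_sequentially by blast
 define m where "m n = r (n + N)" for n
 have m_ge: "m n >= n + N" for n unfolding m_def using seq_suble[OF r(1)] .
 define rho where "rho n = rad (m n)" for n
 have rho: "0 < rho n" for n by (simp add: rho_def)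
 have rhoK: "cball y (rho n) \<subseteq> S" if "y : K" for n y
 proof -
  have "rho n < dlt" unfolding rho_def using m_ge[of n] by (intro N) simp
  then have "cball y (rho n) \<subseteq> cball y dlt" by (intro subset_cball) simp
  then show ?thesis using dlt(2) that by blast
 qed
 have [measurable]: "moll (rho n) : borel_measurable (borel :: 'b measure)" for n using rho by measurable
 define Yn yn where "Yn n = mollify (moll (rho n)) Y" and "yn n = mollify (moll (rho n)) y'" for n
 define DY where "DY n x = (\<integral>w. Y w *# moll_grad (rho n) (x - w) \<partial>lborel)" for n x
 have [measurable]: "Yn n : borel_funs" "yn n : borel_funs" for n unfolding Yn_def yn_def by simp_all
 have sk: "smooth_kernel (moll (rho n) :: 'b => real) (moll_grad (rho n)) (rho n)" for n by (rule smooth_kernel_moll[OF rho])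
 have dY: "(Yn n has_derivative (%h. DY n x \<bullet> h)) (at x)" for n x
  unfolding Yn_def DY_def by (rule smooth_kernel.mollify_has_derivative[OF sk Y(1)])
 have cDY: "continuous_on UNIV (DY n)" for n
  unfolding DY_def by (rule smooth_kernel.continuous_mollify_grad[OF sk Y(1)])
 have cY: "continuous_on UNIV (Yn n)" for n by (rule has_derivative_continuous_on[OF has_derivative_at_withinI[OF dY]])
 have DYb: "DY n x \<bullet> b = yn n x" if "x : K" for n x
  unfolding DY_def yn_def by (rule wderiv_mollify[OF S w Y(1) rho rhoK[OF that]])
 have Ynb: "\<bar>Yn n x\<bar> <= B" for n x
 proof -
  have im: "lint (%w. moll (rho n) (x - w))"
   using nn_integral_moll(2)[OF rho, of n x] by (intro integrableI_nn_integral_finite[where x=1]) (auto simp: moll_nonneg rho)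
  have m1: "(\<integral>w. moll (rho n) (x - w) \<partial>lborel) = 1"
   using nn_integral_moll(2)[OF rho, of n x] nn_integral_eq_integral[OF im] by (auto simp: moll_nonneg rho)
  have "norm (Yn n x) <= (\<integral>w. B * moll (rho n) (x - w) \<partial>lborel)"
   unfolding Yn_def mollify_def
  proof (rule order_trans[OF integral_norm_bound], rule integral_mono')
   show "lint (%w. B * moll (rho n) (x - w))" using im by simp
   show "norm (moll (rho n) (x - w) *# Y w) <= B * moll (rho n) (x - w)" for w
   using mult_right_mono[OF Y(2)[of w] moll_nonneg[OF rho, of n "x - w"]] moll_nonneg[OF rho, of n "x - w"] by (simp add: abs_mult mult.commute)
   show "0 <= B * moll (rho n) (x - w)" for w by (intro mult_nonneg_nonneg B0 moll_nonneg rho)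
  qed
  then show ?thesis by (simp add: m1)
 qed
 define phi where "phi n x = (max 0 (Yn n x))\<^sup>2 * \<theta> x" for n x
 define dphi where "dphi n x = (2 * max 0 (Yn n x) * \<theta> x) *# DY n x + (max 0 (Yn n x))\<^sup>2 *# d\<theta> x" for n x
 have dth: "(\<theta> has_derivative (%h. d\<theta> x \<bullet> h)) (at x)" for x using t by (simp add: C1_test_def)
 have cth: "continuous_on UNIV \<theta>" by (rule has_derivative_continuous_on[OF has_derivative_at_withinI[OF dth]])
 have Cn: "C1_test K (phi n) (dphi n)" for n
  unfolding C1_test_def
 proof (intro conjI allI impI)
  show "compact K" by (rule cK)
  fix x
  have "((%x. (max 0 (Yn n x))\<^sup>2) has_derivative (%h. (2 * max 0 (Yn n x)) * (DY n x \<bullet> h))) (at x)"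
   using has_derivative_compose[OF dY max0_square_deriv[unfolded has_field_derivative_def]] by simp
  from has_derivative_mult[OF this dth]
  show "(phi n has_derivative (%h. dphi n x \<bullet> h)) (at x)"
   unfolding phi_def dphi_def by (rule has_derivative_eq_rhs) (auto simp: inner_add_left algebra_simps)
  show "continuous_on UNIV (dphi n)" unfolding dphi_def
   using t by (intro continuous_intros cY cth cDY) (simp add: C1_test_def)
  show "phi n x = 0" if "x \<notin> K" using C1_test_zero[OF t that] by (simp add: phi_def)
 qed
 define s where "s n x = 2 * max 0 (Yn n x) * \<theta> x * yn n x + (max 0 (Yn n x))\<^sup>2 * (d\<theta> x \<bullet> b)" for n x
 have s_eq: "s n x = dphi n x \<bullet> b" for n x
 proof (cases "x : K")
  case True
  then show ?thesis by (simp add: s_def dphi_def inner_add_left DYb)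
 next
  case False
  then show ?thesis using C1_test_zero[OF t] C1_test_grad_zero[OF t] by (simp add: s_def dphi_def)
 qed
 have s0: "integral\<^sup>L lborel (s n) = 0" for n
 proof -
  have "integral\<^sup>L lborel (s n) = (\<integral>x. dphi n x \<bullet> b \<partial>lborel)" by (intro BI_integral_cong) (simp_all add: s_eq)
  also have "\<dots> = (\<integral>x. dphi n x \<partial>lborel) \<bullet> b" by (rule integral_inner_left) (rule integral_C1_grad_zero[OF Cn])
  also have "\<dots> = 0" by (simp add: integral_C1_grad_zero[OF Cn])
  finally show ?thesis .
 qed
 define f where "f x = 2 * max 0 (Y x) * \<theta> x * y' x + (max 0 (Y x))\<^sup>2 * (d\<theta> x \<bullet> b)" for x
 define g where "g n x = (2 * B * C) * \<bar>yn n x\<bar> + (B\<^sup>2 * (C * norm b)) * indicator K x" for n x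
 define G where "G x = (2 * B * C) * \<bar>y' x\<bar> + (B\<^sup>2 * (C * norm b)) * indicator K x" for x
 have iK: "lint (indicator K :: 'b => real)"
  using emeasure_compact_finite[OF cK] by (intro integrable_real_indicator) auto
 have iyn: "lint (yn n)" for n unfolding yn_def by (rule integrable_mollify[OF rho y'])
 have "(%n. integral\<^sup>L lborel (s n)) \<rightarrow> integral\<^sup>L lborel f"
 proof (rule dominated_convergence_L1(2))
  show "f : borel_measurable lborel" "s n : borel_measurable lborel" for n unfolding f_def s_def by measurable
  show "AE x in lborel. (%n. s n x) \<rightarrow> f x"
   using r(2)
  proof eventually_elim
   case (elim x)
   have "(%n. Yn n x) \<rightarrow> Y x" "(%n. yn n x) \<rightarrow> y' x"
   unfolding Yn_def yn_def rho_def m_def using elim LIMSEQ_ignore_initial_segment by blast+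
   then show ?case unfolding s_def f_def by (intro tendsto_intros)
  qed
  show "AE x in lborel. \<bar>s n x\<bar> <= g n x" for n
  proof (rule AE_I2)
   fix x
   have m: "0 <= max 0 (Yn n x)" "max 0 (Yn n x) <= B" using Ynb[of n x] B0 by auto
   show "\<bar>s n x\<bar> <= g n x"
   proof (cases "x : K")
   case True
   have "max 0 (Yn n x) * \<bar>\<theta> x\<bar> <= B * C" using m C(2)[of x] B0 by (intro mult_mono) auto
   then have "2 * (max 0 (Yn n x) * \<bar>\<theta> x\<bar>) * \<bar>yn n x\<bar> <= 2 * (B * C) * \<bar>yn n x\<bar>" by (intro mult_right_mono) auto
   then have a: "\<bar>2 * max 0 (Yn n x) * \<theta> x * yn n x\<bar> <= (2 * B * C) * \<bar>yn n x\<bar>" using m(1) by (simp add: abs_mult mult.assoc)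
   have "\<bar>d\<theta> x \<bullet> b\<bar> <= C * norm b" using order_trans[OF Cauchy_Schwarz_ineq2 mult_right_mono[OF C(3)[of x]]] by simp
   moreover have "(max 0 (Yn n x))\<^sup>2 <= B\<^sup>2" using m by (intro power_mono)
   ultimately have "(max 0 (Yn n x))\<^sup>2 * \<bar>d\<theta> x \<bullet> b\<bar> <= B\<^sup>2 * (C * norm b)" by (intro mult_mono) auto
   then have c: "\<bar>(max 0 (Yn n x))\<^sup>2 * (d\<theta> x \<bullet> b)\<bar> <= B\<^sup>2 * (C * norm b)" by (simp add: abs_mult)
   show ?thesis using order_trans[OF abs_triangle_ineq add_mono[OF a c]] True by (simp add: s_def g_def)
   next
   case False
   then show ?thesis using C1_test_zero[OF t] C1_test_grad_zero[OF t] B0 C(1) by (simp add: s_def g_def)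
   qed
  qed
  show "lint (g n)" for n unfolding g_def by (intro BI_integrable_add integrable_mult_right integrable_abs iyn iK)
  show "lint G" unfolding G_def by (intro BI_integrable_add integrable_mult_right integrable_abs y' iK)
  show "(%n. \<integral>x. \<bar>g n x - G x\<bar> \<partial>lborel) \<rightarrow> 0"
  proof (rule Lim_null_comparison[OF always_eventually], rule allI)
   fix n
   have i: "lint (%x. norm (yn n x - y' x))" using iyn y' by (intro integrable_norm BI_integrable_diff)
   have "(\<integral>x. \<bar>g n x - G x\<bar> \<partial>lborel) <= (\<integral>x. (2 * B * C) * norm (yn n x - y' x) \<partial>lborel)"
   proof (rule integral_mono')
   show "lint (%x. (2 * B * C) * norm (yn n x - y' x))" using i by (rule integrable_mult_right)
   fix x
   have "\<bar>g n x - G x\<bar> = (2 * B * C) * \<bar>\<bar>yn n x\<bar> - \<bar>y' x\<bar>\<bar>"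
   using B0 C(1) by (simp add: g_def G_def abs_mult flip: right_diff_distrib)
   also have "\<dots> <= (2 * B * C) * norm (yn n x - y' x)" using B0 C(1) by (intro mult_left_mono) auto
   finally show "\<bar>g n x - G x\<bar> <= (2 * B * C) * norm (yn n x - y' x)" .
   show "0 <= (2 * B * C) * norm (yn n x - y' x)" using B0 C(1) by simp
   qed
   then show "norm (\<integral>x. \<bar>g n x - G x\<bar> \<partial>lborel) <= (2 * B * C) * (\<integral>x. norm (yn n x - y' x) \<partial>lborel)" by simp
  next
   have sm: "strict_mono m" using r(1) by (auto simp: m_def strict_mono_def)
   have "(%n. \<integral>x. norm (yn n x - y' x) \<partial>lborel) \<rightarrow> 0"
   using LIMSEQ_subseq_LIMSEQ[OF mollify_L1[OF y'] sm] by (simp add: o_def rho_def yn_def)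
   from tendsto_mult_left[OF this, of "2 * B * C"] show "(%n. (2 * B * C) * (\<integral>x. norm (yn n x - y' x) \<partial>lborel)) \<rightarrow> 0" by simp
  qed
 qed
 then have "(%n. 0) \<rightarrow> integral\<^sup>L lborel f" by (simp only: s0)
 then have "integral\<^sup>L lborel f = 0" by (rule LIMSEQ_unique[OF _ tendsto_const])
 then show ?thesis by (simp add: f_def[abs_def])
qed

text \<open>A \<open>C\<^sup>1\<close> step from zero to one on the unit interval; scaled, it cuts off the initial time.\<close>

definition ramp :: "real => real" where
 "ramp x = 2 * ((max 0 x)\<^sup>2 - 2 * (max 0 (x - 1/2))\<^sup>2 + (max 0 (x - 1))\<^sup>2)"

definition ramp' :: "real => real" where
 "ramp' x = 4 * (max 0 x - 2 * max 0 (x - 1/2) + max 0 (x - 1))"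

lemma ramp_deriv: "(ramp has_real_derivative ramp' x) (at x)"
proof -
 have s: "((%x. (max 0 (x - c))\<^sup>2) has_real_derivative 2 * max 0 (x - c)) (at x)" for c :: real
 proof -
  have "((%x. x - c) has_real_derivative 1) (at x)" by (auto intro!: derivative_eq_intros)
  from DERIV_chain2[OF max0_square_deriv this] show ?thesis by simp
 qed
 have "((%x. 2 * ((max 0 (x - 0))\<^sup>2 - 2 * (max 0 (x - 1/2))\<^sup>2 + (max 0 (x - 1))\<^sup>2)) has_real_derivative
   2 * (2 * max 0 (x - 0) - 2 * (2 * max 0 (x - 1/2)) + 2 * max 0 (x - 1))) (at x)"
  by (intro DERIV_cmult DERIV_add DERIV_diff s)
 then show ?thesis unfolding ramp_def[abs_def] ramp'_def by (simp add: algebra_simps)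
qed

lemma ramp_props:
 "x <= 0 ==> ramp x = 0" "x >= 1 ==> ramp x = 1" "0 <= ramp x" "ramp x <= 1" "0 <= ramp' x" "ramp' x <= 2" "x <= 0 \<or> x >= 1 ==> ramp' x = 0"
proof -
 show a: "x <= 0 ==> ramp x = 0" by (simp add: ramp_def max_def)
 show b: "x >= 1 ==> ramp x = 1" by (simp add: ramp_def max_def power2_eq_square algebra_simps)
 show "x <= 0 \<or> x >= 1 ==> ramp' x = 0" by (auto simp: ramp'_def max_def)
 show "0 <= ramp' x" "ramp' x <= 2" by (auto simp: ramp'_def max_def)
 consider "x <= 0" | "0 < x" "x <= 1/2" | "1/2 < x" "x < 1" | "x >= 1" by linarith
 then have "0 <= ramp x & ramp x <= 1"
 proof cases
  case 2
  have "x\<^sup>2 <= (1/2)\<^sup>2" using 2 by (intro power_mono) auto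
  moreover have "max 0 x = x" "max 0 (x - 1/2) = 0" "max 0 (x - 1) = 0" using 2 by auto
  ultimately show ?thesis by (simp add: ramp_def power2_eq_square)
 next
  case 3
  have e: "ramp x = 1 - 2 * (1 - x)\<^sup>2" using 3 by (simp add: ramp_def max_def power2_eq_square algebra_simps)
  have "(1 - x)\<^sup>2 <= (1/2)\<^sup>2" using 3 by (intro power_mono) auto
  then show ?thesis unfolding e by (simp add: power2_eq_square)
 qed (use a b in auto)
 then show "0 <= ramp x" "ramp x <= 1" by auto
qed

context comparison_setting begin

lemma time_test_ramp:
 assumes s: "0 < s" "s <= T'" "T' < T"
 shows "time_test {s..T'} (%t. (max 0 (T' - t))\<^sup>2 * ramp ((t - s) / s))
   (%t. - (2 * max 0 (T' - t)) * ramp ((t - s) / s) + (max 0 (T' - t))\<^sup>2 * (ramp' ((t - s) / s) / s))"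
proof -
 have d1: "((%t. (max 0 (T' - t))\<^sup>2) has_real_derivative - (2 * max 0 (T' - t))) (at t)" for t
 proof -
  have "((%t. T' - t) has_real_derivative - 1) (at t)" by (auto intro!: derivative_eq_intros)
  from DERIV_chain2[OF max0_square_deriv this] show ?thesis by simp
 qed
 have d2: "((%t. ramp ((t - s) / s)) has_real_derivative ramp' ((t - s) / s) / s) (at t)" for t
 proof -
  have "((%t. (t - s) / s) has_real_derivative 1 / s) (at t)" using s by (auto intro!: derivative_eq_intros)
  from DERIV_chain2[OF ramp_deriv this] show ?thesis by simp
 qed
 have c: "continuous_on UNIV ramp" by (meson DERIV_isCont continuous_at_imp_continuous_on ramp_deriv)
 show ?thesis
  unfolding time_test_def C1_test_def
 proof (intro conjI allI impI)
  fix t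
  show "((%t. (max 0 (T' - t))\<^sup>2 * ramp ((t - s) / s)) has_derivative
   (%h. (- (2 * max 0 (T' - t)) * ramp ((t - s) / s) + (max 0 (T' - t))\<^sup>2 * (ramp' ((t - s) / s) / s)) \<bullet> h)) (at t)"
   using DERIV_mult[OF d1 d2, of t] unfolding has_field_derivative_def by (rule has_derivative_eq_rhs) (simp add: fun_eq_iff algebra_simps)
  show "0 <= (max 0 (T' - t))\<^sup>2 * ramp ((t - s) / s)" by (intro mult_nonneg_nonneg ramp_props) auto
  show "(max 0 (T' - t))\<^sup>2 * ramp ((t - s) / s) = 0" if "t \<notin> {s..T'}"
  proof (cases "t <= s")
   case True
   then have "(t - s) / s <= 0" using s by (simp add: divide_nonpos_pos)
   then show ?thesis by (simp add: ramp_props)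
  next
   case False
   then show ?thesis using that by (simp add: max_def)
  qed
 next
  show "continuous_on UNIV (%t. - (2 * max 0 (T' - t)) * ramp ((t - s) / s) + (max 0 (T' - t))\<^sup>2 * (ramp' ((t - s) / s) / s))"
   unfolding ramp'_def using s by (intro continuous_intros continuous_on_compose2[OF c]) auto
 qed (use s in auto)
qed

text \<open>With the weight \<open>((T' - t)\<^sup>+)\<^sup>2\<close> times a ramp near the initial time, the derivative of the weight is negative apart from the ramp, and there the initial condition makes the contribution small.\<close>

theorem comparison_core:
 assumes su: "sol M u Gu zu h Fu" and sv: "sol M v Gv zv g Fv" and tr: "trace0 u Gu"
  and order: "AE y in lborel. y : Q --> v y < u y --> Fu y * v y powr (q - 1) <= Fv y * u y powr (q - 1)"
  and hg: "AE y in lborel. y : Q --> h y <= g y"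
  and du: "wderiv Q (1, 0) (%y. u y powr q) zu" and dv: "wderiv Q (1, 0) (%y. v y powr q) zv"
  and init: "!!e. e > 0 ==> \<exists>s0>0. AE t in lborel. 0 < t & t < s0 --> (\<integral>\<^sup>+x. (max 0 (u (t, x) powr q - v (t, x) powr q))\<^sup>2 \<partial>lborel) <= ennreal e"
 shows "AE y in lborel. y : Q --> u y <= v y"
proof -
 note uD = solD[OF su] and vD = solD[OF sv]
 note us = stateD[OF uD(1)] and vs = stateD[OF vD(1)]
 note [measurable] = us(1) vs(1)
  borel_measurable_integrable[OF uD(3), simplified] borel_measurable_integrable[OF vD(3), simplified]
 define B where "B = M powr q"
 define Y where "Y y = u y powr q - v y powr q" for y
 define z where "z y = zu y - zv y" for y
 have [measurable]: "Y : borel_funs" "z : borel_funs" unfolding Y_def z_def by measurable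
 have ub: "0 <= u y powr q" "u y powr q <= B" "0 <= v y powr q" "v y powr q <= B" for y
  unfolding B_def using us(3,4)[of y] vs(3,4)[of y] q by (auto intro!: powr_mono2)
 have Yb: "\<bar>Y y\<bar> <= B" for y unfolding Y_def using ub[of y] by (intro abs_leI) linarith+
 have Y0: "Y y = 0" if "y \<notin> Q" for y using us(5)[OF that] vs(5)[OF that] by (simp add: Y_def)
 have iY: "lint Y"
  by (rule integrable_bounded_support[OF _ bounded_Q, where C=B]) (use Y0 Yb in auto)
 have iz: "lint z" unfolding z_def by (intro BI_integrable_diff uD vD)
 have wY: "wderiv Q (1, 0) Y z"
 proof -
  have l: "loc_int Q (%y. Y y *# (1, 0 :: 'a))" "loc_int Q z"
   using iY iz by (intro integrable_imp_loc_int integrable_scaleR_left; simp)+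
  have "(\<integral>y. z y * phi y + Y y *# (1, 0) \<bullet> grad phi y \<partial>lborel) = 0" if phi: "phi : test_functions Q" for phi
  proof -
   define K where "K = closure {y. phi y \<noteq> 0}"
   have Ck: "Ck n phi" for n using phi by (simp add: test_functions_def)
   have t: "C1_test K phi (grad phi)"
   unfolding C1_test_def using phi Ck_grad(1,2)[OF Ck] closure_subset[of "{y. phi y \<noteq> 0}"] by (auto simp: test_functions_def K_def)
   have KQ: "K \<subseteq> Q" using phi by (simp add: test_functions_def K_def)
   note a = weak_div_C1_test[OF open_Q du t KQ] and b = weak_div_C1_test[OF open_Q dv t KQ]
   have "(\<integral>y. z y * phi y + Y y *# (1, 0) \<bullet> grad phi y \<partial>lborel) = (\<integral>y. (zu y * phi y + u y powr q *# (1, 0) \<bullet> grad phi y) - (zv y * phi y + v y powr q *# (1, 0) \<bullet> grad phi y) \<partial>lborel)"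
   by (intro BI_integral_cong) (simp_all only: z_def Y_def inner_scaleR_left left_diff_distrib algebra_simps)
   also have "\<dots> = 0" using a(2) b(2) by (subst BI_integral_diff[OF a(1) b(1)]) simp
   finally show ?thesis .
  qed
  then show ?thesis using l unfolding weak_div_def by blast
 qed
 define w where "w y = (max 0 (Y y))\<^sup>2" for y
 have [measurable]: "w : borel_funs" unfolding w_def by measurable
 have wb: "0 <= w y" "w y <= B\<^sup>2" for y
  using Yb[of y] unfolding w_def by (auto intro!: power_mono)
 have w0: "w y = 0" if "y \<notin> Q" for y using Y0[OF that] by (simp add: w_def)
 have iw: "lint w"
  by (rule integrable_bounded_support[OF _ bounded_Q, where C="B\<^sup>2"]) (use w0 wb in auto)
 have key: "0 <= (\<integral>y. w y * deta (fst y) \<partial>lborel)" if t: "time_test K eta deta" for K eta deta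
 proof -
  have tt: "C1_test K eta deta" using t by (simp add: time_test_def)
  obtain C where C: "C > 0" "!!s. \<bar>eta s\<bar> <= C" "!!s. norm (deta s) <= C" by (rule C1_test_bounded[OF tt]) (rule that)
  note [measurable] = comp_fst_meas(1)[OF C1_test_integrable(2)[OF tt]] comp_fst_meas(1)[OF C1_test_integrable(3)[OF tt]]
  have [measurable]: "(%y::real \<times> 'a. zet n (snd y)) : borel_funs" for n by (rule comp_fst_meas(2)[OF cutD(8)])
  define f where "f y = 2 * max 0 (Y y) * eta (fst y) * z y + w y * deta (fst y)" for y
  have i1: "lint (%y. z y * (2 * max 0 (Y y) * eta (fst y)))"
  proof (rule integrable_bounded_mult[OF iz])
   show "(%y. 2 * max 0 (Y y) * eta (fst y)) : borel_funs" by measurable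
   show "\<bar>2 * max 0 (Y y) * eta (fst y)\<bar> <= 2 * B * C" for y
   unfolding abs_mult using Yb[of y] C(2)[of "fst y"] by (intro mult_mono) auto
  qed
  have i2: "lint (%y. w y * deta (fst y))"
   by (rule integrable_bounded_mult[OF iw, of _ C]) (use C(3) in auto)
  have if': "lint f"
   unfolding f_def using i1 i2 by (intro BI_integrable_add) (simp_all add: mult_ac)
  have fn: "(\<integral>y. f y * zet n (snd y) \<partial>lborel) = 0" for n
  proof -
   have "f y * zet n (snd y) = 2 * max 0 (Y y) * (eta (fst y) * zet n (snd y)) * z y + (max 0 (Y y))\<^sup>2 * ((deta (fst y) * zet n (snd y), eta (fst y) *# dzet n (snd y)) \<bullet> (1, 0))" for y
   by (simp add: f_def w_def inner_prod_def algebra_simps)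
   then show ?thesis using positive_part_square_test[OF open_Q wY iY Yb iz test_product(1,2)[OF t, of n]] by (simp only:)
  qed
  have "(%n. \<integral>y. f y * zet n (snd y) \<partial>lborel) \<rightarrow> (\<integral>y. indicator Q y * f y \<partial>lborel)"
  proof (rule integral_dominated_convergence[where w="%y. \<bar>f y\<bar>"])
   show "(%y. indicator Q y * f y) : borel_measurable lborel" unfolding f_def by measurable
   show "(%y. f y * zet n (snd y)) : borel_measurable lborel" for n unfolding f_def by measurable
   show "AE y in lborel. (%n. f y * zet n (snd y)) \<rightarrow> indicator Q y * f y"
   proof (rule AE_I2)
   fix y
   show "(%n. f y * zet n (snd y)) \<rightarrow> indicator Q y * f y"
   proof (cases "y : Q")
   case True
   then have "(%n. f y * zet n (snd y)) \<rightarrow> f y * 1" by (intro tendsto_intros cut_lim) auto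
   then show ?thesis using True by simp
   next
   case False
   then have "f y = 0" using Y0[OF False] by (simp add: f_def w_def)
   then show ?thesis by simp
   qed
   qed
   show "AE y in lborel. norm (f y * zet n (snd y)) <= \<bar>f y\<bar>" for n
   using cutD(3,4)[of n] by (intro AE_I2) (simp add: abs_mult mult_left_le)
  qed (use if' in simp)
  then have "(%n. 0) \<rightarrow> (\<integral>y. indicator Q y * f y \<partial>lborel)" by (simp only: fn)
  then have "(\<integral>y. indicator Q y * f y \<partial>lborel) = 0" by (rule LIMSEQ_unique[OF _ tendsto_const])
  moreover have "indicator Q y * f y = 2 * (indicator Q y * (z y * max 0 (Y y)) * eta (fst y)) + w y * deta (fst y)" for y
   using w0[of y] by (cases "y : Q") (simp_all add: f_def mult_ac)
  ultimately have "(\<integral>y. 2 * (indicator Q y * (z y * max 0 (Y y)) * eta (fst y)) + w y * deta (fst y) \<partial>lborel) = 0" by (simp only:)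
  moreover have i3: "lint (%y. indicator Q y * (z y * max 0 (Y y)) * eta (fst y))"
  proof -
   have "lint (%y. (z y * (2 * max 0 (Y y) * eta (fst y))) * (indicator Q y / 2))"
   by (rule integrable_bounded_mult[OF i1, of _ 1]) (auto simp: indicator_def)
   then show ?thesis by (simp add: mult_ac)
  qed
  ultimately have "2 * (\<integral>y. indicator Q y * (z y * max 0 (Y y)) * eta (fst y) \<partial>lborel) + (\<integral>y. w y * deta (fst y) \<partial>lborel) = 0"
   using i2 by simp
  moreover have "(\<integral>y. indicator Q y * (z y * max 0 (Y y)) * eta (fst y) \<partial>lborel) <= 0"
   using comparison_limit[OF su sv tr t order hg] by (simp add: z_def Y_def)
  ultimately show ?thesis by linarith
 qed
 have fub: "(\<integral>\<^sup>+y. W y \<partial>lborel) = (\<integral>\<^sup>+t. \<integral>\<^sup>+x. W (t, x) \<partial>lborel \<partial>lborel)" if [measurable]: "W : borel_funs" for W :: "real \<times> 'a => ennreal"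
 proof -
  have "W : borel_measurable (lborel \<Otimes>\<^sub>M lborel)" using that by (simp add: lborel_prod)
  from lborel.nn_integral_fst[OF this] show ?thesis by (simp add: lborel_prod)
 qed
 have zero: "AE y in lborel. fst y < T' --> w y = 0" if T': "0 < T'" "T' < T" for T'
 proof -
  let ?W = "%y. w y * (2 * max 0 (T' - fst y))"
  have small: "(\<integral>y. w y * (2 * max 0 (T' - fst y) * ramp ((fst y - s) / s)) \<partial>lborel) <= 2 * T\<^sup>2 * e"
   if s: "0 < s" "s <= T'" and e: "e > 0" and ie: "AE t in lborel. 0 < t & t < 2 * s --> (\<integral>\<^sup>+x. ennreal (w (t, x)) \<partial>lborel) <= ennreal e" for s e
  proof -
   let ?a = "%y::real \<times> 'a. 2 * max 0 (T' - fst y) * ramp ((fst y - s) / s)"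
   let ?b = "%y::real \<times> 'a. (max 0 (T' - fst y))\<^sup>2 * (ramp' ((fst y - s) / s) / s)"
   note tt = time_test_ramp[OF s T'(2)]
   have cr: "continuous_on UNIV ramp" by (meson DERIV_isCont continuous_at_imp_continuous_on ramp_deriv)
   have [measurable]: "ramp : borel_funs" "ramp' : borel_funs"
   using cr unfolding ramp'_def by (auto intro!: borel_measurable_continuous_onI continuous_intros)
   have ma: "?a : borel_funs" and mb: "?b : borel_funs" by measurable
   define C where "C = \<bar>T' - s\<bar> + T"
   have qT: "fst y : {0<..<T}" if "w y \<noteq> 0" for y using w0[of y] that by (cases y) auto
   have bb: "0 <= ?b y" for y using s by (intro mult_nonneg_nonneg divide_nonneg_pos ramp_props) auto
   have bbd: "w y * ?b y <= w y * (indicator {s..2 * s} (fst y) * (2 * T\<^sup>2 / s))" for y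
   proof (cases "w y = 0")
   case False
   then have t: "0 < fst y" "fst y < T" using qT by auto
   have "?b y <= indicator {s..2 * s} (fst y) * (2 * T\<^sup>2 / s)"
   proof (cases "fst y : {s..2 * s}")
   case True
   have "(max 0 (T' - fst y))\<^sup>2 <= T\<^sup>2" using t T' by (intro power_mono) auto
   moreover have "ramp' ((fst y - s) / s) / s <= 2 / s" using s by (intro divide_right_mono ramp_props) auto
   ultimately have "?b y <= T\<^sup>2 * (2 / s)" using s by (intro mult_mono divide_nonneg_pos ramp_props) auto
   then show ?thesis using True by (simp add: mult.commute)
   next
   case False
   then have "(fst y - s) / s <= 0 \<or> (fst y - s) / s >= 1" using s by (auto simp: divide_le_0_iff le_divide_eq)
   then show ?thesis using False by (simp add: ramp_props)
   qed
   then show ?thesis using wb(1) by (rule mult_left_mono)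
   qed simp
   have ib: "lint (%y. w y * (indicator {s..2 * s} (fst y) * (2 * T\<^sup>2 / s)))"
   proof (rule integrable_bounded_mult[OF iw])
   show "(%y::real \<times> 'a. indicator {s..2 * s} (fst y) * (2 * T\<^sup>2 / s)) : borel_funs" by measurable
   show "\<bar>indicator {s..2 * s} (fst y) * (2 * T\<^sup>2 / s)\<bar> <= 2 * T\<^sup>2 / s" for y :: "real \<times> 'a" using s by (auto simp: indicator_def)
   qed
   have iwb: "lint (%y. w y * ?b y)"
   by (rule BI_integrable_bound[OF ib]) (use mb in measurable, rule AE_I2,
   use abs_of_nonneg[OF mult_nonneg_nonneg[OF wb(1) bb]] order_trans[OF bbd abs_ge_self] in \<open>simp only: real_norm_def\<close>)
   have ia: "lint (%y. w y * ?a y)"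
   proof (rule BI_integrable_bound)
   show "lint (%y. (2 * T) * w y)" using iw by simp
   show "(%y. w y * ?a y) : borel_measurable lborel" using ma by measurable
   show "AE y in lborel. norm (w y * ?a y) <= norm ((2 * T) * w y)"
   proof (rule AE_I2)
   fix y
   show "norm (w y * ?a y) <= norm ((2 * T) * w y)"
   proof (cases "w y = 0")
   case False
   then have t: "0 < fst y" "fst y < T" using qT by auto
   have a1: "?a y <= 2 * T * 1" using t T' T by (intro mult_mono ramp_props) auto
   have a0: "0 <= ?a y" by (intro mult_nonneg_nonneg ramp_props) auto
   have "w y * ?a y <= w y * (2 * T * 1)" by (rule mult_left_mono[OF a1 wb(1)])
   also have "\<dots> = (2 * T) * w y" by simp
   also have "\<dots> <= \<bar>(2 * T) * w y\<bar>" by (rule abs_ge_self)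
   finally have "w y * ?a y <= \<bar>(2 * T) * w y\<bar>" .
   then show ?thesis unfolding real_norm_def abs_of_nonneg[OF mult_nonneg_nonneg[OF wb(1) a0]] .
   qed simp
   qed
   qed
   have "0 <= (\<integral>y. w y * (- (2 * max 0 (T' - fst y)) * ramp ((fst y - s) / s) + (max 0 (T' - fst y))\<^sup>2 * (ramp' ((fst y - s) / s) / s)) \<partial>lborel)"
   by (rule key[OF tt])
   also have "\<dots> = (\<integral>y. w y * ?b y - w y * ?a y \<partial>lborel)" by (intro BI_integral_cong) (auto simp: algebra_simps)
   also have "\<dots> = (\<integral>y. w y * ?b y \<partial>lborel) - (\<integral>y. w y * ?a y \<partial>lborel)" using ia iwb by simp
   finally have "(\<integral>y. w y * ?a y \<partial>lborel) <= (\<integral>y. w y * ?b y \<partial>lborel)" by simp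
   also have "\<dots> <= (\<integral>y. w y * (indicator {s..2 * s} (fst y) * (2 * T\<^sup>2 / s)) \<partial>lborel)" by (rule integral_mono[OF iwb ib bbd])
   also have "\<dots> <= 2 * T\<^sup>2 * e"
   proof -
   have "ennreal (\<integral>y. w y * (indicator {s..2 * s} (fst y) * (2 * T\<^sup>2 / s)) \<partial>lborel) = (\<integral>\<^sup>+y. ennreal (w y * (indicator {s..2 * s} (fst y) * (2 * T\<^sup>2 / s))) \<partial>lborel)"
   using wb(1) s by (intro nn_integral_eq_integral[symmetric] ib) (auto simp: indicator_def)
   also have "\<dots> = (\<integral>\<^sup>+t. \<integral>\<^sup>+x. ennreal (w (t, x) * (indicator {s..2 * s} t * (2 * T\<^sup>2 / s))) \<partial>lborel \<partial>lborel)"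
   by (subst fub) auto
   also have "\<dots> <= (\<integral>\<^sup>+t. ennreal (2 * T\<^sup>2 / s * e) * indicator {s..2 * s} t \<partial>lborel)"
   proof (rule nn_integral_mono_AE)
   have "AE t in lborel. t \<noteq> 2 * s" by (rule AE_lborel_singleton)
   then show "AE t in lborel. (\<integral>\<^sup>+x. ennreal (w (t, x) * (indicator {s..2 * s} t * (2 * T\<^sup>2 / s))) \<partial>lborel) <= ennreal (2 * T\<^sup>2 / s * e) * indicator {s..2 * s} t"
   using ie
   proof eventually_elim
   case (elim t)
   show ?case
   proof (cases "t : {s..2 * s}")
   case True
   then have le: "(\<integral>\<^sup>+x. ennreal (w (t, x)) \<partial>lborel) <= ennreal e" using elim s by auto
   have mt: "(%x. ennreal (w (t, x))) : borel_measurable lborel"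
   proof -
   have "(%x. (t, x)) : (borel :: 'a measure) \<rightarrow>\<^sub>M (borel :: (real \<times> 'a) measure)"
   by (intro borel_measurable_continuous_onI continuous_intros)
   from measurable_compose[OF this, of w borel] show ?thesis by measurable
   qed
   have "(\<integral>\<^sup>+x. ennreal (w (t, x) * (indicator {s..2 * s} t * (2 * T\<^sup>2 / s))) \<partial>lborel) = (\<integral>\<^sup>+x. ennreal (2 * T\<^sup>2 / s) * ennreal (w (t, x)) \<partial>lborel)"
   using True s wb(1) by (intro nn_integral_cong) (simp add: ennreal_mult[symmetric] mult.commute)
   also have "\<dots> = ennreal (2 * T\<^sup>2 / s) * (\<integral>\<^sup>+x. ennreal (w (t, x)) \<partial>lborel)" by (rule nn_integral_cmult[OF mt])
   also have "\<dots> <= ennreal (2 * T\<^sup>2 / s) * ennreal e" by (intro mult_left_mono le) auto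
   also have "\<dots> = ennreal (2 * T\<^sup>2 / s * e)" using s e by (intro ennreal_mult[symmetric]) auto
   finally show ?thesis using True by simp
   qed simp
   qed
   qed
   also have "\<dots> = ennreal (2 * T\<^sup>2 / s * e) * emeasure lborel {s..2 * s}" by (rule nn_integral_cmult_indicator) simp
   also have "\<dots> = ennreal (2 * T\<^sup>2 * e)" using s e by (simp add: ennreal_mult[symmetric])
   finally show ?thesis using e by (simp add: ennreal_le_iff)
   qed
   finally show ?thesis .
  qed
  define good where "good k s \<longleftrightarrow> 0 < s & s <= T' & s <= rad k & (AE t in lborel. 0 < t & t < 2 * s --> (\<integral>\<^sup>+x. ennreal (w (t, x)) \<partial>lborel) <= ennreal (rad k))" for k s
  have seq: "\<exists>s. good k s" for k
  proof -
   obtain s0 where s0: "s0 > 0" "AE t in lborel. 0 < t & t < s0 --> (\<integral>\<^sup>+x. ennreal (w (t, x)) \<partial>lborel) <= ennreal (rad k)"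
   using init[OF rad_pos[of k]] unfolding w_def Y_def by blast
   let ?s = "min (s0 / 2) (min T' (rad k))"
   have "AE t in lborel. 0 < t & t < 2 * ?s --> (\<integral>\<^sup>+x. ennreal (w (t, x)) \<partial>lborel) <= ennreal (rad k)"
   using s0(2) by eventually_elim auto
   then show ?thesis using s0(1) T' unfolding good_def by (intro exI[of _ ?s]) auto
  qed
  then obtain s where "!!k. good k (s k)" by metis
  then have s: "!!k. 0 < s k" "!!k. s k <= T'" "!!k. s k <= rad k"
   "!!k. AE t in lborel. 0 < t & t < 2 * s k --> (\<integral>\<^sup>+x. ennreal (w (t, x)) \<partial>lborel) <= ennreal (rad k)"
   unfolding good_def by auto
  have iW: "lint ?W"
  proof (rule BI_integrable_bound)
   show "lint (%y. (2 * T) * w y)" using iw by simp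
   show "?W : borel_measurable lborel" by measurable
   show "AE y in lborel. norm (?W y) <= norm ((2 * T) * w y)"
   proof (rule AE_I2)
   fix y
   show "norm (?W y) <= norm ((2 * T) * w y)"
   proof (cases "w y = 0")
   case False
   then have "fst y : {0<..<T}" using w0[of y] by (cases y) auto
   then have "w y * (2 * max 0 (T' - fst y)) <= w y * (2 * T)" using T' wb(1) by (intro mult_left_mono) auto
   also have "\<dots> = (2 * T) * w y" by simp
   also have "\<dots> <= \<bar>(2 * T) * w y\<bar>" by (rule abs_ge_self)
   finally show ?thesis using wb(1)[of y] by simp
   qed simp
   qed
  qed
  have "(%k. \<integral>y. w y * (2 * max 0 (T' - fst y) * ramp ((fst y - s k) / s k)) \<partial>lborel) \<rightarrow> integral\<^sup>L lborel ?W"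
  proof (rule integral_dominated_convergence[where w="%y. \<bar>?W y\<bar>"])
   have cr: "continuous_on UNIV ramp" by (meson DERIV_isCont continuous_at_imp_continuous_on ramp_deriv)
   have [measurable]: "ramp : borel_funs" using cr by (rule borel_measurable_continuous_onI)
   show "(%y. w y * (2 * max 0 (T' - fst y) * ramp ((fst y - s k) / s k))) : borel_measurable lborel" for k by measurable
   show "AE y in lborel. (%k. w y * (2 * max 0 (T' - fst y) * ramp ((fst y - s k) / s k))) \<rightarrow> ?W y"
   proof (rule AE_I2)
   fix y
   show "(%k. w y * (2 * max 0 (T' - fst y) * ramp ((fst y - s k) / s k))) \<rightarrow> ?W y"
   proof (cases "w y = 0")
   case False
   then have t: "0 < fst y" using w0[of y] by (cases y) auto
   then have "\<forall>\<^sub>F k in sequentially. rad k < fst y / 2" by (intro rad_eventually) auto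
   then have "\<forall>\<^sub>F k in sequentially. w y * (2 * max 0 (T' - fst y) * ramp ((fst y - s k) / s k)) = ?W y"
   proof eventually_elim
   case (elim k)
   have "2 * s k <= fst y" using s(3)[of k] elim by linarith
   then have "(fst y - s k) / s k >= 1" using s(1)[of k] by (simp add: le_divide_eq)
   then show ?case by (simp add: ramp_props)
   qed
   then show ?thesis by (rule tendsto_eventually)
   qed simp
   qed
   show "AE y in lborel. norm (w y * (2 * max 0 (T' - fst y) * ramp ((fst y - s k) / s k))) <= \<bar>?W y\<bar>" for k
   proof (rule AE_I2)
   fix y
   have "norm (w y * (2 * max 0 (T' - fst y) * ramp ((fst y - s k) / s k))) = \<bar>?W y\<bar> * ramp ((fst y - s k) / s k)"
   by (simp add: abs_mult ramp_props)
   also have "\<dots> <= \<bar>?W y\<bar>" by (rule mult_left_le) (auto simp: ramp_props)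
   finally show "norm (w y * (2 * max 0 (T' - fst y) * ramp ((fst y - s k) / s k))) <= \<bar>?W y\<bar>" .
   qed
  qed (use iW in simp_all)
  moreover have "(%k. 2 * T\<^sup>2 * rad k) \<rightarrow> 2 * T\<^sup>2 * 0" by (intro tendsto_intros rad_tendsto)
  ultimately have "integral\<^sup>L lborel ?W <= 2 * T\<^sup>2 * 0"
   by (rule LIMSEQ_le) (use small[OF s(1,2) rad_pos s(4)] in blast)
  moreover have W0: "0 <= ?W y" for y using wb(1) by simp
  then have "0 <= integral\<^sup>L lborel ?W" by (intro integral_nonneg_AE) auto
  ultimately have "integral\<^sup>L lborel ?W = 0" by simp
  then have "AE y in lborel. ?W y = 0" using integral_nonneg_eq_0_iff_AE[OF iW AE_I2[OF W0]] by simp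
  then show ?thesis by eventually_elim auto
 qed
 have "AE y in lborel. \<forall>n. fst y < T - T * (rad n / 2) --> w y = 0"
  unfolding AE_all_countable
 proof
  fix n
  have "0 < T * (rad n / 2)" using T by simp
  moreover have "T * (rad n / 2) <= T * (1 / 2)" using T rad_le_1[of n] by (intro mult_left_mono) auto
  ultimately show "AE y in lborel. fst y < T - T * (rad n / 2) --> w y = 0" using T by (intro zero) auto
 qed
 then show ?thesis
 proof eventually_elim
  case (elim y)
  show ?case
  proof
   assume y: "y : Q"
   then have "(T - fst y) / T > 0" using T by (cases y) auto
   then obtain n where "rad n < (T - fst y) / T" using rad_eventually unfolding eventually_sequentially by blast
   then have "rad n * T < T - fst y" using T by (simp add: less_divide_eq)
   moreover have "T * (rad n / 2) <= rad n * T" using T rad_pos[of n] by simp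
   ultimately have "fst y < T - T * (rad n / 2)" by linarith
   then have "w y = 0" using elim by blast
   then have "u y powr q <= v y powr q" by (simp add: w_def Y_def max_def split: if_splits)
   then show "u y <= v y" using us(3)[of y] vs(3)[of y] q by (metis powr_less_mono2 not_le less_trans zero_less_one)
  qed
 qed
qed

end

section \<open>Geometry of the domain and regularity of the exponent\<close>

lemma onorm_inner_le:
 fixes a :: "'a::euclidean_space"
 assumes "norm a <= B"
 shows "onorm (%h. a \<bullet> h) <= B"
proof (rule onorm_le)
 fix h
 have "norm (a \<bullet> h) <= norm a * norm h" by (simp add: Cauchy_Schwarz_ineq2)
 also have "\<dots> <= B * norm h" using assms by (rule mult_right_mono) simp
 finally show "norm (a \<bullet> h) <= B * norm h" .
qed

text \<open>
  Near a point of a \<open>C\<^sup>1\<close> hypersurface some coordinate axis is transversal to it, and the defining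
  function grows at a definite rate along that axis. Hence a point at distance \<open>d\<close> from the
  hypersurface meets it along that axis within distance \<open>C d\<close>.
\<close>

lemma hypersurface_exit_local:
 fixes M :: "'a::euclidean_space set"
 assumes h: "C1_holder_hypersurface \<gamma> M" and \<gamma>: "\<gamma> > 0" and x0: "x0 : M"
 shows "\<exists>r>0. \<exists>C\<ge>1. \<forall>x y. y : M --> dist y x0 < r --> dist x y < r -->
   (\<exists>b\<in>Basis. \<exists>s. \<bar>s\<bar> <= C * dist x y & x + s *# b : M)"
proof -
 obtain U \<psi> D H where X: "open U & x0 : U & (\<forall>x\<in>U. (\<psi> has_derivative (%y. D x \<bullet> y)) (at x)) & (\<forall>x\<in>U. D x \<noteq> 0) &
   (\<forall>x\<in>U. \<forall>y\<in>U. norm (D x - D y) <= H * dist x y powr \<gamma>) & M \<inter> U = {x : U. \<psi> x = (0::real)}"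
  using bspec[OF h[unfolded C1_holder_hypersurface_def] x0] by (elim exE) (rule that)
 then have U: "open U" "x0 : U"
  and d: "!!x. x : U ==> (\<psi> has_derivative (%y. D x \<bullet> y)) (at x)"
  and nz: "!!x. x : U ==> D x \<noteq> 0"
  and H: "!!x y. x : U ==> y : U ==> norm (D x - D y) <= H * dist x y powr \<gamma>"
  and MU: "M \<inter> U = {x : U. \<psi> x = (0::real)}"
  by simp_all
 obtain b where b: "b : Basis" "D x0 \<bullet> b \<noteq> 0" using nz[OF U(2)] by (metis euclidean_all_zero_iff)
 define \<sigma> where "\<sigma> = sgn (D x0 \<bullet> b)"
 define c where "c = \<bar>D x0 \<bullet> b\<bar> / 2"
 have c: "c > 0" using b by (simp add: c_def)
 have \<sigma>: "\<sigma> * (D x0 \<bullet> b) = 2 * c" "\<bar>\<sigma>\<bar> = 1" "\<sigma> \<noteq> 0" using b by (auto simp: \<sigma>_def c_def sgn_if)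
 have "((%x. H * dist x x0 powr \<gamma>) \<longlongrightarrow> H * 0) (at x0)"
 proof (intro tendsto_intros)
  have "((%x. dist x x0 powr \<gamma>) \<longlongrightarrow> dist x0 x0 powr \<gamma>) (at x0)"
   using \<gamma> by (intro tendsto_powr2 tendsto_intros always_eventually) auto
  then show "((%x. dist x x0 powr \<gamma>) \<longlongrightarrow> 0) (at x0)" by simp
 qed
 then have "\<forall>\<^sub>F x in at x0. H * dist x x0 powr \<gamma> < c" using c by (intro order_tendstoD) auto
 moreover have "\<forall>\<^sub>F x in at x0. x : U" using U by (rule eventually_at_in_open')
 ultimately have "\<forall>\<^sub>F x in at x0. x : U & norm (D x - D x0) < c"
  by eventually_elim (use H[OF _ U(2)] in \<open>auto intro: le_less_trans\<close>)
 then obtain rho where rho: "rho > 0" and rhoU: "!!x. dist x x0 < rho ==> x : U & norm (D x - D x0) < c"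
  using U(2) c unfolding eventually_at by (metis UNIV_I diff_self norm_zero)
 define \<Lambda> where "\<Lambda> = norm (D x0) + c"
 have \<Lambda>: "\<Lambda> > 0" using c by (simp add: \<Lambda>_def add_nonneg_pos)
 have bnd: "norm (D x) <= \<Lambda>" "c <= \<sigma> * (D x \<bullet> b)" if "dist x x0 < rho" for x
 proof -
  have l: "norm (D x - D x0) < c" using rhoU[OF that] by simp
  show "norm (D x) <= \<Lambda>" using norm_triangle_sub[of "D x" "D x0"] l by (simp add: \<Lambda>_def)
  have "\<bar>\<sigma> * ((D x - D x0) \<bullet> b)\<bar> <= norm (D x - D x0)"
   using Cauchy_Schwarz_ineq2[of "D x - D x0" b] b(1) \<sigma>(2) by (simp add: abs_mult)
  then have "- c <= \<sigma> * ((D x - D x0) \<bullet> b)" using l by linarith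
  then show "c <= \<sigma> * (D x \<bullet> b)" using \<sigma>(1) by (simp add: inner_diff_left right_diff_distrib)
 qed
 define C where "C = max 1 (\<Lambda> / c)"
 have C: "C >= 1" "\<Lambda> <= C * c" using c by (auto simp: C_def max_def field_simps)
 define r where "r = rho / (2 + C)"
 have r: "r > 0" "r * (2 + C) = rho" using rho C by (auto simp: r_def)
 show ?thesis
 proof (rule exI[of _ r], rule conjI[OF r(1)], rule exI[of _ C], rule conjI[OF C(1)], intro allI impI)
  fix x y
  assume y: "y : M" "dist y x0 < r" and xy: "dist x y < r"
  define t where "t = C * dist x y"
  have t: "0 <= t" "t <= C * r" using C xy by (auto simp: t_def)
  have inrho: "dist (x + s *# b) x0 < rho" if "\<bar>s\<bar> <= t" for s
  proof -
   have "dist (x + s *# b) x = \<bar>s\<bar>" using b(1) by (simp add: dist_norm)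
   then have "dist (x + s *# b) x0 <= \<bar>s\<bar> + dist x y + dist y x0"
   using dist_triangle[of "x + s *# b" x0 x] dist_triangle[of x x0 y] by linarith
   also have "\<dots> < C * r + r + r" using that t y xy by linarith
   finally show ?thesis using r by (simp add: algebra_simps)
  qed
  have xrho: "dist x x0 < rho" using inrho[of 0] t by simp
  have yrho: "dist y x0 < rho"
  proof -
   have "r * 1 <= r * (2 + C)" using r C by (intro mult_left_mono) auto
   then show ?thesis using y r by simp
  qed
  have \<psi>y: "\<psi> y = 0" using y(1) rhoU[OF yrho] MU by auto
  have "norm (\<psi> x - \<psi> y) <= \<Lambda> * norm (x - y)"
  proof (rule differentiable_bound[where S="ball x0 rho"])
   show "convex (ball x0 rho)" by simp
   show "(\<psi> has_derivative (%h. D z \<bullet> h)) (at z within ball x0 rho)" if "z : ball x0 rho" for z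
   proof -
   have "dist z x0 < rho" using that by (simp add: dist_commute)
   then have "z : U" using rhoU by blast
   then show ?thesis by (rule has_derivative_at_withinI[OF d])
   qed
   show "onorm (%h. D z \<bullet> h) <= \<Lambda>" if "z : ball x0 rho" for z
   by (rule onorm_inner_le[OF bnd(1)]) (use that in \<open>simp add: dist_commute\<close>)
  qed (use xrho yrho in \<open>auto simp: dist_commute\<close>)
  then have \<psi>x: "\<bar>\<sigma> * \<psi> x\<bar> <= \<Lambda> * dist x y" using \<psi>y \<sigma>(2) by (simp add: dist_norm abs_mult)
  also have "\<dots> <= C * c * dist x y" using C(2) by (intro mult_right_mono) auto
  finally have \<psi>t: "\<bar>\<sigma> * \<psi> x\<bar> <= c * t" by (simp add: t_def mult_ac)
  define g where "g s = \<sigma> * \<psi> (x + s *# b)" for s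
  have dg: "(g has_real_derivative \<sigma> * (D (x + s *# b) \<bullet> b)) (at s)" if "\<bar>s\<bar> <= t" for s
  proof -
   have "((%s. x + s *# b) has_derivative (%h. h *# b)) (at s)" by (auto intro!: derivative_eq_intros)
   from has_derivative_compose[OF this d] rhoU[OF inrho[OF that]]
   have "((%s. \<psi> (x + s *# b)) has_derivative (%h. D (x + s *# b) \<bullet> (h *# b))) (at s)" by blast
   then have "((%s. \<psi> (x + s *# b)) has_real_derivative (D (x + s *# b) \<bullet> b)) (at s)"
   unfolding has_field_derivative_def by (rule has_derivative_eq_rhs) (simp add: fun_eq_iff)
   then show ?thesis unfolding g_def by (rule DERIV_cmult)
  qed
  have mono: "g s1 - c * s1 <= g s2 - c * s2" if "- t <= s1" "s1 <= s2" "s2 <= t" for s1 s2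
  proof (rule DERIV_nonneg_imp_nondecreasing[OF that(2)])
   fix s
   assume "s1 <= s" "s <= s2"
   then have s: "\<bar>s\<bar> <= t" using that by auto
   have "((%s. g s - c * s) has_real_derivative \<sigma> * (D (x + s *# b) \<bullet> b) - c) (at s)"
   using dg[OF s] by (auto intro!: derivative_eq_intros)
   then show "\<exists>y. ((%s. g s - c * s) has_real_derivative y) (at s) & 0 <= y"
   using bnd(2)[OF inrho[OF s]] by auto
  qed
  have g0: "g 0 = \<sigma> * \<psi> x" by (simp add: g_def)
  have "g (- t) <= 0" "0 <= g t" using mono[of "- t" 0] mono[of 0 t] t \<psi>t unfolding g0 by auto
  then have "\<exists>s\<ge>- t. s <= t & g s = 0"
   using t(1) by (intro IVT) (auto intro!: DERIV_isCont dg)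
  then obtain s where s: "- t <= s" "s <= t" "g s = 0" by blast
  have "\<bar>s\<bar> <= t" using s by auto
  moreover have "\<psi> (x + s *# b) = 0" using s(3) \<sigma>(3) by (simp add: g_def)
  then have "x + s *# b : M" using rhoU[OF inrho[OF \<open>\<bar>s\<bar> <= t\<close>]] MU by blast
  ultimately show "\<exists>b\<in>Basis. \<exists>s. \<bar>s\<bar> <= C * dist x y & x + s *# b : M" using b(1) unfolding t_def by blast
 qed
qed

lemma admissible_domain_basic:
 assumes "admissible_domain (Om::'a::euclidean_space set)"
 shows "open Om" "bounded Om" "Om \<noteq> {}" "frontier Om \<noteq> {}" "compact (frontier Om)"
proof -
 show o: "open Om" and b: "bounded Om" and n: "Om \<noteq> {}"
  using assms by (auto simp: admissible_domain_def split: if_splits)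
 have "Om \<noteq> UNIV" using b not_bounded_UNIV by auto
 then show "frontier Om \<noteq> {}" using n by (simp add: frontier_eq_empty)
 show "compact (frontier Om)" using b by (rule compact_frontier_bounded)
qed

lemma admissible_domain_exit:
 assumes a: "admissible_domain (Om::'a::euclidean_space set)"
 obtains C dlt0 where "C >= 1" "0 < dlt0" "dlt0 <= 1"
  "!!x dlt. 0 < dlt ==> dlt < dlt0 ==> x : Om ==> infdist x (frontier Om) < dlt ==>
   \<exists>b\<in>Basis. \<exists>s. \<bar>s\<bar> <= C * dlt & x + s *# b : frontier Om"
proof -
 note A = admissible_domain_basic[OF a]
 have near: "\<exists>y\<in>frontier Om. dist x y < dlt" if "infdist x (frontier Om) < dlt" for x and dlt :: real
  using infdist_attains_inf[OF compact_imp_closed[OF A(5)] A(4), of x] that by metis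
 show thesis
 proof (cases "DIM('a) = 1")
  case True
  then obtain b :: 'a where b: "Basis = {b}" by (auto simp: card_1_singleton_iff)
  show thesis
  proof (rule that[of 1 1])
   fix x dlt
   assume "infdist x (frontier Om) < dlt"
   then obtain y where y: "y : frontier Om" "dist x y < dlt" using near by blast
   have e: "((y - x) \<bullet> b) *# b = y - x" using euclidean_representation[of "y - x"] unfolding b by simp
   have "\<bar>(y - x) \<bullet> b\<bar> <= 1 * dlt" using Basis_le_norm[of b "y - x"] y(2) unfolding b by (simp add: dist_norm norm_minus_commute)
   moreover have "x + ((y - x) \<bullet> b) *# b : frontier Om" using y(1) by (simp add: e)
   ultimately show "\<exists>b\<in>Basis. \<exists>s. \<bar>s\<bar> <= 1 * dlt & x + s *# b : frontier Om" using b by blast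
  qed auto
 next
  case False
  then have "\<exists>\<gamma>\<in>{0<..<1}. C1_holder_hypersurface \<gamma> (frontier Om)"
   using a unfolding admissible_domain_def by presburger
  then obtain \<gamma> where \<gamma>: "\<gamma> : {0<..<1}" "C1_holder_hypersurface \<gamma> (frontier Om)" by blast
  define good where "good x0 r C \<longleftrightarrow> (r::real) > 0 & (C::real) >= 1 & (\<forall>x y. y : frontier Om --> dist y x0 < r --> dist x y < r -->
   (\<exists>b\<in>Basis. \<exists>s. \<bar>s\<bar> <= C * dist x y & x + s *# b : frontier Om))" for x0 r C
  have "\<forall>x0\<in>frontier Om. \<exists>r C. good x0 r C"
   using hypersurface_exit_local[OF \<gamma>(2)] \<gamma>(1) unfolding good_def greaterThanLessThan_iff by blast
  then obtain r C where "!!x0. x0 : frontier Om ==> good x0 (r x0) (C x0)" by metis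
  then have rC: "r x0 > 0 & C x0 >= 1 & (\<forall>x y. y : frontier Om --> dist y x0 < r x0 --> dist x y < r x0 -->
   (\<exists>b\<in>Basis. \<exists>s. \<bar>s\<bar> <= C x0 * dist x y & x + s *# b : frontier Om))" if "x0 : frontier Om" for x0
   using that unfolding good_def by blast
  obtain F where F: "F \<subseteq> frontier Om" "finite F" "frontier Om \<subseteq> (\<Union>x0\<in>F. ball x0 (r x0))"
   by (rule compactE_image[OF A(5), of "frontier Om" "%x0. ball x0 (r x0)"]) (use rC in \<open>auto intro!: centre_in_ball[THEN iffD2]\<close>)
  have Fne: "F \<noteq> {}" using F(3) A(4) by auto
  define C' where "C' = Max (C ` F)"
  define dlt0 where "dlt0 = min 1 (Min (r ` F))"
  have le: "C x0 <= C'" "dlt0 <= r x0" if "x0 : F" for x0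
   using that F(2) unfolding C'_def dlt0_def by (auto intro: min.coboundedI2)
  show thesis
  proof (rule that[of C' dlt0])
   obtain x0 where "x0 : F" using Fne by blast
   then show "C' >= 1" using le(1) rC F(1) by (meson order_trans subsetD)
   show "0 < dlt0" using F Fne rC unfolding dlt0_def by auto
   show "dlt0 <= 1" by (simp add: dlt0_def)
   fix x dlt
   assume dlt: "0 < dlt" "dlt < dlt0" and "infdist x (frontier Om) < dlt"
   then obtain y where y: "y : frontier Om" "dist x y < dlt" using near by blast
   then obtain x0 where x0: "x0 : F" "dist y x0 < r x0" using F(3) by (auto simp: dist_commute)
   have "dist x y < r x0" using y dlt le(2)[OF x0(1)] by linarith
   then obtain b s where bs: "b : Basis" "\<bar>s\<bar> <= C x0 * dist x y" "x + s *# b : frontier Om"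
   using rC[of x0] x0 F(1) y(1) by blast
   have "C x0 * dist x y <= C' * dlt" using le(1)[OF x0(1)] rC[of x0] x0 F(1) y(2) by (intro mult_mono) auto
   then show "\<exists>b\<in>Basis. \<exists>s. \<bar>s\<bar> <= C' * dlt & x + s *# b : frontier Om" using bs by (meson order_trans)
  qed
 qed
qed

text \<open>
  An exponent of class \<open>C\<^sup>1\<close> up to the boundary is Lipschitz along segments inside the domain.
\<close>

lemma C1_closure_properties:
 fixes p :: "'a::euclidean_space => real"
 assumes c: "C1_closure Om p" and Om: "open Om" "bounded Om" "Om \<noteq> {}"
 obtains P L where "L >= 0" "!!x. x : closure Om ==> exponent_min Om p <= p x & p x <= P"
  "!!x y. closed_segment x y \<subseteq> Om ==> \<bar>p x - p y\<bar> <= L * dist x y"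
proof -
 obtain D where D: "continuous_on (closure Om) D" "!!x. x : Om ==> (p has_derivative (%y. D x \<bullet> y)) (at x)"
  and pc: "continuous_on (closure Om) p"
  using c unfolding C1_closure_def by blast
 have cc: "compact (closure Om)" using Om(2) by simp
 obtain B where B: "!!x. x : closure Om ==> norm (D x) <= B"
  using compact_imp_bounded[OF compact_continuous_image[OF D(1) cc]] unfolding bounded_iff by blast
 obtain P where P: "!!x. x : closure Om ==> \<bar>p x\<bar> <= P"
  using compact_imp_bounded[OF compact_continuous_image[OF pc cc]] unfolding bounded_iff by (metis image_eqI real_norm_def)
 have "bdd_below (p ` closure Om)"
  by (rule bdd_belowI2[of _ "- P"]) (use P in fastforce)
 then have m: "exponent_min Om p <= p x" if "x : closure Om" for x
  unfolding exponent_min_def using that by (rule cINF_lower)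
 obtain x0 where "x0 : Om" using Om(3) by blast
 then have "norm (D x0) <= B" using closure_subset B by blast
 then have B0: "B >= 0" using norm_ge_zero order_trans by blast
 show thesis
 proof (rule that[of B P])
  show "B >= 0" by (rule B0)
  show "exponent_min Om p <= p x & p x <= P" if "x : closure Om" for x using m[OF that] P[OF that] by auto
  show "\<bar>p x - p y\<bar> <= B * dist x y" if s: "closed_segment x y \<subseteq> Om" for x y
  proof -
   have "norm (p x - p y) <= B * norm (x - y)"
   proof (rule differentiable_bound[where S="closed_segment x y"])
   show "(p has_derivative (%h. D z \<bullet> h)) (at z within closed_segment x y)" if "z : closed_segment x y" for z
   by (rule has_derivative_at_withinI[OF D(2)]) (use that s in blast)
   show "onorm (%h. D z \<bullet> h) <= B" if "z : closed_segment x y" for z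
   proof -
   have "norm (D z) <= B" using that s closure_subset B by blast
   then show ?thesis by (rule onorm_inner_le)
   qed
   qed auto
   then show ?thesis by (simp add: dist_norm)
  qed
 qed
qed

section \<open>Translation to weak derivatives and Lebesgue spaces\<close>

lemma test_function_C1_test:
 assumes "phi : test_functions S"
 shows "C1_test (closure {y. phi y \<noteq> 0}) phi (grad phi)" "closure {y. phi y \<noteq> 0} \<subseteq> S"
  "frechet_derivative phi (at x) b = grad phi x \<bullet> b"
proof -
 have Ck: "Ck n phi" for n using assms by (simp add: test_functions_def)
 show "C1_test (closure {y. phi y \<noteq> 0}) phi (grad phi)"
  unfolding C1_test_def using assms Ck_grad(1,2)[OF Ck] closure_subset[of "{y. phi y \<noteq> 0}"] by (auto simp: test_functions_def)
 show "closure {y. phi y \<noteq> 0} \<subseteq> S" using assms by (simp add: test_functions_def)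
 show "frechet_derivative phi (at x) b = grad phi x \<bullet> b" using grad_inner[OF Ck_SucD(1)[OF Ck]] by simp
qed

lemma loc_int_test_integrable:
 fixes f :: "'b::euclidean_space => 'c::euclidean_space" and phi :: "'b => real"
 assumes f: "loc_int S f" and K: "compact K" "K \<subseteq> S" and phi: "phi : borel_funs" "!!x. \<bar>phi x\<bar> <= B" "!!x. x \<notin> K ==> phi x = 0"
 shows "lint (%x. phi x *# f x)"
proof -
 have "lint (%x. phi x *# (indicator K x *# f x))"
  by (rule integrable_scaleR_bounded[of _ _ _ B]) (use f K phi(1,2) in \<open>auto simp: loc_int_def\<close>)
 moreover have "phi x *# (indicator K x *# f x) = phi x *# f x" for x using phi(3)[of x] by (cases "x : K") auto
 ultimately show ?thesis by (simp only:)
qed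

lemma loc_int_scaleR_left:
 fixes f :: "'b::euclidean_space => real" and c :: "'c::euclidean_space"
 assumes "loc_int S f"
 shows "loc_int S (%x. f x *# c)"
proof -
 have "lint (%x. indicator K x *# (f x *# c))" if "compact K" "K \<subseteq> S" for K
  using assms that integrable_scaleR_left[of c lborel "%x. indicator K x *# f x"] by (simp add: loc_int_def)
 moreover have "(%x. f x *# c) : borel_funs" using loc_int_borel[OF assms] by measurable
 ultimately show ?thesis by (simp add: loc_int_def)
qed

lemma loc_int_sum:
 fixes f :: "'i => 'b::euclidean_space => 'c::euclidean_space"
 assumes "!!i. i : I ==> loc_int S (f i)"
 shows "loc_int S (%x. \<Sum>i\<in>I. f i x)"
proof -
 have "lint (%x. \<Sum>i\<in>I. indicator K x *# f i x)" if "compact K" "K \<subseteq> S" for K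
  using assms that by (intro BI_integrable_sum) (auto simp: loc_int_def)
 moreover have "(%x. \<Sum>i\<in>I. f i x) : borel_funs"
  using loc_int_borel[OF assms] by (rule borel_measurable_sum)
 ultimately show ?thesis by (simp add: loc_int_def scaleR_sum_right)
qed

lemma weak_derivative_wderiv:
 fixes u g u' g' :: "'b::euclidean_space => real"
 assumes S: "open S" and w: "weak_derivative S b u g"
  and u': "u' : borel_funs" "!!x. x \<notin> S ==> u' x = 0" "AE x in lborel. x : S --> u' x = u x"
  and g': "g' : borel_funs" "!!x. x \<notin> S ==> g' x = 0" "AE x in lborel. x : S --> g' x = g x"
 shows "wderiv S b u' g'"
proof -
 have Sb: "S : sets borel" using S by simp
 have lu: "loc_int S u'" and lg: "loc_int S g'"
  using w locally_integrable_iff_loc_int[OF u'(1,3)] locally_integrable_iff_loc_int[OF g'(1,3)] by (auto simp: weak_derivative_def)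
 have "(\<integral>x. g' x * phi x + u' x *# b \<bullet> grad phi x \<partial>lborel) = 0" if phi: "phi : test_functions S" for phi
 proof -
  note t = test_function_C1_test[OF phi]
  let ?K = "closure {y. phi y \<noteq> 0}"
  have K: "compact ?K" using t(1) unfolding C1_test_def by (rule conjunct1)
  obtain B where B: "B > 0" "!!x. \<bar>phi x\<bar> <= B" "!!x. norm (grad phi x) <= B" by (rule C1_test_bounded[OF t(1)]) (rule that)
  note [measurable] = C1_test_integrable(2,3)[OF t(1)] u'(1) g'(1)
  have db: "\<bar>grad phi x \<bullet> b\<bar> <= B * norm b" for x
   using order_trans[OF Cauchy_Schwarz_ineq2 mult_right_mono[OF B(3)[of x]]] by simp
  have i1: "lint (%x. phi x *# g' x)"
   by (rule loc_int_test_integrable[OF lg K t(2) _ B(2) C1_test_zero[OF t(1)]]) auto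
  have i2: "lint (%x. (grad phi x \<bullet> b) *# u' x)"
   by (rule loc_int_test_integrable[OF lu K t(2) _ db]) (use C1_test_grad_zero[OF t(1)] in auto)
  have "(\<integral>x. u x * frechet_derivative phi (at x) b \<partial>lebesgue_on S) = (\<integral>x. (grad phi x \<bullet> b) *# u' x \<partial>lborel)"
   by (rule lebesgue_on_representative(1)[OF Sb]) (use u' t(3) in \<open>auto elim!: eventually_mono\<close>)
  moreover have "(\<integral>x. g x * phi x \<partial>lebesgue_on S) = (\<integral>x. phi x *# g' x \<partial>lborel)"
   by (rule lebesgue_on_representative(1)[OF Sb]) (use g' in \<open>auto elim!: eventually_mono\<close>)
  ultimately have e: "(\<integral>x. (grad phi x \<bullet> b) *# u' x \<partial>lborel) = - (\<integral>x. phi x *# g' x \<partial>lborel)"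
   using w phi by (simp add: weak_derivative_def)
  have "(\<integral>x. g' x * phi x + u' x *# b \<bullet> grad phi x \<partial>lborel) = (\<integral>x. phi x *# g' x + (grad phi x \<bullet> b) *# u' x \<partial>lborel)"
   by (intro BI_integral_cong) (auto simp: inner_commute mult.commute)
  also have "\<dots> = 0" unfolding BI_integral_add[OF i1 i2] e by simp
  finally show ?thesis .
 qed
 then show ?thesis using loc_int_scaleR_left[OF lu, of b] lg unfolding weak_div_def by blast
qed

lemma weak_gradient_wderiv:
 fixes u u' :: "'b::euclidean_space => real" and G :: "'b => 'a::euclidean_space"
 assumes S: "open S" and w: "!!b. b : Basis ==> weak_derivative S (e b) u (%y. G y \<bullet> b)"
  and u': "u' : borel_funs" "!!x. x \<notin> S ==> u' x = 0" "AE x in lborel. x : S --> u' x = u x"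
 obtains G' where "loc_int S G'" "!!x. x \<notin> S ==> G' x = 0" "AE x in lborel. x : S --> G' x = G x"
  "!!b. b : Basis ==> wderiv S (e b) u' (%y. G' y \<bullet> b)"
proof -
 define rep where "rep b g \<longleftrightarrow> loc_int S g & (\<forall>x. x \<notin> S --> g x = 0) & (AE x in lborel. x : S --> g x = G x \<bullet> b)" for b and g :: "'b => real"
 have "\<exists>g. rep b g" if "b : Basis" for b
 proof -
  have "locally_integrable S (%y. G y \<bullet> b)" using w[OF that] by (simp add: weak_derivative_def)
  then show ?thesis by (rule locally_integrable_representative[OF S]) (auto simp: rep_def)
 qed
 then obtain g where "!!b. b : Basis ==> rep b (g b)" by metis
 then have g: "loc_int S (g b)" "x \<notin> S ==> g b x = 0" "AE x in lborel. x : S --> g b x = G x \<bullet> b" if "b : Basis" for b x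
  using that unfolding rep_def by blast+
 define G' where "G' x = (\<Sum>b\<in>Basis. g b x *# b)" for x
 have G'b: "G' x \<bullet> b = g b x" if "b : Basis" for b x using that by (simp add: G'_def inner_sum_left_Basis)
 show thesis
 proof (rule that[of G'])
  show "loc_int S G'" unfolding G'_def by (intro loc_int_sum loc_int_scaleR_left g)
  show "G' x = 0" if "x \<notin> S" for x using g(2)[OF _ that] by (simp add: G'_def)
  have "AE x in lborel. \<forall>b\<in>Basis. x : S --> g b x = G x \<bullet> b" by (rule AE_finite_allI[OF finite_Basis g(3)])
  then show "AE x in lborel. x : S --> G' x = G x"
  proof eventually_elim
   case (elim x)
   then show ?case by (intro impI euclidean_eqI[of "G' x" "G x"]) (simp add: G'b)
  qed
  show "wderiv S (e b) u' (%y. G' y \<bullet> b)" if b: "b : Basis" for b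
   unfolding G'b[OF b] using loc_int_borel[OF g(1)[OF b]] g(2,3)[OF b] by (intro weak_derivative_wderiv[OF S w[OF b] u']) auto
 qed
qed

lemma weak_gradient_unique:
 fixes u :: "'a::euclidean_space => real"
 assumes S: "open S" and w: "weak_gradient S u G1" "weak_gradient S u G2"
 shows "AE x in lborel. x : S --> G1 x = G2 x"
proof -
 obtain b0 :: 'a where "b0 : Basis" using nonempty_Basis by blast
 then have "locally_integrable S u" using w(1) by (simp add: weak_gradient_def weak_derivative_def)
 then obtain u' where u': "loc_int S u'" "!!x. x \<notin> S ==> u' x = 0" "AE x in lborel. x : S --> u' x = u x"
  by (rule locally_integrable_representative[OF S]) (rule that)
 note u'' = loc_int_borel[OF u'(1)] u'(2,3)
 obtain G1' where 1: "AE x in lborel. x : S --> G1' x = G1 x" "!!b. b : Basis ==> wderiv S b u' (%y. G1' y \<bullet> b)"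
  by (rule weak_gradient_wderiv[of S "%b. b", OF S _ u'']) (use w(1) in \<open>auto simp: weak_gradient_def\<close>)
 obtain G2' where 2: "AE x in lborel. x : S --> G2' x = G2 x" "!!b. b : Basis ==> wderiv S b u' (%y. G2' y \<bullet> b)"
  by (rule weak_gradient_wderiv[of S "%b. b", OF S _ u'']) (use w(2) in \<open>auto simp: weak_gradient_def\<close>)
 have "AE x in lborel. \<forall>b\<in>Basis. x : S --> G1' x \<bullet> b = G2' x \<bullet> b"
  by (rule AE_finite_allI[OF finite_Basis wderiv_unique[OF S 1(2) 2(2)]])
 with 1(1) 2(1) show ?thesis
 proof eventually_elim
  case (elim x)
  then show ?case by (intro impI euclidean_eqI[of "G1 x" "G2 x"]) simp
 qed
qed

lemma cutoff_test_function:
 fixes K S :: "'b::euclidean_space set"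
 assumes K: "compact K" "K \<subseteq> S" and S: "open S"
 obtains phi where "phi : test_functions S" "!!x. x : K ==> phi x = 1"
proof -
 obtain K1 e1 where 1: "compact K1" "K1 \<subseteq> S" "e1 > 0" "!!x. x : K ==> cball x e1 \<subseteq> K1"
  by (rule compact_neighbourhood[OF K(1) S K(2)]) (rule that)
 obtain K2 e2 where 2: "compact K2" "K2 \<subseteq> S" "e2 > 0" "!!x. x : K1 ==> cball x e2 \<subseteq> K2"
  by (rule compact_neighbourhood[OF 1(1) S 1(2)]) (rule that)
 define r where "r = min e1 e2"
 have r: "r > 0" "r <= e1" "r <= e2" using 1 2 by (auto simp: r_def)
 define phi where "phi = mollify (moll r) (indicator K1 :: 'b => real)"
 have iK: "lint (indicator K1 :: 'b => real)"
  using emeasure_compact_finite[OF 1(1)] compact_imp_closed[OF 1(1)] by (intro integrable_real_indicator) auto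
 have z: "phi x = 0" if "x \<notin> K2" for x
  unfolding phi_def
 proof (rule mollify_support[OF r(1)])
  fix y assume "dist x y < r"
  then have "y : K1 ==> x : K2" using 2(4)[of y] r(3) by (auto simp: subset_iff dist_commute)
  then have "y \<notin> K1" using that by blast
  then show "(indicator K1 y :: real) = 0" by simp
 qed
 have sub: "closure {x. phi x \<noteq> 0} \<subseteq> K2" using z compact_imp_closed[OF 2(1)] by (intro closure_minimal) auto
 show thesis
 proof (rule that[of phi])
  have "Ck n phi" for n unfolding phi_def by (rule Ck_mollify[OF iK Ck_moll moll_eq_0[OF r(1)]])
  then show "phi : test_functions S"
   using sub 2(2) bounded_subset[OF compact_imp_bounded[OF 2(1)], of "{x. phi x \<noteq> 0}"] z
   unfolding test_functions_def by (simp add: compact_closure) blast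
  show "phi x = 1" if "x : K" for x
  proof -
   have "phi x = (\<integral>y. moll r (x - y) \<partial>lborel)"
   unfolding phi_def mollify_def
   proof (rule BI_integral_cong[OF refl])
   fix y
   show "moll r (x - y) *# (indicator K1 y :: real) = moll r (x - y)"
   proof (cases "norm (x - y) < r")
   case True
   then have "y : K1" using 1(4)[OF that] r(2) by (auto simp: subset_iff dist_norm)
   then show ?thesis by simp
   qed (simp add: moll_eq_0[OF r(1)])
   qed
   also have "\<dots> = (\<integral>(y::'b). moll r y \<partial>lborel)" by (rule lborel_integral_reflect[OF borel_measurable_moll[OF r(1)]])
   finally show ?thesis using moll_mass(2)[OF r(1)] by simp
  qed
 qed
qed

text \<open>A norm bound gives a dilation of the function with modular at most one; the bound on the exponent undoes the dilation.\<close>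

lemma luxemburg_modular:
 fixes u p :: "'a::euclidean_space => real"
 assumes u: "u : Lpx S p" and p: "p : borel_measurable (lebesgue_on S)" "!!x. x : S ==> 1 <= p x & p x <= P"
 shows "0 <= luxemburg_norm S p u"
  and "luxemburg_norm S p u <= C ==> 0 <= C ==> (\<integral>x. \<bar>u x\<bar> powr p x \<partial>lebesgue_on S) <= (C + 1) powr P"
proof -
 let ?M = "lebesgue_on S"
 have um [measurable]: "u : borel_measurable ?M" and ui: "integrable ?M (%x. \<bar>u x\<bar> powr p x)" using u by (auto simp: Lpx_def)
 note [measurable] = p(1)
 have sp: "x : space ?M ==> x : S" for x by (simp add: space_restrict_space)
 define A where "A = {l. l > 0 & (\<integral>x. \<bar>u x / l\<bar> powr p x \<partial>?M) <= 1}"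
 have N: "luxemburg_norm S p u = Inf A" by (simp add: luxemburg_norm_def A_def)
 have scale: "\<bar>u x / l\<bar> powr p x = \<bar>u x\<bar> powr p x * l powr (- p x)" if "l > 0" for l x
  using that by (simp add: powr_divide powr_minus_divide abs_divide)
 define l0 where "l0 = max 1 (\<integral>x. \<bar>u x\<bar> powr p x \<partial>?M)"
 have l0: "l0 >= 1" "(\<integral>x. \<bar>u x\<bar> powr p x \<partial>?M) <= l0" by (auto simp: l0_def)
 have "(\<integral>x. \<bar>u x / l0\<bar> powr p x \<partial>?M) <= (\<integral>x. \<bar>u x\<bar> powr p x * (1 / l0) \<partial>?M)"
 proof (rule integral_mono')
  show "integrable ?M (%x. \<bar>u x\<bar> powr p x * (1 / l0))" using ui by (rule integrable_mult_left)
  fix x assume x: "x : space ?M"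
  have "l0 powr (- p x) <= l0 powr (- 1)" using p(2)[OF sp[OF x]] l0 by (intro powr_mono) auto
  also have "\<dots> = 1 / l0" using l0 by (simp add: powr_minus_divide)
  finally show "\<bar>u x / l0\<bar> powr p x <= \<bar>u x\<bar> powr p x * (1 / l0)"
   using l0 mult_left_mono[of "l0 powr (- p x)" "1 / l0" "\<bar>u x\<bar> powr p x"] by (subst scale) simp_all
  show "0 <= \<bar>u x\<bar> powr p x * (1 / l0)" using l0 by (intro mult_nonneg_nonneg) auto
 qed
 also have "\<dots> = (\<integral>x. \<bar>u x\<bar> powr p x \<partial>?M) * (1 / l0)" by simp
 also have "\<dots> <= l0 * (1 / l0)" using l0 by (intro mult_right_mono) auto
 finally have "l0 : A" using l0 by (simp add: A_def)
 then have ne: "A \<noteq> {}" by auto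
 show "0 <= luxemburg_norm S p u" unfolding N by (rule cInf_greatest[OF ne]) (auto simp: A_def)
 assume C: "luxemburg_norm S p u <= C" "0 <= C"
 then have "Inf A < C + 1" unfolding N by simp
 then obtain l where l: "l : A" "l < C + 1" using cInf_lessD[OF ne] by blast
 have l0: "l > 0" and m1: "(\<integral>x. \<bar>u x / l\<bar> powr p x \<partial>?M) <= 1" using l by (auto simp: A_def)
 have il: "integrable ?M (%x. \<bar>u x / l\<bar> powr p x)"
 proof (rule BI_integrable_bound)
  show "integrable ?M (%x. \<bar>u x\<bar> powr p x * (1 + l powr (- P)))" using ui by (rule integrable_mult_left)
  show "(%x. \<bar>u x / l\<bar> powr p x) : borel_measurable ?M" by measurable
  show "AE x in ?M. norm (\<bar>u x / l\<bar> powr p x) <= norm (\<bar>u x\<bar> powr p x * (1 + l powr (- P)))"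
  proof (rule AE_I2)
   fix x assume x: "x : space ?M"
   have "l powr (- p x) <= 1 + l powr (- P)"
   proof (cases "l >= 1")
   case True
   then have "l powr (- p x) <= l powr 0" using p(2)[OF sp[OF x]] by (intro powr_mono) auto
   then show ?thesis using l0 by (simp add: add_increasing2)
   next
   case False
   then have "l powr (- p x) <= l powr (- P)" using p(2)[OF sp[OF x]] l0 by (intro powr_mono') auto
   then show ?thesis by simp
   qed
   then have "\<bar>u x\<bar> powr p x * l powr (- p x) <= \<bar>u x\<bar> powr p x * (1 + l powr (- P))" by (rule mult_left_mono) simp
   then show "norm (\<bar>u x / l\<bar> powr p x) <= norm (\<bar>u x\<bar> powr p x * (1 + l powr (- P)))"
   unfolding scale[OF l0] by (simp add: abs_mult add_nonneg_nonneg)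
  qed
 qed
 have "(\<integral>x. \<bar>u x\<bar> powr p x \<partial>?M) <= (\<integral>x. \<bar>u x / l\<bar> powr p x * (C + 1) powr P \<partial>?M)"
 proof (rule integral_mono')
  show "integrable ?M (%x. \<bar>u x / l\<bar> powr p x * (C + 1) powr P)" using il by (rule integrable_mult_left)
  fix x assume x: "x : space ?M"
  have px: "1 <= p x" "p x <= P" using p(2)[OF sp[OF x]] by auto
  have "l powr p x <= (C + 1) powr p x" using l l0 px by (intro powr_mono2) auto
  also have "\<dots> <= (C + 1) powr P" using C px by (intro powr_mono) auto
  finally have le: "l powr p x <= (C + 1) powr P" .
  have "\<bar>u x\<bar> powr p x = \<bar>u x / l\<bar> powr p x * l powr p x"
   using l0 by (simp add: powr_divide abs_divide)
  also have "\<dots> <= \<bar>u x / l\<bar> powr p x * (C + 1) powr P" using le by (rule mult_left_mono) simp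
  finally show "\<bar>u x\<bar> powr p x <= \<bar>u x / l\<bar> powr p x * (C + 1) powr P" .
  show "0 <= \<bar>u x / l\<bar> powr p x * (C + 1) powr P" by simp
 qed
 also have "\<dots> = (\<integral>x. \<bar>u x / l\<bar> powr p x \<partial>?M) * (C + 1) powr P" by simp
 also have "\<dots> <= 1 * (C + 1) powr P" using m1 by (rule mult_right_mono) simp
 finally show "(\<integral>x. \<bar>u x\<bar> powr p x \<partial>?M) <= (C + 1) powr P" by simp
qed

lemma W1px_wgrad:
 fixes u :: "'a::euclidean_space => real"
 assumes S: "open S" and u: "u : W1px S p"
  and p: "p : borel_measurable (lebesgue_on S)"
 shows "weak_gradient S u (wgrad S u)" "u : Lpx S p" "(%x. norm (wgrad S u x)) : Lpx S p"
  "wgrad S u : borel_measurable (lebesgue_on S)"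
proof -
 have Sb: "S : sets borel" using S by simp
 obtain G where G: "weak_gradient S u G" "(%x. norm (G x)) : Lpx S p" and uL: "u : Lpx S p"
  using u by (auto simp: W1px_def)
 show W: "weak_gradient S u (wgrad S u)" unfolding wgrad_def by (rule someI[of _ G]) (rule G)
 show "u : Lpx S p" by (rule uL)
 have "AE x in lborel. x : S --> wgrad S u x = G x" by (rule weak_gradient_unique[OF S W G(1)])
 then have ae: "AE x in lebesgue_on S. wgrad S u x = G x" unfolding AE_lebesgue_on_iff[OF Sb] .
 have "(%x. wgrad S u x \<bullet> b) : borel_measurable (lebesgue_on S)" if "b : Basis" for b
 proof -
  have "locally_integrable S (%x. wgrad S u x \<bullet> b)" using W that by (auto simp: weak_gradient_def weak_derivative_def)
  then obtain f' where f': "loc_int S f'" "!!x. x \<notin> S ==> f' x = 0" "AE x in lborel. x : S --> f' x = wgrad S u x \<bullet> b"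
   by (rule locally_integrable_representative[OF S]) (rule that)
  show ?thesis by (rule lebesgue_on_representative(3)[OF Sb loc_int_borel[OF f'(1)] f'(2,3)])
 qed
 then show m [measurable]: "wgrad S u : borel_measurable (lebesgue_on S)" by (rule borel_measurable_euclidean_space[THEN iffD2, rule_format])
 note [measurable] = p
 show "(%x. norm (wgrad S u x)) : Lpx S p"
 proof -
  have "integrable (lebesgue_on S) (%x. \<bar>norm (G x)\<bar> powr p x)" using G(2) by (simp add: Lpx_def)
  moreover have "(%x. \<bar>norm (wgrad S u x)\<bar> powr p x) : borel_measurable (lebesgue_on S)" by measurable
  moreover have "AE x in lebesgue_on S. \<bar>norm (G x)\<bar> powr p x = \<bar>norm (wgrad S u x)\<bar> powr p x" using ae by eventually_elim simp
  ultimately have "integrable (lebesgue_on S) (%x. \<bar>norm (wgrad S u x)\<bar> powr p x)"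
   by (subst integrable_cong_AE[where g="%x. \<bar>norm (G x)\<bar> powr p x"]) (auto elim!: eventually_mono)
  then show ?thesis by (simp add: Lpx_def)
 qed
qed

lemma lborel_pair_integrable:
 fixes f :: "real \<times> 'a::euclidean_space => 'c::euclidean_space"
 assumes "lint f"
 shows "AE t in lborel. lint (%x. f (t, x))" "lint (%t. \<integral>x. f (t, x) \<partial>lborel)"
  "(\<integral>t. \<integral>x. f (t, x) \<partial>lborel \<partial>lborel) = (\<integral>y. f y \<partial>lborel)"
proof -
 have "integrable (lborel \<Otimes>\<^sub>M lborel) f" using assms by (simp add: lborel_prod)
 from lborel_pair.AE_integrable_fst'[OF this] lborel_pair.integrable_fst'[OF this] lborel_pair.integral_fst'[OF this]
 show "AE t in lborel. lint (%x. f (t, x))" "lint (%t. \<integral>x. f (t, x) \<partial>lborel)"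
  "(\<integral>t. \<integral>x. f (t, x) \<partial>lborel \<partial>lborel) = (\<integral>y. f y \<partial>lborel)" by (simp_all add: lborel_prod)
qed

lemma AE_slices:
 assumes "AE y in lborel. P (y :: real \<times> 'a::euclidean_space)"
 shows "AE t in lborel. AE x in lborel. P (t, x)"
proof -
 have "AE y in (lborel \<Otimes>\<^sub>M lborel). P y" using assms unfolding lborel_prod[symmetric] .
 from lborel_pair.AE_pair[OF this] show ?thesis by simp
qed

lemma Pair_borel:
 "(%x. (t, x)) : (borel :: 'a::euclidean_space measure) \<rightarrow>\<^sub>M (borel :: (real \<times> 'a) measure)"
 by (intro borel_measurable_continuous_onI continuous_intros)

lemma slice_borel:
 fixes f :: "real \<times> 'a::euclidean_space => 'c::euclidean_space"
 assumes "f : borel_funs"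
 shows "(%x. f (t, x)) : borel_funs"
 using measurable_compose[OF Pair_borel assms, of t] .

lemma infdist_inner:
 fixes Om :: "'a::euclidean_space set"
 assumes Om: "open Om" "bounded Om"
 shows "r > 0 ==> cball x r \<subseteq> Om \<longleftrightarrow> r < infdist x (- Om)"
  and "r > 0 ==> compact {x. r <= infdist x (- Om)}" "r > 0 ==> {x. r <= infdist x (- Om)} \<subseteq> Om"
proof -
 have cl: "closed (- Om)" using Om by (simp add: closed_Compl)
 have ne: "- Om \<noteq> {}" using Om(2) not_bounded_UNIV by (metis Compl_empty_eq double_compl)
 show "cball x r \<subseteq> Om \<longleftrightarrow> r < infdist x (- Om)" if "r > 0"
 proof
  assume c: "cball x r \<subseteq> Om"
  obtain y where y: "y : - Om" "infdist x (- Om) = dist x y" using infdist_attains_inf[OF cl ne] by metis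
  show "r < infdist x (- Om)"
  proof (rule ccontr)
   assume "\<not> r < infdist x (- Om)"
   then have "y : cball x r" using y by simp
   then show False using c y by blast
  qed
 next
  assume l: "r < infdist x (- Om)"
  show "cball x r \<subseteq> Om"
  proof
   fix y assume y: "y : cball x r"
   show "y : Om"
   proof (rule ccontr)
   assume "y \<notin> Om"
   then have "infdist x (- Om) <= dist x y" by (intro infdist_le) simp
   then show False using l y by simp
   qed
  qed
 qed
 show sub: "{x. r <= infdist x (- Om)} \<subseteq> Om" if "r > 0"
 proof
  fix x assume x: "x : {x. r <= infdist x (- Om)}"
  show "x : Om"
  proof (rule ccontr)
   assume "x \<notin> Om"
   then have "infdist x (- Om) = 0" by (intro infdist_zero) simp
   then show False using x that by simp
  qed
 qed
 show "compact {x. r <= infdist x (- Om)}" if "r > 0"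
 proof -
  have "closed {x. r <= infdist x (- Om)}" by (intro closed_Collect_le continuous_intros)
  then show ?thesis using bounded_subset[OF Om(2) sub[OF that]] by (simp add: compact_eq_bounded_closed)
 qed
qed

text \<open>Fubini on an exhaustion of the cylinder by countably many compact products.\<close>

lemma loc_int_slices:
 fixes g :: "real \<times> 'a::euclidean_space => real"
 assumes Om: "open Om" "bounded Om" and g: "loc_int (QT T Om) g"
 shows "AE t in lborel. t : {0<..<T} --> loc_int Om (%x. g (t, x))"
proof -
 define J where "J m = {rad m..T - rad m} \<times> {x. rad m <= infdist x (- Om)}" for m
 have J: "compact (J m)" "J m \<subseteq> QT T Om" for m
 proof -
  show "compact (J m)" unfolding J_def by (intro compact_Times infdist_inner(2)[OF Om]) auto
  have "{rad m..T - rad m} \<subseteq> {0<..<T}"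
   unfolding subset_iff atLeastAtMost_iff greaterThanLessThan_iff
  proof (intro allI impI)
   fix t assume "rad m <= t & t <= T - rad m"
   then show "0 < t & t < T" using rad_pos[of m] by linarith
  qed
  then show "J m \<subseteq> QT T Om" unfolding J_def using infdist_inner(3)[OF Om rad_pos[of m]] by (rule Sigma_mono)
 qed
 have "AE t in lborel. \<forall>m. lint (%x. indicator (J m) (t, x) *# g (t, x))"
  unfolding AE_all_countable
  using g J by (intro allI lborel_pair_integrable(1)[of "%y. indicator (J _) y *# g y"]) (simp add: loc_int_def)
 then show ?thesis
 proof eventually_elim
  case (elim t)
  show ?case
   unfolding loc_int_def
  proof (intro impI conjI allI slice_borel loc_int_borel[OF g])
   fix K assume t: "t : {0<..<T}" and K: "compact K" "K \<subseteq> Om"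
   have [measurable]: "K : sets borel" using K by (simp add: compact_imp_closed)
   obtain dlt where dlt: "dlt > 0" "(\<Union>x\<in>K. cball x dlt) \<subseteq> Om"
   using compact_subset_open_imp_cball_epsilon_subset[OF K(1) Om(1) K(2)] by blast
   have "min dlt (min t (T - t)) > 0" using dlt t by auto
   then obtain m where m: "rad m < min dlt (min t (T - t))" using rad_eventually unfolding eventually_sequentially by blast
   have sub: "indicator K x * indicator (J m) (t, x) = (indicator K x :: real)" for x
   proof (cases "x : K")
   case True
   then have "cball x dlt \<subseteq> Om" using dlt(2) by blast
   then have "dlt < infdist x (- Om)" using infdist_inner(1)[OF Om dlt(1)] by simp
   then have "(t, x) : J m" using m by (simp add: J_def)
   then show ?thesis by simp
   qed simp
   have "lint (%x. indicator K x *# (indicator (J m) (t, x) *# g (t, x)))"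
   by (rule integrable_scaleR_bounded[of _ _ _ 1, OF elim[rule_format, of m]]) auto
   then show "lint (%x. indicator K x *# g (t, x))" unfolding scaleR_scaleR sub .
  qed
 qed
qed

text \<open>
  For fixed \<open>x\<close>, testing the space-time identity with products \<open>\<eta>(t) \<rho>(x - y)\<close> shows that the two
  mollifications in \<open>y\<close> agree for almost every \<open>t\<close>; Fubini's theorem exchanges the quantifiers.
\<close>

lemma slice_derivative:
 fixes u g :: "real \<times> 'a::euclidean_space => real"
 assumes Om: "open Om" "bounded Om" and w: "wderiv (QT T Om) (0, b) u g" and u: "lint u"
 shows "AE t in lborel. t : {0<..<T} --> (\<forall>\<gamma>. wderiv Om b (%x. u (t, x)) \<gamma> --> (AE x in lborel. x : Om --> g (t, x) = \<gamma> x))"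
proof -
 let ?Q = "QT T Om"
 have oQ: "open ?Q" by (intro open_Times Om) auto
 have g: "loc_int ?Q g" using w by (simp add: weak_div_def)
 note [measurable] = loc_int_borel[OF g] borel_measurable_integrable[OF u, simplified]
 define F where "F n x y = g y * moll (rad n) (x - snd y) - u y * (moll_grad (rad n) (x - snd y) \<bullet> b)" for n x and y :: "real \<times> 'a"
 define h where "h n x t = (\<integral>y. F n x (t, y) \<partial>lborel)" for n x t
 have mm [measurable]: "moll (rad n) : borel_measurable (borel :: 'a measure)" "moll_grad (rad n) : borel_measurable (borel :: 'a measure)" for n
  using smooth_kernel.meas[OF smooth_kernel_moll[OF rad_pos[of n]]] by auto
 have Fm [measurable]: "F n x : borel_funs" for n x unfolding F_def by measurable
 have hm: "(%z. h n (fst z) (snd z)) : borel_measurable (lborel \<Otimes>\<^sub>M lborel)" for n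
 proof -
  have "(%(z, y). F n (fst z) (snd z, y)) : borel_measurable ((lborel \<Otimes>\<^sub>M lborel) \<Otimes>\<^sub>M lborel)"
   unfolding F_def split_beta by measurable
  from lborel.borel_measurable_lebesgue_integral[OF this] show ?thesis by (simp add: h_def)
 qed
 have zero: "AE t in lborel. t : {0<..<T} --> h n x t = 0" if x: "cball x (rad n) \<subseteq> Om" for n x
 proof (rule loc_int_AE_zero)
  have K: "compact (cball x (rad n))" by simp
  have iF: "lint (%y. indicator K1 (fst y) *# F n x y)" if K1: "compact K1" "K1 \<subseteq> {0<..<T}" for K1
  proof -
   have [measurable]: "K1 : sets borel" using K1 by (simp add: compact_imp_closed)
   obtain B where B: "!!z::'a. norm (moll (rad n) z) <= B"
   using bounded_compact_support[OF continuous_moll[OF rad_pos[of n]] moll_eq_0[OF rad_pos[of n]]] by blast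
   obtain B' where B': "!!z::'a. norm (moll_grad (rad n) z) <= B'"
   using bounded_compact_support[OF continuous_moll_grad[OF rad_pos[of n]] moll_grad_eq_0[OF rad_pos[of n]]] by blast
   have "lint (%y. (indicator K1 (fst y) * moll (rad n) (x - snd y)) *# g y)"
   proof (rule loc_int_test_integrable[OF g, of "K1 \<times> cball x (rad n)" _ B])
   show "\<bar>indicator K1 (fst y) * moll (rad n) (x - snd y)\<bar> <= B" for y :: "real \<times> 'a"
   using B[of "x - snd y"] order_trans[OF norm_ge_zero B[of 0]] by (cases "fst y : K1") auto
   show "indicator K1 (fst y) * moll (rad n) (x - snd y) = 0" if "y \<notin> K1 \<times> cball x (rad n)" for y
   using that moll_eq_0[OF rad_pos, of n "x - snd y"] by (cases "fst y : K1") (auto simp: mem_Times_iff dist_norm)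
   qed (use K1 x in \<open>auto intro!: compact_Times\<close>)
   moreover have "lint (%y. (indicator K1 (fst y) * (moll_grad (rad n) (x - snd y) \<bullet> b)) *# u y)"
   proof (rule integrable_scaleR_bounded[OF u, of _ "B' * norm b"])
   show "\<bar>indicator K1 (fst y) * (moll_grad (rad n) (x - snd y) \<bullet> b)\<bar> <= B' * norm b" for y :: "real \<times> 'a"
   using order_trans[OF Cauchy_Schwarz_ineq2 mult_right_mono[OF B'[of "x - snd y"] norm_ge_zero[of b]]]
   mult_nonneg_nonneg[OF order_trans[OF norm_ge_zero B'[of 0]] norm_ge_zero[of b]] by (cases "fst y : K1") auto
   qed measurable
   ultimately have "lint (%y. (indicator K1 (fst y) * moll (rad n) (x - snd y)) *# g y - (indicator K1 (fst y) * (moll_grad (rad n) (x - snd y) \<bullet> b)) *# u y)"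
   by (rule BI_integrable_diff)
   moreover have "(indicator K1 (fst y) * moll (rad n) (x - snd y)) *# g y - (indicator K1 (fst y) * (moll_grad (rad n) (x - snd y) \<bullet> b)) *# u y = indicator K1 (fst y) *# F n x y" for y
   by (simp add: F_def algebra_simps)
   ultimately show ?thesis by (simp only:)
  qed
  show "open {0<..<T}" by simp
  show "loc_int {0<..<T} (h n x)"
   unfolding loc_int_def
  proof (intro conjI allI impI)
   have "(%z. h n (fst z) (snd z)) : borel_funs" using hm by (simp add: lborel_prod)
   from measurable_compose[OF _ this, of "%t. (x, t)" borel]
   show "h n x : borel_funs" by (simp add: borel_measurable_continuous_onI continuous_intros)
   fix K1 :: "real set" assume "compact K1" "K1 \<subseteq> {0<..<T}"
   from lborel_pair_integrable(2)[OF iF[OF this]]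
   show "lint (%t. indicator K1 t *# h n x t)" by (simp add: h_def)
  qed
  show "AE s in lborel. cball s (rad k) \<subseteq> {0<..<T} --> mollify (moll (rad k)) (h n x) s = 0" for k
  proof (rule AE_I2, rule impI)
   fix s :: real assume s: "cball s (rad k) \<subseteq> {0<..<T}"
   let ?K = "cball s (rad k)"
   note t = product_test[OF moll_C1_test[OF rad_pos, of s k] moll_C1_test[OF rad_pos, of x n]]
   have sub: "?K \<times> cball x (rad n) \<subseteq> ?Q" using s x by (intro Sigma_mono) auto
   note W = weak_div_C1_test[OF oQ w t sub]
   have e: "g y * (moll (rad k) (s - fst y) * moll (rad n) (x - snd y)) + u y *# (0, b) \<bullet> (- moll_grad (rad k) (s - fst y) * moll (rad n) (x - snd y), moll (rad k) (s - fst y) *# - moll_grad (rad n) (x - snd y))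
   = moll (rad k) (s - fst y) * F n x y" for y
   by (simp add: F_def inner_prod_def inner_commute algebra_simps)
   have i: "lint (%y. moll (rad k) (s - fst y) * F n x y)" and z: "(\<integral>y. moll (rad k) (s - fst y) * F n x y \<partial>lborel) = 0"
   using W unfolding e by simp_all
   have "mollify (moll (rad k)) (h n x) s = (\<integral>t. \<integral>y. moll (rad k) (s - t) * F n x (t, y) \<partial>lborel \<partial>lborel)"
   unfolding mollify_def h_def by simp
   also have "\<dots> = 0" using lborel_pair_integrable(3)[OF i] z by simp
   finally show "mollify (moll (rad k)) (h n x) s = 0" .
  qed
 qed
 have "AE t in lborel. AE x in lborel. \<forall>n. cball x (rad n) \<subseteq> Om --> t : {0<..<T} --> h n x t = 0"
 proof (subst lborel_pair.AE_commute[symmetric])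
  have [measurable]: "(%z. h n (fst z) (snd z)) : borel_funs" for n using hm by (simp add: lborel_prod)
  have [measurable]: "(%z::'a \<times> real. infdist (fst z) (- Om)) : borel_funs"
   by (intro borel_measurable_continuous_onI continuous_intros)
  have seq: "sets ((lborel :: 'a measure) \<Otimes>\<^sub>M (lborel :: real measure)) = sets borel" by (subst lborel_prod) (rule sets_lborel)
  have sp: "space ((lborel :: 'a measure) \<Otimes>\<^sub>M (lborel :: real measure)) = UNIV" by (simp add: space_pair_measure)
  have "{z : space borel. \<forall>n. rad n < infdist (fst z) (- Om) --> 0 < snd z & snd z < T --> h n (fst z) (snd z) = 0} : sets (borel :: ('a \<times> real) measure)"
   by measurable
  then have "{z : space (lborel \<Otimes>\<^sub>M lborel). \<forall>n. rad n < infdist (fst z) (- Om) --> snd z : {0<..<T} --> h n (fst z) (snd z) = 0} : sets (lborel \<Otimes>\<^sub>M lborel)"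
   by (simp only: seq sp space_borel greaterThanLessThan_iff)
  then show "{z : space (lborel \<Otimes>\<^sub>M lborel). \<forall>n. cball (fst z) (rad n) \<subseteq> Om --> snd z : {0<..<T} --> h n (fst z) (snd z) = 0} : sets (lborel \<Otimes>\<^sub>M lborel)"
   by (simp only: infdist_inner(1)[OF Om rad_pos])
  show "AE x in lborel. AE t in lborel. \<forall>n. cball x (rad n) \<subseteq> Om --> t : {0<..<T} --> h n x t = 0"
  proof (rule AE_I2)
   fix x
   have "AE t in lborel. cball x (rad n) \<subseteq> Om --> t : {0<..<T} --> h n x t = 0" for n
   using zero[of x n] by (cases "cball x (rad n) \<subseteq> Om") simp_all
   then show "AE t in lborel. \<forall>n. cball x (rad n) \<subseteq> Om --> t : {0<..<T} --> h n x t = 0" unfolding AE_all_countable by blast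
  qed
 qed
 then show ?thesis
  using loc_int_slices[OF Om g] lborel_pair_integrable(1)[OF u]
 proof eventually_elim
  case (elim t)
  show ?case
  proof (intro impI allI)
   fix \<gamma> assume t: "t : {0<..<T}" and \<gamma>: "wderiv Om b (%x. u (t, x)) \<gamma>"
   have lg: "loc_int Om (%x. g (t, x))" using elim t by blast
   have l\<gamma>: "loc_int Om \<gamma>" using \<gamma> by (simp add: weak_div_def)
   have "AE x in lborel. x : Om --> g (t, x) - \<gamma> x = 0"
   proof (rule loc_int_AE_zero[OF Om(1) loc_int_diff[OF lg l\<gamma>]])
   fix n
   show "AE x in lborel. cball x (rad n) \<subseteq> Om --> mollify (moll (rad n)) (%x. g (t, x) - \<gamma> x) x = 0"
   using elim(1)
   proof eventually_elim
   case (elim x)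
   show ?case
   proof
   assume x: "cball x (rad n) \<subseteq> Om"
   have ug: "lint (%y. u (t, y) *# moll_grad (rad n) (x - y))"
   by (rule smooth_kernel.integrable_kernel(2)[OF smooth_kernel_moll[OF rad_pos] \<open>lint (%x. u (t, x))\<close>])
   have i1: "lint (%y. moll (rad n) (x - y) *# g (t, y))"
   proof -
   obtain B where B: "!!z::'a. norm (moll (rad n) z) <= B"
   using bounded_compact_support[OF continuous_moll[OF rad_pos[of n]] moll_eq_0[OF rad_pos[of n]]] by blast
   show ?thesis
   by (rule loc_int_test_integrable[OF lg compact_cball x, of _ B]) (use B in \<open>auto simp: dist_norm intro!: moll_eq_0\<close>)
   qed
   have i2: "lint (%y. (u (t, y) *# moll_grad (rad n) (x - y)) \<bullet> b)" using ug by (rule integrable_inner_left)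
   have "h n x t = (\<integral>y. moll (rad n) (x - y) *# g (t, y) - (u (t, y) *# moll_grad (rad n) (x - y)) \<bullet> b \<partial>lborel)"
   unfolding h_def F_def by (simp add: mult.commute)
   also have "\<dots> = mollify (moll (rad n)) (%y. g (t, y)) x - (\<integral>y. u (t, y) *# moll_grad (rad n) (x - y) \<partial>lborel) \<bullet> b"
   unfolding BI_integral_diff[OF i1 i2] mollify_def by (subst integral_inner_left[OF ug]) (rule refl)
   also have "\<dots> = mollify (moll (rad n)) (%y. g (t, y)) x - mollify (moll (rad n)) \<gamma> x"
   unfolding wderiv_mollify[OF Om(1) \<gamma> \<open>lint (%x. u (t, x))\<close> rad_pos x] ..
   finally show "mollify (moll (rad n)) (%x. g (t, x) - \<gamma> x) x = 0"
   using elim x t unfolding mollify_loc_diff[OF rad_pos lg l\<gamma> x] by simp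
   qed
   qed
   qed
   then show "AE x in lborel. x : Om --> g (t, x) = \<gamma> x" by eventually_elim simp
  qed
 qed
qed

section \<open>Weak solutions\<close>

context comparison_setting begin

lemma state_mono: "state M u G ==> M <= M' ==> state M' u G"
 unfolding state_def by (blast intro: order_trans)

lemma sol_mono: "sol M u G z k F ==> M <= M' ==> sol M' u G z k F"
 unfolding sol_def using state_mono by blast

lemma Q_borel: "Q : sets borel" and Om_borel: "Om : sets borel" by simp_all

lemma Linf_representative:
 assumes "w : Linf Q"
 obtains w' B where "w' : borel_funs" "!!y. y \<notin> Q ==> w' y = 0" "AE y in lborel. y : Q --> w' y = w y"
  "B >= 0" "!!y. \<bar>w' y\<bar> <= B" "lint w'"
proof -
 obtain C where wm: "w : borel_measurable (lebesgue_on Q)" and C: "AE y in lebesgue_on Q. \<bar>w y\<bar> <= C"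
  using assms by (auto simp: Linf_def)
 obtain w1 where w1: "w1 : borel_funs" "!!y. y \<notin> Q ==> w1 y = 0" "AE y in lborel. y : Q --> w1 y = w y"
  by (rule borel_representative[OF Q_borel wm]) (rule that)
 note [measurable] = w1(1)
 define w' where "w' y = max (- \<bar>C\<bar>) (min \<bar>C\<bar> (w1 y))" for y
 have m: "w' : borel_funs" unfolding w'_def by measurable
 have z: "w' y = 0" if "y \<notin> Q" for y using w1(2)[OF that] by (simp add: w'_def)
 have b: "\<bar>w' y\<bar> <= \<bar>C\<bar>" for y unfolding w'_def by (intro abs_leI) auto
 show thesis
 proof (rule that[of w' "\<bar>C\<bar>"])
  show "AE y in lborel. y : Q --> w' y = w y"
   using w1(3) C[unfolded AE_lebesgue_on_iff[OF Q_borel]]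
  proof eventually_elim
   case (elim y)
   show ?case
   proof
   assume y: "y : Q"
   then have e: "w1 y = w y" and c: "\<bar>w y\<bar> <= C" using elim by auto
   have "w y <= \<bar>C\<bar>" "- \<bar>C\<bar> <= w y" using c by linarith+
   then show "w' y = w y" by (simp add: w'_def e)
   qed
  qed
  show "lint w'" by (rule integrable_bounded_support[OF m bounded_Q z]) (use b in auto)
 qed (use m z b in auto)
qed

lemma L2_representative:
 assumes "z : Lr Q 2"
 obtains z' where "z' : borel_funs" "!!y. y \<notin> Q ==> z' y = 0" "AE y in lborel. y : Q --> z' y = z y" "lint z'"
proof -
 have zm: "z : borel_measurable (lebesgue_on Q)" and zi: "integrable (lebesgue_on Q) (%y. \<bar>z y\<bar> powr 2)"
  using assms by (auto simp: Lpx_def)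
 obtain z' where z': "z' : borel_funs" "!!y. y \<notin> Q ==> z' y = 0" "AE y in lborel. y : Q --> z' y = z y"
  by (rule borel_representative[OF Q_borel zm]) (rule that)
 note [measurable] = z'(1)
 have "lint (%y. \<bar>z' y\<bar> powr 2)"
  by (rule lebesgue_on_representative(2)[OF Q_borel, THEN iffD1, OF _ _ _ zi]) (use z' in \<open>auto elim!: eventually_mono\<close>)
 then have "lint (%y. indicator Q y + \<bar>z' y\<bar> powr 2)" using integrable_Q by (rule BI_integrable_add[rotated])
 then have "lint z'"
 proof (rule BI_integrable_bound)
  show "AE y in lborel. norm (z' y) <= norm (indicator Q y + \<bar>z' y\<bar> powr 2)"
  proof (rule AE_I2)
   fix y
   have sq: "\<bar>z' y\<bar> powr 2 = \<bar>z' y\<bar>\<^sup>2" by (simp add: powr_numeral)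
   have "0 <= (\<bar>z' y\<bar> - 1)\<^sup>2" by simp
   then have "2 * \<bar>z' y\<bar> <= 1 + \<bar>z' y\<bar>\<^sup>2" by (simp add: power2_eq_square algebra_simps)
   then have "\<bar>z' y\<bar> <= 1 + \<bar>z' y\<bar>\<^sup>2" by (smt (verit) abs_ge_zero)
   then show "norm (z' y) <= norm (indicator Q y + \<bar>z' y\<bar> powr 2)" unfolding sq using z'(2)[of y] by (cases "y : Q") auto
  qed
 qed simp
 with z' show thesis by (intro that)
qed

text \<open>
  The reaction term is measurable and locally integrable because its products with all test
  functions are integrable and every compact set carries a test function equal to one.
\<close>

lemma reaction_representative:
 fixes f :: "'a => real => real"
 assumes i: "!!phi. phi : test_functions Q ==> integrable (lebesgue_on Q) (%(t, x). f x (w (t, x)) * phi (t, x))"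
  and nn: "AE y in lborel. y : Q --> 0 <= f (snd y) (w y)"
 obtains F where "loc_int Q F" "!!y. y \<notin> Q ==> F y = 0" "AE y in lborel. y : Q --> F y = f (snd y) (w y)" "!!y. 0 <= F y"
proof -
 let ?f = "%y. f (snd y) (w y)"
 have "locally_integrable Q ?f"
  unfolding locally_integrable_def
 proof (intro allI impI)
  fix K assume K: "compact K & K \<subseteq> Q"
  obtain phi where phi: "phi : test_functions Q" "!!x. x : K ==> phi x = 1"
   by (rule cutoff_test_function[of K Q]) (use K open_Q in auto)
  have Kb: "K : sets lebesgue" using K by (simp add: compact_imp_closed)
  have "(%y. ?f y * phi y) = (%(t, x). f x (w (t, x)) * phi (t, x))" by (rule ext) (auto split: prod.split)
  then have "integrable (lebesgue_on Q) (%y. ?f y * phi y)" using i[OF phi(1)] by (simp only:)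
  then have "set_integrable lebesgue Q (%y. ?f y * phi y)"
   unfolding set_integrable_def by (subst (asm) integrable_restrict_space) auto
  then have "set_integrable lebesgue K (%y. ?f y * phi y)" by (rule set_integrable_subset) (use Kb K in auto)
  then have "integrable (lebesgue_on K) (%y. ?f y * phi y)"
   unfolding set_integrable_def by (subst integrable_restrict_space) (use Kb in auto)
  then show "integrable (lebesgue_on K) ?f"
   by (rule BI_integrable_cong[THEN iffD1, rotated 2]) (use phi(2) in \<open>auto simp: space_restrict_space\<close>)
 qed
 then obtain F0 where F0: "loc_int Q F0" "!!y. y \<notin> Q ==> F0 y = 0" "AE y in lborel. y : Q --> F0 y = ?f y"
  by (rule locally_integrable_representative[OF open_Q]) (rule that)
 show thesis
 proof (rule that[of "%y. \<bar>F0 y\<bar>"])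
  have "lint (%y. indicator K y *# \<bar>F0 y\<bar>)" if "compact K" "K \<subseteq> Q" for K
  proof -
   have "lint (%y. \<bar>indicator K y *# F0 y\<bar>)" using F0(1) that by (intro integrable_abs) (simp add: loc_int_def)
   then show ?thesis by (simp add: abs_mult)
  qed
  moreover have "(%y. \<bar>F0 y\<bar>) : borel_funs" using loc_int_borel[OF F0(1)] by measurable
  ultimately show "loc_int Q (%y. \<bar>F0 y\<bar>)" unfolding loc_int_def by blast
  show "AE y in lborel. y : Q --> \<bar>F0 y\<bar> = ?f y" using F0(3) nn by eventually_elim auto
 qed (use F0(2) in auto)
qed

lemma W011_zero_trace:
 assumes w: "w : W011 Om"
  and u: "u : borel_funs" "AE x in lborel. x : Om --> u x = w x"
  and G: "G : borel_funs" "AE x in lborel. x : Om --> G x = wgrad Om w x"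
 shows "zero_trace u G"
 unfolding zero_trace_def
proof (intro allI impI)
 fix e :: real assume e: "e > 0"
 have W: "w : W1px Om (%_. 1)" using w by (simp add: W011_def)
 obtain phi where phi: "phi : test_functions Om"
  and le: "(\<integral>x. \<bar>w x - phi x\<bar> \<partial>lebesgue_on Om) + (\<integral>x. norm (wgrad Om w x - grad phi x) \<partial>lebesgue_on Om) < e"
  using w e by (auto simp: W011_def)
 note t = test_function_C1_test[OF phi]
 note [measurable] = u(1) G(1) C1_test_integrable(2,3)[OF t(1)]
 note D = W1px_wgrad[OF open_Om W borel_measurable_const]
 have rep: "(\<integral>\<^sup>+x. indicator Om x * ennreal (norm (a' x)) \<partial>lborel) <= ennreal e"
  if a: "integrable (lebesgue_on Om) (%x. norm (a x))" "(\<integral>x. norm (a x) \<partial>lebesgue_on Om) < e" "a' : borel_funs" "AE x in lborel. x : Om --> a' x = a x"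
  for a a' :: "'a => 'c::euclidean_space"
 proof -
  let ?r = "%x. indicator Om x * norm (a' x)"
  have r: "?r : borel_funs" "!!x. x \<notin> Om ==> ?r x = 0" "AE x in lborel. x : Om --> ?r x = norm (a x)"
   using a(3,4) by (auto elim!: eventually_mono)
  have i: "lint ?r" using a(1) lebesgue_on_representative(2)[OF Om_borel r] by simp
  have "(\<integral>\<^sup>+x. indicator Om x * ennreal (norm (a' x)) \<partial>lborel) = (\<integral>\<^sup>+x. ennreal (?r x) \<partial>lborel)"
   by (intro nn_integral_cong) (auto simp: indicator_def)
  also have "\<dots> = ennreal (\<integral>x. ?r x \<partial>lborel)" by (rule nn_integral_eq_integral[OF i]) simp
  also have "(\<integral>x. ?r x \<partial>lborel) = (\<integral>x. norm (a x) \<partial>lebesgue_on Om)" using lebesgue_on_representative(1)[OF Om_borel r] by simp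
  finally show ?thesis using a(2) by (simp add: ennreal_leI)
 qed
 have iphi: "integrable (lebesgue_on Om) phi" "integrable (lebesgue_on Om) (grad phi)"
 proof -
  have z: "phi x = 0" "grad phi x = 0" if "x \<notin> Om" for x
   using C1_test_zero[OF t(1)] C1_test_grad_zero[OF t(1)] t(2) that by blast+
  have "lint (grad phi)" by (rule integral_C1_grad_zero[OF t(1)])
  then show "integrable (lebesgue_on Om) phi" "integrable (lebesgue_on Om) (grad phi)"
   using lebesgue_on_representative(2)[OF Om_borel C1_test_integrable(2)[OF t(1)] z(1), of phi] C1_test_integrable(1)[OF t(1)]
   lebesgue_on_representative(2)[OF Om_borel C1_test_integrable(3)[OF t(1)] z(2), of "grad phi"] by auto
 qed
 have iw: "integrable (lebesgue_on Om) w" using D(2) integrable_abs_cancel[of _ w] by (auto simp: Lpx_def)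
 have "integrable (lebesgue_on Om) (%x. norm (wgrad Om w x))" using D(3) by (simp add: Lpx_def)
 then have ig: "integrable (lebesgue_on Om) (wgrad Om w)" by (rule integrable_norm_cancel[OF _ D(4)])
 have i1: "integrable (lebesgue_on Om) (%x. norm (w x - phi x))" using iw iphi by (intro integrable_norm BI_integrable_diff)
 have i2: "integrable (lebesgue_on Om) (%x. norm (wgrad Om w x - grad phi x))" using ig iphi by (intro integrable_norm BI_integrable_diff)
 have n: "0 <= (\<integral>x. norm (w x - phi x) \<partial>lebesgue_on Om)" "0 <= (\<integral>x. norm (wgrad Om w x - grad phi x) \<partial>lebesgue_on Om)" by simp_all
 have l: "(\<integral>x. norm (w x - phi x) \<partial>lebesgue_on Om) < e" "(\<integral>x. norm (wgrad Om w x - grad phi x) \<partial>lebesgue_on Om) < e"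
  using le n unfolding real_norm_def by linarith+
 show "\<exists>phi\<in>test_functions Om. (\<integral>\<^sup>+x. indicator Om x * ennreal \<bar>u x - phi x\<bar> \<partial>lborel) <= ennreal e & (\<integral>\<^sup>+x. indicator Om x * ennreal (norm (G x - grad phi x)) \<partial>lborel) <= ennreal e"
 proof (rule bexI[OF _ phi], rule conjI)
  have "(\<integral>\<^sup>+x. indicator Om x * ennreal (norm (u x - phi x)) \<partial>lborel) <= ennreal e"
   by (rule rep[OF i1 l(1)]) (use u(2) in \<open>auto elim!: eventually_mono\<close>)
  then show "(\<integral>\<^sup>+x. indicator Om x * ennreal \<bar>u x - phi x\<bar> \<partial>lborel) <= ennreal e" by simp
  show "(\<integral>\<^sup>+x. indicator Om x * ennreal (norm (G x - grad phi x)) \<partial>lborel) <= ennreal e"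
   by (rule rep[OF i2 l(2)]) (use G(2) in \<open>auto elim!: eventually_mono\<close>)
 qed
qed

text \<open>
  Almost every time slice carries a weak gradient whose Luxemburg norm, hence whose modular, is
  bounded uniformly in time; the slices of the space-time gradient are those weak gradients.
\<close>

lemma slices_of_solution:
 fixes p0 :: "'a => real"
 assumes p0: "!!x. x : Om ==> p0 x = p x"
  and w: "w : Linf_Bochner T (W01px Om p0) (W1px_norm Om p0)"
  and u: "u : borel_funs" "!!y. y \<notin> Q ==> u y = 0" "AE y in lborel. y : Q --> u y = w y" "lint u"
  and G: "G : borel_funs" "!!y. y \<notin> Q ==> G y = 0" "!!b. b : Basis ==> wderiv Q (0, b) u (%y. G y \<bullet> b)"
 shows "lint (%y. norm (G y) powr p (snd y))" "trace0 u G"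
proof -
 obtain C0 where "AE t in lebesgue_on {0<..<T}. (%x. w (t, x)) : W01px Om p0 & W1px_norm Om p0 (%x. w (t, x)) <= C0"
  using w by (auto simp: Linf_Bochner_def)
 then have w': "AE t in lborel. t : {0<..<T} --> (%x. w (t, x)) : W01px Om p0 & W1px_norm Om p0 (%x. w (t, x)) <= C0"
  by (subst (asm) AE_lebesgue_on_iff) auto
 define C' where "C' = max 0 C0"
 have p0m: "p0 : borel_measurable (lebesgue_on Om)"
  by (rule lebesgue_on_representative(3)[OF Om_borel, of "%x. indicator Om x * p x"]) (use p0 in auto)
 have P: "1 <= p0 x & p0 x <= P" if "x : Om" for x using p0[OF that] p_gt[of x] p_le[of x] by simp
 have sl: "AE t in lborel. \<forall>b\<in>Basis. t : {0<..<T} --> (\<forall>\<gamma>. wderiv Om b (%x. u (t, x)) \<gamma> --> (AE x in lborel. x : Om --> G (t, x) \<bullet> b = \<gamma> x))"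
  by (rule AE_finite_allI[OF finite_Basis slice_derivative[OF open_Om bounded_Om G(3) u(4)]])
 have key: "AE t in lborel. t : {0<..<T} --> (%x. w (t, x)) : W01px Om p0 & W1px_norm Om p0 (%x. w (t, x)) <= C0 &
   (AE x in lborel. x : Om --> u (t, x) = w (t, x)) & (AE x in lborel. x : Om --> G (t, x) = wgrad Om (%x. w (t, x)) x)"
  using w' sl AE_slices[OF u(3)]
 proof eventually_elim
  case (elim t)
  show ?case
  proof
   assume t: "t : {0<..<T}"
   have ae: "AE x in lborel. x : Om --> u (t, x) = w (t, x)" using elim(3) by eventually_elim (use t in auto)
   have w1: "(%x. w (t, x)) : W1px Om p0" using elim(1) t by (simp add: W01px_def)
   note D = W1px_wgrad[OF open_Om w1 p0m]
   have u0: "x \<notin> Om ==> u (t, x) = 0" for x using u(2)[of "(t, x)"] by auto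
   obtain g where g: "loc_int Om g" "AE x in lborel. x : Om --> g x = wgrad Om (%x. w (t, x)) x"
   "!!b. b : Basis ==> wderiv Om b (%x. u (t, x)) (%x. g x \<bullet> b)"
   by (rule weak_gradient_wderiv[of Om "%b. b", OF open_Om _ slice_borel[OF u(1)] u0 ae]) (use D(1) in \<open>auto simp: weak_gradient_def\<close>)
   have "AE x in lborel. x : Om --> G (t, x) \<bullet> b = g x \<bullet> b" if "b : Basis" for b
   using elim(2) t g(3)[OF that] that by blast
   then have "AE x in lborel. \<forall>b\<in>Basis. x : Om --> G (t, x) \<bullet> b = g x \<bullet> b" by (rule AE_finite_allI[OF finite_Basis])
   then have "AE x in lborel. x : Om --> G (t, x) = wgrad Om (%x. w (t, x)) x"
   using g(2)
   proof eventually_elim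
   case (elim x)
   show ?case
   proof
   assume "x : Om"
   then have "G (t, x) = g x" using elim by (intro euclidean_eqI[of "G (t, x)" "g x"]) simp
   then show "G (t, x) = wgrad Om (%x. w (t, x)) x" using elim \<open>x : Om\<close> by simp
   qed
   qed
   then show "(%x. w (t, x)) : W01px Om p0 & W1px_norm Om p0 (%x. w (t, x)) <= C0 &
   (AE x in lborel. x : Om --> u (t, x) = w (t, x)) & (AE x in lborel. x : Om --> G (t, x) = wgrad Om (%x. w (t, x)) x)"
   using elim(1) t ae by blast
  qed
 qed
 show "trace0 u G"
  unfolding trace0_def using key
 proof eventually_elim
  case (elim t)
  show ?case
   by (intro impI, rule W011_zero_trace[of "%x. w (t, x)"]) (use elim in \<open>auto simp: W01px_def intro!: slice_borel u G\<close>)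
 qed
 let ?E = "%y. norm (G y) powr p (snd y)"
 have [measurable]: "p : borel_funs" "G : borel_funs" by (rule p_meas, rule G)
 have Em: "?E : borel_funs" by measurable
 have bound: "AE t in lborel. (\<integral>\<^sup>+x. ennreal (?E (t, x)) \<partial>lborel) <= ennreal ((C' + 1) powr P) * indicator {0<..<T} t"
  using key
 proof eventually_elim
  case (elim t)
  show ?case
  proof (cases "t : {0<..<T}")
   case False
   then have "(t, x) \<notin> Q" for x by auto
   then have "?E (t, x) = 0" for x using G(2)[of "(t, x)"] by simp
   then show ?thesis by simp
  next
   case True
   let ?w = "%x. w (t, x)"
   have w1: "?w : W1px Om p0" using elim True by (simp add: W01px_def)
   note D = W1px_wgrad[OF open_Om w1 p0m]
   have "luxemburg_norm Om p0 (%x. norm (wgrad Om ?w x)) <= C'"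
   proof -
   have "W1px_norm Om p0 ?w <= C0" using elim True by blast
   then show ?thesis using luxemburg_modular(1)[OF D(2) p0m P] unfolding W1px_norm_def C'_def
   by (intro max.coboundedI2) linarith
   qed
   from luxemburg_modular(2)[OF D(3) p0m P this]
   have le: "(\<integral>x. \<bar>norm (wgrad Om ?w x)\<bar> powr p0 x \<partial>lebesgue_on Om) <= (C' + 1) powr P" by (simp add: C'_def)
   have r: "(%x. ?E (t, x)) : borel_funs" "!!x. x \<notin> Om ==> ?E (t, x) = 0"
   "AE x in lborel. x : Om --> ?E (t, x) = \<bar>norm (wgrad Om ?w x)\<bar> powr p0 x"
   proof -
   show "(%x. ?E (t, x)) : borel_funs" by (rule slice_borel[OF Em])
   show "?E (t, x) = 0" if "x \<notin> Om" for x using that G(2)[of "(t, x)"] by simp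
   have "AE x in lborel. x : Om --> G (t, x) = wgrad Om ?w x" using elim True by blast
   then show "AE x in lborel. x : Om --> ?E (t, x) = \<bar>norm (wgrad Om ?w x)\<bar> powr p0 x"
   by eventually_elim (simp add: p0)
   qed
   have "integrable (lebesgue_on Om) (%x. \<bar>norm (wgrad Om ?w x)\<bar> powr p0 x)" using D(3) by (simp add: Lpx_def)
   then have i: "lint (%x. ?E (t, x))" using lebesgue_on_representative(2)[OF Om_borel r] by blast
   have "(\<integral>\<^sup>+x. ennreal (?E (t, x)) \<partial>lborel) = ennreal (\<integral>x. ?E (t, x) \<partial>lborel)" by (rule nn_integral_eq_integral[OF i]) simp
   also have "\<dots> <= ennreal ((C' + 1) powr P)" using le lebesgue_on_representative(1)[OF Om_borel r] by (intro ennreal_leI) simp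
   finally show ?thesis using True by simp
  qed
 qed
 show "lint ?E"
 proof (rule integrableI_nonneg)
  show "?E : borel_measurable lborel" using Em by simp
  have "(%y. ennreal (?E y)) : borel_measurable (lborel \<Otimes>\<^sub>M lborel)" using Em by (simp add: lborel_prod)
  from lborel.nn_integral_fst[OF this]
  have "(\<integral>\<^sup>+y. ennreal (?E y) \<partial>lborel) = (\<integral>\<^sup>+t. \<integral>\<^sup>+x. ennreal (?E (t, x)) \<partial>lborel \<partial>lborel)" by (simp add: lborel_prod)
  also have "\<dots> <= (\<integral>\<^sup>+t. ennreal ((C' + 1) powr P) * indicator {0<..<T} t \<partial>lborel)" by (rule nn_integral_mono_AE[OF bound])
  also have "\<dots> = ennreal ((C' + 1) powr P) * ennreal T" using T by (subst nn_integral_cmult_indicator) auto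
  also have "\<dots> < \<infinity>" by (simp add: ennreal_mult_less_top)
  finally show "(\<integral>\<^sup>+y. ennreal (?E y) \<partial>lborel) < \<infinity>" .
 qed simp
qed

lemma grad_space_slice:
 fixes phi :: "real \<times> 'a => real"
 assumes "phi : test_functions S"
 shows "grad (%x'. phi (t, x')) x = snd (grad phi (t, x))"
proof -
 have d: "(phi has_derivative (%h. grad phi (t, x) \<bullet> h)) (at (t, x))"
  using test_function_C1_test(1)[OF assms] by (simp add: C1_test_def)
 have "((%x'. (t, x')) has_derivative (%h. (0, h))) (at x)" by (auto intro!: derivative_eq_intros)
 from has_derivative_compose[OF this d] have "((%x'. phi (t, x')) has_derivative (%h. grad phi (t, x) \<bullet> (0, h))) (at x)" .
 from grad_inner[OF this] have s: "grad (%x'. phi (t, x')) x \<bullet> h = snd (grad phi (t, x)) \<bullet> h" for h by (simp add: inner_prod_def)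
 show ?thesis by (rule euclidean_eqI) (rule s)
qed

lemma weak_solution_representative:
 fixes p0 :: "'a => real"
 assumes p0: "!!x. x : Om ==> p0 x = p x" and fs: "f_sign Om f" and k: "k : Linf Q"
  and ws: "weak_solution T Om p0 q f k w0 w"
 obtains M u G z k' F where "M >= 0" "sol M u G z k' F" "trace0 u G" "wderiv Q (1, 0) (%y. u y powr q) z"
  "AE y in lborel. y : Q --> u y = w y" "AE y in lborel. y : Q --> k' y = k y" "AE y in lborel. y : Q --> F y = f (snd y) (w y)"
proof -
 have pos: "AE y in lborel. y : Q --> 0 < w y"
  using ws unfolding weak_solution_def AE_lebesgue_on_iff[OF Q_borel] by blast
 have wB: "w : Linf_Bochner T (W01px Om p0) (W1px_norm Om p0)" and wL: "w : Linf Q" using ws unfolding weak_solution_def by blast+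
 obtain z0 G0 where dz: "weak_derivative Q (1, 0) (%y. w y powr q) z0" and z0: "z0 : Lr Q 2"
  and dG: "!!b. b : Basis ==> weak_derivative Q (0, b) w (%y. G0 y \<bullet> b)"
  and fi: "!!phi. phi : test_functions Q ==> integrable (lebesgue_on Q) (%(t, x). f x (w (t, x)) * phi (t, x))"
  and id: "!!phi. phi : test_functions Q ==> (\<integral>y. z0 y * w y powr (q - 1) * phi y \<partial>lebesgue_on Q)
   + (\<integral>(t, x). p_flux (p0 x) (G0 (t, x)) \<bullet> grad (%x'. phi (t, x')) x \<partial>lebesgue_on Q)
   = (\<integral>y. k y * w y powr (q - 1) * phi y \<partial>lebesgue_on Q) + (\<integral>(t, x). f x (w (t, x)) * phi (t, x) \<partial>lebesgue_on Q)"
  using ws unfolding weak_solution_def by blast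
 obtain u1 M where u1: "u1 : borel_funs" "!!y. y \<notin> Q ==> u1 y = 0" "AE y in lborel. y : Q --> u1 y = w y"
  "M >= 0" "!!y. \<bar>u1 y\<bar> <= M" "lint u1" by (rule Linf_representative[OF wL]) (rule that)
 note [measurable] = u1(1)
 define u where "u y = max 0 (u1 y)" for y
 have um [measurable]: "u : borel_funs" unfolding u_def by measurable
 have u0: "y \<notin> Q ==> u y = 0" for y using u1(2) by (simp add: u_def)
 have ub: "0 <= u y" "u y <= M" for y using u1(4) u1(5)[of y] by (auto simp: u_def)
 have uw: "AE y in lborel. y : Q --> u y = w y" using u1(3) pos by eventually_elim (simp add: u_def)
 have ui: "lint u" by (rule integrable_bounded_support[OF um bounded_Q u0, of M]) (use ub in auto)
 obtain z where z: "z : borel_funs" "!!y. y \<notin> Q ==> z y = 0" "AE y in lborel. y : Q --> z y = z0 y" "lint z"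
  by (rule L2_representative[OF z0]) (rule that)
 obtain k' Bk where k': "k' : borel_funs" "!!y. y \<notin> Q ==> k' y = 0" "AE y in lborel. y : Q --> k' y = k y"
  "Bk >= 0" "!!y. \<bar>k' y\<bar> <= Bk" "lint k'" by (rule Linf_representative[OF k]) (rule that)
 obtain G where G: "loc_int Q G" "!!y. y \<notin> Q ==> G y = 0" "AE y in lborel. y : Q --> G y = G0 y"
  "!!b. b : Basis ==> wderiv Q (0, b) u (%y. G y \<bullet> b)"
  by (rule weak_gradient_wderiv[of Q "%b. (0, b)", OF open_Q dG um u0 uw]) (assumption, assumption, rule that)
 note Gm = loc_int_borel[OF G(1)]
 note sl = slices_of_solution[OF p0 wB um u0 uw ui Gm G(2) G(4)]
 have nn: "AE y in lborel. y : Q --> 0 <= f (snd y) (w y)"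
  using pos by eventually_elim (use fs in \<open>auto simp: f_sign_def\<close>)
 obtain F where F: "loc_int Q F" "!!y. y \<notin> Q ==> F y = 0" "AE y in lborel. y : Q --> F y = f (snd y) (w y)" "!!y. 0 <= F y"
  by (rule reaction_representative[OF fi nn]) (assumption, rule that)
 have st: "state M u G" unfolding state_def using um Gm ub u0 G(2,4) sl(1) by blast
 note [measurable] = Gm z(1) k'(1) loc_int_borel[OF F(1)]
 let ?V = "%y. p_flux (p (snd y)) (G y)" and ?uq = "%y. u y powr (q - 1)"
 have Vm [measurable]: "?V : borel_funs" by (rule flux_meas[OF Gm])
 have iV: "lint ?V"
 proof (rule BI_integrable_bound)
  show "lint (%y. norm (G y) powr p (snd y) + indicator Q y)" using sl(1) integrable_Q by (rule BI_integrable_add)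
  show "AE y in lborel. norm (?V y) <= norm (norm (G y) powr p (snd y) + indicator Q y)"
  proof (rule AE_I2)
   fix y
   show "norm (?V y) <= norm (norm (G y) powr p (snd y) + indicator Q y)"
   proof (cases "y : Q")
   case True
   have "norm (?V y) * 1 <= norm (G y) powr p (snd y) + 1 powr p (snd y)" by (rule p_flux_young) (use p_gt in auto)
   then show ?thesis using True by simp
   next
   case False
   then show ?thesis using G(2)[OF False] by (simp add: p_flux_def)
   qed
  qed
 qed (use Vm in simp)
 have uqb: "\<bar>?uq y\<bar> <= M powr (q - 1)" for y using ub[of y] q by (auto intro!: powr_mono2)
 have izu: "lint (%y. z y * ?uq y)" by (rule integrable_bounded_mult[OF z(4) _ uqb]) measurable
 have iku: "lint (%y. k' y * ?uq y)" by (rule integrable_bounded_mult[OF k'(6) _ uqb]) measurable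
 have wd: "weak_div Q (%y. (0, ?V y)) (%y. z y * ?uq y - k' y * ?uq y - F y)"
 proof -
  have lV: "loc_int Q (%y. (0::real, ?V y))"
  proof (rule integrable_imp_loc_int, rule BI_integrable_bound[OF iV])
   show "(%y. (0::real, ?V y)) : borel_measurable lborel" using Vm by (simp add: borel_prod[symmetric])
  qed (simp add: norm_Pair)
  have lA: "loc_int Q (%y. z y * ?uq y - k' y * ?uq y - F y)"
   by (intro loc_int_diff integrable_imp_loc_int izu iku F(1))
  have "(\<integral>y. (z y * ?uq y - k' y * ?uq y - F y) * phi y + (0, ?V y) \<bullet> grad phi y \<partial>lborel) = 0" if phi: "phi : test_functions Q" for phi
  proof -
   note t = test_function_C1_test[OF phi]
   note [measurable] = C1_test_integrable(2,3)[OF t(1)]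
   obtain B where B: "B > 0" "!!x. \<bar>phi x\<bar> <= B" "!!x. norm (grad phi x) <= B" by (rule C1_test_bounded[OF t(1)]) (rule that)
   have cK: "compact (closure {y. phi y \<noteq> 0})" using t(1) unfolding C1_test_def by (rule conjunct1)
   have sB: "norm (snd (grad phi y)) <= B" for y using norm_snd_le_norm[of "grad phi y"] B(3)[of y] by linarith
   have i1: "lint (%y. z y * ?uq y * phi y)" by (rule integrable_bounded_mult[OF izu _ B(2)]) measurable
   have i2: "lint (%y. k' y * ?uq y * phi y)" by (rule integrable_bounded_mult[OF iku _ B(2)]) measurable
   have i3: "lint (%y. phi y *# F y)"
   by (rule loc_int_test_integrable[OF F(1) cK t(2) _ B(2) C1_test_zero[OF t(1)]]) measurable
   have i3': "lint (%y. F y * phi y)" using i3 by (simp add: mult.commute)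
   have i4: "lint (%y. ?V y \<bullet> snd (grad phi y))"
   proof (rule BI_integrable_bound)
   show "lint (%y. B * norm (?V y))" using iV by (intro integrable_mult_right integrable_norm)
   show "AE y in lborel. norm (?V y \<bullet> snd (grad phi y)) <= norm (B * norm (?V y))"
   proof (rule AE_I2)
   fix y
   have "norm (?V y \<bullet> snd (grad phi y)) <= norm (?V y) * norm (snd (grad phi y))" by (simp add: Cauchy_Schwarz_ineq2)
   also have "\<dots> <= norm (?V y) * B" by (rule mult_left_mono[OF sB norm_ge_zero])
   finally show "norm (?V y \<bullet> snd (grad phi y)) <= norm (B * norm (?V y))" using B(1) by (simp add: abs_mult mult.commute)
   qed
   qed measurable
   have e1: "(\<integral>y. z0 y * w y powr (q - 1) * phi y \<partial>lebesgue_on Q) = (\<integral>y. z y * ?uq y * phi y \<partial>lborel)"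
   proof (rule lebesgue_on_representative(1)[OF Q_borel])
   show "AE y in lborel. y : Q --> z y * ?uq y * phi y = z0 y * w y powr (q - 1) * phi y" using z(3) uw by eventually_elim simp
   qed (use z(2) in auto)
   have e2: "(\<integral>y. k y * w y powr (q - 1) * phi y \<partial>lebesgue_on Q) = (\<integral>y. k' y * ?uq y * phi y \<partial>lborel)"
   proof (rule lebesgue_on_representative(1)[OF Q_borel])
   show "AE y in lborel. y : Q --> k' y * ?uq y * phi y = k y * w y powr (q - 1) * phi y" using k'(3) uw by eventually_elim simp
   qed (use k'(2) in auto)
   have e3: "(\<integral>(t, x). f x (w (t, x)) * phi (t, x) \<partial>lebesgue_on Q) = (\<integral>y. F y * phi y \<partial>lborel)"
   proof (rule lebesgue_on_representative(1)[OF Q_borel])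
   show "AE y in lborel. y : Q --> F y * phi y = (case y of (t, x) => f x (w (t, x)) * phi (t, x))" using F(3) by eventually_elim (auto split: prod.split)
   qed (use F(2) in auto)
   have e4: "(\<integral>(t, x). p_flux (p0 x) (G0 (t, x)) \<bullet> grad (%x'. phi (t, x')) x \<partial>lebesgue_on Q) = (\<integral>y. ?V y \<bullet> snd (grad phi y) \<partial>lborel)"
   proof (rule lebesgue_on_representative(1)[OF Q_borel])
   show "AE y in lborel. y : Q --> ?V y \<bullet> snd (grad phi y) = (case y of (t, x) => p_flux (p0 x) (G0 (t, x)) \<bullet> grad (%x'. phi (t, x')) x)"
   using G(3) by eventually_elim (auto simp: grad_space_slice[OF phi] p0 split: prod.split)
   show "y \<notin> Q ==> ?V y \<bullet> snd (grad phi y) = 0" for y using G(2)[of y] by (simp add: p_flux_def)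
   qed measurable
   have "(\<integral>y. (z y * ?uq y - k' y * ?uq y - F y) * phi y + (0, ?V y) \<bullet> grad phi y \<partial>lborel)
   = (\<integral>y. (z y * ?uq y * phi y - k' y * ?uq y * phi y - F y * phi y) + ?V y \<bullet> snd (grad phi y) \<partial>lborel)"
   by (intro BI_integral_cong refl) (simp only: inner_prod_def fst_conv snd_conv inner_zero_left add_0_left left_diff_distrib)
   also have "\<dots> = 0"
   using id[OF phi] unfolding e1 e2 e3 e4 using i1 i2 i3' i4 by simp
   finally show ?thesis .
  qed
  then show ?thesis using lV lA unfolding weak_div_def by blast
 qed
 show thesis
 proof (rule that[of M u G z k' F])
  show "sol M u G z k' F"
   unfolding sol_def
  proof (intro conjI allI)
   show "AE y in lborel. y : Q --> 0 < u y" using uw pos by eventually_elim auto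
  qed (use st z k' F wd loc_int_borel[OF F(1)] in blast)+
  show "wderiv Q (1, 0) (%y. u y powr q) z"
  proof (rule weak_derivative_wderiv[OF open_Q dz])
   show "AE y in lborel. y : Q --> u y powr q = w y powr q" using uw by eventually_elim simp
   show "y \<notin> Q ==> u y powr q = 0" for y using u0[of y] by simp
  qed (use z um in measurable)
 qed (use u1(4) sl(2) uw k'(3) F(3) in blast)+
qed

lemma Lr_norm_1: "Lr_norm S 1 f = (\<integral>x. \<bar>f x\<bar> \<partial>lebesgue_on S)"
 by (simp add: Lr_norm_def)

lemma initial_continuity:
 assumes c: "w : continuous_into_Lr T Om 1" and e: "e > 0"
 shows "\<exists>d>0. \<forall>s. 0 < s --> s < d --> s < T --> integrable (lebesgue_on Om) (%x. \<bar>w (s, x) - w (0, x)\<bar>) & (\<integral>x. \<bar>w (s, x) - w (0, x)\<bar> \<partial>lebesgue_on Om) < e"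
proof -
 have L: "(%x. w (t, x)) : Lr Om 1" if "t : {0..T}" for t using c that unfolding continuous_into_Lr_def by blast
 have i: "integrable (lebesgue_on Om) (%x. w (t, x))" if "t : {0..T}" for t
  using L[OF that] integrable_abs_cancel[of "lebesgue_on Om" "%x. w (t, x)"] by (simp add: Lpx_def)
 have T0: "0 : {0..T}" using T by simp
 have "((%s. Lr_norm Om 1 (%x. w (s, x) - w (0, x))) \<longlongrightarrow> 0) (at 0 within {0..T})"
  using c T0 unfolding continuous_into_Lr_def by blast
 then have "\<forall>\<^sub>F s in at 0 within {0..T}. Lr_norm Om 1 (%x. w (s, x) - w (0, x)) < e" using e by (rule order_tendstoD)
 then obtain d where d: "d > 0" "!!s. s : {0..T} ==> s \<noteq> 0 ==> dist s 0 < d ==> Lr_norm Om 1 (%x. w (s, x) - w (0, x)) < e"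
  unfolding eventually_at by blast
 show ?thesis
 proof (rule exI[of _ d], intro conjI allI impI d(1))
  fix s assume s: "0 < s" "s < d" "s < T"
  then have sT: "s : {0..T}" by simp
  show "integrable (lebesgue_on Om) (%x. \<bar>w (s, x) - w (0, x)\<bar>)" by (intro integrable_abs BI_integrable_diff i sT T0)
  show "(\<integral>x. \<bar>w (s, x) - w (0, x)\<bar> \<partial>lebesgue_on Om) < e" using d(2)[OF sT] s unfolding Lr_norm_1 by simp
 qed
qed

lemma powr_gap_bound:
 fixes a b :: real
 assumes "0 < a" "a <= M" "0 < b" "b <= M"
 shows "(max 0 (a powr q - b powr q))\<^sup>2 <= M powr q * (q * M powr (q - 1)) * max 0 (a - b)"
proof (cases "b < a")
 case True
 obtain c where c: "b < c" "c < a" "a powr q - b powr q = (a - b) * (q * c powr (q - 1))"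
  using MVT2[OF True, of "%x. x powr q" "%x. q * x powr (q - 1)"] assms has_real_derivative_powr[of _ q] by (metis less_le_trans)
 have c1: "c powr (q - 1) <= M powr (q - 1)" using c assms q by (intro powr_mono2) auto
 have g0: "0 <= a powr q - b powr q" using True assms q by (simp add: powr_mono2)
 have "a powr q - b powr q <= a powr q" by simp
 also have "\<dots> <= M powr q" using assms q by (intro powr_mono2) auto
 finally have g1: "a powr q - b powr q <= M powr q" .
 have "(a - b) * (q * c powr (q - 1)) <= (a - b) * (q * M powr (q - 1))" using c1 True q by (intro mult_left_mono) auto
 then have g2: "a powr q - b powr q <= q * M powr (q - 1) * (a - b)" unfolding c(3) by (simp add: mult.commute)
 have "(a powr q - b powr q) * (a powr q - b powr q) <= M powr q * (q * M powr (q - 1) * (a - b))"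
  using g0 g1 g2 by (intro mult_mono) auto
 then show ?thesis using True g0 by (simp add: power2_eq_square max_def mult.assoc)
next
 case False
 then have "a powr q <= b powr q" using assms q by (intro powr_mono2) auto
 then show ?thesis using False by (simp add: max_def)
qed

text \<open>The power function is Lipschitz on bounded intervals of positive numbers, so continuity in \<open>L\<^sup>1\<close> at time zero suffices.\<close>

lemma initial_gap:
 assumes M: "state M u Gu" "state M v Gv"
  and pos: "AE y in lborel. y : Q --> 0 < u y" "AE y in lborel. y : Q --> 0 < v y"
  and rep: "AE y in lborel. y : Q --> u y = U y" "AE y in lborel. y : Q --> v y = V y"
  and c: "U : continuous_into_Lr T Om 1" "V : continuous_into_Lr T Om 1"
  and le: "AE x in lebesgue_on Om. U (0, x) <= V (0, x)" and e: "e > 0"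
 shows "\<exists>s0>0. AE t in lborel. 0 < t & t < s0 --> (\<integral>\<^sup>+x. (max 0 (u (t, x) powr q - v (t, x) powr q))\<^sup>2 \<partial>lborel) <= ennreal e"
proof -
 note us = stateD[OF M(1)] and vs = stateD[OF M(2)]
 note [measurable] = us(1) vs(1)
 define c0 where "c0 = M powr q * (q * M powr (q - 1)) + 1"
 have c0: "c0 > 0" using q by (simp add: c0_def add_nonneg_pos)
 have e': "e / (2 * c0) > 0" using e c0 by simp
 obtain d1 where d1: "d1 > 0" "!!s. 0 < s ==> s < d1 ==> s < T ==> integrable (lebesgue_on Om) (%x. \<bar>U (s, x) - U (0, x)\<bar>) & (\<integral>x. \<bar>U (s, x) - U (0, x)\<bar> \<partial>lebesgue_on Om) < e / (2 * c0)"
  using initial_continuity[OF c(1) e'] by blast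
 obtain d2 where d2: "d2 > 0" "!!s. 0 < s ==> s < d2 ==> s < T ==> integrable (lebesgue_on Om) (%x. \<bar>V (s, x) - V (0, x)\<bar>) & (\<integral>x. \<bar>V (s, x) - V (0, x)\<bar> \<partial>lebesgue_on Om) < e / (2 * c0)"
  using initial_continuity[OF c(2) e'] by blast
 define Y where "Y y = (max 0 (u y powr q - v y powr q))\<^sup>2" for y
 have Ym [measurable]: "Y : borel_funs" unfolding Y_def by measurable
 have Y0: "0 <= Y y" "y \<notin> Q ==> Y y = 0" for y using us(5)[of y] vs(5)[of y] by (auto simp: Y_def)
 have Yb: "Y y <= (M powr q)\<^sup>2" for y
 proof -
  have "u y powr q <= M powr q" using us(3,4)[of y] q by (intro powr_mono2) auto
  moreover have "0 <= v y powr q" by simp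
  ultimately have "u y powr q - v y powr q <= M powr q" by linarith
  then show ?thesis unfolding Y_def by (intro power_mono) auto
 qed
 have all: "AE y in lborel. y : Q --> 0 < u y & 0 < v y & u y = U y & v y = V y"
  using pos rep by eventually_elim blast
 have "AE t in lborel. 0 < t & t < min (min d1 d2) T --> (\<integral>\<^sup>+x. Y (t, x) \<partial>lborel) <= ennreal e"
  using AE_slices[OF all]
 proof eventually_elim
  case (elim t)
  show ?case
  proof
   assume t: "0 < t & t < min (min d1 d2) T"
   let ?a = "%x. \<bar>U (t, x) - U (0, x)\<bar>" and ?b = "%x. \<bar>V (t, x) - V (0, x)\<bar>"
   have A: "integrable (lebesgue_on Om) ?a" "(\<integral>x. ?a x \<partial>lebesgue_on Om) < e / (2 * c0)" using d1(2)[of t] t by auto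
   have B: "integrable (lebesgue_on Om) ?b" "(\<integral>x. ?b x \<partial>lebesgue_on Om) < e / (2 * c0)" using d2(2)[of t] t by auto
   have y: "(%x. Y (t, x)) : borel_funs" "!!x. x \<notin> Om ==> Y (t, x) = 0" "AE x in lborel. x : Om --> Y (t, x) = Y (t, x)"
   using slice_borel[OF Ym] Y0(2) by auto
   have iY: "lint (%x. Y (t, x))"
   by (rule integrable_bounded_support[OF y(1) bounded_Om y(2), of "(M powr q)\<^sup>2"]) (use Y0(1) Yb in auto)
   have iY': "integrable (lebesgue_on Om) (%x. Y (t, x))" using iY lebesgue_on_representative(2)[OF Om_borel y] by blast
   have "(\<integral>x. Y (t, x) \<partial>lborel) = (\<integral>x. Y (t, x) \<partial>lebesgue_on Om)" using lebesgue_on_representative(1)[OF Om_borel y] by simp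
   also have "\<dots> <= (\<integral>x. c0 * (?a x + ?b x) \<partial>lebesgue_on Om)"
   proof (rule integral_mono_AE[OF iY'])
   show "integrable (lebesgue_on Om) (%x. c0 * (?a x + ?b x))" by (intro integrable_mult_right BI_integrable_add A B)
   show "AE x in lebesgue_on Om. Y (t, x) <= c0 * (?a x + ?b x)"
   unfolding AE_lebesgue_on_iff[OF Om_borel] using elim le[unfolded AE_lebesgue_on_iff[OF Om_borel]]
   proof eventually_elim
   case (elim x)
   show ?case
   proof
   assume x: "x : Om"
   then have k: "0 < u (t, x)" "0 < v (t, x)" "u (t, x) = U (t, x)" "v (t, x) = V (t, x)" "U (0, x) <= V (0, x)" using elim t by auto
   have "Y (t, x) <= M powr q * (q * M powr (q - 1)) * max 0 (u (t, x) - v (t, x))"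
   unfolding Y_def by (rule powr_gap_bound[OF k(1) us(4) k(2) vs(4)])
   also have "\<dots> <= c0 * (?a x + ?b x)"
   proof (rule mult_mono)
   show "max 0 (u (t, x) - v (t, x)) <= ?a x + ?b x" unfolding k(3,4) using k(5) by (intro max.boundedI) linarith+
   qed (use c0 in \<open>auto simp: c0_def\<close>)
   finally show "Y (t, x) <= c0 * (?a x + ?b x)" .
   qed
   qed
   qed
   also have "\<dots> = c0 * ((\<integral>x. ?a x \<partial>lebesgue_on Om) + (\<integral>x. ?b x \<partial>lebesgue_on Om))" using A(1) B(1) by simp
   also have "\<dots> <= c0 * (e / (2 * c0) + e / (2 * c0))" using A(2) B(2) c0 by (intro mult_left_mono add_mono) auto
   also have "\<dots> = e" using c0 by (simp add: field_simps)
   finally have "(\<integral>x. Y (t, x) \<partial>lborel) <= e" .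
   then show "(\<integral>\<^sup>+x. Y (t, x) \<partial>lborel) <= ennreal e"
   using nn_integral_eq_integral[OF iY] Y0(1) by (simp add: ennreal_leI)
  qed
 qed
 then show ?thesis unfolding Y_def using d1(1) d2(1) T by (intro exI[of _ "min (min d1 d2) T"]) auto
qed

theorem comparison_of_weak_solutions:
 fixes p0 :: "'a => real"
 assumes p0: "!!x. x : Om ==> p0 x = p x" and fs: "f_sign Om f" and fm: "f_monotone Om q f"
  and h: "h : Linf Q" and g: "g : Linf Q" and hg: "AE y in lebesgue_on Q. h y <= g y"
  and init: "\<forall>x\<in>Om. u0 x <= v0 x"
  and U: "weak_solution T Om p0 q f h u0 U" and V: "weak_solution T Om p0 q f g v0 V"
 shows "AE y in lebesgue_on Q. U y <= V y"
proof -
 obtain M1 u Gu zu h' Fu where u: "M1 >= 0" "sol M1 u Gu zu h' Fu" "trace0 u Gu" "wderiv Q (1, 0) (%y. u y powr q) zu"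
  "AE y in lborel. y : Q --> u y = U y" "AE y in lborel. y : Q --> h' y = h y" "AE y in lborel. y : Q --> Fu y = f (snd y) (U y)"
  by (rule weak_solution_representative[OF p0 fs h U]) (assumption, rule that)
 obtain M2 v Gv zv g' Fv where v: "M2 >= 0" "sol M2 v Gv zv g' Fv" "trace0 v Gv" "wderiv Q (1, 0) (%y. v y powr q) zv"
  "AE y in lborel. y : Q --> v y = V y" "AE y in lborel. y : Q --> g' y = g y" "AE y in lborel. y : Q --> Fv y = f (snd y) (V y)"
  by (rule weak_solution_representative[OF p0 fs g V]) (assumption, rule that)
 define M where "M = max M1 M2"
 have su: "sol M u Gu zu h' Fu" and sv: "sol M v Gv zv g' Fv" using sol_mono[OF u(2)] sol_mono[OF v(2)] by (auto simp: M_def)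
 note uD = solD[OF su] and vD = solD[OF sv]
 have "AE y in lborel. y : Q --> u y <= v y"
 proof (rule comparison_core[OF su sv u(3) _ _ u(4) v(4)])
  show "AE y in lborel. y : Q --> h' y <= g' y"
   using u(6) v(6) hg[unfolded AE_lebesgue_on_iff[OF Q_borel]] by eventually_elim auto
  show "AE y in lborel. y : Q --> v y < u y --> Fu y * v y powr (q - 1) <= Fv y * u y powr (q - 1)"
   using uD(2) vD(2) u(5,7) v(5,7)
  proof eventually_elim
   case (elim y)
   show ?case
   proof (intro impI)
   assume y: "y : Q" and l: "v y < u y"
   have pos: "0 < v y" "0 < u y" using elim y by auto
   have x: "snd y : Om" using y by auto
   have "antimono_on {0<..} (%s. f (snd y) s / s powr (q - 1))" using fm x by (simp add: f_monotone_def)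
   then have "f (snd y) (u y) / u y powr (q - 1) <= f (snd y) (v y) / v y powr (q - 1)"
   using pos l by (auto dest!: monotone_onD[where x="v y" and y="u y"])
   then have "f (snd y) (u y) * v y powr (q - 1) <= f (snd y) (v y) * u y powr (q - 1)"
   using pos by (simp add: divide_simps mult.commute)
   then show "Fu y * v y powr (q - 1) <= Fv y * u y powr (q - 1)" using elim y by simp
   qed
  qed
  have U0: "AE x in lebesgue_on Om. U (0, x) = u0 x" and V0: "AE x in lebesgue_on Om. V (0, x) = v0 x"
   using U V unfolding weak_solution_def by blast+
  have i0: "AE x in lebesgue_on Om. U (0, x) <= V (0, x)"
   using U0 V0 unfolding AE_lebesgue_on_iff[OF Om_borel] by eventually_elim (use init in auto)
  have cU: "U : continuous_into_Lr T Om 1" "V : continuous_into_Lr T Om 1"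
   using U V unfolding weak_solution_def by (meson order_refl)+
  fix e :: real assume "e > 0"
  then show "\<exists>s0>0. AE t in lborel. 0 < t & t < s0 --> (\<integral>\<^sup>+x. (max 0 (u (t, x) powr q - v (t, x) powr q))\<^sup>2 \<partial>lborel) <= ennreal e"
   by (rule initial_gap[OF uD(1) vD(1) uD(2) vD(2) u(5) v(5) cU i0])
 qed
 then show ?thesis
  unfolding AE_lebesgue_on_iff[OF Q_borel] using u(5) v(5) by eventually_elim auto
qed

end

theorem corollary1p2:
  fixes \<Omega> :: "'a::euclidean_space set"
    and p u0 v0 h0 :: "'a \<Rightarrow> real"
    and q T :: real
    and f :: "'a \<Rightarrow> real \<Rightarrow> real"
    and h g u v :: "real \<times> 'a \<Rightarrow> real"
  assumes "admissible_domain \<Omega>"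
    and "C1_closure \<Omega> p" and "1 < exponent_min \<Omega> p"
    and "1 < q" and "q < exponent_min \<Omega> p"
    and "f_sign \<Omega> f" and "f_near_zero \<Omega> q f" and "f_monotone \<Omega> q f"
    and "T > 0"
    and "u0 \<in> Cd0_plus \<Omega> \<inter> W01px \<Omega> p" and "v0 \<in> Cd0_plus \<Omega> \<inter> W01px \<Omega> p"
    and "((\<lambda>x. u0 x powr q) \<in> L2_closure \<Omega> (R_domain \<Omega> p q f) \<and>
          (\<lambda>x. v0 x powr q) \<in> L2_closure \<Omega> (R_domain \<Omega> p q f))
         \<or> exponent_min \<Omega> p \<ge> 2"
    and "h \<in> Linf (QT T \<Omega>)" and "g \<in> Linf (QT T \<Omega>)" and "h0 \<in> Linf \<Omega>"
    and "AE x in lebesgue_on \<Omega>. 0 < h0 x"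
    and "AE (t, x) in lebesgue_on (QT T \<Omega>). h0 x \<le> h (t, x) \<and> h (t, x) \<le> g (t, x)"
    and "\<forall>x\<in>\<Omega>. u0 x \<le> v0 x"
    and "weak_solution T \<Omega> p q f h u0 u"
    and "weak_solution T \<Omega> p q f g v0 v"
  shows "AE y in lebesgue_on (QT T \<Omega>). u y \<le> v y"
proof -
  note A = admissible_domain_basic[OF assms(1)]
  obtain P L where L: "L \<ge> 0" "\<And>x. x \<in> closure \<Omega> \<Longrightarrow> exponent_min \<Omega> p \<le> p x \<and> p x \<le> P"
    "\<And>x y. closed_segment x y \<subseteq> \<Omega> \<Longrightarrow> \<bar>p x - p y\<bar> \<le> L * dist x y"
    by (rule C1_closure_properties[OF assms(2) A(1,2,3)]) (rule that)
  obtain C \<delta>0 where C: "C \<ge> 1" "0 < \<delta>0" "\<delta>0 \<le> 1"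
    "\<And>x \<delta>. 0 < \<delta> \<Longrightarrow> \<delta> < \<delta>0 \<Longrightarrow> x \<in> \<Omega> \<Longrightarrow> infdist x (frontier \<Omega>) < \<delta> \<Longrightarrow>
        \<exists>b\<in>Basis. \<exists>s. \<bar>s\<bar> \<le> C * \<delta> \<and> x + s *\<^sub>R b \<in> frontier \<Omega>"
    by (rule admissible_domain_exit[OF assms(1)]) (rule that)
  \<comment> \<open>Off the domain the exponent is reset to its minimum; this keeps it Borel measurable.\<close>
  define p' where "p' x = (if x \<in> \<Omega> then p x else exponent_min \<Omega> p)" for x
  have p'eq: "x \<in> \<Omega> \<Longrightarrow> p x = p' x" for x by (simp add: p'_def)
  have p\<Omega>: "exponent_min \<Omega> p \<le> p x" "p x \<le> P" if "x \<in> \<Omega>" for x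
    using L(2)[of x] closure_subset[of \<Omega>] that by blast+
  obtain x0 where x0: "x0 \<in> \<Omega>" using A(3) by blast
  have p'b: "exponent_min \<Omega> p \<le> p' x" "p' x \<le> P" for x
    using p\<Omega>[of x] p\<Omega>[OF x0] by (auto simp: p'_def)
  have pc: "continuous_on \<Omega> p" using assms(2) continuous_on_subset[OF _ closure_subset] by (auto simp: C1_closure_def)
  have p'm: "p' \<in> borel_measurable borel"
    unfolding p'_def by (rule borel_measurable_continuous_on_if) (use A(1) pc in auto)
  interpret comparison_setting \<Omega> p' P L T C \<delta>0 q
  proof unfold_locales
    show "\<bar>p' x - p' y\<bar> \<le> L * dist x y" if s: "closed_segment x y \<subseteq> \<Omega>" for x y
    proof -
      have "x \<in> \<Omega>" "y \<in> \<Omega>" using s ends_in_segment by blast+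
      then show ?thesis using L(3)[OF s] by (simp add: p'_def)
    qed
    show "1 < p' x" for x using p'b(1)[of x] assms(3) by linarith
    show "q \<le> p' x" for x using p'b(1)[of x] assms(5) by linarith
  qed (use A p'm p'b L(1) C assms(4,9) in blast)+
  have hg: "AE y in lebesgue_on (QT T \<Omega>). h y \<le> g y"
    using assms(17) by eventually_elim auto
  show ?thesis
    by (rule comparison_of_weak_solutions[OF _ assms(6,8,13,14) hg assms(18,19,20)]) (rule p'eq)
qed

end
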